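(* Let $\Bbbk$ be a field, let $R=\Bbbk[S]$ be a Cohen-Macaulay homogeneous affine semigroup ring over $\Bbbk$, and let $(h_0,h_1,\dots,h_s)$ be its $h$-vector. If $R$ is nearly Gorenstein but not Gorenstein, then $h_s\geq 2$.
   Context: An affine semigroup is a finitely generated additive sub-semigroup $S$ (containing $0$) of $\mathbb{N}^n$ for some $n$, where $\mathbb N$ is the set of nonnegative integers; $\Bbbk[S]$ is the $\Bbbk$-subalgebra of $\Bbbk[x_1,\dots,x_n]$ spanned by the monomials $\mathbf{x}^{\mathbf a}$, $\mathbf a\in S$. $S$ (and $\Bbbk[S]$) is called homogeneous if all minimal generators of $S$ lie on an affine hyperplane not containing the origin; equivalently, $\Bbbk[S]$ is standard graded by assigning degree $1$ to all the monomials corresponding to the minimal generators of $S$. This is the grading used on $R$; its graded maximal ideal is denoted $\mathbf{m}$. The $h$-vector $(h_0,\dots,h_s)$ of $R$ with $d=\dim R$ is defined by $\sum_{i\ge 0}\dim_{\Bbbk}(R_i)\,t^i=\dfrac{h_0+h_1t+\cdots+h_st^s}{(1-t)^d}$ with $h_s\neq 0$. For an $R$-module $M$, the trace of $M$ is the ideal $\mathrm{tr}(M)=\sum_{\phi\in \mathrm{Hom}_R(M,R)}\phi(M)$ of $R$. Let $\omega_R$ denote the canonical module of $R$. The (Cohen-Macaulay) ring $R$ is nearly Gorenstein if $\mathrm{tr}(\omega_R)\supseteq\mathbf{m}$. *)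

theory Defs
  imports
    "HOL-Algebra.Module"
    "HOL-Algebra.Ideal"
    "HOL-Library.Poly_Mapping"
    "HOL-Library.Extended_Nat"
    "HOL-Computational_Algebra.Formal_Power_Series"
begin

section \<open>Modules over a commutative ring\<close>

text \<open>
  The record type \<^type>\<open>module_ext\<close> of HOL-Algebra extends the one of rings; the fields
  \<open>mult\<close> and \<open>one\<close> play no role for a module and are left undefined below.
  Functions between carriers are extensional, so that equality in Hom is equality of functions.
\<close>

definition ring_module :: "('a, 'c) ring_scheme \<Rightarrow> ('a, 'a) module" where
  "ring_module R = \<lparr>carrier = carrier R, monoid.mult = (\<otimes>\<^bsub>R\<^esub>), one = \<one>\<^bsub>R\<^esub>,
     zero = \<zero>\<^bsub>R\<^esub>, add = (\<oplus>\<^bsub>R\<^esub>), smult = (\<otimes>\<^bsub>R\<^esub>)\<rparr>"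

definition free_module :: "('a, 'c) ring_scheme \<Rightarrow> nat \<Rightarrow> ('a, nat \<Rightarrow> 'a) module" where
  "free_module R b = \<lparr>carrier = {..<b} \<rightarrow>\<^sub>E carrier R,
     monoid.mult = undefined, one = undefined,
     zero = (\<lambda>j\<in>{..<b}. \<zero>\<^bsub>R\<^esub>),
     add = (\<lambda>x y. \<lambda>j\<in>{..<b}. x j \<oplus>\<^bsub>R\<^esub> y j),
     smult = (\<lambda>r x. \<lambda>j\<in>{..<b}. r \<otimes>\<^bsub>R\<^esub> x j)\<rparr>"

definition mod_hom ::
  "('a, 'c) ring_scheme \<Rightarrow> ('a, 'm, 'd) module_scheme \<Rightarrow> ('a, 'n, 'e) module_scheme \<Rightarrow> ('m \<Rightarrow> 'n) set"
  where
  "mod_hom R M N = {f \<in> carrier M \<rightarrow>\<^sub>E carrier N.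
     (\<forall>x\<in>carrier M. \<forall>y\<in>carrier M. f (x \<oplus>\<^bsub>M\<^esub> y) = f x \<oplus>\<^bsub>N\<^esub> f y) \<and>
     (\<forall>r\<in>carrier R. \<forall>x\<in>carrier M. f (r \<odot>\<^bsub>M\<^esub> x) = r \<odot>\<^bsub>N\<^esub> f x)}"

definition mod_iso ::
  "('a, 'c) ring_scheme \<Rightarrow> ('a, 'm, 'd) module_scheme \<Rightarrow> ('a, 'n, 'e) module_scheme \<Rightarrow> bool"
  where
  "mod_iso R M N \<longleftrightarrow> (\<exists>f\<in>mod_hom R M N. bij_betw f (carrier M) (carrier N))"

definition hom_module ::
  "('a, 'c) ring_scheme \<Rightarrow> ('a, 'm, 'd) module_scheme \<Rightarrow> ('a, 'n, 'e) module_scheme \<Rightarrow>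
   ('a, 'm \<Rightarrow> 'n) module" where
  "hom_module R M N = \<lparr>carrier = mod_hom R M N,
     monoid.mult = undefined, one = undefined,
     zero = (\<lambda>x\<in>carrier M. \<zero>\<^bsub>N\<^esub>),
     add = (\<lambda>f g. \<lambda>x\<in>carrier M. f x \<oplus>\<^bsub>N\<^esub> g x),
     smult = (\<lambda>r f. \<lambda>x\<in>carrier M. r \<odot>\<^bsub>N\<^esub> f x)\<rparr>"

definition quotient_module :: "('a, 'm, 'd) module_scheme \<Rightarrow> 'm set \<Rightarrow> ('a, 'm set) module" where
  "quotient_module M N = \<lparr>carrier = a_rcosets\<^bsub>M\<^esub> N,
     monoid.mult = undefined, one = undefined,
     zero = N,
     add = (<+>\<^bsub>M\<^esub>),
     smult = (\<lambda>r X. \<Union>x\<in>X. N +>\<^bsub>M\<^esub> (r \<odot>\<^bsub>M\<^esub> x))\<rparr>"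

definition finitely_generated_module ::
  "('a, 'c) ring_scheme \<Rightarrow> ('a, 'm, 'd) module_scheme \<Rightarrow> bool" where
  "finitely_generated_module R M \<longleftrightarrow>
     (\<exists>G. finite G \<and> G \<subseteq> carrier M \<and> (\<forall>N. submodule N R M \<and> G \<subseteq> N \<longrightarrow> N = carrier M))"

text \<open>
  The trace is the sum of the ideals \<open>\<phi>(M)\<close> over all \<open>\<phi> \<in> Hom(M, R)\<close>; a sum of ideals is
  the ideal generated by their union.
\<close>

definition trace_ideal :: "('a, 'c) ring_scheme \<Rightarrow> ('a, 'm, 'd) module_scheme \<Rightarrow> 'a set" where
  "trace_ideal R M = Idl\<^bsub>R\<^esub> (\<Union>\<phi>\<in>mod_hom R M (ring_module R). \<phi> ` carrier M)"


section \<open>Ext\<close>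

text \<open>
  A resolution \<open>\<dots> \<rightarrow> R\<^bsup>b 2\<^esup> \<rightarrow> R\<^bsup>b 1\<^esup> \<rightarrow> R\<^bsup>b 0\<^esup> \<rightarrow> N \<rightarrow> 0\<close> by free modules of finite rank, with
  differentials \<open>d i : R\<^bsup>b (i+1)\<^esup> \<rightarrow> R\<^bsup>b i\<^esup>\<close> and augmentation \<open>e\<close>. It exists whenever \<open>R\<close> is
  Noetherian and \<open>N\<close> is finitely generated.
\<close>

definition free_resolution ::
  "('a, 'c) ring_scheme \<Rightarrow> ('a, 'n, 'e) module_scheme \<Rightarrow>
   (nat \<Rightarrow> nat) \<Rightarrow> (nat \<Rightarrow> (nat \<Rightarrow> 'a) \<Rightarrow> nat \<Rightarrow> 'a) \<Rightarrow> ((nat \<Rightarrow> 'a) \<Rightarrow> 'n) \<Rightarrow> bool" where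
  "free_resolution R N b d e \<longleftrightarrow>
     (let F = (\<lambda>i. free_module R (b i)) in
       e \<in> mod_hom R (F 0) N \<and>
       (\<forall>i. d i \<in> mod_hom R (F (Suc i)) (F i)) \<and>
       e ` carrier (F 0) = carrier N \<and>
       d 0 ` carrier (F 1) = {x \<in> carrier (F 0). e x = \<zero>\<^bsub>N\<^esub>} \<and>
       (\<forall>i. d (Suc i) ` carrier (F (Suc (Suc i))) =
              {x \<in> carrier (F (Suc i)). d i x = \<zero>\<^bsub>F i\<^esub>}))"

text \<open>
  The cohomology at position \<open>i\<close> of the complex
  \<open>0 \<rightarrow> Hom(R\<^bsup>b 0\<^esup>, C) \<rightarrow> Hom(R\<^bsup>b 1\<^esup>, C) \<rightarrow> \<dots>\<close>.
\<close>

definition ext_cocycles ::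
  "('a, 'c) ring_scheme \<Rightarrow> (nat \<Rightarrow> nat) \<Rightarrow> (nat \<Rightarrow> (nat \<Rightarrow> 'a) \<Rightarrow> nat \<Rightarrow> 'a) \<Rightarrow>
   ('a, 'm, 'd) module_scheme \<Rightarrow> nat \<Rightarrow> ((nat \<Rightarrow> 'a) \<Rightarrow> 'm) set" where
  "ext_cocycles R b d C i =
     {f \<in> mod_hom R (free_module R (b i)) C.
        \<forall>x\<in>carrier (free_module R (b (Suc i))). f (d i x) = \<zero>\<^bsub>C\<^esub>}"

fun ext_coboundaries ::
  "('a, 'c) ring_scheme \<Rightarrow> (nat \<Rightarrow> nat) \<Rightarrow> (nat \<Rightarrow> (nat \<Rightarrow> 'a) \<Rightarrow> nat \<Rightarrow> 'a) \<Rightarrow>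
   ('a, 'm, 'd) module_scheme \<Rightarrow> nat \<Rightarrow> ((nat \<Rightarrow> 'a) \<Rightarrow> 'm) set" where
  "ext_coboundaries R b d C 0 = {\<zero>\<^bsub>hom_module R (free_module R (b 0)) C\<^esub>}"
| "ext_coboundaries R b d C (Suc i) =
     (\<lambda>g. compose (carrier (free_module R (b (Suc i)))) g (d i)) `
       mod_hom R (free_module R (b i)) C"

definition ext_of_resolution ::
  "('a, 'c) ring_scheme \<Rightarrow> (nat \<Rightarrow> nat) \<Rightarrow> (nat \<Rightarrow> (nat \<Rightarrow> 'a) \<Rightarrow> nat \<Rightarrow> 'a) \<Rightarrow>
   ('a, 'm, 'd) module_scheme \<Rightarrow> nat \<Rightarrow> ('a, ((nat \<Rightarrow> 'a) \<Rightarrow> 'm) set) module" where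
  "ext_of_resolution R b d C i =
     quotient_module (hom_module R (free_module R (b i)) C \<lparr>carrier := ext_cocycles R b d C i\<rparr>)
       (ext_coboundaries R b d C i)"

text \<open>
  Ext is computed from a chosen resolution of \<open>N\<close>. It is meaningful only if there is one, which is
  the case for the modules \<open>R / \<mm>\<close> over a Noetherian ring to which it is applied below.
\<close>

definition Ext ::
  "('a, 'c) ring_scheme \<Rightarrow> ('a, 'n, 'e) module_scheme \<Rightarrow> ('a, 'm, 'd) module_scheme \<Rightarrow> nat \<Rightarrow>
   ('a, ((nat \<Rightarrow> 'a) \<Rightarrow> 'm) set) module" where
  "Ext R N C i =
     (let (b, d) = (SOME (b, d). \<exists>e. free_resolution R N b d e) in ext_of_resolution R b d C i)"


section \<open>Dimension, depth, Cohen-Macaulay rings\<close>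

definition krull_dim :: "('a, 'c) ring_scheme \<Rightarrow> enat" where
  "krull_dim R = Sup {enat n | n.
     \<exists>P. (\<forall>i\<le>n. primeideal (P i) R) \<and> (\<forall>i<n. P i \<subset> P (Suc i))}"

definition regular_sequence :: "('a, 'c) ring_scheme \<Rightarrow> 'a list \<Rightarrow> bool" where
  "regular_sequence R xs \<longleftrightarrow>
     set xs \<subseteq> carrier R \<and>
     Idl\<^bsub>R\<^esub> (set xs) \<noteq> carrier R \<and>
     (\<forall>i<length xs. \<forall>a\<in>carrier R.
        xs ! i \<otimes>\<^bsub>R\<^esub> a \<in> Idl\<^bsub>R\<^esub> (set (take i xs)) \<longrightarrow> a \<in> Idl\<^bsub>R\<^esub> (set (take i xs)))"

definition depth :: "('a, 'c) ring_scheme \<Rightarrow> 'a set \<Rightarrow> enat" where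
  "depth R I = Sup {enat (length xs) | xs. regular_sequence R xs \<and> set xs \<subseteq> I}"

text \<open>
  From here on \<open>R\<close> is a Noetherian ring, nonnegatively graded by \<open>Rg\<close> with \<open>Rg 0\<close> a field, and
  \<open>\<mm>\<close> is its graded maximal ideal. The notions are those of graded ring theory, i.e. the ones for
  local rings with \<open>\<mm>\<close> in place of the maximal ideal.
\<close>

definition cohen_macaulay :: "('a, 'c) ring_scheme \<Rightarrow> 'a set \<Rightarrow> bool" where
  "cohen_macaulay R \<mm> \<longleftrightarrow> depth R \<mm> = krull_dim R"


section \<open>Canonical modules, Gorenstein and nearly Gorenstein rings\<close>

definition module_grading ::
  "('a, 'c) ring_scheme \<Rightarrow> (nat \<Rightarrow> 'a set) \<Rightarrow> ('a, 'm, 'd) module_scheme \<Rightarrow> (int \<Rightarrow> 'm set) \<Rightarrow> bool"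
  where
  "module_grading R Rg M Mg \<longleftrightarrow>
     (\<forall>j. subgroup (Mg j) (add_monoid M)) \<and>
     (\<forall>i j. \<forall>r\<in>Rg i. \<forall>x\<in>Mg j. r \<odot>\<^bsub>M\<^esub> x \<in> Mg (int i + j)) \<and>
     (\<forall>x\<in>carrier M. \<exists>!c. (\<forall>j. c j \<in> Mg j) \<and> finite {j. c j \<noteq> \<zero>\<^bsub>M\<^esub>} \<and>
        x = finsum M c {j. c j \<noteq> \<zero>\<^bsub>M\<^esub>})"

text \<open>
  A canonical module of a Cohen-Macaulay graded ring of dimension \<open>d\<close> is a finitely generated
  graded module \<open>C\<close> with \<open>Ext\<^sup>i(R/\<mm>, C)\<close> zero for \<open>i \<noteq> d\<close> and isomorphic to \<open>R/\<mm>\<close> for \<open>i = d\<close>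
  (Bruns and Herzog, Cohen-Macaulay Rings, 3.6.8). Requiring the latter isomorphism to be
  homogeneous of degree 0 would only normalize the grading of \<open>C\<close> by a shift; here the grading is
  existentially quantified and the shift is left free.
\<close>

definition canonical_module ::
  "('a, 'c) ring_scheme \<Rightarrow> (nat \<Rightarrow> 'a set) \<Rightarrow> 'a set \<Rightarrow> ('a, 'm, 'd) module_scheme \<Rightarrow> bool" where
  "canonical_module R Rg \<mm> C \<longleftrightarrow>
     Module.module R C \<and> finitely_generated_module R C \<and> (\<exists>Cg. module_grading R Rg C Cg) \<and>
     (\<forall>i. if enat i = krull_dim R
          then mod_iso R (Ext R (quotient_module (ring_module R) \<mm>) C i)
                 (quotient_module (ring_module R) \<mm>)
          else carrier (Ext R (quotient_module (ring_module R) \<mm>) C i) =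
                 {\<zero>\<^bsub>Ext R (quotient_module (ring_module R) \<mm>) C i\<^esub>})"

text \<open>
  A Cohen-Macaulay graded ring is Gorenstein if its canonical module is, up to a shift of the
  grading, \<open>R\<close> itself.
\<close>

definition gorenstein :: "('a, 'c) ring_scheme \<Rightarrow> (nat \<Rightarrow> 'a set) \<Rightarrow> 'a set \<Rightarrow> bool" where
  "gorenstein R Rg \<mm> \<longleftrightarrow> cohen_macaulay R \<mm> \<and> canonical_module R Rg \<mm> (ring_module R)"

text \<open>
  The canonical module \<open>C\<close> is an argument because its carrier may live in any type. As a module it is unique
  up to isomorphism, and the trace depends on its isomorphism class only.
\<close>

definition nearly_gorenstein ::
  "('a, 'c) ring_scheme \<Rightarrow> 'a set \<Rightarrow> ('a, 'm, 'd) module_scheme \<Rightarrow> bool" where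
  "nearly_gorenstein R \<mm> C \<longleftrightarrow> cohen_macaulay R \<mm> \<and> \<mm> \<subseteq> trace_ideal R C"


section \<open>Affine semigroups\<close>

text \<open>
  A point of \<open>\<nat>\<^sup>n\<close> is a finitely supported function \<^typ>\<open>nat \<Rightarrow>\<^sub>0 nat\<close> with support in \<open>{..<n}\<close>.
\<close>

definition semigroup_generated :: "(nat \<Rightarrow>\<^sub>0 nat) set \<Rightarrow> (nat \<Rightarrow>\<^sub>0 nat) set" where
  "semigroup_generated G = {sum_mset A | A. set_mset A \<subseteq> G}"

definition affine_semigroup :: "nat \<Rightarrow> (nat \<Rightarrow>\<^sub>0 nat) set \<Rightarrow> bool" where
  "affine_semigroup n S \<longleftrightarrow>
     (\<exists>G. finite G \<and> (\<forall>a\<in>G. Poly_Mapping.keys a \<subseteq> {..<n}) \<and> S = semigroup_generated G)"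

text \<open>
  The elements that are not sums of two nonzero elements; as \<open>0\<close> is the only invertible element
  of \<open>S\<close>, they form the unique minimal generating set.
\<close>

definition minimal_generators :: "(nat \<Rightarrow>\<^sub>0 nat) set \<Rightarrow> (nat \<Rightarrow>\<^sub>0 nat) set" where
  "minimal_generators S =
     {a \<in> S - {0}. \<not> (\<exists>b\<in>S - {0}. \<exists>c\<in>S - {0}. a = b + c)}"

definition homogeneous_semigroup :: "nat \<Rightarrow> (nat \<Rightarrow>\<^sub>0 nat) set \<Rightarrow> bool" where
  "homogeneous_semigroup n S \<longleftrightarrow>
     (\<exists>(u :: nat \<Rightarrow> real) (c :: real). c \<noteq> 0 \<and>
        (\<forall>a\<in>minimal_generators S. (\<Sum>j<n. u j * real (Poly_Mapping.lookup a j)) = c))"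


section \<open>Homogeneous affine semigroup rings\<close>

text \<open>
  The polynomial \<open>\<Sum>\<^sub>a p\<^sub>a x\<^sup>a\<close> is the finitely supported function \<open>a \<mapsto> p\<^sub>a\<close>, with the convolution
  product of \<^theory>\<open>HOL-Library.Poly_Mapping\<close>.
\<close>

definition semigroup_ring :: "(nat \<Rightarrow>\<^sub>0 nat) set \<Rightarrow> ((nat \<Rightarrow>\<^sub>0 nat) \<Rightarrow>\<^sub>0 'k::field) ring" where
  "semigroup_ring S = \<lparr>carrier = {p. Poly_Mapping.keys p \<subseteq> S},
     monoid.mult = (*), one = 1, zero = 0, add = (+)\<rparr>"

text \<open>
  The graded components for the grading in which the minimal generators have degree 1: the
  component of degree \<open>i\<close> is spanned by the products of \<open>i\<close> of them.
\<close>

definition semigroup_ring_component ::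
  "(nat \<Rightarrow>\<^sub>0 nat) set \<Rightarrow> nat \<Rightarrow> ((nat \<Rightarrow>\<^sub>0 nat) \<Rightarrow>\<^sub>0 'k::field) set" where
  "semigroup_ring_component S i =
     {p. Poly_Mapping.keys p \<subseteq> {sum_mset A | A. set_mset A \<subseteq> minimal_generators S \<and> size A = i}}"

definition graded_maximal_ideal ::
  "(nat \<Rightarrow>\<^sub>0 nat) set \<Rightarrow> ((nat \<Rightarrow>\<^sub>0 nat) \<Rightarrow>\<^sub>0 'k::field) set" where
  "graded_maximal_ideal S = {p. Poly_Mapping.keys p \<subseteq> S - {0}}"

definition poly_scale ::
  "'k::field \<Rightarrow> ((nat \<Rightarrow>\<^sub>0 nat) \<Rightarrow>\<^sub>0 'k) \<Rightarrow> ((nat \<Rightarrow>\<^sub>0 nat) \<Rightarrow>\<^sub>0 'k)" where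
  "poly_scale c p = Poly_Mapping.single 0 c * p"

interpretation poly_mapping: vector_space poly_scale
  by standard
    (simp_all add: poly_scale_def algebra_simps single_add mult_single flip: mult.assoc)

definition is_h_vector ::
  "((nat \<Rightarrow>\<^sub>0 nat) \<Rightarrow>\<^sub>0 'k::field) ring \<Rightarrow> (nat \<Rightarrow> ((nat \<Rightarrow>\<^sub>0 nat) \<Rightarrow>\<^sub>0 'k) set) \<Rightarrow>
   nat \<Rightarrow> (nat \<Rightarrow> int) \<Rightarrow> bool" where
  "is_h_vector R Rg s h \<longleftrightarrow>
     h s \<noteq> 0 \<and>
     (\<exists>d. krull_dim R = enat d \<and>
        Abs_fps (\<lambda>i. int (poly_mapping.dim (Rg i))) * (1 - fps_X) ^ d =
          (\<Sum>i\<le>s. fps_const (h i) * fps_X ^ i))"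

end

theory Submission
  imports Defs "HOL-Library.Function_Algebras"
begin

text \<open>
 Let \<open>R = k[S]\<close> with maximal ideal \<open>\<mm>\<close>, canonical module \<open>\<omega>\<close> and dimension \<open>d\<close>. The plan is to show that
 \<open>h\<^sub>s \<le> 1\<close> forces \<open>\<omega>\<close> to be free of rank 1, so that \<open>R\<close> is Gorenstein.

 Modules are written as \<open>L/K\<close> with \<open>L\<close> a graded free module, and \<open>Ext(k, L/K)\<close> is the cohomology of the
 complex of tuples of elements of \<open>L\<close>, modulo \<open>K\<close>, given by the matrices of a resolution of \<open>k\<close>. An
 element of \<open>\<mm>\<close> is null-homotopic on the resolution, so a regular sequence makes low cohomology vanish,
 and vanishing of degree 0 yields a further regular element by prime avoidance. Hence there are
 homogeneous \<open>\<theta>\<^sub>1, ..., \<theta>\<^sub>d\<close> that are regular on \<open>R\<close> and on \<open>\<omega>\<close> (\<open>common_regular_sequence\<close>).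

 Put \<open>A = R/\<theta>R\<close> and \<open>N = \<omega>/\<theta>\<omega>\<close>. The top coefficient of the Hilbert polynomial of \<open>A\<close> is \<open>h\<^sub>s\<close>
 (\<open>hilb_series\<close>), so for \<open>h\<^sub>s = 1\<close> the top component of \<open>A\<close> is a line. The long exact sequences bound the
 cohomology of \<open>N\<close> by 1 in degree 0 and by \<open>d\<close> in degree 1 (\<open>coh_bound\<close>). The first bound says that the socle
 of \<open>N\<close> is simple. The second one is attained by the classes that the \<open>\<theta>\<^sub>i\<close> produce, so that no classes
 are left over \<open>A\<close>, i.e. \<open>N\<close> is injective over \<open>A\<close> (\<open>ideal_hom_extends\<close>). Consequently \<open>A\<close> and \<open>N\<close> are in
 perfect duality (\<open>pairing\<close>); in particular the lowest component of \<open>\<omega>\<close> is a line \<open>k v\<^sub>0\<close>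
 (\<open>lowest_component\<close>), and all homogeneous endomorphisms of \<open>\<omega>\<close> are multiplications by ring elements
 (\<open>scalar\<close>). The latter gives \<open>\<psi>(v) w = \<psi>(w) v\<close> for \<open>\<psi> : \<omega> \<rightarrow> R\<close> (\<open>rhom_commute\<close>).

 Now the trace contains \<open>\<mm>\<close>, so a form \<open>r\<close> of degree 1 is a sum of values \<open>\<psi>(w)\<close> with \<open>\<psi>\<close> homogeneous. As
 \<open>v\<^sub>0\<close> has the lowest degree, either some \<open>\<psi>(v\<^sub>0)\<close> is a unit, or \<open>r\<close> itself is a value at \<open>v\<^sub>0\<close>. In the
 latter case \<open>r \<omega> \<subseteq> R v\<^sub>0\<close> for all such \<open>r\<close>, and the depth of \<open>R\<close> gives \<open>\<omega> = R v\<^sub>0\<close> (\<open>cyclic\<close>). This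
 takes a sequence of length 2; a ring of dimension at most 1 among the \<open>k[S]\<close> is \<open>k\<close> or a polynomial ring in
 one variable, because two different minimal generators give \<open>n + 1\<close> monomials of degree \<open>n\<close>
 (\<open>growth\<close>).

 The remaining parts translate between this description and modules given as records: a
 presentation of \<open>\<omega>\<close> turns its Ext modules into the cohomology of \<open>L/K\<close>, and these depend on \<open>K\<close> only
 (\<open>ext_transfer\<close>). If \<open>\<omega>\<close> is free of rank 1, then \<open>R\<close> has a presentation with the same \<open>K\<close>, hence is a
 canonical module of itself (\<open>gorenstein_of_trace\<close>).
\<close>

section \<open>Linear algebra modulo a subspace\<close>

locale linear_space = vector_space scale
 for scale :: "'a::field => 'b::ab_group_add => 'b" (infixr "*s" 75)
begin

definition codim_le :: "'b set => 'b set => nat => bool" where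
 "codim_le Z B n \<longleftrightarrow> (\<exists>T. finite T \<and> card T \<le> n \<and> Z \<subseteq> span (B \<union> T))"

lemma span_of_subspace_finite:
 assumes "finite T" "subspace Z" "subspace B" "Z \<subseteq> span (B \<union> T)"
 shows "\<exists>T'. finite T' \<and> card T' \<le> card T \<and> T' \<subseteq> Z \<and> Z \<subseteq> span ((B \<inter> Z) \<union> T')"
 using assms
proof (induction T arbitrary: Z rule: finite_induct)
 case empty
 then have "Z \<subseteq> B" by (metis Un_empty_right span_eq_iff)
 then have "Z \<subseteq> span ((B \<inter> Z) \<union> {})" using span_superset[of "B \<inter> Z"] by auto
 then show ?case by (intro exI[of _ "{}"]) auto
next
 case (insert t T)
 define Z1 where "Z1 = Z \<inter> span (B \<union> T)"
 have "subspace Z1" unfolding Z1_def using insert.prems(1) by (simp add: subspace_inter)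
 then obtain T1 where T1: "finite T1" "card T1 \<le> card T" "T1 \<subseteq> Z1" "Z1 \<subseteq> span ((B \<inter> Z1) \<union> T1)"
  using insert.IH[of Z1] insert.prems(2) Z1_def by blast
 have sub: "span ((B \<inter> Z1) \<union> T1) \<subseteq> span ((B \<inter> Z) \<union> T1)"
  by (rule span_mono) (auto simp: Z1_def)
 show ?case
 proof (cases "Z \<subseteq> Z1")
  case True
  then show ?thesis using T1 sub insert.hyps
   by (intro exI[of _ T1]) (auto simp: Z1_def)
 next
  case False
  then obtain z where z: "z \<in> Z" "z \<notin> span (B \<union> T)" by (auto simp: Z1_def)
  have br: "\<exists>k. w - k *s t \<in> span (B \<union> T)" if "w \<in> Z" for w
   using insert.prems(3) that span_breakdown_eq[of w t "B \<union> T"] by auto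
  obtain k where k: "z - k *s t \<in> span (B \<union> T)" using br z by blast
  have k0: "k ~= 0" using k z by auto
  have "Z \<subseteq> span ((B \<inter> Z) \<union> insert z T1)"
  proof
   fix w assume w: "w \<in> Z"
   obtain c where c: "w - c *s t \<in> span (B \<union> T)" using br w by blast
   have eq: "w - (c/k) *s z = (w - c *s t) - (c/k) *s (z - k *s t)"
    using k0 by (simp add: scale_right_diff_distrib)
   have "w - (c/k) *s z \<in> span (B \<union> T)" unfolding eq
    by (intro span_diff span_scale c k)
   moreover have "w - (c/k) *s z \<in> Z"
    using w z insert.prems(1) by (intro subspace_diff subspace_scale) auto
   ultimately have "w - (c/k) *s z \<in> span ((B \<inter> Z) \<union> T1)" using T1 sub Z1_def by blast
   then show "w \<in> span ((B \<inter> Z) \<union> insert z T1)"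
    using span_breakdown_eq[of w z "(B \<inter> Z) \<union> T1"] by auto
  qed
  moreover have "card (insert z T1) \<le> card (insert t T)"
   using T1 insert.hyps by (simp add: card_insert_if)
  moreover have "insert z T1 \<subseteq> Z" using T1 z by (auto simp: Z1_def)
  ultimately show ?thesis using T1 by (intro exI[of _ "insert z T1"]) auto
 qed
qed

lemma dependent_mod_subspace:
 assumes "finite T" "subspace B" "finite I" "card T < card I" "!!i. i \<in> I ==> f i \<in> span (B \<union> T)"
 shows "\<exists>c. (\<exists>i\<in>I. c i ~= 0) \<and> (\<Sum>i\<in>I. c i *s f i) \<in> B"
 using assms
proof (induction T arbitrary: I f rule: finite_induct)
 case empty
 have "f i \<in> B" if "i \<in> I" for i using empty.prems(4)[OF that] empty.prems(1)
  by (metis Un_empty_right span_eq_iff)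
 then have "(\<Sum>i\<in>I. 1 *s f i) \<in> B" by (simp add: subspace_sum empty.prems(1))
 moreover have "I ~= {}" using empty.prems(3) by auto
 ultimately show ?case by (intro exI[of _ "\<lambda>_. 1"]) auto
next
 case (insert t T)
 have "\<forall>i\<in>I. \<exists>k. f i - k *s t \<in> span (B \<union> T)"
  using insert.prems(4) span_breakdown_eq[of _ t "B \<union> T"] by auto
 then obtain \<alpha> where \<alpha>: "!!i. i \<in> I ==> f i - \<alpha> i *s t \<in> span (B \<union> T)" by metis
 show ?case
 proof (cases "\<forall>i\<in>I. \<alpha> i = 0")
  case True
  then have "f i \<in> span (B \<union> T)" if "i \<in> I" for i using \<alpha>[OF that] that by auto
  then show ?thesis using insert.IH[OF insert.prems(1,2)] insert.prems(3) insert.hyps by auto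
 next
  case False
  then obtain p where p: "p \<in> I" "\<alpha> p ~= 0" by blast
  define g where "g i = f i - (\<alpha> i / \<alpha> p) *s f p" for i
  have g: "g i \<in> span (B \<union> T)" if "i \<in> I" for i
  proof -
   have "g i = (f i - \<alpha> i *s t) - (\<alpha> i / \<alpha> p) *s (f p - \<alpha> p *s t)"
    using p by (simp add: g_def scale_right_diff_distrib)
   then show ?thesis using \<alpha>[OF that] \<alpha>[OF p(1)] by (simp add: span_diff span_scale)
  qed
  have "card T < card (I - {p})" using insert.prems(3) insert.hyps p insert.prems(2) by simp
  then obtain c where c: "\<exists>i\<in>I - {p}. c i ~= 0" "(\<Sum>i\<in>I - {p}. c i *s g i) \<in> B"
   using insert.IH[OF insert.prems(1), of "I - {p}" g] insert.prems(2) g by auto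
  define c' where "c' = c(p := - (\<Sum>i\<in>I - {p}. c i * (\<alpha> i / \<alpha> p)))"
  have "(\<Sum>i\<in>I. c' i *s f i) = c' p *s f p + (\<Sum>i\<in>I - {p}. c' i *s f i)"
   using p insert.prems(2) by (simp add: sum.remove)
  also have "(\<Sum>i\<in>I - {p}. c' i *s f i) = (\<Sum>i\<in>I - {p}. c i *s f i)"
   by (rule sum.cong) (auto simp: c'_def)
  also have "c' p *s f p + (\<Sum>i\<in>I - {p}. c i *s f i) = (\<Sum>i\<in>I - {p}. c i *s g i)"
   by (simp add: c'_def g_def scale_right_diff_distrib sum_subtractf scale_sum_left)
  finally have "(\<Sum>i\<in>I. c' i *s f i) \<in> B" using c by simp
  moreover have "\<exists>i\<in>I. c' i ~= 0" using c(1) by (auto simp: c'_def)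
  ultimately show ?thesis by blast
 qed
qed

text \<open>The form in which dimension bounds for quotients are used: too many elements satisfy a relation.\<close>

lemma codim_le_dependent:
 assumes "codim_le Z B n" "subspace B" "finite I" "n < card I" "!!i. i \<in> I ==> f i \<in> Z"
 shows "\<exists>c. (\<exists>i\<in>I. c i ~= 0) \<and> (\<Sum>i\<in>I. c i *s f i) \<in> B"
proof -
 obtain T where T: "finite T" "card T \<le> n" "Z \<subseteq> span (B \<union> T)"
  using assms(1) unfolding codim_le_def by blast
 show ?thesis
  using dependent_mod_subspace[OF T(1) assms(2,3), of f] T(2,3) assms(4,5) by (meson le_less_trans subsetD)
qed

text \<open>
 A functional that vanishes on the common kernel of finitely many others is a combination of them.
\<close>

lemma functional_combination:
 fixes f :: "'b => 'a"
 assumes "finite I" "subspace U"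
  and "!!v w. v \<in> U ==> w \<in> U ==> f (v + w) = f v + f w"
  and "!!a v. v \<in> U ==> f (a *s v) = a * f v"
  and "!!i v w. i \<in> I ==> v \<in> U ==> w \<in> U ==> F i (v + w) = F i v + F i w"
  and "!!i a v. i \<in> I ==> v \<in> U ==> F i (a *s v) = a * F i v"
  and "!!v. v \<in> U ==> (!!i. i \<in> I ==> F i v = 0) ==> f v = 0"
 shows "\<exists>c. \<forall>v\<in>U. f v = (\<Sum>i\<in>I. c i * F i v)"
 using assms
proof (induction I arbitrary: U rule: finite_induct)
 case empty
 then show ?case by simp
next
 case (insert j I)
 define U' where "U' = {v\<in>U. F j v = 0}"
 have F0: "F j 0 = 0" using insert.prems(5)[of j 0 0] insert.prems(1) subspace_0 by auto
 have "subspace U'" unfolding U'_def using insert.prems(1,4,5) F0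
  by (intro subspaceI) (auto simp: subspace_0 subspace_add subspace_scale)
 then have "\<exists>c. \<forall>v\<in>U'. f v = (\<Sum>i\<in>I. c i * F i v)"
 proof (rule insert.IH)
  fix v assume v: "v \<in> U'" "!!i. i \<in> I ==> F i v = 0"
  then have "F i v = 0" if "i \<in> insert j I" for i using that by (auto simp: U'_def)
  then show "f v = 0" using insert.prems(6)[of v] v(1) by (auto simp: U'_def)
 qed (use insert.prems in \<open>auto simp: U'_def\<close>)
 then obtain c where c: "!!v. v \<in> U' ==> f v = (\<Sum>i\<in>I. c i * F i v)" by blast
 show ?case
 proof (cases "U \<subseteq> U'")
  case True
  have "(\<Sum>i\<in>insert j I. (c(j := 0)) i * F i v) = (\<Sum>i\<in>I. c i * F i v)" for v
  proof -
   have "(\<Sum>i\<in>I. (c(j := 0)) i * F i v) = (\<Sum>i\<in>I. c i * F i v)"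
    using insert.hyps by (intro sum.cong) auto
   then show ?thesis using insert.hyps by simp
  qed
  then show ?thesis using c True by (metis subsetD)
 next
  case False
  then obtain w0 where w0: "w0 \<in> U" "F j w0 ~= 0" by (auto simp: U'_def)
  define c' where "c' = c(j := (f w0 - (\<Sum>i\<in>I. c i * F i w0)) / F j w0)"
  have "f v = (\<Sum>i\<in>insert j I. c' i * F i v)" if v: "v \<in> U" for v
  proof -
   define a where "a = F j v / F j w0"
   have aw: "(- a) *s w0 \<in> U" by (rule subspace_scale[OF insert.prems(1) w0(1)])
   have lin: "f (v + (- a) *s w0) = f v - a * f w0"
    "!!i. i \<in> insert j I ==> F i (v + (- a) *s w0) = F i v - a * F i w0"
    using insert.prems(2)[OF v aw] insert.prems(3)[OF w0(1)]
     insert.prems(4)[OF _ v aw] insert.prems(5)[OF _ w0(1)] by (simp_all del: scale_minus_left)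
   have "v + (- a) *s w0 \<in> U'" unfolding U'_def
    using lin(2)[of j] w0 subspace_add[OF insert.prems(1) v aw] by (auto simp: a_def)
   from c[OF this] have "f v - a * f w0 = (\<Sum>i\<in>I. c i * F i (v + (- a) *s w0))"
    unfolding lin(1) .
   also have "... = (\<Sum>i\<in>I. c i * (F i v - a * F i w0))"
    by (intro sum.cong refl) (simp only: lin(2) insertI2)
   also have "... = (\<Sum>i\<in>I. c i * F i v) - a * (\<Sum>i\<in>I. c i * F i w0)"
    by (simp add: algebra_simps sum_subtractf sum_distrib_left)
   finally have "f v = (\<Sum>i\<in>I. c i * F i v) + c' j * F j v"
    using w0 by (simp add: c'_def a_def field_simps)
   moreover have "(\<Sum>i\<in>I. c' i * F i v) = (\<Sum>i\<in>I. c i * F i v)"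
    using insert.hyps by (intro sum.cong) (auto simp: c'_def)
   ultimately show ?thesis using insert.hyps by simp
  qed
  then show ?thesis by blast
 qed
qed

end


section \<open>Noetherian modules\<close>

locale scalar_module = module scale
 for scale :: "'a::comm_ring_1 => 'b::ab_group_add => 'b" (infixr "*s" 75)
begin

definition submod :: "'a set => 'b set => bool" where
 "submod \<Omega> N \<longleftrightarrow> 0 \<in> N \<and> (\<forall>v\<in>N. \<forall>w\<in>N. v + w \<in> N) \<and> (\<forall>r\<in>\<Omega>. \<forall>v\<in>N. r *s v \<in> N)"

definition gen :: "'a set => 'b set => 'b set" where
 "gen \<Omega> W = \<Inter>{N. submod \<Omega> N \<and> W \<subseteq> N}"

definition noetherian :: "'a set => 'b set => bool" where
 "noetherian \<Omega> M \<longleftrightarrow> (\<forall>N. submod \<Omega> N \<and> N \<subseteq> M --> (\<exists>W. finite W \<and> W \<subseteq> N \<and> N \<subseteq> gen \<Omega> W))"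

lemma submodI:
 "0 \<in> N ==> (!!v w. v \<in> N ==> w \<in> N ==> v + w \<in> N) ==>
  (!!r v. r \<in> \<Omega> ==> v \<in> N ==> r *s v \<in> N) ==> submod \<Omega> N"
 by (simp add: submod_def)

lemma submod_zero: "submod \<Omega> N ==> 0 \<in> N"
 and submod_add: "submod \<Omega> N ==> v \<in> N ==> w \<in> N ==> v + w \<in> N"
 and submod_scale: "submod \<Omega> N ==> r \<in> \<Omega> ==> v \<in> N ==> r *s v \<in> N"
 by (auto simp: submod_def)

lemma submod_diff: "submod \<Omega> N ==> - 1 \<in> \<Omega> ==> v \<in> N ==> w \<in> N ==> v - w \<in> N"
 using submod_add[of \<Omega> N v "- w"] submod_scale[of \<Omega> N "- 1" w] by simp

lemma submod_sum: "submod \<Omega> N ==> (!!i. i \<in> I ==> f i \<in> N) ==> sum f I \<in> N"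
 by (induction I rule: infinite_finite_induct) (auto simp: submod_def)

lemma submod_gen: "submod \<Omega> (gen \<Omega> W)"
 by (auto simp: gen_def submod_def)

lemma gen_superset: "W \<subseteq> gen \<Omega> W"
 by (auto simp: gen_def)

lemma gen_minimal: "submod \<Omega> N ==> W \<subseteq> N ==> gen \<Omega> W \<subseteq> N"
 by (auto simp: gen_def)

lemma gen_mono: "W \<subseteq> W' ==> gen \<Omega> W \<subseteq> gen \<Omega> W'"
 by (auto simp: gen_def)

lemma submod_mono: "submod \<Omega> N ==> \<Omega>' \<subseteq> \<Omega> ==> submod \<Omega>' N"
 by (auto simp: submod_def)

lemma gen_finite_subset:
 assumes "v \<in> gen \<Omega> W"
 shows "\<exists>W0. finite W0 \<and> W0 \<subseteq> W \<and> v \<in> gen \<Omega> W0"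
proof -
 let ?N = "{v. \<exists>W0. finite W0 \<and> W0 \<subseteq> W \<and> v \<in> gen \<Omega> W0}"
 have "submod \<Omega> ?N"
 proof (rule submodI)
  show "0 \<in> ?N" using submod_zero[OF submod_gen] by (auto intro: exI[of _ "{}"])
 next
  fix v w assume "v \<in> ?N" "w \<in> ?N"
  then obtain V1 V2 where "finite V1" "V1 \<subseteq> W" "v \<in> gen \<Omega> V1" "finite V2" "V2 \<subseteq> W" "w \<in> gen \<Omega> V2"
   by blast
  moreover from this have "v + w \<in> gen \<Omega> (V1 \<union> V2)"
   using gen_mono[of V1 "V1 \<union> V2" \<Omega>] gen_mono[of V2 "V1 \<union> V2" \<Omega>] submod_add[OF submod_gen] by blast
  ultimately show "v + w \<in> ?N" by (metis (mono_tags, lifting) finite_Un le_sup_iff mem_Collect_eq)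
 next
  fix r v assume "r \<in> \<Omega>" "v \<in> ?N"
  then obtain V1 where "finite V1" "V1 \<subseteq> W" "v \<in> gen \<Omega> V1" by blast
  moreover from this have "r *s v \<in> gen \<Omega> V1" using submod_scale[OF submod_gen] \<open>r \<in> \<Omega>\<close> by blast
  ultimately show "r *s v \<in> ?N" by blast
 qed
 moreover have "W \<subseteq> ?N"
 proof
  fix w assume "w \<in> W"
  moreover have "w \<in> gen \<Omega> {w}" using gen_superset[of "{w}" \<Omega>] by simp
  ultimately show "w \<in> ?N" by (intro CollectI exI[of _ "{w}"]) simp
 qed
 ultimately have "gen \<Omega> W \<subseteq> ?N" by (rule gen_minimal)
 then show ?thesis using assms by blast
qed

text \<open>A finitely generated hull is generated by finitely many members of any generating set.\<close>

lemma gen_finite_of_finite: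
 assumes "finite V" "V \<subseteq> gen \<Omega> W"
 shows "\<exists>W0. finite W0 \<and> W0 \<subseteq> W \<and> V \<subseteq> gen \<Omega> W0"
 using assms
proof (induction V rule: finite_induct)
 case empty
 then show ?case by blast
next
 case (insert v V)
 from insert obtain W0 where W0: "finite W0" "W0 \<subseteq> W" "V \<subseteq> gen \<Omega> W0" by auto
 obtain W1 where W1: "finite W1" "W1 \<subseteq> W" "v \<in> gen \<Omega> W1"
  using gen_finite_subset[of v \<Omega> W] insert.prems by auto
 have "insert v V \<subseteq> gen \<Omega> (W0 \<union> W1)"
  using W0(3) W1(3) gen_mono[of W0 "W0 \<union> W1" \<Omega>] gen_mono[of W1 "W0 \<union> W1" \<Omega>] by auto
 then show ?case using W0(1,2) W1(1,2) by (intro exI[of _ "W0 \<union> W1"]) simp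
qed

text \<open>
 The argument of Hilbert's basis theorem, for \<open>M = \<Sum>\<^sub>i x\<^sup>i M\<^sub>0\<close> rather than for a polynomial ring:
 the leading coefficients in degree \<open>n\<close> of the elements of a submodule form an ascending
 chain of submodules of \<open>M\<^sub>0\<close>.
\<close>

lemma noetherian_adjoin:
 assumes neg: "- 1 \<in> \<Omega>" and M0: "submod \<Omega> M\<^sub>0" and noeth: "noetherian \<Omega> M\<^sub>0"
 shows "\<exists>M. M\<^sub>0 \<subseteq> M \<and> submod (insert x \<Omega>) M \<and> noetherian (insert x \<Omega>) M"
proof -
 let ?O = "insert x \<Omega>"
 define P where "P = rec_nat {0} (\<lambda>n A. {v + (x ^ n) *s m | v m. v \<in> A \<and> m \<in> M\<^sub>0})"
 have P0: "P 0 = {0}" and PS: "!!n. P (Suc n) = {v + (x ^ n) *s m | v m. v \<in> P n \<and> m \<in> M\<^sub>0}"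
  by (simp_all add: P_def)
 have PI: "a + (x^n) *s b \<in> P (Suc n)" if "a \<in> P n" "b \<in> M\<^sub>0" for n a b
  using that unfolding PS by blast
 have PE: "\<exists>a\<in>P n. \<exists>b\<in>M\<^sub>0. v = a + (x^n) *s b" if "v \<in> P (Suc n)" for n v
  using that unfolding PS by blast
 have P_sub: "submod \<Omega> (P n)" for n
 proof (induction n)
  case 0
  then show ?case by (auto simp: P0 submod_def)
 next
  case (Suc n)
  show ?case
  proof (rule submodI)
   show "0 \<in> P (Suc n)" using PI[OF submod_zero[OF Suc] submod_zero[OF M0]] by simp
  next
   fix v w assume "v \<in> P (Suc n)" "w \<in> P (Suc n)"
   then obtain a b c d where "v = a + (x^n) *s b" "w = c + (x^n) *s d" "a \<in> P n" "c \<in> P n"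
    "b \<in> M\<^sub>0" "d \<in> M\<^sub>0" using PE by metis
   then show "v + w \<in> P (Suc n)"
    using PI[OF submod_add[OF Suc, of a c] submod_add[OF M0, of b d]]
    by (simp add: scale_right_distrib algebra_simps)
  next
   fix r v assume r: "r \<in> \<Omega>" "v \<in> P (Suc n)"
   then obtain a b where "v = a + (x^n) *s b" "a \<in> P n" "b \<in> M\<^sub>0" using PE by metis
   then show "r *s v \<in> P (Suc n)"
    using PI[OF submod_scale[OF Suc r(1), of a] submod_scale[OF M0 r(1), of b]]
    by (simp add: scale_right_distrib mult.commute)
  qed
 qed
 have P_Suc: "P n \<subseteq> P (Suc n)" for n
  using PI[OF _ submod_zero[OF M0], of _ n] by auto
 have P_mono: "m \<le> n ==> P m \<subseteq> P n" for m n
  using P_Suc by (rule lift_Suc_mono_le)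
 have P_x: "v \<in> P n ==> x *s v \<in> P (Suc n)" for v n
 proof (induction n arbitrary: v)
  case 0
  then show ?case using submod_zero[OF P_sub] by (auto simp: P0)
 next
  case (Suc n)
  then obtain a b where ab: "v = a + (x^n) *s b" "a \<in> P n" "b \<in> M\<^sub>0" using PE by metis
  then have "x *s v = x *s a + (x ^ Suc n) *s b" by (simp add: scale_right_distrib)
  then show ?case using PI[OF Suc.IH[OF ab(2)] ab(3)] by simp
 qed
 have P_xk: "v \<in> P n ==> (x^k) *s v \<in> P (n + k)" for v n k
 proof (induction k)
  case (Suc k)
  then show ?case using P_x[of "(x^k) *s v" "n + k"] by simp
 qed auto
 define M where "M = (\<Union>n. P n)"
 have "M\<^sub>0 \<subseteq> P (Suc 0)" using PI[of 0 0] by (auto simp: P0)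
 then have "M\<^sub>0 \<subseteq> M" by (auto simp: M_def)
 moreover have "submod ?O M"
 proof (rule submodI)
  show "0 \<in> M" using P0 by (auto simp: M_def)
 next
  fix v w assume "v \<in> M" "w \<in> M"
  then obtain m n where "v \<in> P m" "w \<in> P n" by (auto simp: M_def)
  then have "v \<in> P (max m n)" "w \<in> P (max m n)" using P_mono[of m "max m n"] P_mono[of n "max m n"] by auto
  then show "v + w \<in> M" using submod_add[OF P_sub] by (auto simp: M_def)
 next
  fix r v assume "r \<in> ?O" "v \<in> M"
  then show "r *s v \<in> M" using submod_scale[OF P_sub] P_x unfolding M_def by blast
 qed
 moreover have "noetherian ?O M"
  unfolding noetherian_def
 proof (intro allI impI, elim conjE)
  fix N assume N: "submod ?O N" "N \<subseteq> M"
  have N': "submod \<Omega> N" using N(1) submod_mono by blast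
  have Nx: "(x^k) *s v \<in> N" if "v \<in> N" for v k
   using that
  proof (induction k)
   case (Suc k)
   then show ?case using submod_scale[OF N(1), of x "(x^k) *s v"] by simp
  qed auto
  define lead where "lead n = {m \<in> M\<^sub>0. \<exists>v\<in>N. v - (x^n) *s m \<in> P n}" for n
  have leadI: "m \<in> lead n" if "m \<in> M\<^sub>0" "v \<in> N" "v - (x^n) *s m \<in> P n" for n m v
   using that unfolding lead_def by blast
  have leadE: "m \<in> M\<^sub>0 \<and> (\<exists>v\<in>N. v - (x^n) *s m \<in> P n)" if "m \<in> lead n" for n m
   using that unfolding lead_def by blast
  have lead_sub: "submod \<Omega> (lead n)" for n
  proof (rule submodI)
   have "0 - (x^n) *s 0 \<in> P n" using submod_zero[OF P_sub] by simp
   then show "0 \<in> lead n" using leadI[OF submod_zero[OF M0] submod_zero[OF N(1)]] by blast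
  next
   fix a b assume "a \<in> lead n" "b \<in> lead n"
   then obtain v w where vw: "a \<in> M\<^sub>0" "b \<in> M\<^sub>0" "v \<in> N" "w \<in> N" "v - (x^n) *s a \<in> P n" "w - (x^n) *s b \<in> P n"
    using leadE by metis
   have eq: "(v + w) - (x^n) *s (a + b) = (v - (x^n) *s a) + (w - (x^n) *s b)"
    by (simp add: scale_right_distrib)
   have "(v + w) - (x^n) *s (a + b) \<in> P n" unfolding eq by (rule submod_add[OF P_sub vw(5,6)])
   then show "a + b \<in> lead n"
    using leadI[OF submod_add[OF M0 vw(1,2)] submod_add[OF N(1) vw(3,4)]] by blast
  next
   fix r a assume r: "r \<in> \<Omega>" "a \<in> lead n"
   then obtain v where v: "a \<in> M\<^sub>0" "v \<in> N" "v - (x^n) *s a \<in> P n" using leadE by metis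
   have eq: "r *s v - (x^n) *s (r *s a) = r *s (v - (x^n) *s a)"
    by (simp add: scale_right_diff_distrib mult.commute)
   have "r *s v - (x^n) *s (r *s a) \<in> P n" unfolding eq by (rule submod_scale[OF P_sub r(1) v(3)])
   then show "r *s a \<in> lead n"
    using leadI[OF submod_scale[OF M0 r(1) v(1)] submod_scale[OF N' r(1) v(2)]] by blast
  qed
  have lead_Suc: "lead n \<subseteq> lead (Suc n)" for n
  proof
   fix a assume "a \<in> lead n"
   then obtain v where v: "a \<in> M\<^sub>0" "v \<in> N" "v - (x^n) *s a \<in> P n" using leadE by metis
   have eq: "x *s v - (x^Suc n) *s a = x *s (v - (x^n) *s a)"
    by (simp add: scale_right_diff_distrib)
   have "x *s v - (x^Suc n) *s a \<in> P (Suc n)" unfolding eq by (rule P_x[OF v(3)])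
   then show "a \<in> lead (Suc n)" using leadI[OF v(1) submod_scale[OF N(1) _ v(2)], of x] by blast
  qed
  have lead_mono: "m \<le> n ==> lead m \<subseteq> lead n" for m n
   using lead_Suc by (rule lift_Suc_mono_le)
  have "submod \<Omega> (\<Union>n. lead n)"
  proof (rule submodI)
   show "0 \<in> (\<Union>n. lead n)" using submod_zero[OF lead_sub] by blast
  next
   fix v w assume "v \<in> (\<Union>n. lead n)" "w \<in> (\<Union>n. lead n)"
   then obtain m n where "v \<in> lead m" "w \<in> lead n" by auto
   then have "v \<in> lead (max m n)" "w \<in> lead (max m n)"
    using lead_mono[of m "max m n"] lead_mono[of n "max m n"] by auto
   then show "v + w \<in> (\<Union>n. lead n)" using submod_add[OF lead_sub] by blast
  next
   fix r v assume "r \<in> \<Omega>" "v \<in> (\<Union>n. lead n)"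
   then show "r *s v \<in> (\<Union>n. lead n)" using submod_scale[OF lead_sub] by blast
  qed
  moreover have "(\<Union>n. lead n) \<subseteq> M\<^sub>0" by (auto simp: lead_def)
  ultimately obtain W where W: "finite W" "W \<subseteq> (\<Union>n. lead n)" "(\<Union>n. lead n) \<subseteq> gen \<Omega> W"
   using noeth unfolding noetherian_def by meson
  have "\<exists>p. W \<subseteq> lead p" using W(1,2)
  proof (induction W rule: finite_induct)
   case (insert w W)
   then obtain p q where "W \<subseteq> lead p" "w \<in> lead q" by auto
   then show ?case using lead_mono[of p "max p q"] lead_mono[of q "max p q"]
    by (intro exI[of _ "max p q"]) auto
  qed auto
  then obtain p where p: "W \<subseteq> lead p" by blast
  have stab: "lead n \<subseteq> lead p" for n
   using W(3) gen_minimal[OF lead_sub p] by blast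
  have "\<forall>n. \<exists>T. finite T \<and> T \<subseteq> lead n \<and> lead n \<subseteq> gen \<Omega> T"
  proof
   fix n
   have "lead n \<subseteq> M\<^sub>0" by (auto simp: lead_def)
   then show "\<exists>T. finite T \<and> T \<subseteq> lead n \<and> lead n \<subseteq> gen \<Omega> T"
    using noeth lead_sub unfolding noetherian_def by blast
  qed
  then obtain T where T: "!!n. finite (T n)" "!!n. T n \<subseteq> lead n" "!!n. lead n \<subseteq> gen \<Omega> (T n)"
   by metis
  have "\<forall>n t. t \<in> T n --> (\<exists>v\<in>N. v - (x^n) *s t \<in> P n)"
   using T(2) leadE by blast
  then obtain \<nu> where \<nu>: "!!n t. t \<in> T n ==> \<nu> n t \<in> N" "!!n t. t \<in> T n ==> \<nu> n t - (x^n) *s t \<in> P n"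
   by metis
  define V where "V = (\<Union>n\<le>p. \<nu> n ` T n)"
  have V: "finite V" "V \<subseteq> N" using T \<nu> by (auto simp: V_def)
  have gV: "gen ?O V \<subseteq> N" using gen_minimal[OF N(1) V(2)] .
  have gV': "submod \<Omega> (gen ?O V)" using submod_gen submod_mono by blast
  have lift: "\<exists>v\<in>gen ?O V. v - (x^n) *s m \<in> P n" if "n \<le> p" "m \<in> lead n" for n m
  proof -
   let ?A = "{m. \<exists>v\<in>gen ?O V. v - (x^n) *s m \<in> P n}"
   have "submod \<Omega> ?A"
   proof (rule submodI)
    have "0 - (x^n) *s 0 \<in> P n" using submod_zero[OF P_sub] by simp
    then show "0 \<in> ?A" using submod_zero[OF submod_gen] by blast
   next
    fix a b assume "a \<in> ?A" "b \<in> ?A"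
    then obtain v w where vw: "v \<in> gen ?O V" "w \<in> gen ?O V" "v - (x^n) *s a \<in> P n" "w - (x^n) *s b \<in> P n"
     by blast
    have eq: "(v + w) - (x^n) *s (a + b) = (v - (x^n) *s a) + (w - (x^n) *s b)"
     by (simp add: scale_right_distrib)
    have "(v + w) - (x^n) *s (a + b) \<in> P n" unfolding eq by (rule submod_add[OF P_sub vw(3,4)])
    then show "a + b \<in> ?A" using submod_add[OF submod_gen vw(1,2)] by blast
   next
    fix r a assume r: "r \<in> \<Omega>" "a \<in> ?A"
    then obtain v where v: "v \<in> gen ?O V" "v - (x^n) *s a \<in> P n" by blast
    have eq: "r *s v - (x^n) *s (r *s a) = r *s (v - (x^n) *s a)"
     by (simp add: scale_right_diff_distrib mult.commute)
    have "r *s v - (x^n) *s (r *s a) \<in> P n" unfolding eq by (rule submod_scale[OF P_sub r(1) v(2)])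
    then show "r *s a \<in> ?A" using submod_scale[OF gV' r(1) v(1)] by blast
   qed
   moreover have "T n \<subseteq> ?A"
   proof
    fix t assume t: "t \<in> T n"
    then have "\<nu> n t \<in> V" using that by (auto simp: V_def)
    then show "t \<in> ?A" using \<nu>(2)[OF t] gen_superset by blast
   qed
   ultimately show ?thesis using gen_minimal[of \<Omega> ?A "T n"] T(3)[of n] that by blast
  qed
  have "v \<in> N ==> v \<in> P n ==> v \<in> gen ?O V" for v n
  proof (induction n arbitrary: v)
   case 0
   then show ?case using submod_zero[OF submod_gen] by (simp add: P0)
  next
   case (Suc n)
   then obtain a m where am: "v = a + (x^n) *s m" "a \<in> P n" "m \<in> M\<^sub>0" using PE by metis
   have "v - (x^n) *s m \<in> P n" using am by simp
   then have mn: "m \<in> lead n" using leadI[OF am(3) Suc.prems(1)] by blast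
   have "\<exists>w\<in>gen ?O V. w - (x^n) *s m \<in> P n"
   proof (cases "n \<le> p")
    case True
    then show ?thesis using lift mn by blast
   next
    case False
    then obtain w where w: "w \<in> gen ?O V" "w - (x^p) *s m \<in> P p" using lift[of p m] stab mn by blast
    have eq: "(x^(n-p)) *s w - (x^n) *s m = (x^(n-p)) *s (w - (x^p) *s m)"
     using False by (simp add: scale_right_diff_distrib flip: power_add)
    have "(x^(n-p)) *s w - (x^n) *s m \<in> P n" unfolding eq
     using P_xk[OF w(2), of "n - p"] False by simp
    moreover have "(x^k) *s w \<in> gen ?O V" for k
    proof (induction k)
     case (Suc k)
     then show ?case using submod_scale[OF submod_gen, of x ?O "(x^k) *s w" V] by simp
    qed (use w in auto)
    ultimately show ?thesis by blast
   qed
   then obtain w where w: "w \<in> gen ?O V" "w - (x^n) *s m \<in> P n" by blast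
   have eq: "v - w = a - (w - (x^n) *s m)" using am(1) by simp
   have "v - w \<in> P n" unfolding eq by (rule submod_diff[OF P_sub neg am(2) w(2)])
   moreover have "v - w \<in> N" by (rule submod_diff[OF N' neg Suc.prems(1) subsetD[OF gV w(1)]])
   ultimately have "v - w \<in> gen ?O V" by (rule Suc.IH[rotated])
   from submod_add[OF submod_gen this w(1)] show ?case by simp
  qed
  then have "N \<subseteq> gen ?O V" using N(2) unfolding M_def by fast
  then show "\<exists>W. finite W \<and> W \<subseteq> N \<and> N \<subseteq> gen ?O W" using V by blast
 qed
 ultimately show ?thesis by (intro exI[of _ M]) simp
qed

lemma noetherian_finite_adjoin:
 assumes "finite X" "- 1 \<in> \<Omega>" "submod \<Omega> M\<^sub>0" "noetherian \<Omega> M\<^sub>0"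
 shows "\<exists>M. M\<^sub>0 \<subseteq> M \<and> submod (\<Omega> \<union> X) M \<and> noetherian (\<Omega> \<union> X) M"
 using assms(1)
proof (induction X rule: finite_induct)
 case empty
 then show ?case using assms(3,4) by (intro exI[of _ "M\<^sub>0"]) simp
next
 case (insert x X)
 then obtain M where M: "M\<^sub>0 \<subseteq> M" "submod (\<Omega> \<union> X) M" "noetherian (\<Omega> \<union> X) M" by blast
 have "- 1 \<in> \<Omega> \<union> X" using assms(2) by simp
 from noetherian_adjoin[OF this M(2,3), of x] M(1)
 show ?case by (metis Un_insert_right order_trans)
qed

end

sublocale linear_space \<subseteq> scalar_module
 by unfold_locales

lemma (in linear_space) noetherian_span_finite:
 assumes "finite F"
 shows "noetherian UNIV (span F)"
 unfolding noetherian_def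
proof (intro allI impI, elim conjE)
 fix N assume N: "submod UNIV N" "N \<subseteq> span F"
 obtain B where B: "B \<subseteq> N" "independent B" "N \<subseteq> span B" using maximal_independent_subset by blast
 have "finite B" using independent_span_bound[OF assms B(2)] B(1) N(2) by auto
 moreover have "span B \<subseteq> gen UNIV B"
  by (rule span_minimal[OF gen_superset]) (use submod_gen[of UNIV B] in \<open>auto simp: submod_def subspace_def\<close>)
 ultimately show "\<exists>W. finite W \<and> W \<subseteq> N \<and> N \<subseteq> gen UNIV W" using B by blast
qed

section \<open>Graded modules over a standard graded domain\<close>

text \<open>
 A standard graded domain inside the type \<open>'r\<close>: its degree 0 part is the field \<open>emb k\<close>, it is generated
 by the finite set \<open>X\<close> of forms of degree 1, and \<open>cmp n\<close> is the projection to the component of degree \<open>n\<close>.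
\<close>

locale graded_domain =
 fixes emb :: "'k::field => 'r::idom" and R :: "'r set" and cmp :: "int => 'r => 'r" and X :: "'r set"
 assumes emb_add: "emb (a + b) = emb a + emb b"
  and emb_mult: "emb (a * b) = emb a * emb b"
  and emb_one [simp]: "emb 1 = 1"
  and emb_R [simp]: "emb a \<in> R"
  and R_add: "r \<in> R ==> s \<in> R ==> r + s \<in> R"
  and R_mult: "r \<in> R ==> s \<in> R ==> r * s \<in> R"
  and cmp_R: "r \<in> R ==> cmp n r \<in> R"
  and cmp_add: "r \<in> R ==> s \<in> R ==> cmp n (r + s) = cmp n r + cmp n s"
  and cmp_cmp: "r \<in> R ==> cmp m (cmp n r) = (if m = n then cmp n r else 0)"
  and finite_cmp: "r \<in> R ==> finite {n. cmp n r ~= 0}"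
  and sum_cmp: "r \<in> R ==> (\<Sum>n | cmp n r ~= 0. cmp n r) = r"
  and cmp_mult: "r \<in> R ==> s \<in> R ==> cmp m r = r ==> cmp n s = s ==> cmp (m + n) (r * s) = r * s"
  and cmp_neg: "r \<in> R ==> n < 0 ==> cmp n r = 0"
  and cmp_zero_deg: "r \<in> R ==> \<exists>a. cmp 0 r = emb a"
  and cmp_emb: "cmp 0 (emb a) = emb a"
  and X_finite: "finite X"
  and X_R: "x \<in> X ==> x \<in> R"
  and X_deg: "x \<in> X ==> cmp 1 x = x"
  and X_gen: "r \<in> R ==> n \<ge> 0 ==> cmp (n + 1) r = r ==>
   \<exists>s. (\<forall>x\<in>X. s x \<in> R \<and> cmp n (s x) = s x) \<and> r = (\<Sum>x\<in>X. x * s x)"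
begin

definition H :: "int => 'r set" where "H n = {r \<in> R. cmp n r = r}"

definition mm :: "'r set" where "mm = {r \<in> R. cmp 0 r = 0}"

lemma emb_zero [simp]: "emb 0 = 0"
 using emb_add[of 0 0] by (metis add_0 add_left_cancel add_0_right)

lemma emb_minus: "emb (- a) = - emb a"
 using emb_add[of a "- a"] by (simp add: minus_unique)

lemma emb_diff: "emb (a - b) = emb a - emb b"
 using emb_add[of a "- b"] by (simp add: emb_minus)

lemma emb_inverse: "a ~= 0 ==> emb (inverse a) * emb a = 1"
 using emb_mult[of "inverse a" a] by simp

lemma emb_eq_0 [simp]: "emb a = 0 \<longleftrightarrow> a = 0"
proof
 assume "emb a = 0"
 then show "a = 0" using emb_inverse[of a] by (cases "a = 0") simp_all
qed simp

lemma R_zero [simp]: "0 \<in> R" and R_one [simp]: "1 \<in> R"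
 using emb_R[of 0] emb_R[of 1] by simp_all

lemma R_minus: "r \<in> R ==> - r \<in> R"
 using R_mult[OF emb_R[of "- 1"], of r] by (simp add: emb_minus)

lemma neg_one_R: "- 1 \<in> R"
 using R_minus[OF R_one] by simp

lemma R_diff: "r \<in> R ==> s \<in> R ==> r - s \<in> R"
 using R_add[OF _ R_minus, of r s] by simp

lemma R_sum: "(!!i. i \<in> I ==> f i \<in> R) ==> sum f I \<in> R"
 by (induction I rule: infinite_finite_induct) (auto intro: R_add)

lemma cmp_zero [simp]: "cmp n 0 = 0"
 using cmp_add[of 0 0 n] by (metis R_zero add_0 add_left_cancel add_0_right)

lemma cmp_minus: "r \<in> R ==> cmp n (- r) = - cmp n r"
 using cmp_add[of r "- r" n] by (simp add: R_minus minus_unique)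

lemma cmp_diff: "r \<in> R ==> s \<in> R ==> cmp n (r - s) = cmp n r - cmp n s"
 using cmp_add[of r "- s" n] by (simp add: R_minus cmp_minus)

lemma cmp_sum: "(!!i. i \<in> I ==> f i \<in> R) ==> cmp n (sum f I) = (\<Sum>i\<in>I. cmp n (f i))"
proof (induction I rule: infinite_finite_induct)
 case (insert i I)
 then show ?case using cmp_add[of "f i" "sum f I" n] R_sum[of I f] by simp
qed auto

lemma H_R: "r \<in> H n ==> r \<in> R" by (simp add: H_def)

lemma H_cmp: "r \<in> R ==> cmp n r \<in> H n" by (simp add: H_def cmp_R cmp_cmp)

lemma H_zero [simp]: "0 \<in> H n" by (simp add: H_def)

lemma H_add: "r \<in> H n ==> s \<in> H n ==> r + s \<in> H n" by (simp add: H_def cmp_add R_add)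

lemma H_diff: "r \<in> H n ==> s \<in> H n ==> r - s \<in> H n" by (simp add: H_def cmp_diff R_diff)

lemma H_sum: "(!!i. i \<in> I ==> f i \<in> H n) ==> sum f I \<in> H n"
 by (induction I rule: infinite_finite_induct) (auto intro: H_add)

lemma H_mult: "r \<in> H m ==> s \<in> H n ==> r * s \<in> H (m + n)"
 by (simp add: H_def R_mult cmp_mult)

lemma H_emb: "emb a \<in> H 0" by (simp add: H_def cmp_emb)

lemma H_emb_mult: "r \<in> H n ==> emb a * r \<in> H n"
 using H_mult[OF H_emb, of r n a] by simp

lemma H_one: "1 \<in> H 0" using H_emb[of 1] by simp

lemma H_zero_emb: "r \<in> H 0 ==> \<exists>a. r = emb a"
 using cmp_zero_deg[of r] by (auto simp: H_def)

lemma H_neg: "r \<in> H n ==> n < 0 ==> r = 0"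
 using cmp_neg[of r n] by (simp add: H_def)

lemma H_power: "r \<in> H m ==> r ^ n \<in> H (m * int n)"
proof (induction n)
 case (Suc n)
 then show ?case using H_mult[of r m "r ^ n" "m * int n"] by (simp add: algebra_simps)
qed (simp add: H_one)

lemma cmp_H_other: "r \<in> H n ==> m ~= n ==> cmp m r = 0"
 using cmp_cmp[of r m n] by (simp add: H_def)

lemma cmp_H: "r \<in> H n ==> cmp n r = r"
 by (simp add: H_def)

lemma X_H: "x \<in> X ==> x \<in> H 1" by (simp add: H_def X_R X_deg)

lemma H_gen:
 assumes "r \<in> H n" "n \<ge> 1"
 shows "\<exists>s. (\<forall>x\<in>X. s x \<in> H (n - 1)) \<and> r = (\<Sum>x\<in>X. x * s x)"
 using X_gen[of r "n - 1"] assms by (simp add: H_def)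

lemma mm_R: "r \<in> mm ==> r \<in> R" by (simp add: mm_def)

lemma H_mm: "r \<in> H n ==> n > 0 ==> r \<in> mm"
 using cmp_H_other[of r n 0] by (auto simp: mm_def H_R)

lemma mm_add: "r \<in> mm ==> s \<in> mm ==> r + s \<in> mm"
 by (simp add: mm_def cmp_add R_add)

lemma R_decomp: "r \<in> R ==> \<exists>a. r - emb a \<in> mm"
 using cmp_zero_deg[of r] by (auto simp: mm_def cmp_diff R_diff cmp_emb)

lemma mm_gen:
 assumes r: "r \<in> mm"
 shows "\<exists>s. (\<forall>x\<in>X. s x \<in> R) \<and> r = (\<Sum>x\<in>X. x * s x)"
proof -
 let ?N = "{n. cmp n r ~= 0}"
 have rR: "r \<in> R" using r by (simp add: mm_def)
 have "\<forall>n. \<exists>s. n \<in> ?N --> (\<forall>x\<in>X. s x \<in> R) \<and> cmp n r = (\<Sum>x\<in>X. x * s x)"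
 proof
  fix n
  show "\<exists>s. n \<in> ?N --> (\<forall>x\<in>X. s x \<in> R) \<and> cmp n r = (\<Sum>x\<in>X. x * s x)"
  proof (cases "n \<in> ?N")
   case True
   then have "n ~= 0" "\<not> n < 0" using r rR cmp_neg by (auto simp: mm_def)
   then show ?thesis using H_gen[OF H_cmp[OF rR, of n]] H_R by fastforce
  qed auto
 qed
 from choice[OF this] obtain s where
  *: "!!n. n \<in> ?N ==> (\<forall>x\<in>X. s n x \<in> R) \<and> cmp n r = (\<Sum>x\<in>X. x * s n x)" by blast
 have s: "!!n x. n \<in> ?N ==> x \<in> X ==> s n x \<in> R"
  "!!n. n \<in> ?N ==> cmp n r = (\<Sum>x\<in>X. x * s n x)"
  using * by blast+
 have "r = (\<Sum>n\<in>?N. cmp n r)" by (simp only: sum_cmp[OF rR])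
 also have "... = (\<Sum>n\<in>?N. \<Sum>x\<in>X. x * s n x)" by (intro sum.cong refl s(2))
 also have "... = (\<Sum>x\<in>X. x * (\<Sum>n\<in>?N. s n x))"
  by (subst sum.swap) (simp add: sum_distrib_left)
 finally show ?thesis
  using s(1) by (intro exI[of _ "\<lambda>x. \<Sum>n\<in>?N. s n x"]) (auto intro: R_sum)
qed

sublocale kR: linear_space "\<lambda>c r. emb c * r"
 by unfold_locales (simp_all add: algebra_simps emb_add emb_mult)

sublocale RR: scalar_module "(*) :: 'r => 'r => 'r"
 by unfold_locales (simp_all add: algebra_simps)

end


text \<open>
 A finitely generated graded module \<open>L\<close> inside the type \<open>'v\<close>. A quotient \<open>L/N\<close> is represented by the
 submodule \<open>N\<close> throughout: notions for \<open>L/N\<close> are notions for \<open>L\<close> with a parameter \<open>N\<close>.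
\<close>

locale graded_module = graded_domain emb R cmp X + scalar_module scale
 for emb :: "'k::field => 'r::idom" and R cmp X
  and scale :: "'r => 'v::ab_group_add => 'v" (infixr "*s" 75) +
 fixes L :: "'v set" and prj :: "int => 'v => 'v" and E :: "'v set"
 assumes L_sub: "submod R L"
  and prj_L: "v \<in> L ==> prj a v \<in> L"
  and prj_add: "v \<in> L ==> w \<in> L ==> prj a (v + w) = prj a v + prj a w"
  and prj_prj: "v \<in> L ==> prj a (prj b v) = (if a = b then prj b v else 0)"
  and finite_prj: "v \<in> L ==> finite {a. prj a v ~= 0}"
  and sum_prj: "v \<in> L ==> (\<Sum>a | prj a v ~= 0. prj a v) = v"
  and prj_scale_H: "r \<in> H n ==> v \<in> L ==> prj a (r *s v) = r *s prj (a - n) v"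
  and E_finite: "finite E"
  and E_L: "e \<in> E ==> e \<in> L"
  and E_hom: "e \<in> E ==> \<exists>a. prj a e = e"
  and E_gen: "L \<subseteq> gen R E"
begin

sublocale k: linear_space "\<lambda>c v. emb c *s v"
 by unfold_locales (simp_all add: algebra_simps emb_add emb_mult)

definition Lh :: "int => 'v set" where "Lh a = {v \<in> L. prj a v = v}"

definition grsub :: "'v set => bool" where
 "grsub N \<longleftrightarrow> submod R N \<and> N \<subseteq> L \<and> (\<forall>a. \<forall>v\<in>N. prj a v \<in> N)"

definition addmul :: "'v set => 'r => 'v set" where
 "addmul N \<theta> = {n + \<theta> *s v | n v. n \<in> N \<and> v \<in> L}"

definition regular :: "'v set => 'r => bool" where
 "regular N \<theta> \<longleftrightarrow> (\<forall>v\<in>L. \<theta> *s v \<in> N --> v \<in> N)"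

lemmas L_zero [simp] = submod_zero[OF L_sub]
 and L_add = submod_add[OF L_sub]
 and L_scale = submod_scale[OF L_sub]
 and L_sum = submod_sum[OF L_sub]
 and L_diff = submod_diff[OF L_sub neg_one_R]

lemma prj_zero [simp]: "prj a 0 = 0"
 using prj_add[of 0 0 a] by (metis L_zero add_0 add_left_cancel add_0_right)

lemma prj_diff: "v \<in> L ==> w \<in> L ==> prj a (v - w) = prj a v - prj a w"
 using prj_add[of "v - w" w a] by (simp add: L_diff)

lemma prj_sum: "(!!i. i \<in> I ==> f i \<in> L) ==> prj a (sum f I) = (\<Sum>i\<in>I. prj a (f i))"
proof (induction I rule: infinite_finite_induct)
 case (insert i I)
 then show ?case using prj_add[of "f i" "sum f I" a] L_sum[of I f] by simp
qed auto

lemma Lh_L: "v \<in> Lh a ==> v \<in> L" by (simp add: Lh_def)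

lemma Lh_prj: "v \<in> L ==> prj a v \<in> Lh a" by (simp add: Lh_def prj_L prj_prj)

lemma Lh_zero [simp]: "0 \<in> Lh a" by (simp add: Lh_def)

lemma Lh_add: "v \<in> Lh a ==> w \<in> Lh a ==> v + w \<in> Lh a"
 by (simp add: Lh_def prj_add L_add)

lemma Lh_diff: "v \<in> Lh a ==> w \<in> Lh a ==> v - w \<in> Lh a"
 by (simp add: Lh_def prj_diff L_diff)

lemma Lh_scale: "r \<in> H n ==> v \<in> Lh a ==> r *s v \<in> Lh (n + a)"
 by (simp add: Lh_def prj_scale_H L_scale H_R)

lemma Lh_scale': "r \<in> H n ==> v \<in> Lh a ==> b = n + a ==> r *s v \<in> Lh b"
 using Lh_scale by simp

lemma Lh_emb: "v \<in> Lh a ==> emb c *s v \<in> Lh a"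
 using Lh_scale[OF H_emb, of v a c] by simp

lemma prj_Lh_other: "v \<in> Lh a ==> b ~= a ==> prj b v = 0"
 using prj_prj[of v b a] by (simp add: Lh_def)

lemma prj_Lh: "v \<in> Lh a ==> prj a v = v" by (simp add: Lh_def)

lemma prj_scale:
 assumes "r \<in> R" "v \<in> L"
 shows "prj a (r *s v) = (\<Sum>n | cmp n r ~= 0. cmp n r *s prj (a - n) v)"
proof -
 have "prj a (r *s v) = prj a (\<Sum>n | cmp n r ~= 0. cmp n r *s v)"
  using sum_cmp[OF assms(1)] by (simp flip: scale_sum_left)
 also have "... = (\<Sum>n | cmp n r ~= 0. prj a (cmp n r *s v))"
  by (rule prj_sum) (simp add: L_scale cmp_R assms)
 also have "... = (\<Sum>n | cmp n r ~= 0. cmp n r *s prj (a - n) v)"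
  by (intro sum.cong refl prj_scale_H H_cmp assms)
 finally show ?thesis .
qed

lemma hom_induct:
 assumes "submod R N" "!!a v. v \<in> Lh a ==> v \<in> N" "v \<in> L"
 shows "v \<in> N"
proof -
 have "(\<Sum>a | prj a v ~= 0. prj a v) \<in> N"
  using assms by (intro submod_sum) (auto intro: Lh_prj)
 then show ?thesis using sum_prj assms by simp
qed

lemma submod_generators:
 assumes "submod (range emb \<union> X) N"
 shows "submod R N"
proof -
 have H: "r \<in> H (int n) ==> v \<in> N ==> r *s v \<in> N" for r n v
 proof (induction n arbitrary: r)
  case 0
  then show ?case using H_zero_emb[of r] submod_scale[OF assms, of r v] by auto
 next
  case (Suc n)
  obtain s where s: "!!x. x \<in> X ==> s x \<in> H (int n)" "r = (\<Sum>x\<in>X. x * s x)"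
   using H_gen[OF Suc.prems(1)] by auto
  have "x *s s x *s v \<in> N" if "x \<in> X" for x
   using submod_scale[OF assms, of x] Suc.IH[OF s(1)[OF that] Suc.prems(2)] that by blast
  then have "(\<Sum>x\<in>X. x *s s x *s v) \<in> N" by (intro submod_sum[OF assms])
  then show ?case by (simp add: s(2) scale_sum_left)
 qed
 show ?thesis
 proof (rule submodI)
  show "0 \<in> N" by (rule submod_zero[OF assms])
  show "v + w \<in> N" if "v \<in> N" "w \<in> N" for v w by (rule submod_add[OF assms that])
  show "r *s v \<in> N" if r: "r \<in> R" and v: "v \<in> N" for r v
  proof -
   have "cmp n r *s v \<in> N" for n
   proof (cases "n < 0")
    case True
    then show ?thesis using cmp_neg[OF r True] submod_zero[OF assms] by simp
   next
    case False
    then show ?thesis using H[of "cmp n r" "nat n" v] H_cmp[OF r, of n] v by simp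
   qed
   then have "(\<Sum>n | cmp n r ~= 0. cmp n r *s v) \<in> N" by (intro submod_sum[OF assms])
   then show ?thesis using sum_cmp[OF r] by (simp flip: scale_sum_left)
  qed
 qed
qed

lemma noetherian_L: "noetherian R L"
proof -
 let ?O = "range emb"
 have O: "!!N. submod ?O N = k.submod UNIV N" by (auto simp: submod_def k.submod_def)
 have "noetherian ?O (k.span E)"
  using k.noetherian_span_finite[OF E_finite]
  unfolding noetherian_def k.noetherian_def gen_def k.gen_def O .
 moreover have "submod ?O (k.span E)"
  unfolding O by (auto simp: k.submod_def k.span_zero k.span_add k.span_scale)
 moreover have "- 1 \<in> ?O" using emb_minus[of 1] by (metis emb_one rangeI)
 ultimately obtain M where M: "k.span E \<subseteq> M" "submod (?O \<union> X) M" "noetherian (?O \<union> X) M"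
  using noetherian_finite_adjoin[OF X_finite] by blast
 have "E \<subseteq> M" using M(1) k.span_superset[of E] by simp
 then have LM: "L \<subseteq> M" using gen_minimal[OF submod_generators[OF M(2)]] E_gen by blast
 have OR: "?O \<union> X \<subseteq> R" using X_R by auto
 show ?thesis unfolding noetherian_def
 proof (intro allI impI, elim conjE)
  fix N assume N: "submod R N" "N \<subseteq> L"
  have "submod (?O \<union> X) N" by (rule submod_mono[OF N(1) OR])
  then obtain W where W: "finite W" "W \<subseteq> N" "N \<subseteq> gen (?O \<union> X) W"
   using M(3) N(2) LM unfolding noetherian_def by (meson subset_trans)
  have "gen (?O \<union> X) W \<subseteq> gen R W"
   by (rule gen_minimal[OF submod_mono[OF submod_gen OR] gen_superset])
  then show "\<exists>W. finite W \<and> W \<subseteq> N \<and> N \<subseteq> gen R W" using W by blast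
 qed
qed

lemma bounded_below: "\<exists>b. \<forall>a<b. Lh a = {0}"
proof -
 have "\<forall>e. \<exists>d. e \<in> E --> prj d e = e" using E_hom by blast
 then obtain d where d: "!!e. e \<in> E ==> prj (d e) e = e" by metis
 define b where "b = Min (insert 0 (d ` E))"
 have b: "b \<le> d e" if "e \<in> E" for e using that E_finite by (simp add: b_def)
 let ?N = "{v \<in> L. \<forall>a<b. prj a v = 0}"
 have "submod R ?N"
 proof (rule submodI)
  show "r *s v \<in> ?N" if r: "r \<in> R" and v: "v \<in> ?N" for r v
  proof -
   have "cmp n r *s prj (a - n) v = 0" if "a < b" for a n
   proof (cases "n < 0")
    case True
    then show ?thesis using cmp_neg[OF r] by simp
   next
    case False
    then show ?thesis using v that by simp
   qed
   then have "prj a (r *s v) = 0" if "a < b" for a using that r v by (simp add: prj_scale)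
   then show ?thesis using r v L_scale by simp
  qed
 qed (auto simp: prj_add L_add)
 moreover have "E \<subseteq> ?N"
 proof
  fix e assume e: "e \<in> E"
  have "prj a e = 0" if "a < b" for a
   using prj_Lh_other[of e "d e" a] d[OF e] E_L[OF e] b[OF e] that by (simp add: Lh_def)
  then show "e \<in> ?N" using E_L[OF e] by simp
 qed
 ultimately have "L \<subseteq> ?N" using E_gen gen_minimal by blast
 then have "Lh a = {0}" if "a < b" for a using that by (fastforce simp: Lh_def)
 then show ?thesis by blast
qed

lemma grsub_submod: "grsub N ==> submod R N"
 and grsub_L: "grsub N ==> v \<in> N ==> v \<in> L"
 and grsub_prj: "grsub N ==> v \<in> N ==> prj a v \<in> N"
 by (auto simp: grsub_def)

lemma grsub_zero [simp]: "grsub N ==> 0 \<in> N"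
 and grsub_add: "grsub N ==> v \<in> N ==> w \<in> N ==> v + w \<in> N"
 and grsub_scale: "grsub N ==> r \<in> R ==> v \<in> N ==> r *s v \<in> N"
 by (auto simp: grsub_def submod_def)

lemma grsub_diff: "grsub N ==> v \<in> N ==> w \<in> N ==> v - w \<in> N"
 using submod_diff[OF grsub_submod neg_one_R] .

lemma grsub_sum: "grsub N ==> (!!i. i \<in> I ==> f i \<in> N) ==> sum f I \<in> N"
 using submod_sum[OF grsub_submod] .

lemma grsub_homI:
 assumes "grsub N" "v \<in> L" "!!a. prj a v \<in> N"
 shows "v \<in> N"
 using grsub_sum[OF assms(1), of "{a. prj a v ~= 0}" "\<lambda>a. prj a v"] assms sum_prj by simp

lemma addmul_iff: "v \<in> addmul N \<theta> \<longleftrightarrow> (\<exists>w\<in>L. v - \<theta> *s w \<in> N)"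
proof
 assume "\<exists>w\<in>L. v - \<theta> *s w \<in> N"
 then obtain w where "w \<in> L" "v - \<theta> *s w \<in> N" by blast
 moreover have "v = (v - \<theta> *s w) + \<theta> *s w" by simp
 ultimately show "v \<in> addmul N \<theta>" unfolding addmul_def by blast
next
 assume "v \<in> addmul N \<theta>"
 then obtain n w where "v = n + \<theta> *s w" "n \<in> N" "w \<in> L" unfolding addmul_def by blast
 then show "\<exists>w\<in>L. v - \<theta> *s w \<in> N" by (intro bexI[of _ w]) auto
qed

lemma submod_addmul:
 assumes N: "submod R N" and t: "\<theta> \<in> R"
 shows "submod R (addmul N \<theta>)"
proof (rule submodI)
 show "0 \<in> addmul N \<theta>" unfolding addmul_iff using submod_zero[OF N] by (intro bexI[of _ 0]) auto
next
 fix v w assume "v \<in> addmul N \<theta>" "w \<in> addmul N \<theta>"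
 then obtain v' w' where *: "v' \<in> L" "w' \<in> L" "v - \<theta> *s v' \<in> N" "w - \<theta> *s w' \<in> N"
  by (auto simp: addmul_iff)
 have eq: "(v + w) - \<theta> *s (v' + w') = (v - \<theta> *s v') + (w - \<theta> *s w')"
  by (simp add: scale_right_distrib)
 have "(v + w) - \<theta> *s (v' + w') \<in> N" unfolding eq by (rule submod_add[OF N *(3,4)])
 then show "v + w \<in> addmul N \<theta>" unfolding addmul_iff using L_add[OF *(1,2)] by blast
next
 fix r v assume r: "r \<in> R" and "v \<in> addmul N \<theta>"
 then obtain v' where *: "v' \<in> L" "v - \<theta> *s v' \<in> N" by (auto simp: addmul_iff)
 have eq: "r *s v - \<theta> *s (r *s v') = r *s (v - \<theta> *s v')"
  by (simp add: scale_right_diff_distrib mult.commute)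
 have "r *s v - \<theta> *s (r *s v') \<in> N" unfolding eq by (rule submod_scale[OF N r *(2)])
 then show "r *s v \<in> addmul N \<theta>" unfolding addmul_iff using L_scale[OF r *(1)] by blast
qed

lemma addmul_subset_L: "N \<subseteq> L ==> \<theta> \<in> R ==> addmul N \<theta> \<subseteq> L"
 unfolding addmul_def using L_add L_scale by blast

lemma grsub_addmul:
 assumes N: "grsub N" and t: "\<theta> \<in> H n"
 shows "grsub (addmul N \<theta>)"
proof -
 have "prj a v \<in> addmul N \<theta>" if "v \<in> addmul N \<theta>" for a v
 proof -
  from that obtain w where w: "w \<in> L" "v - \<theta> *s w \<in> N" by (auto simp: addmul_iff)
  then have vL: "v \<in> L" using grsub_L[OF N w(2)] L_add[of "v - \<theta> *s w" "\<theta> *s w"] L_scale[OF H_R[OF t] w(1)]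
   by simp
  have "prj a (v - \<theta> *s w) = prj a v - \<theta> *s prj (a - n) w"
   using vL w(1) t by (simp add: prj_diff L_scale H_R prj_scale_H)
  then have "prj a v - \<theta> *s prj (a - n) w \<in> N" using grsub_prj[OF N w(2), of a] by simp
  then show ?thesis unfolding addmul_iff using prj_L[OF w(1)] by blast
 qed
 then show ?thesis unfolding grsub_def
  using submod_addmul[OF grsub_submod[OF N] H_R[OF t]]
   addmul_subset_L[of N \<theta>] N t by (auto simp: grsub_def H_R)
qed

lemma addmul_superset: "v \<in> N ==> v \<in> addmul N \<theta>"
 unfolding addmul_iff by (intro bexI[of _ 0]) auto

lemma addmul_mult: "submod R N ==> v \<in> L ==> \<theta> *s v \<in> addmul N \<theta>"
 unfolding addmul_iff by (intro bexI[of _ v]) (auto simp: submod_zero)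

lemma addmul_hom:
 assumes N: "grsub N" and t: "\<theta> \<in> H n" and v: "v \<in> Lh a" "v \<in> addmul N \<theta>"
 shows "\<exists>w\<in>Lh (a - n). v - \<theta> *s w \<in> N"
proof -
 obtain w where w: "w \<in> L" "v - \<theta> *s w \<in> N" using v by (auto simp: addmul_iff)
 have "prj a (v - \<theta> *s w) = v - \<theta> *s prj (a - n) w"
  using v w(1) t by (simp add: prj_diff L_scale H_R prj_scale_H Lh_L prj_Lh)
 then show ?thesis using grsub_prj[OF N w(2), of a] Lh_prj[OF w(1)] by force
qed

lemma regular_homI:
 assumes N: "grsub N" and t: "\<theta> \<in> H n"
  and *: "!!a v. v \<in> Lh a ==> \<theta> *s v \<in> N ==> v \<in> N"
 shows "regular N \<theta>"
 unfolding regular_def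
proof (intro ballI impI)
 fix v assume v: "v \<in> L" "\<theta> *s v \<in> N"
 have "prj a v \<in> N" for a
 proof (rule *)
  show "prj a v \<in> Lh a" by (rule Lh_prj[OF v(1)])
  show "\<theta> *s prj a v \<in> N" using grsub_prj[OF N v(2), of "a + n"] prj_scale_H[OF t v(1), of "a + n"] by simp
 qed
 then show "v \<in> N" by (rule grsub_homI[OF N v(1)])
qed

end

lemma (in graded_domain) graded_module_self: "graded_module emb R cmp X (*) R cmp {1}"
proof (unfold_locales)
 show "RR.submod R R" by (rule RR.submodI) (auto intro: R_add R_mult)
 show "R \<subseteq> RR.gen R {1}"
 proof
  fix r assume "r \<in> R"
  then show "r \<in> RR.gen R {1}"
   using RR.submod_scale[OF RR.submod_gen, of r R 1 "{1}"] RR.gen_superset[of "{1}" R] by simp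
 qed
 show "\<exists>a. cmp a e = e" if "e \<in> {1}" for e
  using that H_one cmp_H by blast
 show "cmp a (r * v) = r * cmp (a - n) v" if r: "r \<in> H n" and v: "v \<in> R" for r n v a
 proof -
  have *: "cmp a (r * cmp i v) = (if i = a - n then r * cmp i v else 0)" for i
   using H_mult[OF r H_cmp[OF v, of i]] cmp_H_other[of "r * cmp i v" "n + i" a] cmp_H[of "r * cmp i v" "n + i"]
   by auto
  have "cmp a (r * v) = cmp a (\<Sum>i | cmp i v ~= 0. r * cmp i v)"
   using sum_cmp[OF v] by (simp flip: sum_distrib_left)
  also have "... = (\<Sum>i | cmp i v ~= 0. cmp a (r * cmp i v))"
   by (rule cmp_sum) (simp add: R_mult H_R[OF r] cmp_R v)
  also have "... = (if a - n \<in> {i. cmp i v ~= 0} then r * cmp (a - n) v else 0)"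
   unfolding * using finite_cmp[OF v] by (subst sum.delta) auto
  also have "... = r * cmp (a - n) v" by simp
  finally show ?thesis .
 qed
qed (auto simp: cmp_R cmp_add cmp_cmp finite_cmp sum_cmp)

section \<open>Homogeneous prime avoidance\<close>

lemma (in scalar_module) noetherian_maximal:
 assumes "noetherian \<Omega> M" "\<S> ~= {}" "!!N. N \<in> \<S> ==> submod \<Omega> N \<and> N \<subseteq> M"
 shows "\<exists>N\<in>\<S>. \<forall>N'\<in>\<S>. N \<subseteq> N' --> N' = N"
proof (rule subset_Zorn)
 fix C assume C: "subset.chain \<S> C"
 show "\<exists>U\<in>\<S>. \<forall>A\<in>C. A \<subseteq> U"
 proof (cases "C = {}")
  case True
  then show ?thesis using assms(2) by auto
 next
  case False
  have CS: "C \<subseteq> \<S>" and lin: "!!A B. A \<in> C ==> B \<in> C ==> A \<subseteq> B \<or> B \<subseteq> A"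
   using C by (auto simp: subset_chain_def)
  have sub: "submod \<Omega> N" "N \<subseteq> M" if "N \<in> C" for N using assms(3) CS that by blast+
  have "submod \<Omega> (\<Union>C)"
  proof (rule submodI)
   show "0 \<in> \<Union>C" using False submod_zero[OF sub(1)] by blast
  next
   fix v w assume "v \<in> \<Union>C" "w \<in> \<Union>C"
   then obtain A B where "A \<in> C" "B \<in> C" "v \<in> A" "w \<in> B" by blast
   then obtain N where "N \<in> C" "v \<in> N" "w \<in> N" using lin by blast
   then show "v + w \<in> \<Union>C" using submod_add[OF sub(1), of N v w] by blast
  next
   fix r v assume "r \<in> \<Omega>" "v \<in> \<Union>C"
   then show "r *s v \<in> \<Union>C" using submod_scale[OF sub(1), of _ r v] by blast
  qed
  moreover have "\<Union>C \<subseteq> M" using sub(2) by blast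
  ultimately obtain W where W: "finite W" "W \<subseteq> \<Union>C" "\<Union>C \<subseteq> gen \<Omega> W"
   using assms(1) unfolding noetherian_def by meson
  obtain B where B: "B \<in> C" "W \<subseteq> B"
   using finite_subset_Union_chain[OF W(1,2) False C] by blast
  have "\<Union>C \<subseteq> B" using gen_minimal[OF sub(1)[OF B(1)] B(2)] W(3) by blast
  then show ?thesis using B(1) CS by blast
 qed
qed

context graded_domain
begin

definition hprime :: "'r set => bool" where
 "hprime P \<longleftrightarrow> RR.submod R P \<and> P \<subseteq> R \<and>
   (\<forall>m n. \<forall>a\<in>H m. \<forall>b\<in>H n. a * b \<in> P --> a \<in> P \<or> b \<in> P)"

lemma hprime_mult: "hprime P ==> a \<in> H m ==> b \<in> H n ==> a * b \<in> P ==> a \<in> P \<or> b \<in> P"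
 unfolding hprime_def by blast

lemma hprime_power:
 assumes "hprime P" "1 \<notin> P" "a \<in> H m" "a \<notin> P"
 shows "a ^ n \<notin> P"
proof (induction n)
 case (Suc n)
 then show ?case using hprime_mult[OF assms(1,3) H_power[OF assms(3), of n]] assms(4) by auto
qed (use assms in simp)

lemma one_notin: "RR.submod R P ==> \<not> X \<subseteq> P ==> 1 \<notin> P"
 using RR.submod_scale[of R P _ 1] X_R by fastforce

text \<open>A homogeneous element of all \<open>Q\<close> but not of the prime \<open>P\<close>, as a product.\<close>

lemma hprime_avoiding_product:
 assumes P: "hprime P" "1 \<notin> P" and "finite \<Q>"
  and "!!Q. Q \<in> \<Q> ==> RR.submod R Q"
  and "!!Q. Q \<in> \<Q> ==> \<exists>n. \<exists>q\<in>H n. q \<in> Q \<and> q \<notin> P"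
 shows "\<exists>n. \<exists>p\<in>H n. p \<notin> P \<and> (\<forall>Q\<in>\<Q>. p \<in> Q)"
 using assms(3-5)
proof (induction \<Q> rule: finite_induct)
 case empty
 then show ?case using P(2) H_one by auto
next
 case (insert Q \<Q>)
 then obtain n p where p: "p \<in> H n" "p \<notin> P" "!!Q. Q \<in> \<Q> ==> p \<in> Q" by auto
 obtain m q where q: "q \<in> H m" "q \<in> Q" "q \<notin> P" using insert.prems(2)[of Q] by auto
 have "p * q \<in> Q" using RR.submod_scale[of R Q p q] insert.prems(1)[of Q] q H_R[OF p(1)] by simp
 moreover have "p * q \<in> Q'" if "Q' \<in> \<Q>" for Q'
  using RR.submod_scale[of R Q' q p] insert.prems(1)[of Q'] p(3)[OF that] H_R[OF q(1)] that
  by (simp add: mult.commute)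
 moreover have "p * q \<notin> P" using hprime_mult[OF P(1) p(1) q(1)] p(2) q(3) by blast
 ultimately show ?case using H_mult[OF p(1) q(1)] by auto
qed

text \<open>
 Primes may be assumed incomparable on homogeneous elements. Then products avoid all but one prime
 each, and suitable powers of them bring the summands to the same degree.
\<close>

lemma prime_avoidance:
 assumes "finite \<P>" "!!P. P \<in> \<P> ==> hprime P \<and> \<not> X \<subseteq> P"
 shows "\<exists>n>0. \<exists>f\<in>H n. \<forall>P\<in>\<P>. f \<notin> P"
 using assms
proof (induction "card \<P>" arbitrary: \<P> rule: less_induct)
 case less
 have sub: "RR.submod R P" if "P \<in> \<P>" for P using less.prems(2)[OF that] by (simp add: hprime_def)
 show ?case
 proof (cases "\<exists>P\<in>\<P>. \<exists>Q\<in>\<P>. P ~= Q \<and> (\<forall>n. P \<inter> H n \<subseteq> Q)")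
  case True
  then obtain P Q where PQ: "P \<in> \<P>" "Q \<in> \<P>" "P ~= Q" "!!n. P \<inter> H n \<subseteq> Q" by blast
  have "card (\<P> - {P}) < card \<P>" using PQ less.prems(1) by (meson card_Diff1_less)
  then obtain n f where f: "n > 0" "f \<in> H n" "!!P'. P' \<in> \<P> - {P} ==> f \<notin> P'"
   using less.hyps[of "\<P> - {P}"] less.prems by auto
  have "f \<notin> Q" using f(3) PQ by blast
  then have "f \<notin> P" using PQ(4)[of n] f(2) by blast
  then show ?thesis using f by blast
 next
  case False
  show ?thesis
  proof (cases "\<P> = {}")
   case True
   then show ?thesis by (intro exI[of _ 1] conjI bexI[of _ 0]) simp_all
  next
   case nonempty: False
   then obtain Q where Q: "Q \<in> \<P>" by blast
   have hQ: "hprime Q" "1 \<notin> Q" "\<not> X \<subseteq> Q" using less.prems(2)[OF Q] one_notin sub Q by auto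
   have "card (\<P> - {Q}) < card \<P>" using Q less.prems(1) by (meson card_Diff1_less)
   then obtain m f where f: "m > 0" "f \<in> H m" "!!P'. P' \<in> \<P> - {Q} ==> f \<notin> P'"
    using less.hyps[of "\<P> - {Q}"] less.prems by auto
   show ?thesis
   proof (cases "f \<in> Q")
    case False
    then show ?thesis using f by blast
   next
    case True
    have "\<exists>n. \<exists>q\<in>H n. q \<in> P \<and> q \<notin> Q" if "P \<in> \<P> - {Q}" for P
     using False Q that by blast
    then obtain n p where p: "p \<in> H n" "p \<notin> Q" "!!P. P \<in> \<P> - {Q} ==> p \<in> P"
     using hprime_avoiding_product[OF hQ(1,2), of "\<P> - {Q}"] less.prems(1) sub by auto
    obtain x where x: "x \<in> X" "x \<notin> Q" using hQ(3) by blast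
    define g where "g = x * p"
    have gH: "g \<in> H (1 + n)" unfolding g_def by (rule H_mult[OF X_H[OF x(1)] p(1)])
    have gQ: "g \<notin> Q" unfolding g_def using hprime_mult[OF hQ(1) X_H[OF x(1)] p(1)] x p by blast
    then have "g ~= 0" using RR.submod_zero[OF sub[OF Q]] by auto
    then have n: "1 + n \<ge> 0" using H_neg[OF gH] by linarith
    have gP: "g \<in> P" if "P \<in> \<P> - {Q}" for P
     unfolding g_def using RR.submod_scale[of R P x p] sub that p(3)[OF that] X_R[OF x(1)] by blast
    have "p ~= 0" using p(2) RR.submod_zero[OF sub[OF Q]] by auto
    then have n0: "n \<ge> 0" using H_neg[OF p(1)] by linarith
    define F where "F = f ^ nat (1 + n) + g ^ nat m"
    have deg: "m * int (nat (1 + n)) = (1 + n) * m" "(1 + n) * int (nat m) = (1 + n) * m"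
     using n f(1) by (simp_all add: mult.commute)
    have fH: "f ^ nat (1 + n) \<in> H ((1 + n) * m)"
     using H_power[OF f(2), of "nat (1 + n)"] by (simp only: deg)
    have gH': "g ^ nat m \<in> H ((1 + n) * m)"
     using H_power[OF gH, of "nat m"] by (simp only: deg)
    have FH: "F \<in> H ((1 + n) * m)" unfolding F_def by (rule H_add[OF fH gH'])
    have pow: "h ^ k \<in> P" if "h \<in> P" "h \<in> R" "k > 0" "P \<in> \<P>" for h k P
    proof -
     have "h ^ j \<in> R" for j by (induction j) (auto simp: that R_mult)
     then have "h ^ (k - 1) * h \<in> P" using RR.submod_scale[OF sub[OF that(4)], of "h ^ (k - 1)" h] that by simp
     then show ?thesis using that(3) by (simp flip: power_Suc2)
    qed
    have FP: "F \<notin> P" if P: "P \<in> \<P>" for P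
    proof (cases "P = Q")
     case True
     have "f ^ nat (1 + n) \<in> Q" using pow[of f Q] \<open>f \<in> Q\<close> H_R[OF f(2)] n0 Q by simp
     moreover have "g ^ nat m \<notin> Q" by (rule hprime_power[OF hQ(1,2) gH gQ])
     moreover have "g ^ nat m = F - f ^ nat (1 + n)" by (simp add: F_def)
     ultimately show ?thesis using RR.submod_diff[OF sub[OF Q] neg_one_R, of F "f ^ nat (1 + n)"] True by auto
    next
     case False
     then have P': "P \<in> \<P> - {Q}" using P by simp
     have hP: "hprime P" "1 \<notin> P" using less.prems(2)[OF P] one_notin sub P by auto
     have "g ^ nat m \<in> P" using pow[of g P] gP[OF P'] H_R[OF gH] f(1) P by simp
     moreover have "f ^ nat (1 + n) \<notin> P" by (rule hprime_power[OF hP f(2) f(3)[OF P']])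
     moreover have "f ^ nat (1 + n) = F - g ^ nat m" by (simp add: F_def)
     ultimately show ?thesis using RR.submod_diff[OF sub[OF P] neg_one_R, of F "g ^ nat m"] by auto
    qed
    have "(1 + n) * m > 0" using n0 f(1) by simp
    then show ?thesis by (intro exI[of _ "(1 + n) * m"] conjI bexI[of _ F] ballI FP FH)
   qed
  qed
 qed
qed

end

lemma (in graded_domain) noetherian_R: "RR.noetherian R R"
 using graded_module.noetherian_L[OF graded_module_self] .

context graded_module
begin

definition Ann :: "'v set => 'v => 'r set" where "Ann N w = {r \<in> R. r *s w \<in> N}"

lemma submod_Ann:
 assumes "submod R N"
 shows "RR.submod R (Ann N w)"
proof (rule RR.submodI)
 show "0 \<in> Ann N w" using submod_zero[OF assms] by (simp add: Ann_def)
 show "a + b \<in> Ann N w" if "a \<in> Ann N w" "b \<in> Ann N w" for a b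
  using that submod_add[OF assms] by (simp add: Ann_def scale_left_distrib R_add)
 show "r * a \<in> Ann N w" if "r \<in> R" "a \<in> Ann N w" for r a
  using that submod_scale[OF assms, of r "a *s w"] by (simp add: Ann_def R_mult)
qed

definition socle_free :: "'v set => bool" where
 "socle_free N \<longleftrightarrow> (\<forall>w\<in>L. (\<forall>x\<in>X. x *s w \<in> N) --> w \<in> N)"

text \<open>
 The maximal ones among the annihilators of homogeneous elements outside \<open>N\<close> are prime. There are
 finitely many: if all elements with maximal annihilators are generated by finitely many of
 them, then a product of elements of the corresponding annihilators kills everything.
\<close>

lemma associated_primes:
 assumes N: "grsub N" and sf: "socle_free N"
 shows "\<exists>\<P>. finite \<P> \<and> (\<forall>P\<in>\<P>. hprime P \<and> \<not> X \<subseteq> P) \<and>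
      (\<forall>a. \<forall>w\<in>Lh a. w \<notin> N --> (\<exists>P\<in>\<P>. Ann N w \<subseteq> P))"
proof -
 note Ns = grsub_submod[OF N]
 define \<A> where "\<A> = {Ann N w | w. \<exists>a. w \<in> Lh a \<and> w \<notin> N}"
 define \<M> where "\<M> = {P \<in> \<A>. \<forall>Q\<in>\<A>. P \<subseteq> Q --> Q = P}"
 have A_sub: "RR.submod R P \<and> P \<subseteq> R" if "P \<in> \<A>" for P
  using that submod_Ann[OF Ns] by (auto simp: \<A>_def Ann_def)
 have below: "\<exists>P\<in>\<M>. A \<subseteq> P" if A: "A \<in> \<A>" for A
 proof -
  have "\<exists>P\<in>{Q\<in>\<A>. A \<subseteq> Q}. \<forall>Q\<in>{Q\<in>\<A>. A \<subseteq> Q}. P \<subseteq> Q --> Q = P"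
   by (rule RR.noetherian_maximal[OF noetherian_R]) (use A A_sub in auto)
  then obtain P where P: "P \<in> {Q\<in>\<A>. A \<subseteq> Q}" "\<forall>Q\<in>{Q\<in>\<A>. A \<subseteq> Q}. P \<subseteq> Q --> Q = P"
   by (elim bexE)
  have "Q = P" if "Q \<in> \<A>" "P \<subseteq> Q" for Q
  proof -
   have "Q \<in> {Q\<in>\<A>. A \<subseteq> Q}" using P(1) that by auto
   then show ?thesis using P(2) that(2) by simp
  qed
  then have "P \<in> \<M>" using P(1) by (simp add: \<M>_def)
  then show ?thesis using P(1) by (intro bexI[of _ P]) simp_all
 qed
 have ME: "\<exists>w a. w \<in> Lh a \<and> w \<notin> N \<and> P = Ann N w" if "P \<in> \<M>" for P
  using that unfolding \<M>_def \<A>_def by blast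
 have Mmax: "Ann N w = P" if "P \<in> \<M>" "w \<in> Lh a" "w \<notin> N" "P \<subseteq> Ann N w" for P w a
  using that unfolding \<M>_def \<A>_def by blast
 have M_prime: "hprime P" if P: "P \<in> \<M>" for P
 proof -
  obtain w a where w: "w \<in> Lh a" "w \<notin> N" "P = Ann N w" using ME[OF P] by blast
  have "\<alpha> \<in> P \<or> \<beta> \<in> P" if ab: "\<alpha> \<in> H m" "\<beta> \<in> H n" "\<alpha> * \<beta> \<in> P" for m n \<alpha> \<beta>
  proof (cases "\<beta> \<in> P")
   case False
   then have nN: "\<beta> *s w \<notin> N" using w(3) H_R[OF ab(2)] by (simp add: Ann_def)
   have "Ann N w \<subseteq> Ann N (\<beta> *s w)"
   proof
    fix r assume "r \<in> Ann N w"
    then show "r \<in> Ann N (\<beta> *s w)"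
     using submod_scale[OF Ns H_R[OF ab(2)], of "r *s w"] by (simp add: Ann_def mult.commute)
   qed
   then have "Ann N (\<beta> *s w) = P" using Mmax[OF P Lh_scale[OF ab(2) w(1)] nN] w(3) by blast
   moreover have "\<alpha> \<in> Ann N (\<beta> *s w)" using ab w(3) H_R[OF ab(1)] by (simp add: Ann_def)
   ultimately show ?thesis by blast
  qed auto
  then show ?thesis unfolding hprime_def using A_sub[of P] P by (auto simp: \<M>_def)
 qed
 have M_X: "\<not> X \<subseteq> P" if P: "P \<in> \<M>" for P
 proof
  assume "X \<subseteq> P"
  obtain w a where w: "w \<in> Lh a" "w \<notin> N" "P = Ann N w" using ME[OF P] by blast
  then have "\<forall>x\<in>X. x *s w \<in> N" using \<open>X \<subseteq> P\<close> by (auto simp: Ann_def)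
  then show False using sf w Lh_L[OF w(1)] by (auto simp: socle_free_def)
 qed
 have "finite \<M>"
 proof -
  from ME obtain \<omega> where \<omega>: "!!P. P \<in> \<M> ==> \<exists>a. \<omega> P \<in> Lh a" "!!P. P \<in> \<M> ==> \<omega> P \<notin> N"
   "!!P. P \<in> \<M> ==> P = Ann N (\<omega> P)"
   by metis
  have mem: "r \<in> P \<longleftrightarrow> r \<in> R \<and> r *s \<omega> P \<in> N" if "P \<in> \<M>" for P r
   using arg_cong[OF \<omega>(3)[OF that], of "\<lambda>A. r \<in> A"] by (simp add: Ann_def)
  have \<omega>L: "\<omega> ` \<M> \<subseteq> L" using \<omega>(1) Lh_L by blast
  then have "gen R (\<omega> ` \<M>) \<subseteq> L" by (rule gen_minimal[OF L_sub])
  then obtain V where V: "finite V" "V \<subseteq> gen R (\<omega> ` \<M>)" "gen R (\<omega> ` \<M>) \<subseteq> gen R V"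
   using noetherian_L submod_gen[of R "\<omega> ` \<M>"] unfolding noetherian_def by meson
  obtain W where W: "finite W" "W \<subseteq> \<omega> ` \<M>" "V \<subseteq> gen R W"
   using gen_finite_of_finite[OF V(1,2)] by blast
  obtain \<Q> where Q: "\<Q> \<subseteq> \<M>" "finite \<Q>" "W = \<omega> ` \<Q>" using finite_subset_image[OF W(1,2)] by blast
  have "\<M> \<subseteq> \<Q>"
  proof
   fix P assume P: "P \<in> \<M>"
   show "P \<in> \<Q>"
   proof (rule ccontr)
    assume PQ: "P \<notin> \<Q>"
    have 1: "1 \<notin> P" using \<omega>(2)[OF P] mem[OF P, of 1] by simp
    have "\<exists>n. \<exists>q\<in>H n. q \<in> Q \<and> q \<notin> P" if "Q \<in> \<Q>" for Q
    proof (rule ccontr)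
     assume neg: "\<not> ?thesis"
     have QM: "Q \<in> \<M>" using that Q(1) by blast
     obtain a where a: "\<omega> Q \<in> Lh a" using \<omega>(1)[OF QM] by blast
     have "Q \<subseteq> P"
     proof
      fix r assume "r \<in> Q"
      then have r: "r \<in> R" "r *s \<omega> Q \<in> N" using mem[OF QM] by auto
      have "cmp n r \<in> P" for n
      proof -
       have "prj (a + n) (r *s \<omega> Q) = (\<Sum>m | cmp m r ~= 0. cmp m r *s prj (a + n - m) (\<omega> Q))"
        by (rule prj_scale[OF r(1) Lh_L[OF a]])
       also have "... = (\<Sum>m | cmp m r ~= 0. if m = n then cmp n r *s \<omega> Q else 0)"
        by (rule sum.cong) (auto simp: prj_Lh[OF a] prj_Lh_other[OF a])
       also have "... = cmp n r *s \<omega> Q" using finite_cmp[OF r(1)] by simp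
       finally have "cmp n r *s \<omega> Q \<in> N" using grsub_prj[OF N r(2), of "a + n"] by simp
       then have "cmp n r \<in> Q" using cmp_R[OF r(1)] mem[OF QM] by simp
       then show ?thesis using neg H_cmp[OF r(1), of n] by blast
      qed
      then have "(\<Sum>n | cmp n r ~= 0. cmp n r) \<in> P"
       using A_sub[of P] P by (intro RR.submod_sum[of R]) (auto simp: \<M>_def)
      then show "r \<in> P" using sum_cmp[OF r(1)] by simp
     qed
     then have "P = Q" using QM P unfolding \<M>_def by blast
     then show False using that PQ by blast
    qed
    moreover have "RR.submod R Q" if "Q \<in> \<Q>" for Q using A_sub Q(1) that by (auto simp: \<M>_def)
    ultimately obtain n p where p: "p \<in> H n" "p \<notin> P" "!!Q. Q \<in> \<Q> ==> p \<in> Q"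
     using hprime_avoiding_product[OF M_prime[OF P] 1 Q(2)] by blast
    let ?K = "{v. p *s v \<in> N}"
    have "submod R ?K"
    proof (rule submodI)
     show "r *s v \<in> ?K" if "r \<in> R" "v \<in> ?K" for r v
      using submod_scale[OF Ns that(1), of "p *s v"] that(2) by (simp add: mult.commute)
    qed (auto simp: submod_zero[OF Ns] submod_add[OF Ns] scale_right_distrib)
    moreover have "W \<subseteq> ?K"
    proof
     fix w assume "w \<in> W"
     then obtain Q' where "Q' \<in> \<Q>" "w = \<omega> Q'" using Q(3) by blast
     then show "w \<in> ?K" using p(3)[of Q'] mem[of Q' p] Q(1) by auto
    qed
    ultimately have "gen R W \<subseteq> ?K" by (rule gen_minimal)
    then have "gen R V \<subseteq> ?K" using gen_minimal[OF submod_gen W(3)] by blast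
    then have "\<omega> P \<in> ?K" using V(3) gen_superset[of "\<omega> ` \<M>" R] P by blast
    then have "p \<in> P" using mem[OF P, of p] H_R[OF p(1)] by simp
    then show False using p(2) by simp
   qed
  qed
  then show ?thesis using Q(2) finite_subset by blast
 qed
 moreover have "\<exists>P\<in>\<M>. Ann N w \<subseteq> P" if "w \<in> Lh a" "w \<notin> N" for a w
  using below[of "Ann N w"] that unfolding \<A>_def by blast
 ultimately show ?thesis using M_prime M_X by (intro exI[of _ \<M>]) auto
qed

lemma regular_of_avoiding:
 assumes "grsub N" "f \<in> H n" "!!a w. w \<in> Lh a ==> w \<notin> N ==> f \<notin> Ann N w"
 shows "regular N f"
 using assms(3) by (intro regular_homI[OF assms(1,2)]) (auto simp: Ann_def H_R[OF assms(2)])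

end

section \<open>The complex of a free resolution of the residue field\<close>

text \<open>
 A resolution by matrices: \<open>D i k j\<close> is the \<open>j\<close>-th coordinate of the image of the \<open>k\<close>-th basis
 vector of \<open>R\<^bsup>b (i+1)\<^esup>\<close>, and \<open>c j\<close> is the residue class of the image of the \<open>j\<close>-th basis vector of
 \<open>R\<^bsup>b 0\<^esup>\<close> in \<open>R/\<mm> = k\<close>.
\<close>

locale residue_resolution = graded_domain emb R cmp X
 for emb :: "'k::field => 'r::idom" and R cmp X +
 fixes b :: "nat => nat" and D :: "nat => nat => nat => 'r" and c :: "nat => 'k"
 assumes D_R: "k < b (Suc i) ==> j < b i ==> D i k j \<in> R"
  and aug: "k < b 1 ==> (\<Sum>j<b 0. D 0 k j * emb (c j)) \<in> mm"
  and aug_exact: "(!!j. j < b 0 ==> a j \<in> R) ==> (\<Sum>j<b 0. a j * emb (c j)) \<in> mm ==>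
   \<exists>y. (\<forall>k<b 1. y k \<in> R) \<and> (\<forall>j<b 0. a j = (\<Sum>k<b 1. y k * D 0 k j))"
  and aug_unit: "\<exists>j<b 0. c j ~= 0"
  and complex: "l < b (Suc (Suc i)) ==> j < b i ==> (\<Sum>k<b (Suc i). D (Suc i) l k * D i k j) = 0"
  and exact: "(!!k. k < b (Suc i) ==> a k \<in> R) ==>
   (!!j. j < b i ==> (\<Sum>k<b (Suc i). a k * D i k j) = 0) ==>
   \<exists>y. (\<forall>l<b (Suc (Suc i)). y l \<in> R) \<and>
    (\<forall>k<b (Suc i). a k = (\<Sum>l<b (Suc (Suc i)). y l * D (Suc i) l k))"
begin

text \<open>
 An element \<open>x\<close> of the maximal ideal is null-homotopic on the resolution. The second conjunct is
 what a homotopy \<open>s\<close> satisfies after composition with the differential.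
\<close>

definition homotopy :: "'r => nat => (nat => nat => 'r) => bool" where
 "homotopy x i s \<longleftrightarrow> (\<forall>j<b i. \<forall>l<b (Suc i). s j l \<in> R) \<and>
   (\<forall>k<b (Suc i). \<forall>j'<b i. (\<Sum>j<b i. \<Sum>l<b (Suc i). D i k j * s j l * D i l j') = x * D i k j')"

lemma homotopy_step:
 assumes s: "homotopy x i s" and x: "x \<in> R"
 shows "\<exists>s'. (\<forall>k<b (Suc i). \<forall>l<b (Suc (Suc i)). s' k l \<in> R) \<and>
  (\<forall>k<b (Suc i). \<forall>k'<b (Suc i). (if k' = k then x else 0) - (\<Sum>j<b i. D i k j * s j k') =
    (\<Sum>l<b (Suc (Suc i)). s' k l * D (Suc i) l k'))"
proof -
 have "\<exists>y. (\<forall>l<b (Suc (Suc i)). y l \<in> R) \<and> (\<forall>k'<b (Suc i).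
  (if k' = k then x else 0) - (\<Sum>j<b i. D i k j * s j k') = (\<Sum>l<b (Suc (Suc i)). y l * D (Suc i) l k'))"
  if k: "k < b (Suc i)" for k
 proof (rule exact)
  show "(if k' = k then x else 0) - (\<Sum>j<b i. D i k j * s j k') \<in> R" if "k' < b (Suc i)" for k'
   using s that k x by (intro R_diff R_sum R_mult) (auto simp: homotopy_def D_R)
  show "(\<Sum>k'<b (Suc i). ((if k' = k then x else 0) - (\<Sum>j<b i. D i k j * s j k')) * D i k' j') = 0"
   if j': "j' < b i" for j'
  proof -
   have "(\<Sum>k'<b (Suc i). ((if k' = k then x else 0) - (\<Sum>j<b i. D i k j * s j k')) * D i k' j') =
    (\<Sum>k'<b (Suc i). (if k' = k then x * D i k j' else 0)) -
    (\<Sum>k'<b (Suc i). \<Sum>j<b i. D i k j * s j k' * D i k' j')"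
    by (simp add: left_diff_distrib sum_subtractf sum_distrib_right if_distrib[of "\<lambda>z. z * _"] cong: if_cong)
   also have "(\<Sum>k'<b (Suc i). \<Sum>j<b i. D i k j * s j k' * D i k' j') = x * D i k j'"
    using s k j' unfolding homotopy_def by (subst sum.swap) blast
   finally show ?thesis using k by simp
  qed
 qed
 then show ?thesis by metis
qed

text \<open>Lifting through the resolution starts because \<open>x\<close> annihilates the residue field.\<close>

lemma homotopy_exists:
 assumes x: "x \<in> mm"
 shows "\<exists>s. homotopy x i s"
proof (induction i)
 case 0
 have xR: "x \<in> R" using x mm_R by blast
 have "\<exists>y. (\<forall>l<b 1. y l \<in> R) \<and> (\<forall>j'<b 0. (if j' = j then x else 0) = (\<Sum>l<b 1. y l * D 0 l j'))"
  if j: "j < b 0" for j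
 proof (rule aug_exact)
  show "(if j' = j then x else 0) \<in> R" for j' using xR by simp
  have "(\<Sum>j'<b 0. (if j' = j then x else 0) * emb (c j')) = (\<Sum>j'<b 0. if j' = j then x * emb (c j) else 0)"
   by (rule sum.cong) auto
  also have "... = x * emb (c j)" using j by simp
  also have "... \<in> mm"
  proof -
   interpret S: graded_module emb R cmp X "(*)" R cmp "{1}" by (rule graded_module_self)
   have "cmp 0 (emb (c j) * x) = emb (c j) * cmp 0 x"
    using S.prj_scale_H[OF H_emb, of x 0 "c j"] xR by simp
   then show ?thesis using x by (simp add: mm_def R_mult mult.commute)
  qed
  finally show "(\<Sum>j'<b 0. (if j' = j then x else 0) * emb (c j')) \<in> mm" .
 qed
 then have "\<forall>j. \<exists>y. j < b 0 --> (\<forall>l<b 1. y l \<in> R) \<and>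
  (\<forall>j'<b 0. (if j' = j then x else 0) = (\<Sum>l<b 1. y l * D 0 l j'))" by blast
 from choice[OF this] obtain s where *: "!!j. j < b 0 ==> (\<forall>l<b 1. s j l \<in> R) \<and>
  (\<forall>j'<b 0. (if j' = j then x else 0) = (\<Sum>l<b 1. s j l * D 0 l j'))" by blast
 have s: "!!j l. j < b 0 ==> l < b 1 ==> s j l \<in> R"
  "!!j j'. j < b 0 ==> j' < b 0 ==> (\<Sum>l<b 1. s j l * D 0 l j') = (if j' = j then x else 0)"
  by (rule *[THEN conjunct1, rule_format], assumption+) (rule *[THEN conjunct2, rule_format, symmetric], assumption+)
 have "(\<Sum>j<b 0. \<Sum>l<b (Suc 0). D 0 k j * s j l * D 0 l j') = x * D 0 k j'" if "k < b 1" "j' < b 0" for k j'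
 proof -
  have "(\<Sum>j<b 0. \<Sum>l<b (Suc 0). D 0 k j * s j l * D 0 l j') = (\<Sum>j<b 0. D 0 k j * (\<Sum>l<b 1. s j l * D 0 l j'))"
   by (simp only: sum_distrib_left mult.assoc One_nat_def)
  also have "... = (\<Sum>j<b 0. if j' = j then D 0 k j * x else 0)"
   using that(2) by (intro sum.cong refl) (simp only: s(2) lessThan_iff if_distrib[of "\<lambda>z. _ * z"] mult_zero_right)
  also have "... = x * D 0 k j'" using that(2) by (simp add: mult.commute)
  finally show ?thesis .
 qed
 then show ?case using s(1) unfolding homotopy_def by (intro exI[of _ s]) simp
next
 case (Suc i)
 then obtain s where s: "homotopy x i s" by blast
 obtain s' where *: "\<forall>k<b (Suc i). \<forall>l<b (Suc (Suc i)). s' k l \<in> R"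
  "\<forall>k<b (Suc i). \<forall>k'<b (Suc i). (if k' = k then x else 0) - (\<Sum>j<b i. D i k j * s j k') =
    (\<Sum>l<b (Suc (Suc i)). s' k l * D (Suc i) l k')"
  using homotopy_step[OF s mm_R[OF x]] by (elim exE conjE)
 have s': "!!k l. k < b (Suc i) ==> l < b (Suc (Suc i)) ==> s' k l \<in> R"
  "!!k k'. k < b (Suc i) ==> k' < b (Suc i) ==>
    (\<Sum>l<b (Suc (Suc i)). s' k l * D (Suc i) l k') = (if k' = k then x else 0) - (\<Sum>j<b i. D i k j * s j k')"
  by (rule *(1)[rule_format], assumption+) (rule *(2)[rule_format, symmetric], assumption+)
 have "(\<Sum>k<b (Suc i). \<Sum>l<b (Suc (Suc i)). D (Suc i) m k * s' k l * D (Suc i) l k') = x * D (Suc i) m k'"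
  if m: "m < b (Suc (Suc i))" "k' < b (Suc i)" for m k'
 proof -
  have "(\<Sum>k<b (Suc i). \<Sum>l<b (Suc (Suc i)). D (Suc i) m k * s' k l * D (Suc i) l k') =
   (\<Sum>k<b (Suc i). D (Suc i) m k * (\<Sum>l<b (Suc (Suc i)). s' k l * D (Suc i) l k'))"
   by (simp only: sum_distrib_left mult.assoc)
  also have "... = (\<Sum>k<b (Suc i). D (Suc i) m k * ((if k' = k then x else 0) - (\<Sum>j<b i. D i k j * s j k')))"
   using that(2) by (intro sum.cong refl) (simp only: s'(2) lessThan_iff)
  also have "... = (\<Sum>k<b (Suc i). if k' = k then D (Suc i) m k * x else 0) -
    (\<Sum>k<b (Suc i). \<Sum>j<b i. D (Suc i) m k * D i k j * s j k')"
   unfolding sum_subtractf[symmetric]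
   by (intro sum.cong refl) (simp only: right_diff_distrib sum_distrib_left mult.assoc if_distrib[of "\<lambda>z. _ * z"] mult_zero_right)
  also have "(\<Sum>k<b (Suc i). \<Sum>j<b i. D (Suc i) m k * D i k j * s j k') =
    (\<Sum>j<b i. (\<Sum>k<b (Suc i). D (Suc i) m k * D i k j) * s j k')"
   by (subst sum.swap) (simp add: sum_distrib_right)
  also have "... = 0" using complex[OF m(1)] by (intro sum.neutral) auto
  also have "(\<Sum>k<b (Suc i). if k' = k then D (Suc i) m k * x else 0) - 0 = x * D (Suc i) m k'"
   using m(2) by (simp add: mult.commute)
  finally show ?thesis .
 qed
 then show ?case using s'(1) unfolding homotopy_def by (intro exI[of _ s']) simp
qed

end


locale graded_module_resolution =
 graded_module emb R cmp X scale L prj E + residue_resolution emb R cmp X b D c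
 for emb :: "'k::field => 'r::idom" and R cmp X
  and scale :: "'r => 'v::ab_group_add => 'v" (infixr "*s" 75)
  and L prj E b D c
begin

definition coch :: "nat => (nat => 'v) => bool" where
 "coch i z \<longleftrightarrow> (\<forall>j<b i. z j \<in> L)"

definition delta :: "nat => (nat => 'v) => nat => 'v" where
 "delta i z k = (\<Sum>j<b i. D i k j *s z j)"

definition cocyc :: "'v set => nat => (nat => 'v) set" where
 "cocyc N i = {z. coch i z \<and> (\<forall>k<b (Suc i). delta i z k \<in> N)}"

text \<open>
 Coboundaries modulo \<open>N\<close>. Values at indices outside \<open>{..<b i}\<close> are unconstrained.
\<close>

fun cobd :: "'v set => nat => (nat => 'v) set" where
 "cobd N 0 = {z. \<forall>j<b 0. z j \<in> N}"
| "cobd N (Suc i) = {z. \<exists>w. coch i w \<and> (\<forall>j<b (Suc i). z j - delta i w j \<in> N)}"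

sublocale kc: linear_space "\<lambda>a (z :: nat => 'v) j. emb a *s z j"
 by unfold_locales (auto simp: fun_eq_iff scale_right_distrib scale_left_distrib emb_add emb_mult)

text \<open>
 The dimension over \<open>k\<close> of the \<open>i\<close>-th cohomology with values in \<open>L/N\<close> is at most \<open>n\<close>.
\<close>

definition coh_le :: "'v set => nat => nat => bool" where
 "coh_le N i n \<longleftrightarrow> kc.codim_le (cocyc N i) (cobd N i) n"

lemma delta_add: "delta i (\<lambda>j. z j + w j) k = delta i z k + delta i w k"
 by (simp add: delta_def scale_right_distrib sum.distrib)

lemma delta_diff: "delta i (\<lambda>j. z j - w j) k = delta i z k - delta i w k"
 by (simp add: delta_def scale_right_diff_distrib sum_subtractf)

lemma delta_scale: "delta i (\<lambda>j. r *s z j) k = r *s delta i z k"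
 by (simp add: delta_def scale_sum_right mult.commute)

lemma delta_in:
 assumes "submod R N" "!!j. j < b i ==> z j \<in> N" "k < b (Suc i)"
 shows "delta i z k \<in> N"
 unfolding delta_def using assms D_R by (intro submod_sum[OF assms(1)] submod_scale[OF assms(1)]) auto

lemma coch_delta: "coch i z ==> coch (Suc i) (delta i z)"
 using delta_in[OF L_sub] by (simp add: coch_def)

lemma delta_delta:
 assumes "l < b (Suc (Suc i))"
 shows "delta (Suc i) (delta i z) l = 0"
proof -
 have "delta (Suc i) (delta i z) l = (\<Sum>k<b (Suc i). \<Sum>j<b i. (D (Suc i) l k * D i k j) *s z j)"
  by (simp add: delta_def scale_sum_right)
 also have "... = (\<Sum>j<b i. (\<Sum>k<b (Suc i). D (Suc i) l k * D i k j) *s z j)"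
  by (subst sum.swap) (simp add: scale_sum_left)
 also have "... = 0" using complex[OF assms] by (intro sum.neutral) auto
 finally show ?thesis .
qed

lemma coch_add: "coch i z ==> coch i w ==> coch i (\<lambda>j. z j + w j)"
 by (simp add: coch_def L_add)

lemma coch_diff: "coch i z ==> coch i w ==> coch i (\<lambda>j. z j - w j)"
 by (simp add: coch_def L_diff)

lemma coch_scale: "r \<in> R ==> coch i z ==> coch i (\<lambda>j. r *s z j)"
 by (simp add: coch_def L_scale)

lemma subspace_cocyc: "submod R N ==> kc.subspace (cocyc N i)"
 by (rule kc.subspaceI)
   (auto simp: cocyc_def plus_fun_def zero_fun_def delta_add delta_scale submod_add submod_scale coch_add coch_scale,
   auto simp: coch_def delta_def submod_zero)

lemma subspace_cobd:
 assumes "submod R N"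
 shows "kc.subspace (cobd N i)"
proof (cases i)
 case 0
 then show ?thesis
  by (intro kc.subspaceI) (auto simp: submod_zero[OF assms] submod_add[OF assms] submod_scale[OF assms])
next
 case (Suc m)
 show ?thesis unfolding Suc
 proof (rule kc.subspaceI)
  have "coch m (\<lambda>_. 0)" "!!j. 0 - delta m (\<lambda>_. 0) j \<in> N"
   by (auto simp: coch_def delta_def submod_zero[OF assms])
  then show "0 \<in> cobd N (Suc m)" by auto
 next
  fix x y assume "x \<in> cobd N (Suc m)" "y \<in> cobd N (Suc m)"
  then obtain u v where uv: "coch m u" "coch m v" "!!j. j < b (Suc m) ==> x j - delta m u j \<in> N"
   "!!j. j < b (Suc m) ==> y j - delta m v j \<in> N"
   by auto
  have "(x + y) j - delta m (\<lambda>j. u j + v j) j \<in> N" if "j < b (Suc m)" for j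
   using submod_add[OF assms uv(3)[OF that] uv(4)[OF that]] by (simp add: delta_add algebra_simps)
  then show "x + y \<in> cobd N (Suc m)" using coch_add[OF uv(1,2)] by auto
 next
  fix a x assume "x \<in> cobd N (Suc m)"
  then obtain u where u: "coch m u" "!!j. j < b (Suc m) ==> x j - delta m u j \<in> N" by auto
  have "emb a *s x j - delta m (\<lambda>j. emb a *s u j) j \<in> N" if "j < b (Suc m)" for j
   using submod_scale[OF assms emb_R u(2)[OF that], of a] by (simp add: delta_scale scale_right_diff_distrib)
  then show "(\<lambda>j. emb a *s x j) \<in> cobd N (Suc m)" using coch_scale[OF emb_R u(1)] by auto
 qed
qed

lemma cobd_mono: "N \<subseteq> N' ==> cobd N i \<subseteq> cobd N' i"
 by (cases i) (simp, blast)+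

lemma coh_le_0:
 assumes N: "submod R N"
 shows "coh_le N i 0 \<longleftrightarrow> cocyc N i \<subseteq> cobd N i"
proof -
 have eq: "kc.span (cobd N i) = cobd N i" using subspace_cobd[OF N] by simp
 have "(\<exists>T. finite T \<and> card T \<le> 0 \<and> cocyc N i \<subseteq> kc.span (cobd N i \<union> T)) \<longleftrightarrow>
  cocyc N i \<subseteq> kc.span (cobd N i \<union> {})" (is "?l \<longleftrightarrow> ?r")
 proof
  assume ?l
  then obtain T where "finite T" "card T \<le> 0" "cocyc N i \<subseteq> kc.span (cobd N i \<union> T)" by blast
  moreover from this have "T = {}" by simp
  ultimately show ?r by simp
 next
  assume ?r
  then show ?l by (intro exI[of _ "{}"]) simp
 qed
 then show ?thesis unfolding coh_le_def kc.codim_le_def Un_empty_right eq .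
qed

text \<open>
 The part of the long exact sequence of \<open>0 \<rightarrow> L/N \<rightarrow> L/N \<rightarrow> L/(N + \<theta>L) \<rightarrow> 0\<close> around degree \<open>i\<close>.
\<close>

lemma coh_le_addmul:
 assumes N: "submod R N" "N \<subseteq> L" and t: "\<theta> \<in> R" "regular N \<theta>"
  and p: "coh_le N i p" and q: "coh_le N (Suc i) q"
 shows "coh_le (addmul N \<theta>) i (p + q)"
proof -
 let ?N = "addmul N \<theta>"
 have N': "submod R ?N" by (rule submod_addmul[OF N(1) t(1)])
 obtain T1 where T1: "finite T1" "card T1 \<le> p" "cocyc N i \<subseteq> kc.span (cobd N i \<union> T1)"
  using p unfolding coh_le_def kc.codim_le_def by blast
 obtain T2 where T2: "finite T2" "card T2 \<le> q" "cocyc N (Suc i) \<subseteq> kc.span (cobd N (Suc i) \<union> T2)"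
  using q unfolding coh_le_def kc.codim_le_def by blast
 define conn where "conn z y \<longleftrightarrow> z \<in> cocyc ?N i \<and> coch (Suc i) y \<and>
  (\<forall>k<b (Suc i). delta i z k - \<theta> *s y k \<in> N)" for z y
 define Z where "Z = {y. \<exists>z. conn z y}"
 have conn_add: "conn (z + z') (y + y')" if "conn z y" "conn z' y'" for z y z' y'
 proof -
  have 1: "z + z' \<in> cocyc ?N i" using that kc.subspace_add[OF subspace_cocyc[OF N']] by (simp add: conn_def)
  have 2: "delta i (\<lambda>j. z j + z' j) k - \<theta> *s (y k + y' k) \<in> N" if "k < b (Suc i)" for k
  proof -
   have "delta i (\<lambda>j. z j + z' j) k - \<theta> *s (y k + y' k) =
    (delta i z k - \<theta> *s y k) + (delta i z' k - \<theta> *s y' k)"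
    by (simp add: delta_add scale_right_distrib)
   then show ?thesis using submod_add[OF N(1)] \<open>conn z y\<close> \<open>conn z' y'\<close> that by (simp add: conn_def)
  qed
  show ?thesis using 1 2 that coch_add[of "Suc i" y y'] unfolding conn_def by (simp add: plus_fun_def)
 qed
 have conn_scale: "conn (\<lambda>j. emb a *s z j) (\<lambda>j. emb a *s y j)" if "conn z y" for a z y
 proof -
  have 1: "(\<lambda>j. emb a *s z j) \<in> cocyc ?N i"
   using that kc.subspace_scale[OF subspace_cocyc[OF N']] by (simp add: conn_def)
  have 2: "delta i (\<lambda>j. emb a *s z j) k - \<theta> *s emb a *s y k \<in> N" if "k < b (Suc i)" for k
  proof -
   have "delta i (\<lambda>j. emb a *s z j) k - \<theta> *s emb a *s y k = emb a *s (delta i z k - \<theta> *s y k)"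
    by (simp add: delta_scale scale_right_diff_distrib mult.commute)
   then show ?thesis using submod_scale[OF N(1) emb_R] \<open>conn z y\<close> that by (simp add: conn_def)
  qed
  show ?thesis using 1 2 that coch_scale[OF emb_R, of "Suc i" y] unfolding conn_def by simp
 qed
 have conn_zero: "conn 0 0"
  using kc.subspace_0[OF subspace_cocyc[OF N', of i]] submod_zero[OF N(1)]
  by (simp add: conn_def coch_def delta_def)
 have conn_ex: "\<exists>y. conn z y" if z: "z \<in> cocyc ?N i" for z
 proof -
  have "\<forall>k. \<exists>y. k < b (Suc i) --> y \<in> L \<and> delta i z k - \<theta> *s y \<in> N"
   using z by (auto simp: cocyc_def addmul_iff)
  from choice[OF this] show ?thesis using z by (auto simp: conn_def coch_def)
 qed
 have conn_cocyc: "y \<in> cocyc N (Suc i)" if y: "conn z y" for z y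
 proof -
  have "delta (Suc i) y l \<in> N" if l: "l < b (Suc (Suc i))" for l
  proof -
   have "delta (Suc i) (\<lambda>k. delta i z k - \<theta> *s y k) l \<in> N"
    using y l by (intro delta_in[OF N(1)]) (auto simp: conn_def)
   then have "- (\<theta> *s delta (Suc i) y l) \<in> N"
    by (simp add: delta_diff delta_scale delta_delta[OF l])
   then have "\<theta> *s delta (Suc i) y l \<in> N" using submod_scale[OF N(1) neg_one_R, of "- (\<theta> *s delta (Suc i) y l)"] by simp
   moreover have "delta (Suc i) y l \<in> L"
    using y l by (intro delta_in[OF L_sub]) (auto simp: conn_def coch_def)
   ultimately show ?thesis using t(2) by (simp add: regular_def)
  qed
  then show ?thesis using y by (simp add: cocyc_def conn_def)
 qed
 have subZ: "kc.subspace Z"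
  unfolding Z_def using conn_zero conn_add conn_scale by (intro kc.subspaceI) blast+
 have ZT: "Z \<subseteq> kc.span (cobd N (Suc i) \<union> T2)" using T2(3) conn_cocyc by (auto simp: Z_def)
 obtain T3 where T3: "finite T3" "card T3 \<le> card T2" "T3 \<subseteq> Z"
   "Z \<subseteq> kc.span ((cobd N (Suc i) \<inter> Z) \<union> T3)"
  using kc.span_of_subspace_finite[OF T2(1) subZ subspace_cobd[OF N(1)] ZT] by (elim exE conjE)
 have "\<forall>t. \<exists>z. t \<in> T3 --> conn z t" using T3(3) by (auto simp: Z_def)
 from choice[OF this] obtain \<zeta> where \<zeta>: "!!t. t \<in> T3 ==> conn (\<zeta> t) t" by blast
 have lift: "\<exists>x\<in>kc.span (\<zeta> ` T3). conn x \<tau>" if "\<tau> \<in> kc.span T3" for \<tau>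
 proof -
  let ?A = "{\<tau>. \<exists>x\<in>kc.span (\<zeta> ` T3). conn x \<tau>}"
  have "kc.subspace ?A"
  proof (rule kc.subspaceI)
   show "0 \<in> ?A" using conn_zero kc.span_zero by blast
   show "x + y \<in> ?A" if "x \<in> ?A" "y \<in> ?A" for x y
    using that conn_add kc.span_add by blast
   show "(\<lambda>j. emb a *s x j) \<in> ?A" if "x \<in> ?A" for a x
    using that conn_scale kc.span_scale by blast
  qed
  moreover have "T3 \<subseteq> ?A" using \<zeta> kc.span_base by blast
  ultimately show ?thesis using kc.span_minimal[of T3 ?A] that by blast
 qed
 have N_sub: "N \<subseteq> ?N" using addmul_superset by blast
 let ?T = "T1 \<union> \<zeta> ` T3"
 have "cocyc ?N i \<subseteq> kc.span (cobd ?N i \<union> ?T)"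
 proof
  fix z assume z: "z \<in> cocyc ?N i"
  obtain y where y: "conn z y" using conn_ex[OF z] by blast
  then have "y \<in> kc.span ((cobd N (Suc i) \<inter> Z) \<union> T3)" using T3(4) by (auto simp: Z_def)
  then obtain \<beta> \<tau> where bt: "y = \<beta> + \<tau>" "\<beta> \<in> kc.span (cobd N (Suc i) \<inter> Z)" "\<tau> \<in> kc.span T3"
   unfolding kc.span_Un by blast
  have "\<beta> \<in> cobd N (Suc i)"
   using bt(2) kc.span_minimal[of "cobd N (Suc i) \<inter> Z" "cobd N (Suc i)"] subspace_cobd[OF N(1)] by blast
  then obtain u where u: "coch i u" "!!k. k < b (Suc i) ==> \<beta> k - delta i u k \<in> N" by auto
  obtain x where x: "x \<in> kc.span (\<zeta> ` T3)" "conn x \<tau>" using lift[OF bt(3)] by blast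
  define z' where "z' = (\<lambda>j. z j - x j - \<theta> *s u j)"
  have "delta i z' k \<in> N" if k: "k < b (Suc i)" for k
  proof -
   have eq: "delta i z' k = (delta i z k - \<theta> *s y k) - (delta i x k - \<theta> *s \<tau> k) + \<theta> *s (\<beta> k - delta i u k)"
    by (simp add: z'_def delta_diff delta_scale bt(1) scale_right_distrib scale_right_diff_distrib)
   have 1: "delta i z k - \<theta> *s y k \<in> N" and 2: "delta i x k - \<theta> *s \<tau> k \<in> N"
    using y x(2) k by (auto simp: conn_def)
   show ?thesis unfolding eq
    by (rule submod_add[OF N(1) submod_diff[OF N(1) neg_one_R 1 2] submod_scale[OF N(1) t(1) u(2)[OF k]]])
  qed
  moreover have "coch i z'" unfolding z'_def
   using z x(2) u(1) t(1) by (intro coch_diff coch_scale) (auto simp: conn_def cocyc_def)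
  ultimately have "z' \<in> cocyc N i" by (simp add: cocyc_def)
  then have "z' \<in> kc.span (cobd N i \<union> T1)" using T1(3) by blast
  then have 1: "z' \<in> kc.span (cobd ?N i \<union> ?T)"
   using kc.span_mono[of "cobd N i \<union> T1" "cobd ?N i \<union> ?T"] cobd_mono[OF N_sub, of i] by blast
  have 2: "x \<in> kc.span (cobd ?N i \<union> ?T)"
   using kc.span_mono[of "\<zeta> ` T3" "cobd ?N i \<union> ?T"] x(1) by blast
  have "(\<lambda>j. \<theta> *s u j) \<in> cobd ?N i"
  proof (cases i)
   case 0
   then show ?thesis using u(1) addmul_mult[OF N(1)] by (simp add: coch_def)
  next
   case (Suc m)
   have "\<theta> *s u j - delta m (\<lambda>_. 0) j \<in> ?N" if "j < b (Suc m)" for j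
    using u(1) addmul_mult[OF N(1)] that by (simp add: coch_def delta_def Suc)
   moreover have "coch m (\<lambda>_. 0)" by (simp add: coch_def)
   ultimately show ?thesis unfolding Suc cobd.simps by blast
  qed
  then have 3: "(\<lambda>j. \<theta> *s u j) \<in> kc.span (cobd ?N i \<union> ?T)" using kc.span_base by blast
  have "z = z' + x + (\<lambda>j. \<theta> *s u j)" by (simp add: z'_def fun_eq_iff)
  then show "z \<in> kc.span (cobd ?N i \<union> ?T)" using kc.span_add[OF kc.span_add[OF 1 2] 3] by simp
 qed
 moreover have "finite ?T" using T1 T3 by simp
 moreover have "card ?T \<le> p + q"
 proof -
  have "card ?T \<le> card T1 + card (\<zeta> ` T3)" by (rule card_Un_le)
  also have "... \<le> p + q" using T1 T2 T3 card_image_le[of T3 \<zeta>] by linarith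
  finally show ?thesis .
 qed
 ultimately show ?thesis unfolding coh_le_def kc.codim_le_def by blast
qed

text \<open>The cocycle is the composition of the augmentation with the homomorphism \<open>k \<rightarrow> L/N\<close> that maps \<open>1\<close> to \<open>w\<close>.\<close>

lemma socle_cocyc:
 assumes N: "submod R N" and w: "w \<in> L" "!!r. r \<in> mm ==> r *s w \<in> N"
 shows "(\<lambda>j. emb (c j) *s w) \<in> cocyc N 0"
proof -
 have "delta 0 (\<lambda>j. emb (c j) *s w) k \<in> N" if "k < b (Suc 0)" for k
 proof -
  have "delta 0 (\<lambda>j. emb (c j) *s w) k = (\<Sum>j<b 0. D 0 k j * emb (c j)) *s w"
   by (simp add: delta_def scale_sum_left)
  then show ?thesis using w(2)[OF aug] that by simp
 qed
 then show ?thesis using L_scale[OF emb_R w(1)] by (simp add: cocyc_def coch_def)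
qed

lemma mm_scale_in:
 assumes "submod R N" "v \<in> L" "N \<subseteq> L" "!!x. x \<in> X ==> x *s v \<in> N" "r \<in> mm"
 shows "r *s v \<in> N"
proof -
 obtain s where s: "!!x. x \<in> X ==> s x \<in> R" "r = (\<Sum>x\<in>X. x * s x)" using mm_gen[OF assms(5)] by blast
 have "r *s v = (\<Sum>x\<in>X. s x *s x *s v)" by (simp add: s(2) scale_sum_left mult.commute)
 also have "... \<in> N"
  by (rule submod_sum[OF assms(1)], rule submod_scale[OF assms(1) s(1) assms(4)])
 finally show ?thesis .
qed

text \<open>
 An element \<open>w\<close> annihilated by the maximal ideal is a homomorphism from the residue field, i.e. the
 cocycle \<open>(c\<^sub>j w)\<^sub>j\<close>.
\<close>

lemma socle_free_of_coh:
 assumes N: "submod R N" "N \<subseteq> L" and "coh_le N 0 0"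
 shows "socle_free N"
 unfolding socle_free_def
proof (intro ballI impI)
 fix w assume w: "w \<in> L" "\<forall>x\<in>X. x *s w \<in> N"
 have "(\<lambda>j. emb (c j) *s w) \<in> cocyc N 0"
  using mm_scale_in[OF N(1) w(1) N(2)] w by (intro socle_cocyc[OF N(1)]) auto
 then have *: "!!j. j < b 0 ==> emb (c j) *s w \<in> N" using assms(3) coh_le_0[OF N(1)] by auto
 obtain j where j: "j < b 0" "c j ~= 0" using aug_unit by blast
 have "emb (inverse (c j)) *s emb (c j) *s w = w" using emb_inverse[OF j(2)] by simp
 then show "w \<in> N" using submod_scale[OF N(1) emb_R *[OF j(1)], of "inverse (c j)"] by metis
qed

text \<open>By the homotopy \<open>x z\<close> is a coboundary for every cocycle \<open>z\<close>; in degree 0 this says \<open>x z \<in> N\<close>.\<close>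

lemma coh_zero_of_regular:
 assumes N: "submod R N" and x: "x \<in> mm" "regular N x"
 shows "coh_le N 0 0"
 unfolding coh_le_0[OF N]
proof
 fix z assume z: "z \<in> cocyc N 0"
 obtain s where s: "homotopy x 0 s" using homotopy_exists[OF x(1)] by blast
 have "z j \<in> N" if j: "j < b 0" for j
 proof -
  have "\<exists>y. (\<forall>l<b 1. y l \<in> R) \<and> (\<forall>j'<b 0. (if j' = j then x else 0) = (\<Sum>l<b 1. y l * D 0 l j'))"
  proof (rule aug_exact)
   show "(if j' = j then x else 0) \<in> R" for j' using mm_R[OF x(1)] by simp
   have "(\<Sum>j'<b 0. (if j' = j then x else 0) * emb (c j')) = (\<Sum>j'<b 0. if j' = j then x * emb (c j) else 0)"
    by (rule sum.cong) auto
   also have "... = x * emb (c j)" using j by simp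
   also have "... \<in> mm"
   proof -
    interpret S: graded_module emb R cmp X "(*)" R cmp "{1}" by (rule graded_module_self)
    have "cmp 0 (emb (c j) * x) = emb (c j) * cmp 0 x"
     using S.prj_scale_H[OF H_emb, of x 0 "c j"] mm_R[OF x(1)] by simp
    then show ?thesis using x(1) by (simp add: mm_def R_mult mult.commute)
   qed
   finally show "(\<Sum>j'<b 0. (if j' = j then x else 0) * emb (c j')) \<in> mm" .
  qed
  then obtain y where *: "\<forall>l<b 1. y l \<in> R"
   "\<forall>j'<b 0. (if j' = j then x else 0) = (\<Sum>l<b 1. y l * D 0 l j')" by (elim exE conjE)
  have y: "!!l. l < b 1 ==> y l \<in> R"
   "!!j'. j' < b 0 ==> (\<Sum>l<b 1. y l * D 0 l j') = (if j' = j then x else 0)"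
   by (rule *(1)[rule_format], assumption+) (rule *(2)[rule_format, symmetric], assumption+)
  have "x *s z j = (\<Sum>j'<b 0. (if j' = j then x else 0) *s z j')"
   using j by (simp add: if_distrib[of "\<lambda>r. r *s _"] cong: if_cong)
  also have "... = (\<Sum>j'<b 0. (\<Sum>l<b 1. y l * D 0 l j') *s z j')"
   by (rule sum.cong) (simp_all only: y(2) lessThan_iff)
  also have "... = (\<Sum>l<b 1. y l *s delta 0 z l)"
   unfolding delta_def scale_sum_left scale_sum_right by (subst sum.swap) simp
  also have "... \<in> N"
   using z y(1) by (intro submod_sum[OF N] submod_scale[OF N]) (auto simp: cocyc_def)
  finally show ?thesis using x(2) z j by (simp add: regular_def cocyc_def coch_def)
 qed
 then show "z \<in> cobd N 0" by simp
qed

text \<open>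
 If the cohomology of \<open>L/(N + xL)\<close> vanishes in degree \<open>i\<close>, then multiplication by \<open>x\<close> is injective on
 that of \<open>L/N\<close> in degree \<open>i + 1\<close>, while it is zero by the homotopy.
\<close>

lemma coh_zero_Suc:
 assumes N: "submod R N" "N \<subseteq> L" and x: "x \<in> mm" "regular N x" and van: "coh_le (addmul N x) i 0"
 shows "coh_le N (Suc i) 0"
 unfolding coh_le_0[OF N(1)]
proof
 let ?N = "addmul N x"
 have xR: "x \<in> R" using mm_R[OF x(1)] .
 have N': "submod R ?N" by (rule submod_addmul[OF N(1) xR])
 fix z assume z: "z \<in> cocyc N (Suc i)"
 obtain s where s: "homotopy x i s" using homotopy_exists[OF x(1)] by blast
 obtain s' where *: "\<forall>k<b (Suc i). \<forall>l<b (Suc (Suc i)). s' k l \<in> R"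
  "\<forall>k<b (Suc i). \<forall>k'<b (Suc i). (if k' = k then x else 0) - (\<Sum>j<b i. D i k j * s j k') =
    (\<Sum>l<b (Suc (Suc i)). s' k l * D (Suc i) l k')"
  using homotopy_step[OF s xR] by (elim exE conjE)
 have s': "!!k l. k < b (Suc i) ==> l < b (Suc (Suc i)) ==> s' k l \<in> R"
  "!!k k'. k < b (Suc i) ==> k' < b (Suc i) ==>
    (if k' = k then x else 0) - (\<Sum>j<b i. D i k j * s j k') = (\<Sum>l<b (Suc (Suc i)). s' k l * D (Suc i) l k')"
  by (rule *(1)[rule_format], assumption+) (rule *(2)[rule_format], assumption+)
 define w where "w = (\<lambda>j. \<Sum>l<b (Suc i). s j l *s z l)"
 have w: "coch i w" using s z by (auto simp: coch_def w_def homotopy_def cocyc_def intro!: L_sum L_scale)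
 have xz: "x *s z k - delta i w k \<in> N" if k: "k < b (Suc i)" for k
 proof -
  have "delta i w k = (\<Sum>k'<b (Suc i). (\<Sum>j<b i. D i k j * s j k') *s z k')"
   unfolding delta_def w_def scale_sum_left scale_sum_right by (subst sum.swap) simp
  moreover have "x *s z k = (\<Sum>k'<b (Suc i). (if k' = k then x else 0) *s z k')"
   using k by (simp add: if_distrib[of "\<lambda>r. r *s _"] cong: if_cong)
  ultimately have "x *s z k - delta i w k =
    (\<Sum>k'<b (Suc i). ((if k' = k then x else 0) - (\<Sum>j<b i. D i k j * s j k')) *s z k')"
   by (simp only: scale_left_diff_distrib sum_subtractf)
  also have "... = (\<Sum>k'<b (Suc i). (\<Sum>l<b (Suc (Suc i)). s' k l * D (Suc i) l k') *s z k')"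
   by (rule sum.cong) (simp_all only: s'(2)[OF k] lessThan_iff)
  also have "... = (\<Sum>l<b (Suc (Suc i)). s' k l *s delta (Suc i) z l)"
   unfolding delta_def scale_sum_left scale_sum_right by (subst sum.swap) simp
  also have "... \<in> N"
   using z s'(1)[OF k] by (intro submod_sum[OF N(1)] submod_scale[OF N(1)]) (auto simp: cocyc_def)
  finally show ?thesis .
 qed
 have zL: "z k \<in> L" if "k < b (Suc i)" for k using z that by (simp add: cocyc_def coch_def)
 have "delta i w k \<in> ?N" if k: "k < b (Suc i)" for k
 proof -
  have "delta i w k - x *s z k \<in> N"
   using submod_scale[OF N(1) neg_one_R xz[OF k]] by (simp add: algebra_simps)
  then show ?thesis unfolding addmul_iff using zL[OF k] by blast
 qed
 then have "w \<in> cocyc ?N i" using w by (simp add: cocyc_def)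
 then have wb: "w \<in> cobd ?N i" using van coh_le_0[OF N'] by blast
 have "\<exists>v. coch i v \<and> (\<forall>k<b (Suc i). delta i w k - x *s delta i v k \<in> N)"
 proof (cases i)
  case 0
  have "\<forall>j. \<exists>v. j < b 0 --> v \<in> L \<and> w j - x *s v \<in> N"
   using wb 0 by (auto simp: addmul_iff)
  from choice[OF this] obtain v where v: "!!j. j < b 0 ==> v j \<in> L \<and> w j - x *s v j \<in> N" by blast
  have "delta 0 w k - x *s delta 0 v k \<in> N" if "k < b (Suc 0)" for k
   using delta_in[OF N(1), of 0 "\<lambda>j. w j - x *s v j" k] v that by (simp add: delta_diff delta_scale)
  then show ?thesis using v 0 by (intro exI[of _ v]) (simp add: coch_def)
 next
  case (Suc m)
  obtain u where u: "coch m u" "!!j. j < b (Suc m) ==> w j - delta m u j \<in> ?N" using wb Suc by auto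
  have "\<forall>j. \<exists>v. j < b (Suc m) --> v \<in> L \<and> w j - delta m u j - x *s v \<in> N"
   using u(2) by (auto simp: addmul_iff)
  from choice[OF this] obtain v where v: "!!j. j < b (Suc m) ==> v j \<in> L \<and> w j - delta m u j - x *s v j \<in> N" by blast
  have "delta (Suc m) w k - x *s delta (Suc m) v k \<in> N" if k: "k < b (Suc (Suc m))" for k
   using delta_in[OF N(1), of "Suc m" "\<lambda>j. w j - delta m u j - x *s v j" k] v k
   by (simp add: delta_diff delta_scale delta_delta[OF k])
  then show ?thesis using v Suc by (intro exI[of _ v]) (simp add: coch_def)
 qed
 then obtain v where v: "coch i v" "!!k. k < b (Suc i) ==> delta i w k - x *s delta i v k \<in> N" by blast
 have "z k - delta i v k \<in> N" if k: "k < b (Suc i)" for k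
 proof -
  have "x *s (z k - delta i v k) = (x *s z k - delta i w k) + (delta i w k - x *s delta i v k)"
   by (simp add: scale_right_diff_distrib)
  then have "x *s (z k - delta i v k) \<in> N" using submod_add[OF N(1) xz[OF k] v(2)[OF k]] by simp
  moreover have "z k - delta i v k \<in> L"
   using L_diff[OF zL[OF k]] coch_delta[OF v(1)] k by (simp add: coch_def)
  ultimately show ?thesis using x(2) by (simp add: regular_def)
 qed
 then show "z \<in> cobd N (Suc i)" using v(1) by auto
qed

end

section \<open>Regular sequences\<close>

context graded_domain
begin

lemma submod_mm: "RR.submod R mm"
proof (rule RR.submodI)
 interpret S: graded_module emb R cmp X "(*)" R cmp "{1}" by (rule graded_module_self)
 show "s * r \<in> mm" if s: "s \<in> R" and r: "r \<in> mm" for r s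
 proof -
  have "cmp n s * cmp (0 - n) r = 0" for n
  proof (cases "n < 0")
   case True
   then show ?thesis using cmp_neg[OF s] by simp
  next
   case False
   then show ?thesis using r cmp_neg[OF mm_R[OF r], of "- n"] by (cases "n = 0") (auto simp: mm_def)
  qed
  then have "cmp 0 (s * r) = 0" unfolding S.prj_scale[OF s mm_R[OF r], of 0] by (intro sum.neutral ballI)
  then show ?thesis using R_mult[OF s mm_R[OF r]] by (simp add: mm_def)
 qed
qed (auto simp: mm_def cmp_add R_add)

end

context graded_module
begin

fun Nth :: "'v set => (nat => 'r) => nat => 'v set" where
 "Nth K \<theta> 0 = K"
| "Nth K \<theta> (Suc j) = addmul (Nth K \<theta> j) (\<theta> j)"

lemma Nth_cong: "(!!i. i < j ==> \<theta> i = \<theta>' i) ==> Nth K \<theta> j = Nth K \<theta>' j"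
 by (induction j) auto

lemma grsub_Nth: "grsub K ==> (!!i. i < j ==> \<theta> i \<in> H (e i)) ==> grsub (Nth K \<theta> j)"
 by (induction j) (auto intro: grsub_addmul)

lemma Nth_iff:
 "v \<in> Nth K \<theta> j \<longleftrightarrow> (\<exists>w. (\<forall>i<j. w i \<in> L) \<and> v - (\<Sum>i<j. \<theta> i *s w i) \<in> K)"
proof (induction j arbitrary: v)
 case (Suc j)
 show ?case
 proof
  assume "v \<in> Nth K \<theta> (Suc j)"
  then obtain u w where u: "u \<in> L" and w: "\<forall>i<j. w i \<in> L" "v - \<theta> j *s u - (\<Sum>i<j. \<theta> i *s w i) \<in> K"
   unfolding Nth.simps addmul_iff Suc by blast
  have "(\<Sum>i<j. \<theta> i *s (w(j := u)) i) = (\<Sum>i<j. \<theta> i *s w i)" by (rule sum.cong) auto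
  then have "v - (\<Sum>i<Suc j. \<theta> i *s (w(j := u)) i) = v - \<theta> j *s u - (\<Sum>i<j. \<theta> i *s w i)"
   by (simp add: algebra_simps)
  then have "v - (\<Sum>i<Suc j. \<theta> i *s (w(j := u)) i) \<in> K" using w(2) by (simp only:)
  moreover have "\<forall>i<Suc j. (w(j := u)) i \<in> L" using u w(1) by (simp add: less_Suc_eq)
  ultimately show "\<exists>w. (\<forall>i<Suc j. w i \<in> L) \<and> v - (\<Sum>i<Suc j. \<theta> i *s w i) \<in> K"
   by (intro exI[of _ "w(j := u)"]) simp
 next
  assume "\<exists>w. (\<forall>i<Suc j. w i \<in> L) \<and> v - (\<Sum>i<Suc j. \<theta> i *s w i) \<in> K"
  then obtain w where w: "\<forall>i<Suc j. w i \<in> L" "v - (\<Sum>i<Suc j. \<theta> i *s w i) \<in> K" by blast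
  then have "v - \<theta> j *s w j - (\<Sum>i<j. \<theta> i *s w i) \<in> K" by (simp add: algebra_simps)
  then have "v - \<theta> j *s w j \<in> Nth K \<theta> j" unfolding Suc using w(1) by (intro exI[of _ w]) simp
  then show "v \<in> Nth K \<theta> (Suc j)" unfolding Nth.simps addmul_iff using w(1) by blast
 qed
qed simp

lemma Nth_hom:
 assumes K: "grsub K" and t: "!!i. i < j ==> \<theta> i \<in> H (e i)" and v: "v \<in> Lh a" "v \<in> Nth K \<theta> j"
 shows "\<exists>w. (\<forall>i<j. w i \<in> Lh (a - e i)) \<and> v - (\<Sum>i<j. \<theta> i *s w i) \<in> K"
proof -
 obtain w where w: "\<forall>i<j. w i \<in> L" "v - (\<Sum>i<j. \<theta> i *s w i) \<in> K" using v(2) Nth_iff by blast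
 have tL: "\<theta> i *s w i \<in> L" if "i < j" for i using w(1) that L_scale H_R[OF t[OF that]] by blast
 have "prj a (v - (\<Sum>i<j. \<theta> i *s w i)) = v - (\<Sum>i<j. prj a (\<theta> i *s w i))"
  using prj_diff[OF Lh_L[OF v(1)], of "\<Sum>i<j. \<theta> i *s w i" a] L_sum[of "{..<j}" "\<lambda>i. \<theta> i *s w i"] tL
   prj_sum[of "{..<j}" "\<lambda>i. \<theta> i *s w i" a] by (simp add: prj_Lh[OF v(1)])
 also have "(\<Sum>i<j. prj a (\<theta> i *s w i)) = (\<Sum>i<j. \<theta> i *s prj (a - e i) (w i))"
  using w(1) t by (intro sum.cong refl prj_scale_H) auto
 finally have "v - (\<Sum>i<j. \<theta> i *s prj (a - e i) (w i)) \<in> K" using grsub_prj[OF K w(2), of a] by simp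
 then show ?thesis using w(1) Lh_prj by (intro exI[of _ "\<lambda>i. prj (a - e i) (w i)"]) auto
qed

lemma Nth_superset: "v \<in> K ==> v \<in> Nth K \<theta> j"
 by (induction j) (auto intro: addmul_superset)

lemma Nth_mono: "i \<le> j ==> v \<in> Nth K \<theta> i ==> v \<in> Nth K \<theta> j"
 by (induction j) (auto simp: le_Suc_eq intro: addmul_superset)

lemma Nth_mult:
 assumes "submod R (Nth K \<theta> i)" "i < j" "w \<in> L"
 shows "\<theta> i *s w \<in> Nth K \<theta> j"
 using Nth_mono[of "Suc i" j] addmul_mult[OF assms(1,3), of "\<theta> i"] assms(2) by simp

text \<open>By induction: regularity puts the coefficient of the last member into the preceding submodule, so that it is absorbed by the others.\<close>

lemma quasi_regular:
 assumes "grsub K" "!!i. i < j ==> \<theta> i \<in> H (e i)" "!!i. i < j ==> regular (Nth K \<theta> i) (\<theta> i)"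
  and "!!i. i < j ==> w i \<in> L" "(\<Sum>i<j. \<theta> i *s w i) \<in> K" "i < j"
 shows "w i \<in> Nth K \<theta> j"
 using assms
proof (induction j arbitrary: w i)
 case (Suc j)
 have gr: "grsub (Nth K \<theta> j)" using grsub_Nth[OF Suc.prems(1), of j \<theta> e] Suc.prems(2) by simp
 have "- (\<Sum>i<Suc j. \<theta> i *s w i) \<in> K"
  using grsub_scale[OF Suc.prems(1) neg_one_R Suc.prems(5)] by simp
 then have "(- (\<theta> j *s w j)) - (\<Sum>i<j. \<theta> i *s w i) \<in> K" by (simp add: algebra_simps)
 then have "- (\<theta> j *s w j) \<in> Nth K \<theta> j" unfolding Nth_iff using Suc.prems(4) by (intro exI[of _ w]) simp
 then have "\<theta> j *s w j \<in> Nth K \<theta> j" using grsub_scale[OF gr neg_one_R, of "- (\<theta> j *s w j)"] by simp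
 then have wj: "w j \<in> Nth K \<theta> j" using Suc.prems(3)[of j] Suc.prems(4)[of j] by (simp add: regular_def)
 then obtain v where v: "!!i. i < j ==> v i \<in> L" "w j - (\<Sum>i<j. \<theta> i *s v i) \<in> K"
  unfolding Nth_iff by blast
 have tj: "\<theta> j \<in> R" using H_R Suc.prems(2) by blast
 have "(\<Sum>i<Suc j. \<theta> i *s w i) - \<theta> j *s (w j - (\<Sum>i<j. \<theta> i *s v i)) \<in> K"
  by (rule grsub_diff[OF Suc.prems(1,5) grsub_scale[OF Suc.prems(1) tj v(2)]])
 also have "(\<Sum>i<Suc j. \<theta> i *s w i) - \<theta> j *s (w j - (\<Sum>i<j. \<theta> i *s v i)) =
  (\<Sum>i<j. \<theta> i *s (w i + \<theta> j *s v i))"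
  by (simp add: scale_right_diff_distrib scale_right_distrib sum.distrib scale_sum_right mult.commute)
 finally have rel: "(\<Sum>i<j. \<theta> i *s (w i + \<theta> j *s v i)) \<in> K" .
 show ?case
 proof (cases "i = j")
  case True
  then show ?thesis using wj by (auto intro: addmul_superset)
 next
  case False
  then have i: "i < j" using Suc.prems(6) by simp
  have "w i + \<theta> j *s v i \<in> Nth K \<theta> j"
   using Suc.prems(1-4) v(1) L_add L_scale[OF tj] by (intro Suc.IH[OF _ _ _ _ rel i]) auto
  then have 1: "w i + \<theta> j *s v i \<in> Nth K \<theta> (Suc j)" by (simp add: addmul_superset)
  have 2: "\<theta> j *s v i \<in> Nth K \<theta> (Suc j)"
   by (rule Nth_mult[OF grsub_submod[OF gr] _ v(1)[OF i]]) simp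
  have "grsub (Nth K \<theta> (Suc j))" by (rule grsub_Nth[OF Suc.prems(1,2)])
  then show ?thesis using grsub_diff[OF _ 1 2] by simp
 qed
qed simp

lemma degree_induct:
 assumes M: "submod R M" and step: "!!a. (!!a'. a' < a ==> Lh a' \<subseteq> M) ==> Lh a \<subseteq> M"
 shows "L \<subseteq> M"
proof -
 obtain b0 where b0: "!!a. a < b0 ==> Lh a = {0}" using bounded_below by blast
 have "Lh a \<subseteq> M" for a
 proof (induction "nat (a - b0)" arbitrary: a rule: less_induct)
  case less
  show ?case
  proof (cases "a < b0")
   case True
   then show ?thesis using b0 submod_zero[OF M] by simp
  next
   case False
   have "Lh a' \<subseteq> M" if "a' < a" for a'
   proof (cases "a' < b0")
    case True
    then show ?thesis using b0 submod_zero[OF M] by simp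
   next
    case False
    then show ?thesis using that by (intro less) simp
   qed
   then show ?thesis by (rule step)
  qed
 qed
 then show ?thesis using hom_induct[OF M] by blast
qed

end

lemma (in residue_resolution) graded_module_resolution_self:
 "graded_module_resolution emb R cmp X (*) R cmp {1} b D c"
 by (intro graded_module_resolution.intro graded_module_self residue_resolution_axioms)


section \<open>Canonical modules modulo a regular sequence\<close>

text \<open>The module \<open>L/K\<close> has the cohomology of a canonical module of a ring of dimension \<open>d\<close>.\<close>

locale canonical_candidate =
 graded_module_resolution emb R cmp X scale L prj E b D c
 for emb :: "'k::field => 'r::idom" and R cmp X
  and scale :: "'r => 'v::ab_group_add => 'v" (infixr "*s" 75)
  and L prj E b D c +
 fixes K :: "'v set" and d :: nat
 assumes K: "grsub K"
  and coh_other: "i ~= d ==> coh_le K i 0"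
  and coh_d: "coh_le K d 1"
  and coh_d_nonzero: "\<not> coh_le K d 0"

sublocale canonical_candidate \<subseteq> S: graded_module_resolution emb R cmp X "(*)" R cmp "{1}" b D c
 by (rule graded_module_resolution_self)

context canonical_candidate
begin

text \<open>The long exact sequences add up to Pascal's rule.\<close>

lemma coh_bound:
 assumes "!!i. i < n ==> \<theta> i \<in> H (e i)" "!!i. i < n ==> regular (Nth K \<theta> i) (\<theta> i)"
 shows "coh_le (Nth K \<theta> n) i (if i \<le> d then n choose (d - i) else 0)"
 using assms
proof (induction n arbitrary: i)
 case 0
 show ?case using coh_other[of i] coh_d by (cases "i = d") (auto simp: binomial_eq_0)
next
 case (Suc n)
 have gr: "grsub (Nth K \<theta> n)" using grsub_Nth[OF K, of n \<theta> e] Suc.prems(1) by simp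
 have IH: "coh_le (Nth K \<theta> n) i (if i \<le> d then n choose (d - i) else 0)" for i
  using Suc by simp
 have "coh_le (addmul (Nth K \<theta> n) (\<theta> n)) i
  ((if i \<le> d then n choose (d - i) else 0) + (if Suc i \<le> d then n choose (d - Suc i) else 0))"
  using gr Suc.prems by (intro coh_le_addmul IH) (auto simp: grsub_def intro: H_R)
 moreover have "(if i \<le> d then n choose (d - i) else 0) + (if Suc i \<le> d then n choose (d - Suc i) else 0) =
  (if i \<le> d then Suc n choose (d - i) else 0)"
 proof (cases "i < d")
  case True
  then have "d - i = Suc (d - Suc i)" by simp
  then show ?thesis using True by simp
 qed auto
 ultimately show ?case by simp
qed

lemma S_grsub_0: "S.grsub {0}"
 by (auto simp: S.grsub_def RR.submod_def)

lemma S_coh_zero: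
 assumes "!!i. i < d ==> S.coh_le {0} i 0"
  and "!!i. i < n ==> \<theta> i \<in> H (e i)" "!!i. i < n ==> S.regular (S.Nth {0} \<theta> i) (\<theta> i)"
  and "i + n < d"
 shows "S.coh_le (S.Nth {0} \<theta> n) i 0"
 using assms
proof (induction n arbitrary: i)
 case (Suc n)
 have gr: "S.grsub (S.Nth {0} \<theta> n)" using S.grsub_Nth[OF S_grsub_0, of n \<theta> e] Suc.prems(2) by simp
 have IH: "S.coh_le (S.Nth {0} \<theta> n) i 0" if "i + n < d" for i
  using Suc that by simp
 have "S.coh_le (S.addmul (S.Nth {0} \<theta> n) (\<theta> n)) i (0 + 0)"
  using gr Suc.prems by (intro S.coh_le_addmul IH) (auto simp: S.grsub_def intro: H_R)
 then show ?case by simp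
qed simp

text \<open>Prime avoidance for the associated primes of both modules at each step.\<close>

lemma common_regular_sequence:
 assumes "!!i. i < d ==> S.coh_le {0} i 0"
 shows "\<exists>\<theta> e. \<forall>i<d. \<theta> i \<in> H (e i) \<and> e i > 0 \<and> regular (Nth K \<theta> i) (\<theta> i) \<and>
  S.regular (S.Nth {0} \<theta> i) (\<theta> i)"
proof -
 have "n \<le> d ==> \<exists>\<theta> e. \<forall>i<n. \<theta> i \<in> H (e i) \<and> e i > 0 \<and> regular (Nth K \<theta> i) (\<theta> i) \<and>
  S.regular (S.Nth {0} \<theta> i) (\<theta> i)" for n
 proof (induction n)
  case (Suc n)
  then obtain \<theta> e where t: "!!i. i < n ==> \<theta> i \<in> H (e i)" "!!i. i < n ==> e i > 0"
   "!!i. i < n ==> regular (Nth K \<theta> i) (\<theta> i)" "!!i. i < n ==> S.regular (S.Nth {0} \<theta> i) (\<theta> i)"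
   by force
  let ?N = "Nth K \<theta> n" and ?I = "S.Nth {0} \<theta> n"
  have gN: "grsub ?N" by (rule grsub_Nth[OF K t(1)])
  have gI: "S.grsub ?I" by (rule S.grsub_Nth[OF S_grsub_0 t(1)])
  have "coh_le ?N 0 (if 0 \<le> d then n choose (d - 0) else 0)" by (rule coh_bound[OF t(1,3)])
  then have "coh_le ?N 0 0" using Suc.prems by (simp add: binomial_eq_0)
  then have sN: "socle_free ?N" using gN by (intro socle_free_of_coh) (auto simp: grsub_def)
  have "S.coh_le ?I 0 0" using Suc.prems by (intro S_coh_zero[OF assms t(1,4)]) auto
  then have sI: "S.socle_free ?I" using gI by (intro S.socle_free_of_coh) (auto simp: S.grsub_def)
  obtain \<P> where P: "finite \<P>" "\<forall>P\<in>\<P>. hprime P \<and> \<not> X \<subseteq> P"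
   "\<forall>a. \<forall>w\<in>Lh a. w \<notin> ?N --> (\<exists>P\<in>\<P>. Ann ?N w \<subseteq> P)" using associated_primes[OF gN sN] by (elim exE conjE)
  obtain \<Q> where Q: "finite \<Q>" "\<forall>P\<in>\<Q>. hprime P \<and> \<not> X \<subseteq> P"
   "\<forall>a. \<forall>w\<in>S.Lh a. w \<notin> ?I --> (\<exists>P\<in>\<Q>. S.Ann ?I w \<subseteq> P)" using S.associated_primes[OF gI sI] by (elim exE conjE)
  have "\<exists>m>0. \<exists>f\<in>H m. \<forall>P\<in>\<P> \<union> \<Q>. f \<notin> P"
   using P(1,2) Q(1,2) by (intro prime_avoidance) auto
  then obtain m f where f: "m > 0" "f \<in> H m" "\<forall>P\<in>\<P> \<union> \<Q>. f \<notin> P" by blast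
  have rN: "regular ?N f" using P(3) f(3) by (intro regular_of_avoiding[OF gN f(2)]) blast
  have rI: "S.regular ?I f" using Q(3) f(3) by (intro S.regular_of_avoiding[OF gI f(2)]) blast
  have cong: "Nth K (\<theta>(n := f)) i = Nth K \<theta> i" "S.Nth {0} (\<theta>(n := f)) i = S.Nth {0} \<theta> i" if "i \<le> n" for i
   using that by (intro Nth_cong S.Nth_cong; simp)+
  show ?case
  proof (intro exI[of _ "\<theta>(n := f)"] exI[of _ "e(n := m)"] allI impI)
   fix i assume "i < Suc n"
   then consider "i < n" | "i = n" by linarith
   then show "(\<theta>(n := f)) i \<in> H ((e(n := m)) i) \<and> (e(n := m)) i > 0 \<and>
    regular (Nth K (\<theta>(n := f)) i) ((\<theta>(n := f)) i) \<and> S.regular (S.Nth {0} (\<theta>(n := f)) i) ((\<theta>(n := f)) i)"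
   proof cases
    case 1
    then show ?thesis using t[of i] cong[of i] by simp
   next
    case 2
    then show ?thesis using f rN rI cong[of n] by simp
   qed
  qed
 qed simp
 then show ?thesis by blast
qed

end

section \<open>The reduction of the canonical module is injective with simple socle\<close>

lemma (in graded_domain) last_degree:
 assumes "!!n s. n > t ==> s \<in> H n ==> \<not> P s" "s0 \<in> H n0" "P s0" "\<not> P 0"
 shows "\<exists>n. \<exists>s\<in>H n. P s \<and> (\<forall>x\<in>X. \<not> P (x * s))"
proof -
 let ?A = "{n. \<exists>s\<in>H n. P s}"
 have sub: "?A \<subseteq> {0..t}"
 proof
  fix n assume "n \<in> ?A"
  then obtain s where s: "s \<in> H n" "P s" by blast
  then have "\<not> n > t" using assms(1) by blast
  moreover have "\<not> n < 0" using H_neg[OF s(1)] s(2) assms(4) by auto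
  ultimately show "n \<in> {0..t}" by simp
 qed
 then have fin: "finite ?A" using finite_subset by blast
 have "n0 \<in> ?A" using assms(2,3) by blast
 then have "Max ?A \<in> ?A" using Max_in[OF fin] by blast
 then obtain s where s: "s \<in> H (Max ?A)" "P s" by blast
 have "\<not> P (x * s)" if "x \<in> X" for x
 proof
  assume "P (x * s)"
  then have "1 + Max ?A \<in> ?A" using H_mult[OF X_H[OF that] s(1)] by blast
  then show False using Max_ge[OF fin] by fastforce
 qed
 then show ?thesis using s by blast
qed

lemma sum_fun_eval: "(\<Sum>i\<in>A. f i) x = (\<Sum>i\<in>A. (f i x :: 'a::comm_monoid_add))"
 by (induction A rule: infinite_finite_induct) auto

text \<open>A common regular sequence \<open>\<theta>\<close> such that the last component of \<open>R/\<theta>R\<close>, in degree \<open>top\<close>, is a line.\<close>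

locale dualizing = canonical_candidate emb R cmp X scale L prj E b D c K d
 for emb :: "'k::field => 'r::idom" and R cmp X
  and scale :: "'r => 'v::ab_group_add => 'v" (infixr "*s" 75)
  and L prj E b D c K d +
 fixes \<theta> :: "nat => 'r" and e :: "nat => int" and top :: int
 assumes theta_H: "i < d ==> \<theta> i \<in> H (e i)"
  and e_pos: "i < d ==> e i > 0"
  and theta_regular: "i < d ==> regular (Nth K \<theta> i) (\<theta> i)"
  and theta_regular_R: "i < d ==> S.regular (S.Nth {0} \<theta> i) (\<theta> i)"
  and above_top: "n > top ==> H n \<subseteq> S.Nth {0} \<theta> d"
  and top_one: "\<exists>\<rho>\<in>H top. \<rho> \<notin> S.Nth {0} \<theta> d \<and> (\<forall>r\<in>H top. \<exists>a. r - emb a * \<rho> \<in> S.Nth {0} \<theta> d)"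
begin

definition N :: "'v set" where "N = Nth K \<theta> d"

definition I :: "'r set" where "I = S.Nth {0} \<theta> d"

lemma grN: "grsub N" unfolding N_def by (rule grsub_Nth[OF K theta_H])

lemma grI: "S.grsub I" unfolding I_def by (rule S.grsub_Nth[OF S_grsub_0 theta_H])

lemmas Ns = grsub_submod[OF grN]
lemmas Is = S.grsub_submod[OF grI]

lemma N_L: "N \<subseteq> L" using grN by (auto simp: grsub_def)

lemma I_R: "I \<subseteq> R" using grI by (auto simp: S.grsub_def)

lemma theta_R: "i < d ==> \<theta> i \<in> R" using theta_H H_R by blast

lemma theta_mm: "i < d ==> \<theta> i \<in> mm" using H_mm[OF theta_H e_pos] by blast

lemma theta_N: "i < d ==> w \<in> L ==> \<theta> i *s w \<in> N"
 unfolding N_def by (rule Nth_mult[OF grsub_submod[OF grsub_Nth[OF K theta_H]]]) auto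

lemma theta_I: "i < d ==> w \<in> R ==> \<theta> i * w \<in> I"
 unfolding I_def by (rule S.Nth_mult[OF S.grsub_submod[OF S.grsub_Nth[OF S_grsub_0 theta_H]]]) auto

lemma I_scale_N:
 assumes "r \<in> I" "v \<in> L"
 shows "r *s v \<in> N"
proof -
 obtain w where w: "\<forall>i<d. w i \<in> R" "r - (\<Sum>i<d. \<theta> i * w i) \<in> {0}"
  using assms(1) unfolding I_def S.Nth_iff by blast
 have "r *s v = (\<Sum>i<d. \<theta> i *s w i *s v)" using w(2) by (simp add: scale_sum_left)
 also have "... \<in> N" by (rule submod_sum[OF Ns], rule theta_N) (use w(1) L_scale assms(2) in auto)
 finally show ?thesis .
qed

definition cg :: "'v => 'v => bool" where "cg v w \<longleftrightarrow> v - w \<in> N"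

lemma cg_refl [simp]: "cg v v" by (simp add: cg_def submod_zero[OF Ns])

lemma cg_sym: "cg v w ==> cg w v"
 using submod_scale[OF Ns neg_one_R, of "v - w"] by (simp add: cg_def)

lemma cg_trans [trans]: "cg u v ==> cg v w ==> cg u w"
 using submod_add[OF Ns, of "u - v" "v - w"] by (simp add: cg_def)

lemma cg_add: "cg v w ==> cg v' w' ==> cg (v + v') (w + w')"
 using submod_add[OF Ns, of "v - w" "v' - w'"] by (simp add: cg_def algebra_simps)

lemma cg_scale: "r \<in> R ==> cg v w ==> cg (r *s v) (r *s w)"
 using submod_scale[OF Ns, of r "v - w"] by (simp add: cg_def scale_right_diff_distrib)

lemma cg_sum: "(!!i. i \<in> A ==> cg (f i) (g i)) ==> cg (sum f A) (sum g A)"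
 by (induction A rule: infinite_finite_induct) (auto intro: cg_add)

lemma cg_0: "cg v 0 \<longleftrightarrow> v \<in> N" by (simp add: cg_def)

lemma cg_in: "cg v w ==> w \<in> N ==> v \<in> N"
 using submod_add[OF Ns, of "v - w" w] by (simp add: cg_def)

lemma emb_scale_N: "emb a *s v \<in> N ==> a ~= 0 ==> v \<in> N"
 using submod_scale[OF Ns emb_R, of "emb a *s v" "inverse a"] by (simp add: emb_inverse)

text \<open>Homomorphisms from an ideal \<open>J\<close> to \<open>L/N\<close>, given by representatives.\<close>

definition mhom :: "'r set => ('r => 'v) => bool" where
 "mhom J \<psi> \<longleftrightarrow> (\<forall>r\<in>J. \<psi> r \<in> L) \<and> (\<forall>r\<in>J. \<forall>r'\<in>J. cg (\<psi> (r + r')) (\<psi> r + \<psi> r')) \<and>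
   (\<forall>s\<in>R. \<forall>r\<in>J. cg (\<psi> (s * r)) (s *s \<psi> r))"

lemma mhom_L: "mhom J \<psi> ==> r \<in> J ==> \<psi> r \<in> L"
 and mhom_add: "mhom J \<psi> ==> r \<in> J ==> r' \<in> J ==> cg (\<psi> (r + r')) (\<psi> r + \<psi> r')"
 and mhom_scale: "mhom J \<psi> ==> s \<in> R ==> r \<in> J ==> cg (\<psi> (s * r)) (s *s \<psi> r)"
 by (auto simp: mhom_def)

lemma mhom_zero: "mhom J \<psi> ==> 0 \<in> J ==> \<psi> 0 \<in> N"
 using mhom_scale[of J \<psi> 0 0] by (simp add: cg_0)

lemma mhom_diff:
 assumes "mhom J \<psi>" "RR.submod R J" "r \<in> J" "r' \<in> J"
 shows "cg (\<psi> (r - r')) (\<psi> r - \<psi> r')"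
proof -
 have "cg (\<psi> (r + (- 1) * r')) (\<psi> r + \<psi> ((- 1) * r'))"
  by (rule mhom_add[OF assms(1,3)], rule RR.submod_scale[OF assms(2) neg_one_R assms(4)])
 also have "cg (\<psi> r + \<psi> ((- 1) * r')) (\<psi> r + (- 1) *s \<psi> r')"
  by (rule cg_add[OF cg_refl mhom_scale[OF assms(1) neg_one_R assms(4)]])
 finally show ?thesis by simp
qed

lemma mhom_sum:
 assumes "mhom J \<psi>" "RR.submod R J" "!!k. k < (n::nat) ==> a k \<in> R" "!!k. k < n ==> g k \<in> J"
 shows "cg (\<psi> (\<Sum>k<n. a k * g k)) (\<Sum>k<n. a k *s \<psi> (g k))"
 using assms(3,4)
proof (induction n)
 case 0
 then show ?case using mhom_zero[OF assms(1) RR.submod_zero[OF assms(2)]] by (simp add: cg_0)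
next
 case (Suc n)
 have in_J: "a n * g n \<in> J" by (rule RR.submod_scale[OF assms(2)]) (use Suc.prems in auto)
 have sum_J: "(\<Sum>k<n. a k * g k) \<in> J"
  by (rule RR.submod_sum[OF assms(2)], rule RR.submod_scale[OF assms(2)]) (use Suc.prems in auto)
 have "cg (\<psi> ((\<Sum>k<n. a k * g k) + a n * g n)) (\<psi> (\<Sum>k<n. a k * g k) + \<psi> (a n * g n))"
  by (rule mhom_add[OF assms(1) sum_J in_J])
 also have "cg (\<psi> (\<Sum>k<n. a k * g k) + \<psi> (a n * g n)) ((\<Sum>k<n. a k *s \<psi> (g k)) + a n *s \<psi> (g n))"
  using Suc.prems by (intro cg_add Suc.IH mhom_scale[OF assms(1)]) auto
 finally show ?case by simp
qed

lemma mhom_combination: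
 assumes "RR.submod R J" "!!i. i \<in> A ==> mhom J (f i)"
 shows "mhom J (\<lambda>r. \<Sum>i\<in>A. emb (a i) *s f i r)"
 unfolding mhom_def
proof (intro conjI ballI)
 fix r r' assume r: "r \<in> J" "r' \<in> J"
 show "(\<Sum>i\<in>A. emb (a i) *s f i r) \<in> L"
  using mhom_L[OF assms(2) r(1)] by (intro L_sum L_scale) auto
 have "cg (\<Sum>i\<in>A. emb (a i) *s f i (r + r')) (\<Sum>i\<in>A. emb (a i) *s (f i r + f i r'))"
  by (intro cg_sum cg_scale mhom_add[OF assms(2)] r) auto
 then show "cg (\<Sum>i\<in>A. emb (a i) *s f i (r + r')) ((\<Sum>i\<in>A. emb (a i) *s f i r) + (\<Sum>i\<in>A. emb (a i) *s f i r'))"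
  by (simp add: scale_right_distrib sum.distrib)
next
 fix s r assume s: "s \<in> R" and r: "r \<in> J"
 have "cg (\<Sum>i\<in>A. emb (a i) *s f i (s * r)) (\<Sum>i\<in>A. emb (a i) *s s *s f i r)"
  by (intro cg_sum cg_scale mhom_scale[OF assms(2)] r s) auto
 then show "cg (\<Sum>i\<in>A. emb (a i) *s f i (s * r)) (s *s (\<Sum>i\<in>A. emb (a i) *s f i r))"
  by (simp add: scale_sum_right mult.commute)
qed

text \<open>
 A homomorphism \<open>\<psi>\<close> from the maximal ideal gives a cocycle of degree 1, via \<open>R\<^bsup>b 1\<^esup> \<rightarrow> R\<^bsup>b 0\<^esup> \<rightarrow> R\<close>.
\<close>

definition aug_col :: "nat => 'r" where "aug_col k = (\<Sum>j<b 0. D 0 k j * emb (c j))"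

definition Zc :: "('r => 'v) => nat => 'v" where "Zc \<psi> k = \<psi> (aug_col k)"

lemma aug_col_mm: "k < b (Suc 0) ==> aug_col k \<in> mm"
 using aug by (simp add: aug_col_def)

lemma Zc_cocyc:
 assumes "mhom mm \<psi>"
 shows "Zc \<psi> \<in> cocyc N (Suc 0)"
proof -
 have "delta (Suc 0) (Zc \<psi>) l \<in> N" if l: "l < b (Suc (Suc 0))" for l
 proof -
  have "(\<Sum>k<b (Suc 0). D (Suc 0) l k * aug_col k) =
   (\<Sum>j<b 0. (\<Sum>k<b (Suc 0). D (Suc 0) l k * D 0 k j) * emb (c j))"
   unfolding aug_col_def sum_distrib_left sum_distrib_right mult.assoc by (rule sum.swap)
  also have "... = 0" using complex[OF l] by (intro sum.neutral) simp
  finally have z: "(\<Sum>k<b (Suc 0). D (Suc 0) l k * aug_col k) = 0" .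
  have "cg (\<psi> (\<Sum>k<b (Suc 0). D (Suc 0) l k * aug_col k)) (\<Sum>k<b (Suc 0). D (Suc 0) l k *s \<psi> (aug_col k))"
   by (rule mhom_sum[OF assms submod_mm D_R aug_col_mm]) (use l in auto)
  then have "cg (\<Sum>k<b (Suc 0). D (Suc 0) l k *s \<psi> (aug_col k)) (\<psi> 0)" unfolding z by (rule cg_sym)
  then show ?thesis using mhom_zero[OF assms RR.submod_zero[OF submod_mm]]
   unfolding delta_def Zc_def by (rule cg_in)
 qed
 then show ?thesis using mhom_L[OF assms aug_col_mm] by (auto simp: cocyc_def coch_def Zc_def)
qed

lemma Zc_cobd:
 assumes \<psi>: "mhom mm \<psi>" and Z: "Zc \<psi> \<in> cobd N (Suc 0)"
 shows "\<exists>b0\<in>L. \<forall>r\<in>mm. cg (\<psi> r) (r *s b0)"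
proof -
 obtain w where w: "coch 0 w" "\<forall>k<b (Suc 0). Zc \<psi> k - delta 0 w k \<in> N" using Z by auto
 obtain j0 where j0: "j0 < b 0" "c j0 ~= 0" using aug_unit by blast
 let ?b0 = "emb (inverse (c j0)) *s w j0"
 have "cg (\<psi> r) (r *s ?b0)" if r: "r \<in> mm" for r
 proof -
  let ?a = "\<lambda>j. if j = j0 then r * emb (inverse (c j0)) else 0"
  have sum_a: "(\<Sum>j<b 0. ?a j * emb (c j)) = r"
  proof -
   have "(\<Sum>j<b 0. ?a j * emb (c j)) = (\<Sum>j<b 0. if j = j0 then r * emb (inverse (c j0)) * emb (c j0) else 0)"
    by (rule sum.cong) auto
   then show ?thesis using j0 emb_inverse[OF j0(2)] by (simp add: mult.assoc)
  qed
  have "\<exists>y. (\<forall>k<b 1. y k \<in> R) \<and> (\<forall>j<b 0. ?a j = (\<Sum>k<b 1. y k * D 0 k j))"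
   by (rule aug_exact) (use sum_a r mm_R[OF r] R_mult in auto)
  then obtain y where y: "\<forall>k<b 1. y k \<in> R" "\<forall>j<b 0. ?a j = (\<Sum>k<b 1. y k * D 0 k j)" by (elim exE conjE)
  have "(\<Sum>j<b 0. ?a j * emb (c j)) = (\<Sum>j<b 0. (\<Sum>k<b 1. y k * D 0 k j) * emb (c j))"
   by (rule sum.cong[OF refl]) (simp only: y(2)[rule_format] lessThan_iff)
  also have "... = (\<Sum>k<b 1. y k * aug_col k)"
   unfolding aug_col_def sum_distrib_left sum_distrib_right mult.assoc by (rule sum.swap)
  finally have rr: "r = (\<Sum>k<b (Suc 0). y k * aug_col k)" unfolding sum_a One_nat_def .
  have "cg (\<psi> (\<Sum>k<b (Suc 0). y k * aug_col k)) (\<Sum>k<b (Suc 0). y k *s \<psi> (aug_col k))"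
   by (rule mhom_sum[OF \<psi> submod_mm _ aug_col_mm]) (use y(1) in auto)
  then have "cg (\<psi> r) (\<Sum>k<b (Suc 0). y k *s \<psi> (aug_col k))" unfolding rr[symmetric] .
  also have "cg (\<Sum>k<b (Suc 0). y k *s \<psi> (aug_col k)) (\<Sum>k<b (Suc 0). y k *s delta 0 w k)"
   by (intro cg_sum cg_scale) (use y(1) w(2) in \<open>auto simp: Zc_def cg_def\<close>)
  also have "(\<Sum>k<b (Suc 0). y k *s delta 0 w k) = (\<Sum>j<b 0. (\<Sum>k<b 1. y k * D 0 k j) *s w j)"
   unfolding delta_def scale_sum_left scale_sum_right scale_scale One_nat_def by (rule sum.swap)
  also have "... = (\<Sum>j<b 0. ?a j *s w j)"
   by (rule sum.cong[OF refl]) (simp only: y(2)[rule_format] lessThan_iff)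
  also have "... = (\<Sum>j<b 0. if j = j0 then r *s ?b0 else 0)"
   by (rule sum.cong) auto
  also have "... = r *s ?b0" using j0 by simp
  finally show ?thesis .
 qed
 moreover have "?b0 \<in> L" using w(1) j0 L_scale[OF emb_R] by (simp add: coch_def)
 ultimately show ?thesis by blast
qed

lemma coh_N_1: "coh_le N (Suc 0) d"
proof -
 have "coh_le N (Suc 0) (if Suc 0 \<le> d then d choose (d - Suc 0) else 0)"
  unfolding N_def by (rule coh_bound[OF theta_H theta_regular])
 moreover have "d choose (d - Suc 0) = d" if "Suc 0 \<le> d"
  using binomial_symmetric[OF that] by simp
 ultimately show ?thesis by (cases "d = 0") auto
qed

lemma coh_N_0: "coh_le N 0 1"
proof -
 have "coh_le N 0 (if 0 \<le> d then d choose (d - 0) else 0)"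
  unfolding N_def by (rule coh_bound[OF theta_H theta_regular])
 then show ?thesis by simp
qed

text \<open>
 Dividing the relations \<open>r u \<in> N\<close> by the regular sequence gives \<open>d\<close> homomorphisms from the maximal
 ideal to \<open>L/N\<close>, one for each \<open>\<theta> j\<close>, and the \<open>j\<close>-th does not vanish at \<open>\<theta> j\<close> only. Their
 classes exhaust the cohomology of degree 1, so that any other homomorphism that kills all \<open>\<theta> j\<close>
 comes from an element.
\<close>

lemma mm_hom_extends:
 assumes u: "u \<in> L" "u \<notin> N" "!!r. r \<in> mm ==> r *s u \<in> N"
  and \<psi>: "mhom mm \<psi>" "!!j. j < d ==> \<psi> (\<theta> j) \<in> N"
 shows "\<exists>b0\<in>L. \<forall>r\<in>mm. cg (\<psi> r) (r *s b0)"
proof -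
 have "\<forall>r. \<exists>w. r \<in> mm --> (\<forall>i<d. w i \<in> L) \<and> r *s u - (\<Sum>i<d. \<theta> i *s w i) \<in> K"
  using u(3) unfolding N_def Nth_iff by blast
 from choice[OF this] obtain W where
  W: "!!r. r \<in> mm ==> (\<forall>i<d. W r i \<in> L) \<and> r *s u - (\<Sum>i<d. \<theta> i *s W r i) \<in> K" by blast
 have WL: "W r i \<in> L" if "r \<in> mm" "i < d" for r i using W[OF that(1)] that(2) by blast
 have WK: "r *s u - (\<Sum>i<d. \<theta> i *s W r i) \<in> K" if "r \<in> mm" for r using W[OF that] by blast
 have unique: "v i \<in> N" if "!!i. i < d ==> v i \<in> L" "(\<Sum>i<d. \<theta> i *s v i) \<in> K" "i < d" for v i
  unfolding N_def by (rule quasi_regular[OF K theta_H theta_regular that(1,2,3)])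
 have W_hom: "mhom mm (\<lambda>r. W r i)" if i: "i < d" for i
  unfolding mhom_def
 proof (intro conjI ballI)
  show "W r i \<in> L" if "r \<in> mm" for r using WL[OF that i] .
 next
  fix r r' assume r: "r \<in> mm" "r' \<in> mm"
  have rr: "r + r' \<in> mm" by (rule mm_add[OF r])
  let ?v = "\<lambda>i. W (r + r') i - (W r i + W r' i)"
  have "(\<Sum>i<d. \<theta> i *s ?v i) = (r *s u - (\<Sum>i<d. \<theta> i *s W r i)) + (r' *s u - (\<Sum>i<d. \<theta> i *s W r' i))
   - ((r + r') *s u - (\<Sum>i<d. \<theta> i *s W (r + r') i))"
   by (simp add: scale_left_distrib scale_right_distrib scale_right_diff_distrib sum.distrib sum_subtractf)
  also have "... \<in> K" by (rule grsub_diff[OF K grsub_add[OF K WK[OF r(1)] WK[OF r(2)]] WK[OF rr]])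
  finally have "?v i \<in> N" by (intro unique i L_diff L_add WL r rr)
  then show "cg (W (r + r') i) (W r i + W r' i)" by (simp add: cg_def)
 next
  fix s r assume s: "s \<in> R" and r: "r \<in> mm"
  have sr: "s * r \<in> mm" by (rule RR.submod_scale[OF submod_mm s r])
  let ?v = "\<lambda>i. W (s * r) i - s *s W r i"
  have "(\<Sum>i<d. \<theta> i *s ?v i) = s *s (r *s u - (\<Sum>i<d. \<theta> i *s W r i))
   - ((s * r) *s u - (\<Sum>i<d. \<theta> i *s W (s * r) i))"
   by (simp add: scale_right_diff_distrib sum_subtractf scale_sum_right mult.commute)
  also have "... \<in> K" by (rule grsub_diff[OF K grsub_scale[OF K s WK[OF r]] WK[OF sr]])
  finally have "?v i \<in> N" by (intro unique i L_diff L_scale WL r s sr)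
  then show "cg (W (s * r) i) (s *s W r i)" by (simp add: cg_def)
 qed
 have W_theta: "cg (W (\<theta> j) i) (if i = j then u else 0)" if i: "i < d" and j: "j < d" for i j
 proof -
  let ?v = "\<lambda>i. W (\<theta> j) i - (if i = j then u else 0)"
  have "(\<Sum>i<d. \<theta> i *s (if i = j then u else 0)) = \<theta> j *s u"
   using j by (simp add: if_distrib[of "\<lambda>z. _ *s z"] cong: if_cong)
  then have "(\<Sum>i<d. \<theta> i *s ?v i) = - (\<theta> j *s u - (\<Sum>i<d. \<theta> i *s W (\<theta> j) i))"
   by (simp add: scale_right_diff_distrib sum_subtractf)
  also have "... \<in> K" using grsub_scale[OF K neg_one_R WK[OF theta_mm[OF j]]] by simp
  finally have vK: "(\<Sum>i<d. \<theta> i *s ?v i) \<in> K" .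
  have "?v i \<in> N"
  proof (rule unique[of ?v, OF _ vK i])
   show "?v i \<in> L" if "i < d" for i using WL[OF theta_mm[OF j] that] u(1) by (auto intro: L_diff)
  qed
  then show ?thesis by (simp add: cg_def)
 qed
 define f where "f i = (if i < d then (\<lambda>r. W r i) else \<psi>)" for i
 have f_hom: "mhom mm (f i)" for i using W_hom \<psi>(1) by (simp add: f_def)
 have "\<exists>a. (\<exists>i\<in>{..d}. a i ~= 0) \<and> (\<Sum>i\<in>{..d}. (\<lambda>j. emb (a i) *s Zc (f i) j)) \<in> cobd N (Suc 0)"
  using coh_N_1 Zc_cocyc[OF f_hom] unfolding coh_le_def
  by (intro kc.codim_le_dependent[where f = "\<lambda>i. Zc (f i)"] subspace_cobd[OF Ns]) auto
 then obtain a where a: "\<exists>i\<in>{..d}. a i ~= 0" "(\<Sum>i\<in>{..d}. (\<lambda>j. emb (a i) *s Zc (f i) j)) \<in> cobd N (Suc 0)"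
  by (elim exE conjE)
 define \<Psi> where "\<Psi> = (\<lambda>r. \<Sum>i\<in>{..d}. emb (a i) *s f i r)"
 have \<Psi>_hom: "mhom mm \<Psi>" unfolding \<Psi>_def by (rule mhom_combination[OF submod_mm f_hom])
 have "Zc \<Psi> = (\<Sum>i\<in>{..d}. (\<lambda>j. emb (a i) *s Zc (f i) j))"
  by (rule ext) (simp add: sum_fun_eval Zc_def \<Psi>_def)
 then have "Zc \<Psi> \<in> cobd N (Suc 0)" using a(2) by (simp only:)
 from Zc_cobd[OF \<Psi>_hom this] obtain b0 where b0: "b0 \<in> L" "\<forall>r\<in>mm. cg (\<Psi> r) (r *s b0)" by blast
 have a0: "a j = 0" if j: "j < d" for j
 proof (rule ccontr)
  assume aj: "a j ~= 0"
  have "cg (\<Psi> (\<theta> j)) (\<Sum>i\<in>{..d}. if i = j then emb (a j) *s u else 0)"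
   unfolding \<Psi>_def
  proof (rule cg_sum)
   fix i assume "i \<in> {..d}"
   show "cg (emb (a i) *s f i (\<theta> j)) (if i = j then emb (a j) *s u else 0)"
   proof (cases "i < d")
    case True
    then show ?thesis using cg_scale[OF emb_R W_theta[OF True j], of "a i"] by (auto simp: f_def)
   next
    case False
    then show ?thesis using j submod_scale[OF Ns emb_R \<psi>(2)[OF j]] by (auto simp: f_def cg_0)
   qed
  qed
  also have "(\<Sum>i\<in>{..d}. if i = j then emb (a j) *s u else 0) = emb (a j) *s u" using j by simp
  finally have "cg (emb (a j) *s u) (\<Psi> (\<theta> j))" by (rule cg_sym)
  also have "cg (\<Psi> (\<theta> j)) (\<theta> j *s b0)" using b0(2) theta_mm[OF j] by blast
  finally have "emb (a j) *s u \<in> N" using theta_N[OF j b0(1)] by (rule cg_in)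
  then show False using emb_scale_N aj u(2) by blast
 qed
 then have ad: "a d ~= 0" using a(1) by (metis atMost_iff le_neq_implies_less)
 have \<Psi>_eq: "\<Psi> r = emb (a d) *s \<psi> r" for r
 proof -
  have "\<Psi> r = (\<Sum>i\<in>{..d}. if i = d then emb (a d) *s \<psi> r else 0)"
   unfolding \<Psi>_def by (rule sum.cong) (auto simp: f_def a0)
  then show ?thesis by simp
 qed
 have "cg (\<psi> r) (r *s emb (inverse (a d)) *s b0)" if r: "r \<in> mm" for r
 proof -
  have "cg (emb (inverse (a d)) *s \<Psi> r) (emb (inverse (a d)) *s r *s b0)"
   using b0(2) r by (intro cg_scale emb_R) blast
  then show ?thesis unfolding \<Psi>_eq using emb_inverse[OF ad] by (simp add: mult.commute)
 qed
 then show ?thesis using L_scale[OF emb_R b0(1)] by blast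
qed

text \<open>
 Homomorphisms to \<open>L/N\<close> extend from every ideal that contains the regular sequence: otherwise take
 a largest ideal \<open>J\<close> where this fails and \<open>y \<notin> J\<close> with \<open>\<mm>y \<subseteq> J\<close>, and extend to \<open>J + Ry\<close>.
\<close>

lemma ideal_hom_extends:
 assumes u: "u \<in> L" "u \<notin> N" "!!r. r \<in> mm ==> r *s u \<in> N"
  and J: "RR.submod R J" "J \<subseteq> R" "I \<subseteq> J"
  and f: "mhom J f" "!!r. r \<in> I ==> f r \<in> N"
 shows "\<exists>b0\<in>L. \<forall>r\<in>J. cg (f r) (r *s b0)"
proof -
 define good where "good J \<longleftrightarrow> (\<forall>f. mhom J f \<and> (\<forall>r\<in>I. f r \<in> N) --> (\<exists>b0\<in>L. \<forall>r\<in>J. cg (f r) (r *s b0)))" for J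
 define \<B> where "\<B> = {J. RR.submod R J \<and> J \<subseteq> R \<and> I \<subseteq> J \<and> \<not> good J}"
 have "\<B> = {}"
 proof (rule ccontr)
  assume "\<B> ~= {}"
  then have "\<exists>J\<in>\<B>. \<forall>J'\<in>\<B>. J \<subseteq> J' --> J' = J"
   by (rule RR.noetherian_maximal[OF noetherian_R]) (auto simp: \<B>_def)
  then obtain J where JB: "J \<in> \<B>" and max: "!!J'. J' \<in> \<B> ==> J \<subseteq> J' ==> J' = J" by blast
  have J: "RR.submod R J" "J \<subseteq> R" "I \<subseteq> J" "\<not> good J" using JB by (auto simp: \<B>_def)
  then obtain f where f: "mhom J f" "!!r. r \<in> I ==> f r \<in> N"
   and nf: "\<not> (\<exists>b0\<in>L. \<forall>r\<in>J. cg (f r) (r *s b0))"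
   unfolding good_def by blast
  have one: "1 \<notin> J"
  proof
   assume 1: "1 \<in> J"
   have "cg (f r) (r *s f 1)" if "r \<in> J" for r
    using mhom_scale[OF f(1) _ 1, of r] J(2) that by auto
   then show False using nf mhom_L[OF f(1) 1] by blast
  qed
  have "\<exists>n. \<exists>y\<in>H n. y \<notin> J \<and> (\<forall>x\<in>X. \<not> x * y \<notin> J)"
  proof (rule last_degree[where t = top and ?s0.0 = 1 and ?n0.0 = 0])
   show "\<not> s \<notin> J" if "n > top" "s \<in> H n" for n s
    using above_top[OF that(1)] that(2) J(3) by (auto simp: I_def)
  qed (use one H_one RR.submod_zero[OF J(1)] in auto)
  then obtain n y where y: "y \<in> H n" "y \<notin> J" "!!x. x \<in> X ==> x * y \<in> J" by blast
  have yR: "y \<in> R" using H_R[OF y(1)] .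
  have my: "r * y \<in> J" if "r \<in> mm" for r
   by (rule S.mm_scale_in[OF J(1) yR J(2) y(3) that])
  have q_mm: "q \<in> mm" if q: "q \<in> R" "q * y \<in> J" for q
  proof -
   obtain a where a: "q - emb a \<in> mm" using R_decomp[OF q(1)] by blast
   have "a = 0"
   proof (rule ccontr)
    assume a0: "a ~= 0"
    have "q * y - (q - emb a) * y \<in> J" by (rule RR.submod_diff[OF J(1) neg_one_R q(2) my[OF a]])
    then have "emb a * y \<in> J" by (simp add: algebra_simps)
    then have "emb (inverse a) * (emb a * y) \<in> J" by (rule RR.submod_scale[OF J(1) emb_R])
    then show False using y(2) emb_inverse[OF a0] by (simp flip: mult.assoc)
   qed
   then show ?thesis using a by simp
  qed
  define \<psi> where "\<psi> r = f (r * y)" for r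
  have psi_hom: "mhom mm \<psi>" unfolding mhom_def
  proof (intro conjI ballI)
   show "\<psi> r \<in> L" if "r \<in> mm" for r unfolding \<psi>_def by (rule mhom_L[OF f(1) my[OF that]])
   show "cg (\<psi> (r + r')) (\<psi> r + \<psi> r')" if "r \<in> mm" "r' \<in> mm" for r r'
    unfolding \<psi>_def distrib_right by (rule mhom_add[OF f(1) my[OF that(1)] my[OF that(2)]])
   show "cg (\<psi> (s * r)) (s *s \<psi> r)" if "s \<in> R" "r \<in> mm" for s r
    unfolding \<psi>_def mult.assoc by (rule mhom_scale[OF f(1) that(1) my[OF that(2)]])
  qed
  have "\<psi> (\<theta> j) \<in> N" if "j < d" for j unfolding \<psi>_def by (rule f(2)[OF theta_I[OF that yR]])
  from mm_hom_extends[OF u psi_hom this] obtain b0 where b0: "b0 \<in> L" "!!r. r \<in> mm ==> cg (f (r * y)) (r *s b0)"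
   unfolding \<psi>_def by blast
  define J' where "J' = {j + r * y | j r. j \<in> J \<and> r \<in> R}"
  have J'I: "j + r * y \<in> J'" if "j \<in> J" "r \<in> R" for j r using that unfolding J'_def by blast
  have J'E: "\<exists>j\<in>J. \<exists>r\<in>R. v = j + r * y" if "v \<in> J'" for v using that unfolding J'_def by blast
  have J'_sub: "RR.submod R J'"
  proof (rule RR.submodI)
   show "0 \<in> J'" using J'I[OF RR.submod_zero[OF J(1)] R_zero] by simp
  next
   fix v w assume "v \<in> J'" "w \<in> J'"
   then obtain j r j' r' where *: "v = j + r * y" "w = j' + r' * y" "j \<in> J" "j' \<in> J" "r \<in> R" "r' \<in> R"
    unfolding J'_def by blast
   have eq: "v + w = (j + j') + (r + r') * y" unfolding *(1,2) by (simp add: algebra_simps)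
   show "v + w \<in> J'" unfolding eq by (rule J'I[OF RR.submod_add[OF J(1) *(3,4)] R_add[OF *(5,6)]])
  next
   fix s v assume s: "s \<in> R" and v: "v \<in> J'"
   obtain j r where *: "v = j + r * y" "j \<in> J" "r \<in> R" using J'E[OF v] by (elim bexE)
   have eq: "s * v = s * j + (s * r) * y" unfolding *(1) by (simp only: distrib_left mult.assoc)
   show "s * v \<in> J'" unfolding eq by (rule J'I[OF RR.submod_scale[OF J(1) s *(2)] R_mult[OF s *(3)]])
  qed
  have JJ': "J \<subseteq> J'" using J'I[OF _ R_zero] by force
  have yJ': "y \<in> J'" using J'I[OF RR.submod_zero[OF J(1)] R_one] by simp
  have "J' \<subseteq> R" using J(2) R_add R_mult yR unfolding J'_def by blast
  then have gJ': "good J'" using max[of J'] JJ' yJ' y(2) J'_sub J(3) unfolding \<B>_def by blast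
  have "\<forall>z. \<exists>p. z \<in> J' --> fst p \<in> J \<and> snd p \<in> R \<and> z = fst p + snd p * y"
   unfolding J'_def by fastforce
  from choice[OF this] obtain p where p: "!!z. z \<in> J' ==> fst (p z) \<in> J \<and> snd (p z) \<in> R \<and> z = fst (p z) + snd (p z) * y"
   by blast
  define f' where "f' z = f (fst (p z)) + snd (p z) *s b0" for z
  have f'_eq: "cg (f' (j + r * y)) (f j + r *s b0)" if j: "j \<in> J" and r: "r \<in> R" for j r
  proof -
   let ?z = "j + r * y"
   have zJ: "?z \<in> J'" unfolding J'_def using j r by blast
   let ?j = "fst (p ?z)" and ?r = "snd (p ?z)"
   have pz: "?j \<in> J" "?r \<in> R" "?z = ?j + ?r * y" using p[OF zJ] by blast+
   have jj: "j - ?j = (?r - r) * y" using pz(3) by (simp add: algebra_simps)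
   have "j - ?j \<in> J" by (rule RR.submod_diff[OF J(1) neg_one_R j pz(1)])
   then have q: "?r - r \<in> mm" using q_mm[OF R_diff[OF pz(2) r]] jj by simp
   have "cg (f j - f ?j) (f (j - ?j))" by (rule cg_sym[OF mhom_diff[OF f(1) J(1) j pz(1)]])
   also have "cg (f (j - ?j)) ((?r - r) *s b0)" unfolding jj by (rule b0(2)[OF q])
   finally have "cg (f j - f ?j) (?r *s b0 - r *s b0)" by (simp add: scale_left_diff_distrib)
   then have "f j - f ?j - (?r *s b0 - r *s b0) \<in> N" by (simp add: cg_def)
   then have "cg (f j + r *s b0) (f' ?z)" unfolding cg_def f'_def by (simp add: algebra_simps)
   then show ?thesis by (rule cg_sym)
  qed
  have "mhom J' f'" unfolding mhom_def
  proof (intro conjI ballI)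
   show "f' z \<in> L" if "z \<in> J'" for z
    unfolding f'_def using p[OF that] mhom_L[OF f(1)] b0(1) by (intro L_add L_scale) auto
  next
   fix v w assume "v \<in> J'" "w \<in> J'"
   then obtain j r j' r' where *: "v = j + r * y" "w = j' + r' * y" "j \<in> J" "j' \<in> J" "r \<in> R" "r' \<in> R"
    unfolding J'_def by blast
   have eq: "v + w = (j + j') + (r + r') * y" unfolding *(1,2) by (simp add: algebra_simps)
   have "cg (f' (v + w)) (f (j + j') + (r + r') *s b0)"
    unfolding eq by (rule f'_eq[OF RR.submod_add[OF J(1) *(3,4)] R_add[OF *(5,6)]])
   also have "cg (f (j + j') + (r + r') *s b0) ((f j + f j') + (r + r') *s b0)"
    by (rule cg_add[OF mhom_add[OF f(1) *(3,4)] cg_refl])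
   also have "(f j + f j') + (r + r') *s b0 = (f j + r *s b0) + (f j' + r' *s b0)"
    by (simp add: scale_left_distrib)
   also have "cg ((f j + r *s b0) + (f j' + r' *s b0)) (f' v + f' w)"
    unfolding *(1,2) by (rule cg_sym[OF cg_add[OF f'_eq[OF *(3,5)] f'_eq[OF *(4,6)]]])
   finally show "cg (f' (v + w)) (f' v + f' w)" .
  next
   fix s v assume s: "s \<in> R" and v: "v \<in> J'"
   obtain j r where *: "v = j + r * y" "j \<in> J" "r \<in> R" using J'E[OF v] by (elim bexE)
   have eq: "s * v = s * j + (s * r) * y" unfolding *(1) by (simp only: distrib_left mult.assoc)
   have "cg (f' (s * v)) (f (s * j) + (s * r) *s b0)"
    unfolding eq by (rule f'_eq[OF RR.submod_scale[OF J(1) s *(2)] R_mult[OF s *(3)]])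
   also have "cg (f (s * j) + (s * r) *s b0) (s *s f j + (s * r) *s b0)"
    by (rule cg_add[OF mhom_scale[OF f(1) s *(2)] cg_refl])
   also have "s *s f j + (s * r) *s b0 = s *s (f j + r *s b0)" by (simp add: scale_right_distrib)
   also have "cg (s *s (f j + r *s b0)) (s *s f' v)"
    unfolding *(1) by (rule cg_scale[OF s cg_sym[OF f'_eq[OF *(2,3)]]])
   finally show "cg (f' (s * v)) (s *s f' v)" .
  qed
  moreover have f'f: "cg (f' r) (f r)" if "r \<in> J" for r
   using f'_eq[OF that R_zero] by simp
  moreover have "f' r \<in> N" if "r \<in> I" for r
   using cg_in[OF f'f f(2)] that J(3) by blast
  ultimately obtain b1 where b1: "b1 \<in> L" "!!r. r \<in> J' ==> cg (f' r) (r *s b1)"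
   using gJ' unfolding good_def by blast
  have "cg (f r) (r *s b1)" if r: "r \<in> J" for r
   by (rule cg_trans[OF cg_sym[OF f'f[OF r]] b1(2)]) (use r JJ' in blast)
  then show False using nf b1(1) by blast
 qed
 then have "good J" using J unfolding \<B>_def by blast
 then show ?thesis using f unfolding good_def by blast
qed

end

lemma (in graded_domain) H_finite_span: "\<exists>B. finite B \<and> B \<subseteq> H n \<and> H n \<subseteq> kR.span B"
proof -
 have "\<exists>B. finite B \<and> B \<subseteq> H (int m) \<and> H (int m) \<subseteq> kR.span B" for m
 proof (induction m)
  case 0
  have "H (int 0) \<subseteq> kR.span {1}"
   using H_zero_emb kR.span_singleton[of 1] by fastforce
  then show ?case using H_one by (intro exI[of _ "{1}"]) simp
 next
  case (Suc m)
  then obtain B where B: "finite B" "B \<subseteq> H (int m)" "H (int m) \<subseteq> kR.span B" by blast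
  let ?C = "(\<lambda>(x, r). x * r) ` (X \<times> B)"
  have "H (int (Suc m)) \<subseteq> kR.span ?C"
  proof
   fix r assume r: "r \<in> H (int (Suc m))"
   obtain s where s: "!!x. x \<in> X ==> s x \<in> H (int m)" "r = (\<Sum>x\<in>X. x * s x)"
    using H_gen[OF r] by auto
   have mult: "x * v \<in> kR.span ?C" if x: "x \<in> X" and v: "v \<in> kR.span B" for x v
   proof -
    let ?A = "{v. x * v \<in> kR.span ?C}"
    have "kR.subspace ?A"
    proof (rule kR.subspaceI)
     show "0 \<in> ?A" using kR.span_zero by simp
     show "v + w \<in> ?A" if "v \<in> ?A" "w \<in> ?A" for v w using that kR.span_add by (simp add: distrib_left)
     show "emb a * v \<in> ?A" if "v \<in> ?A" for a v
      unfolding mem_Collect_eq mult.left_commute[of x "emb a"] by (rule kR.span_scale) (use that in simp)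
    qed
    moreover have "B \<subseteq> ?A" using x by (auto intro!: kR.span_base)
    ultimately show ?thesis using kR.span_minimal[of B ?A] v by blast
   qed
   show "r \<in> kR.span ?C" unfolding s(2) using s(1) B(3) mult by (intro kR.span_sum) blast
  qed
  moreover have "?C \<subseteq> H (int (Suc m))"
   using B(2) H_mult[OF X_H] by fastforce
  ultimately show ?case using B(1) X_finite by (intro exI[of _ ?C]) simp
 qed
 from this[of "nat n"] show ?thesis
 proof (cases "n < 0")
  case True
  then have "H n \<subseteq> kR.span {}" using H_neg by auto
  then show ?thesis by (intro exI[of _ "{}"]) simp
 qed simp
qed

context graded_module
begin

lemma Lh_sum: "(!!i. i \<in> A ==> f i \<in> Lh a) ==> sum f A \<in> Lh a"
 by (induction A rule: infinite_finite_induct) (auto intro: Lh_add)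

lemma degree_induct_below:
 assumes M: "0 \<in> M" and step: "!!a. a < t ==> (!!a'. a' < a ==> Lh a' \<subseteq> M) ==> Lh a \<subseteq> M" and "a < t"
 shows "Lh a \<subseteq> M"
proof -
 obtain b0 where b0: "!!a. a < b0 ==> Lh a = {0}" using bounded_below by blast
 show ?thesis using assms(3)
 proof (induction "nat (a - b0)" arbitrary: a rule: less_induct)
  case less
  show ?case
  proof (cases "a < b0")
   case True
   then show ?thesis using b0 M by simp
  next
   case False
   have "Lh a' \<subseteq> M" if "a' < a" for a'
   proof (cases "a' < b0")
    case True
    then show ?thesis using b0 M by simp
   next
    case False
    then show ?thesis using that less.prems by (intro less.hyps) auto
   qed
   then show ?thesis by (rule step[OF less.prems])
  qed
 qed
qed

end


context dualizing
begin

lemma L_not_N: "\<not> L \<subseteq> N"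
proof
 assume LN: "L \<subseteq> N"
 have "L \<subseteq> K"
 proof (rule degree_induct[OF grsub_submod[OF K]])
  fix a assume IH: "!!a'. a' < a ==> Lh a' \<subseteq> K"
  show "Lh a \<subseteq> K"
  proof
   fix v assume v: "v \<in> Lh a"
   then have "v \<in> Nth K \<theta> d" using LN Lh_L unfolding N_def by blast
   from Nth_hom[OF K theta_H v this] obtain w where
    w: "\<forall>i<d. w i \<in> Lh (a - e i)" "v - (\<Sum>i<d. \<theta> i *s w i) \<in> K" by blast
   have "(\<Sum>i<d. \<theta> i *s w i) \<in> K"
   proof (rule grsub_sum[OF K], rule grsub_scale[OF K])
    fix i assume i: "i \<in> {..<d}"
    show "\<theta> i \<in> R" using theta_R i by simp
    show "w i \<in> K" using w(1) i IH[of "a - e i"] e_pos[of i] by auto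
   qed
   from grsub_add[OF K w(2) this] show "v \<in> K" by simp
  qed
 qed
 have "cocyc K d \<subseteq> cobd K d"
 proof
  fix z assume "z \<in> cocyc K d"
  then have z: "!!j. j < b d ==> z j \<in> K" using \<open>L \<subseteq> K\<close> by (auto simp: cocyc_def coch_def)
  show "z \<in> cobd K d"
  proof (cases d)
   case 0
   then show ?thesis using z by simp
  next
   case (Suc m)
   have "coch m (\<lambda>_. 0)" "!!j. delta m (\<lambda>_. 0) j = 0" by (simp_all add: coch_def delta_def)
   then show ?thesis using z Suc by (auto intro!: exI[of _ "\<lambda>_. 0"])
  qed
 qed
 then show False using coh_d_nonzero coh_le_0[OF grsub_submod[OF K]] by blast
qed

lemma socle_multiple:
 assumes w: "w \<in> L" "w \<notin> N"
 shows "\<exists>n. \<exists>s\<in>H n. s *s w \<notin> N \<and> (\<forall>r\<in>mm. r *s s *s w \<in> N)"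
proof -
 have "\<exists>n. \<exists>s\<in>H n. s *s w \<notin> N \<and> (\<forall>x\<in>X. \<not> (x * s) *s w \<notin> N)"
 proof (rule last_degree[where t = top and ?s0.0 = 1 and ?n0.0 = 0])
  show "\<not> s *s w \<notin> N" if "n > top" "s \<in> H n" for n s
   using above_top[OF that(1)] that(2) I_scale_N[OF _ w(1), of s] by (auto simp: I_def)
 qed (use w H_one submod_zero[OF Ns] in auto)
 then obtain n s where s: "s \<in> H n" "s *s w \<notin> N" "!!x. x \<in> X ==> x *s s *s w \<in> N" by auto
 have "s *s w \<in> L" by (rule L_scale[OF H_R[OF s(1)] w(1)])
 then have "r *s s *s w \<in> N" if "r \<in> mm" for r
  by (rule mm_scale_in[OF Ns _ N_L s(3) that])
 then show ?thesis using s(1,2) by blast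
qed

lemma socle_exists: "\<exists>\<sigma>. \<exists>u\<in>Lh \<sigma>. u \<notin> N \<and> (\<forall>r\<in>mm. r *s u \<in> N)"
proof -
 have "\<exists>a. \<exists>w\<in>Lh a. w \<notin> N"
 proof (rule ccontr)
  assume "\<not> ?thesis"
  then have "L \<subseteq> N" using hom_induct[OF Ns] by blast
  then show False using L_not_N by simp
 qed
 then obtain a w where w: "w \<in> Lh a" "w \<notin> N" by blast
 obtain n s where s: "s \<in> H n" "s *s w \<notin> N" "\<forall>r\<in>mm. r *s s *s w \<in> N"
  using socle_multiple[OF Lh_L[OF w(1)] w(2)] by blast
 have "s *s w \<in> Lh (n + a)" by (rule Lh_scale[OF s(1) w(1)])
 then show ?thesis using s(2,3) by blast
qed

end

locale dualizing_socle = dualizing emb R cmp X scale L prj E b D c K d \<theta> e top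
 for emb :: "'k::field => 'r::idom" and R cmp X
  and scale :: "'r => 'v::ab_group_add => 'v" (infixr "*s" 75)
  and L prj E b D c K d \<theta> e top +
 fixes u :: 'v and \<sigma> :: int
 assumes u_hom: "u \<in> Lh \<sigma>" and u_N: "u \<notin> N" and u_socle: "r \<in> mm ==> r *s u \<in> N"
begin

lemma u_L: "u \<in> L" by (rule Lh_L[OF u_hom])

lemma emb_u_N: "emb a *s u \<in> N ==> a = 0"
 using emb_scale_N u_N by blast

text \<open>Two independent socle elements would be two independent classes in degree 0.\<close>

lemma simple_socle:
 assumes w: "w \<in> L" "!!r. r \<in> mm ==> r *s w \<in> N"
 shows "\<exists>a. cg w (emb a *s u)"
proof -
 define f where "f i = (\<lambda>j. emb (c j) *s (if i = (0::nat) then u else w))" for i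
 have "f i \<in> cocyc N 0" for i
  unfolding f_def by (rule socle_cocyc[OF Ns]) (use w u_L u_socle in auto)
 then have "\<exists>a. (\<exists>i\<in>{0, Suc 0}. a i ~= 0) \<and> (\<Sum>i\<in>{0, Suc 0}. (\<lambda>j. emb (a i) *s f i j)) \<in> cobd N 0"
  using coh_N_0 unfolding coh_le_def
  by (intro kc.codim_le_dependent[where f = f] subspace_cobd[OF Ns]) auto
 then obtain a where a: "a 0 ~= 0 \<or> a (Suc 0) ~= 0" "!!j. j < b 0 ==> emb (a 0) *s f 0 j + emb (a (Suc 0)) *s f (Suc 0) j \<in> N"
  by auto
 obtain j where j: "j < b 0" "c j ~= 0" using aug_unit by blast
 have "emb (c j) *s (emb (a 0) *s u + emb (a (Suc 0)) *s w) \<in> N"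
  using a(2)[OF j(1)] by (simp add: f_def scale_right_distrib mult.commute)
 then have rel: "emb (a 0) *s u + emb (a (Suc 0)) *s w \<in> N" using emb_scale_N j(2) by blast
 have a1: "a (Suc 0) ~= 0"
 proof
  assume "a (Suc 0) = 0"
  then show False using rel a(1) emb_u_N[of "a 0"] by simp
 qed
 have "emb (inverse (a (Suc 0))) *s (emb (a 0) *s u + emb (a (Suc 0)) *s w) \<in> N"
  by (rule submod_scale[OF Ns emb_R rel])
 then have "cg w (emb (- (inverse (a (Suc 0)) * a 0)) *s u)"
  using emb_inverse[OF a1] by (simp add: cg_def scale_right_distrib emb_minus emb_mult add.commute)
 then show ?thesis by blast
qed

text \<open>
 Otherwise some \<open>r \<notin> I\<close> with \<open>\<mm>r \<subseteq> I\<close> annihilates \<open>L/N\<close>; but the homomorphism \<open>I + Rr \<rightarrow> L/N\<close> with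
 \<open>r \<mapsto> u\<close> is the multiplication by an element.
\<close>

lemma annihilator:
 assumes r: "r \<in> R" "!!v. v \<in> L ==> r *s v \<in> N"
 shows "r \<in> I"
proof (rule ccontr)
 assume rI: "r \<notin> I"
 have "\<exists>n. \<exists>s\<in>H n. s * r \<notin> I \<and> (\<forall>x\<in>X. \<not> (x * s) * r \<notin> I)"
 proof (rule last_degree[where t = top and ?s0.0 = 1 and ?n0.0 = 0])
  show "\<not> s * r \<notin> I" if "n > top" "s \<in> H n" for n s
   using above_top[OF that(1)] that(2) RR.submod_scale[OF Is r(1), of s] by (auto simp: I_def mult.commute)
 qed (use rI H_one RR.submod_zero[OF Is] in auto)
 then obtain n s where s0: "s \<in> H n" "s * r \<notin> I \<and> (\<forall>x\<in>X. \<not> (x * s) * r \<notin> I)" by (elim exE bexE)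
 have s: "s \<in> H n" "s * r \<notin> I" "!!x. x \<in> X ==> x * (s * r) \<in> I"
  using s0 by (auto simp only: mult.assoc)
 define x where "x = s * r"
 have xR: "x \<in> R" unfolding x_def by (rule R_mult[OF H_R[OF s(1)] r(1)])
 have mx: "t * x \<in> I" if "t \<in> mm" for t
  unfolding x_def by (rule S.mm_scale_in[OF Is _ I_R s(3) that]) (use xR in \<open>auto simp: x_def\<close>)
 have xI: "x \<notin> I" using s(2) by (simp add: x_def)
 have xv: "x *s v \<in> N" if "v \<in> L" for v
  unfolding x_def using submod_scale[OF Ns H_R[OF s(1)] r(2)[OF that]] by simp
 have t_mm: "t \<in> mm" if t: "t \<in> R" "t * x \<in> I" for t
 proof -
  obtain a where a: "t - emb a \<in> mm" using R_decomp[OF t(1)] by blast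
  have "a = 0"
  proof (rule ccontr)
   assume a0: "a ~= 0"
   have "t * x - (t - emb a) * x \<in> I" by (rule RR.submod_diff[OF Is neg_one_R t(2) mx[OF a]])
   then have "emb a * x \<in> I" by (simp add: algebra_simps)
   then have "emb (inverse a) * (emb a * x) \<in> I" by (rule RR.submod_scale[OF Is emb_R])
   then show False using xI emb_inverse[OF a0] by (simp flip: mult.assoc)
  qed
  then show ?thesis using a by simp
 qed
 define J where "J = {t * x + i | t i. t \<in> R \<and> i \<in> I}"
 have JI: "t * x + i \<in> J" if "t \<in> R" "i \<in> I" for t i using that unfolding J_def by blast
 have JE: "\<exists>t\<in>R. \<exists>i\<in>I. z = t * x + i" if "z \<in> J" for z using that unfolding J_def by blast
 have J_sub: "RR.submod R J"
 proof (rule RR.submodI)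
  show "0 \<in> J" using JI[OF R_zero RR.submod_zero[OF Is]] by simp
 next
  fix v w assume v: "v \<in> J" and w: "w \<in> J"
  obtain t i where ti: "t \<in> R" "i \<in> I" "v = t * x + i" using JE[OF v] by (elim bexE)
  obtain t' i' where ti': "t' \<in> R" "i' \<in> I" "w = t' * x + i'" using JE[OF w] by (elim bexE)
  have eq: "v + w = (t + t') * x + (i + i')" unfolding ti(3) ti'(3) by (simp add: algebra_simps)
  show "v + w \<in> J" unfolding eq by (rule JI[OF R_add[OF ti(1) ti'(1)] RR.submod_add[OF Is ti(2) ti'(2)]])
 next
  fix q v assume q: "q \<in> R" and v: "v \<in> J"
  obtain t i where ti: "t \<in> R" "i \<in> I" "v = t * x + i" using JE[OF v] by (elim bexE)
  have eq: "q * v = (q * t) * x + q * i" unfolding ti(3) by (simp only: distrib_left mult.assoc)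
  show "q * v \<in> J" unfolding eq by (rule JI[OF R_mult[OF q ti(1)] RR.submod_scale[OF Is q ti(2)]])
 qed
 have JR: "J \<subseteq> R" using xR I_R R_add R_mult unfolding J_def by blast
 have IJ: "I \<subseteq> J" using JI[OF R_zero] by force
 have "\<forall>z. \<exists>t. z \<in> J --> t \<in> R \<and> z - t * x \<in> I" using JE by force
 from choice[OF this] obtain T where T: "!!z. z \<in> J ==> T z \<in> R \<and> z - T z * x \<in> I" by blast
 define f where "f z = T z *s u" for z
 have f_eq: "cg (f z) (t *s u)" if z: "z \<in> J" and t: "t \<in> R" "z - t * x \<in> I" for z t
 proof -
  have "(z - t * x) - (z - T z * x) \<in> I" using T[OF z] by (intro RR.submod_diff[OF Is neg_one_R t(2)]) simp
  then have "(T z - t) * x \<in> I" by (simp add: algebra_simps)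
  then have "T z - t \<in> mm" using T[OF z] t(1) R_diff by (intro t_mm) auto
  then have "(T z - t) *s u \<in> N" by (rule u_socle)
  then show ?thesis by (simp add: cg_def f_def scale_left_diff_distrib)
 qed
 have "mhom J f" unfolding mhom_def
 proof (intro conjI ballI)
  show "f z \<in> L" if "z \<in> J" for z unfolding f_def using T[OF that] u_L by (intro L_scale) auto
 next
  fix v w assume v: "v \<in> J" and w: "w \<in> J"
  have "(v - T v * x) + (w - T w * x) \<in> I" using T[OF v] T[OF w] by (intro RR.submod_add[OF Is]) auto
  then have "(v + w) - (T v + T w) * x \<in> I" by (simp add: algebra_simps)
  then have "cg (f (v + w)) ((T v + T w) *s u)"
   using T[OF v] T[OF w] R_add by (intro f_eq RR.submod_add[OF J_sub v w]) auto
  then show "cg (f (v + w)) (f v + f w)" by (simp add: f_def scale_left_distrib)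
 next
  fix q v assume q: "q \<in> R" and v: "v \<in> J"
  have "q * (v - T v * x) \<in> I" using T[OF v] by (intro RR.submod_scale[OF Is q]) auto
  then have "q * v - (q * T v) * x \<in> I" by (simp only: right_diff_distrib mult.assoc)
  then have "cg (f (q * v)) ((q * T v) *s u)"
   using T[OF v] R_mult q by (intro f_eq RR.submod_scale[OF J_sub q v]) auto
  then show "cg (f (q * v)) (q *s f v)" by (simp add: f_def)
 qed
 moreover have "f i \<in> N" if "i \<in> I" for i
  using f_eq[of i 0] that IJ by (auto simp: cg_0)
 ultimately obtain b0 where b0: "b0 \<in> L" "!!z. z \<in> J ==> cg (f z) (z *s b0)"
  using ideal_hom_extends[OF u_L u_N u_socle J_sub JR IJ] by blast
 have xJ: "x \<in> J" using JI[OF R_one RR.submod_zero[OF Is]] by simp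
 have "cg u (f x)" using f_eq[OF xJ R_one] RR.submod_zero[OF Is] cg_sym by simp
 also have "cg (f x) (x *s b0)" by (rule b0(2)[OF xJ])
 finally have "u \<in> N" using xv[OF b0(1)] by (rule cg_in)
 then show False using u_N by simp
qed

text \<open>
 The pairing of \<open>R/I\<close> and \<open>L/N\<close> into the socle is perfect: a nonzero multiple of an element by a form of
 the largest possible degree lies in the socle.
\<close>

lemma pairing:
 assumes w: "w \<in> Lh a" "w \<notin> N"
 shows "\<exists>s\<in>H (\<sigma> - a). cg (s *s w) u"
proof -
 obtain n s where s: "s \<in> H n" "s *s w \<notin> N" "!!r. r \<in> mm ==> r *s s *s w \<in> N"
  using socle_multiple[OF Lh_L[OF w(1)] w(2)] by blast
 have sw: "s *s w \<in> Lh (n + a)" by (rule Lh_scale[OF s(1) w(1)])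
 obtain q where q: "cg (s *s w) (emb q *s u)" using simple_socle[OF Lh_L[OF sw] s(3)] by blast
 have n: "n + a = \<sigma>"
 proof (rule ccontr)
  assume ne: "n + a ~= \<sigma>"
  have "prj (n + a) (s *s w - emb q *s u) = s *s w"
   using prj_diff[OF Lh_L[OF sw] Lh_L[OF Lh_emb[OF u_hom, of q]], of "n + a"]
    prj_Lh[OF sw] prj_Lh_other[OF Lh_emb[OF u_hom, of q] ne] by simp
  then show False using grsub_prj[OF grN, of "s *s w - emb q *s u" "n + a"] q s(2) by (simp add: cg_def)
 qed
 have q0: "q ~= 0" using q s(2) by (auto simp: cg_0)
 have "cg ((emb (inverse q) * s) *s w) u"
  using cg_scale[OF emb_R q, of "inverse q"] emb_inverse[OF q0] by simp
 moreover have "emb (inverse q) * s \<in> H (\<sigma> - a)" 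
 proof -
  have "\<sigma> - a = n" using n by simp
  then show ?thesis using H_emb_mult[OF s(1)] by simp
 qed
 ultimately show ?thesis by blast
qed

lemma socle_degree:
 assumes "w \<in> Lh \<sigma>"
 shows "\<exists>a. cg w (emb a *s u)"
proof (cases "w \<in> N")
 case True
 then show ?thesis by (intro exI[of _ 0]) (simp add: cg_0)
next
 case False
 then obtain s where s: "s \<in> H 0" "cg (s *s w) u" using pairing[OF assms] by auto
 obtain q where q: "s = emb q" using H_zero_emb[OF s(1)] by blast
 have q0: "q ~= 0"
 proof
  assume "q = 0"
  then have "cg u 0" using cg_sym[OF s(2)] by (simp add: q)
  then show False using u_N by (simp add: cg_0)
 qed
 have "cg (emb (inverse q) *s s *s w) (emb (inverse q) *s u)" by (rule cg_scale[OF emb_R s(2)])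
 then show ?thesis using emb_inverse[OF q0] by (auto simp: q)
qed

definition lam :: "'v => 'k" where "lam w = (SOME a. cg w (emb a *s u))"

lemma lam_eq: "cg w (emb a *s u) ==> lam w = a"
proof -
 assume *: "cg w (emb a *s u)"
 then have "cg w (emb (lam w) *s u)" unfolding lam_def by (rule someI)
 from cg_trans[OF cg_sym[OF this] *] have "emb (lam w - a) *s u \<in> N"
  by (simp add: cg_def emb_diff scale_left_diff_distrib)
 then show "lam w = a" using emb_u_N by force
qed

lemma lam: "w \<in> Lh \<sigma> ==> cg w (emb (lam w) *s u)"
 using socle_degree lam_eq by blast

lemma lam_add: "v \<in> Lh \<sigma> ==> w \<in> Lh \<sigma> ==> lam (v + w) = lam v + lam w"
 using cg_add[OF lam lam, of v w] by (intro lam_eq) (simp add: emb_add scale_left_distrib)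

lemma lam_scale: "v \<in> Lh \<sigma> ==> lam (emb a *s v) = a * lam v"
 using cg_scale[OF emb_R lam, of v a] by (intro lam_eq) (simp add: emb_mult)

lemma lam_0: "v \<in> Lh \<sigma> ==> lam v = 0 \<longleftrightarrow> v \<in> N"
 using lam[of v] lam_eq[of v 0] by (auto simp: cg_0)

lemma lam_cong: "v \<in> Lh \<sigma> ==> cg v w ==> lam v = lam w"
 using lam_eq[OF cg_trans[OF cg_sym lam], of v w] by simp

lemma lam_zero: "lam 0 = 0"
 by (rule lam_eq) simp

lemma lam_sum: "(!!i. i \<in> A ==> f i \<in> Lh \<sigma>) ==> sum f A \<in> Lh \<sigma> \<and> lam (sum f A) = (\<Sum>i\<in>A. lam (f i))"
 by (induction A rule: infinite_finite_induct) (auto simp: lam_add lam_zero intro: Lh_add)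

subsection \<open>Homogeneous endomorphisms\<close>

text \<open>Homogeneous homomorphisms \<open>L/K \<rightarrow> L/M\<close> of degree \<open>\<epsilon>\<close>; \<open>g a\<close> is the component in degree \<open>a\<close>.\<close>

definition ghom :: "'v set => int => (int => 'v => 'v) => bool" where
 "ghom M \<epsilon> g \<longleftrightarrow> (\<forall>a. \<forall>v\<in>Lh a. g a v \<in> Lh (a + \<epsilon>)) \<and>
   (\<forall>a. \<forall>v\<in>Lh a. \<forall>w\<in>Lh a. g a (v + w) - (g a v + g a w) \<in> M) \<and>
   (\<forall>n a. \<forall>r\<in>H n. \<forall>v\<in>Lh a. g (n + a) (r *s v) - r *s g a v \<in> M) \<and>
   (\<forall>a. \<forall>v\<in>Lh a. v \<in> K --> g a v \<in> M)"

lemma ghom_Lh: "ghom M \<epsilon> g ==> v \<in> Lh a ==> g a v \<in> Lh (a + \<epsilon>)"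
 and ghom_add: "ghom M \<epsilon> g ==> v \<in> Lh a ==> w \<in> Lh a ==> g a (v + w) - (g a v + g a w) \<in> M"
 and ghom_scale: "ghom M \<epsilon> g ==> r \<in> H n ==> v \<in> Lh a ==> g (n + a) (r *s v) - r *s g a v \<in> M"
 and ghom_K: "ghom M \<epsilon> g ==> v \<in> Lh a ==> v \<in> K ==> g a v \<in> M"
 unfolding ghom_def by blast+

lemma ghom_sum:
 assumes g: "ghom M \<epsilon> g" and M: "submod R M" and "finite A"
  and "!!i. i \<in> A ==> r i \<in> H (n i)" "!!i. i \<in> A ==> v i \<in> Lh (a - n i)"
 shows "(\<Sum>i\<in>A. r i *s v i) \<in> Lh a \<and> g a (\<Sum>i\<in>A. r i *s v i) - (\<Sum>i\<in>A. r i *s g (a - n i) (v i)) \<in> M"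
 using assms(3-5)
proof (induction A rule: finite_induct)
 case empty
 then show ?case using ghom_K[OF g Lh_zero, of a] grsub_zero[OF K] by simp
next
 case (insert i A)
 let ?S = "\<Sum>i\<in>A. r i *s v i" and ?T = "\<Sum>i\<in>A. r i *s g (a - n i) (v i)"
 have IH: "?S \<in> Lh a" "g a ?S - ?T \<in> M" using insert by auto
 have ri: "r i *s v i \<in> Lh a" by (rule Lh_scale'[of _ "n i" _ "a - n i"]) (use insert in auto)
 have 1: "g a (r i *s v i) - r i *s g (a - n i) (v i) \<in> M"
  using ghom_scale[OF g, of "r i" "n i" "v i" "a - n i"] insert.prems by simp
 have 2: "g a (r i *s v i + ?S) - (g a (r i *s v i) + g a ?S) \<in> M" by (rule ghom_add[OF g ri IH(1)])
 have "g a (r i *s v i + ?S) - (r i *s g (a - n i) (v i) + ?T) =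
  (g a (r i *s v i + ?S) - (g a (r i *s v i) + g a ?S)) + ((g a (r i *s v i) - r i *s g (a - n i) (v i)) + (g a ?S - ?T))"
  by simp
 also have "... \<in> M" by (rule submod_add[OF M 2 submod_add[OF M 1 IH(2)]])
 finally show ?case using insert.hyps Lh_add[OF ri IH(1)] by simp
qed

lemma ghom_negative:
 "\<exists>\<epsilon>0. \<forall>\<epsilon><\<epsilon>0. \<forall>M g. submod R M --> ghom M \<epsilon> g --> (\<forall>a. \<forall>v\<in>Lh a. g a v \<in> M)"
proof -
 have "\<forall>h. \<exists>a. h \<in> E --> prj a h = h" using E_hom by blast
 from choice[OF this] obtain dg' where dg': "!!h. h \<in> E ==> h \<in> Lh (dg' h)" using E_L by (auto simp: Lh_def)
 obtain b0 where b0: "!!a. a < b0 ==> Lh a = {0}" using bounded_below by blast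
 define m where "m = Max (insert 0 (dg' ` E))"
 have m: "dg' h \<le> m" if "h \<in> E" for h using that E_finite by (simp add: m_def)
 have "g a v \<in> M" if \<epsilon>: "\<epsilon> < b0 - m" and M: "submod R M" and g: "ghom M \<epsilon> g" and v: "v \<in> Lh a" for \<epsilon> M g a v
 proof -
  have E0: "g (dg' h) h = 0" if "h \<in> E" for h
   using ghom_Lh[OF g dg'[OF that]] b0[of "dg' h + \<epsilon>"] m[OF that] \<epsilon> by simp
  let ?M = "{v \<in> L. \<forall>a. g a (prj a v) \<in> M}"
  have gsum: "g a (sum f A) \<in> M" if "!!i. i \<in> A ==> f i \<in> Lh a \<and> g a (f i) \<in> M" "finite A" for f a and A :: "int set"
   using that(2,1)
  proof (induction A rule: finite_induct)
   case empty
   then show ?case using ghom_K[OF g Lh_zero, of a] grsub_zero[OF K] by simp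
  next
   case (insert i A)
   have s: "sum f A \<in> Lh a" using insert.prems by (intro Lh_sum) simp
   have fi: "f i \<in> Lh a" "g a (f i) \<in> M" using insert.prems by simp_all
   have fA: "g a (sum f A) \<in> M" by (rule insert.IH) (use insert.prems in simp)
   from submod_add[OF M ghom_add[OF g fi(1) s] submod_add[OF M fi(2) fA]]
   show ?case using insert.hyps by simp
  qed
  have "submod R ?M"
  proof (rule submodI)
   show "0 \<in> ?M" using ghom_K[OF g Lh_zero] grsub_zero[OF K] by simp
  next
   fix v w assume v: "v \<in> ?M" and w: "w \<in> ?M"
   have "g a (prj a (v + w)) \<in> M" for a
   proof -
    have vL: "v \<in> L" "g a (prj a v) \<in> M" and wL: "w \<in> L" "g a (prj a w) \<in> M" using v w by auto
    from submod_add[OF M ghom_add[OF g Lh_prj[OF vL(1)] Lh_prj[OF wL(1)], of a] submod_add[OF M vL(2) wL(2)]]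
    show ?thesis by (simp add: prj_add vL(1) wL(1))
   qed
   then show "v + w \<in> ?M" using v w L_add by simp
  next
   fix r v assume r: "r \<in> R" and v: "v \<in> ?M"
   then have vL: "v \<in> L" by simp
   have "g a (prj a (r *s v)) \<in> M" for a
    unfolding prj_scale[OF r vL]
   proof (rule gsum[OF _ finite_cmp[OF r]], intro conjI)
    fix n
    show "cmp n r *s prj (a - n) v \<in> Lh a"
     by (rule Lh_scale'[OF H_cmp[OF r] Lh_prj[OF vL]]) simp
    have "cmp n r *s g (a - n) (prj (a - n) v) \<in> M"
     using v by (intro submod_scale[OF M cmp_R[OF r]]) auto
    from submod_add[OF M ghom_scale[OF g H_cmp[OF r] Lh_prj[OF vL], of n "a - n"] this]
    show "g a (cmp n r *s prj (a - n) v) \<in> M" by simp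
   qed
   then show "r *s v \<in> ?M" using L_scale[OF r vL] by simp
  qed
  moreover have "E \<subseteq> ?M"
  proof
   fix h assume h: "h \<in> E"
   have "g a (prj a h) \<in> M" for a
   proof (cases "a = dg' h")
    case True
    then show ?thesis using prj_Lh[OF dg'[OF h]] E0[OF h] submod_zero[OF M] by simp
   next
    case False
    then show ?thesis using prj_Lh_other[OF dg'[OF h]] ghom_K[OF g Lh_zero] grsub_zero[OF K] by simp
   qed
   then show "h \<in> ?M" using E_L[OF h] by simp
  qed
  ultimately have "L \<subseteq> ?M" using gen_minimal E_gen by blast
  then have "v \<in> ?M" using Lh_L[OF v] by blast
  then have "g a (prj a v) \<in> M" by simp
  then show ?thesis by (simp only: prj_Lh[OF v])
 qed
 then show ?thesis by blast
qed

end

context dualizing_socle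
begin

text \<open>
 Followed by the coefficient of \<open>u\<close>, the map \<open>g\<close> is a functional on the component of degree
 \<open>\<sigma> - \<epsilon>\<close>. The perfect pairing represents it by a ring element of degree \<open>\<epsilon>\<close>, and determines \<open>g\<close> in the other degrees.
\<close>

lemma scalar_top:
 assumes g: "ghom N \<epsilon> g"
 shows "\<exists>r\<in>H \<epsilon>. \<forall>a. \<forall>v\<in>Lh a. cg (g a v) (r *s v)"
proof -
 obtain B where B: "finite B" "B \<subseteq> H \<epsilon>" "H \<epsilon> \<subseteq> kR.span B" using H_finite_span by blast
 let ?U = "Lh (\<sigma> - \<epsilon>)"
 have U_sub: "k.subspace ?U" by (rule k.subspaceI) (auto intro: Lh_add Lh_emb)
 have gU: "g (\<sigma> - \<epsilon>) v \<in> Lh \<sigma>" if "v \<in> ?U" for v using ghom_Lh[OF g that] by simp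
 have sU: "s *s v \<in> Lh \<sigma>" if "v \<in> ?U" "s \<in> H \<epsilon>" for s v
  by (rule Lh_scale'[OF that(2,1)]) simp
 have g_N: "g a v \<in> N" if v: "v \<in> Lh a" "v \<in> N" for a v
 proof -
  from Nth_hom[OF K theta_H v(1) v(2)[unfolded N_def]] obtain w where
   w: "\<forall>i<d. w i \<in> Lh (a - e i)" "v - (\<Sum>i<d. \<theta> i *s w i) \<in> K" by blast
  let ?S = "\<Sum>i<d. \<theta> i *s w i"
  have S: "?S \<in> Lh a" "g a ?S - (\<Sum>i<d. \<theta> i *s g (a - e i) (w i)) \<in> N"
   using ghom_sum[OF g Ns, of "{..<d}" \<theta> e w a] w(1) theta_H by auto
  have "(\<Sum>i<d. \<theta> i *s g (a - e i) (w i)) \<in> N"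
   by (rule submod_sum[OF Ns], rule theta_N) (use w(1) ghom_Lh[OF g, THEN Lh_L] in auto)
  from submod_add[OF Ns S(2) this] have gS: "g a ?S \<in> N" by simp
  have vS: "v - ?S \<in> Lh a" by (rule Lh_diff[OF v(1) S(1)])
  have "g a ((v - ?S) + ?S) - (g a (v - ?S) + g a ?S) \<in> N" by (rule ghom_add[OF g vS S(1)])
  from submod_add[OF Ns this submod_add[OF Ns ghom_K[OF g vS w(2)] gS]] show ?thesis by simp
 qed
 have "\<exists>q. \<forall>v\<in>?U. lam (g (\<sigma> - \<epsilon>) v) = (\<Sum>s\<in>B. q s * lam (s *s v))"
 proof (rule k.functional_combination[OF B(1) U_sub])
  show "lam (g (\<sigma> - \<epsilon>) (v + w)) = lam (g (\<sigma> - \<epsilon>) v) + lam (g (\<sigma> - \<epsilon>) w)" if "v \<in> ?U" "w \<in> ?U" for v w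
   using lam_cong[OF gU[OF Lh_add[OF that]], of "g (\<sigma> - \<epsilon>) v + g (\<sigma> - \<epsilon>) w"] ghom_add[OF g that]
    lam_add[OF gU[OF that(1)] gU[OF that(2)]] by (simp add: cg_def)
  show "lam (g (\<sigma> - \<epsilon>) (emb a *s v)) = a * lam (g (\<sigma> - \<epsilon>) v)" if "v \<in> ?U" for a v
   using lam_cong[OF gU[OF Lh_emb[OF that, of a]], of "emb a *s g (\<sigma> - \<epsilon>) v"] ghom_scale[OF g H_emb that, of a]
    lam_scale[OF gU[OF that], of a] by (simp add: cg_def)
  show "lam (s *s (v + w)) = lam (s *s v) + lam (s *s w)" if "s \<in> B" "v \<in> ?U" "w \<in> ?U" for s v w
   using that B(2) sU by (simp add: scale_right_distrib lam_add subsetD)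
  show "lam (s *s emb a *s v) = a * lam (s *s v)" if "s \<in> B" "v \<in> ?U" for s a v
   using lam_scale[OF sU[OF that(2)], of s a] that(1) B(2) by (auto simp: mult.commute)
  show "lam (g (\<sigma> - \<epsilon>) v) = 0" if v: "v \<in> ?U" and 0: "!!s. s \<in> B ==> lam (s *s v) = 0" for v
  proof -
   have "v \<in> N"
   proof (rule ccontr)
    assume "v \<notin> N"
    from pairing[OF v this] obtain s where s: "s \<in> H \<epsilon>" "cg (s *s v) u" by auto
    let ?A = "{s. s *s v \<in> N}"
    have "kR.subspace ?A"
    proof (rule kR.subspaceI)
     show "0 \<in> ?A" using submod_zero[OF Ns] by simp
     show "s + t \<in> ?A" if "s \<in> ?A" "t \<in> ?A" for s t
      using that submod_add[OF Ns, of "s *s v" "t *s v"] by (simp add: scale_left_distrib)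
     show "emb a * s \<in> ?A" if "s \<in> ?A" for a s
      using that submod_scale[OF Ns emb_R, of "s *s v" a] by simp
    qed
    moreover have "B \<subseteq> ?A"
    proof
     fix s assume "s \<in> B"
     then show "s \<in> ?A" using 0[of s] lam_0[OF sU[OF v, of s]] B(2) by auto
    qed
    ultimately have "kR.span B \<subseteq> ?A" by (intro kR.span_minimal)
    then have "s *s v \<in> N" using s(1) B(3) by blast
    then show False using cg_in[OF cg_sym[OF s(2)]] u_N by blast
   qed
   then show ?thesis using lam_0[OF gU[OF v]] g_N[OF v] by simp
  qed
 qed
 then obtain q where q: "!!v. v \<in> ?U ==> lam (g (\<sigma> - \<epsilon>) v) = (\<Sum>s\<in>B. q s * lam (s *s v))" by blast
 define r where "r = (\<Sum>s\<in>B. emb (q s) * s)"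
 have rH: "r \<in> H \<epsilon>" unfolding r_def using B(2) by (intro H_sum H_emb_mult) auto
 have top: "cg (g (\<sigma> - \<epsilon>) v) (r *s v)" if v: "v \<in> ?U" for v
 proof -
  have rv: "r *s v = (\<Sum>s\<in>B. emb (q s) *s s *s v)" by (simp add: r_def scale_sum_left)
  have "lam (r *s v) = (\<Sum>s\<in>B. lam (emb (q s) *s s *s v))"
   unfolding rv using lam_sum[of B "\<lambda>s. emb (q s) *s s *s v"] Lh_emb[OF sU[OF v]] B(2) by blast
  also have "... = (\<Sum>s\<in>B. q s * lam (s *s v))"
   using sU[OF v] B(2) by (intro sum.cong refl lam_scale) auto
  finally have "lam (g (\<sigma> - \<epsilon>) v) = lam (r *s v)" using q[OF v] by simp
  then show ?thesis using lam[OF gU[OF v]] cg_sym[OF lam[OF sU[OF v rH]]] cg_trans by simp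
 qed
 have "cg (g a v) (r *s v)" if v: "v \<in> Lh a" for a v
 proof (rule ccontr)
  assume "\<not> ?thesis"
  then have nN: "g a v - r *s v \<notin> N" by (simp add: cg_def)
  have h: "g a v - r *s v \<in> Lh (a + \<epsilon>)"
   by (rule Lh_diff[OF ghom_Lh[OF g v] Lh_scale'[OF rH v]]) simp
  obtain s where s: "s \<in> H (\<sigma> - (a + \<epsilon>))" "cg (s *s (g a v - r *s v)) u" using pairing[OF h nN] by blast
  have sR: "s \<in> R" using H_R[OF s(1)] .
  have sv: "s *s v \<in> ?U" by (rule Lh_scale'[OF s(1) v]) simp
  have "g (\<sigma> - (a + \<epsilon>) + a) (s *s v) - s *s g a v \<in> N" by (rule ghom_scale[OF g s(1) v])
  then have "cg (g (\<sigma> - \<epsilon>) (s *s v)) (s *s g a v)" by (simp add: cg_def algebra_simps)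
  then have "cg (s *s g a v) (r *s s *s v)" using cg_trans[OF cg_sym top[OF sv]] by blast
  then have "s *s g a v - r *s s *s v \<in> N" by (simp only: cg_def)
  then have "s *s (g a v - r *s v) \<in> N" by (simp add: scale_right_diff_distrib mult.commute)
  then show False using cg_in[OF cg_sym[OF s(2)]] u_N by blast
 qed
 then show ?thesis using rH by blast
qed

text \<open>
 Scalars modulo \<open>\<theta>\<close> lift: if \<open>g - r\<close> is divisible by \<open>\<theta> j\<close>, then the quotient is a homomorphism of
 smaller degree.
\<close>

lemma scalar:
 assumes "j \<le> d" "ghom (Nth K \<theta> j) \<epsilon> g"
 shows "\<exists>r\<in>H \<epsilon>. \<forall>a. \<forall>v\<in>Lh a. g a v - r *s v \<in> Nth K \<theta> j"
 using assms
proof (induction "d - j" arbitrary: j \<epsilon> g)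
 case 0
 then have "j = d" by simp
 then show ?case using scalar_top[of \<epsilon> g] 0 by (simp add: N_def cg_def)
next
 case (Suc m)
 then have j: "j < d" "m = d - Suc j" by simp_all
 let ?M = "Nth K \<theta> j"
 have grM: "grsub ?M" by (rule grsub_Nth[OF K, of j \<theta> e]) (use theta_H j in simp)
 note Ms = grsub_submod[OF grM]
 obtain \<epsilon>0 where \<epsilon>0: "\<forall>\<epsilon><\<epsilon>0. \<forall>M g. submod R M --> ghom M \<epsilon> g --> (\<forall>a. \<forall>v\<in>Lh a. g a v \<in> M)"
  using ghom_negative by blast
 show ?case using Suc.prems(2)
 proof (induction "nat (\<epsilon> - \<epsilon>0)" arbitrary: \<epsilon> g rule: less_induct)
  case less
  note g = less.prems
  show ?case
  proof (cases "\<epsilon> < \<epsilon>0")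
   case True
   then show ?thesis using \<epsilon>0 Ms g by (intro bexI[of _ 0]) auto
  next
   case False
   have "ghom (Nth K \<theta> (Suc j)) \<epsilon> g"
    using g unfolding ghom_def Nth.simps by (blast intro: addmul_superset)
   from Suc.hyps(1)[OF j(2) _ this] j(1) obtain r where
    r: "r \<in> H \<epsilon>" "\<forall>a. \<forall>v\<in>Lh a. g a v - r *s v \<in> addmul ?M (\<theta> j)" by auto
   have gr: "g a v - r *s v \<in> Lh (a + \<epsilon>)" if "v \<in> Lh a" for a v
    by (rule Lh_diff[OF ghom_Lh[OF g that] Lh_scale'[OF r(1) that]]) simp
   have "\<forall>p. \<exists>w. snd p \<in> Lh (fst p) --> w \<in> Lh (fst p + \<epsilon> - e j) \<and>
    g (fst p) (snd p) - r *s snd p - \<theta> j *s w \<in> ?M"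
    using addmul_hom[OF grM theta_H[OF j(1)] gr] r(2) by blast
   from choice[OF this] obtain G where
    G: "!!p. snd p \<in> Lh (fst p) ==> G p \<in> Lh (fst p + \<epsilon> - e j) \<and>
     g (fst p) (snd p) - r *s snd p - \<theta> j *s G p \<in> ?M" by blast
   define h where "h a v = G (a, v)" for a v
   have h: "h a v \<in> Lh (a + \<epsilon> - e j)" "g a v - r *s v - \<theta> j *s h a v \<in> ?M" if "v \<in> Lh a" for a v
    using G[of "(a, v)"] that by (simp_all add: h_def)
   have reg: "w \<in> ?M" if "w \<in> L" "\<theta> j *s w \<in> ?M" for w
    using theta_regular[OF j(1)] that by (simp add: regular_def)
   have "ghom ?M (\<epsilon> - e j) h" unfolding ghom_def
   proof (intro conjI allI ballI impI)
    show "h a v \<in> Lh (a + (\<epsilon> - e j))" if "v \<in> Lh a" for a v using h(1)[OF that] by (simp add: algebra_simps)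
   next
    fix a v w assume v: "v \<in> Lh a" and w: "w \<in> Lh a"
    let ?D = "\<lambda>v. g a v - r *s v - \<theta> j *s h a v"
    have vw: "v + w \<in> Lh a" by (rule Lh_add[OF v w])
    have "\<theta> j *s (h a (v + w) - (h a v + h a w)) =
     (g a (v + w) - (g a v + g a w)) + ((?D v + ?D w) - ?D (v + w))"
     by (simp add: scale_right_distrib scale_right_diff_distrib)
    also have "... \<in> ?M"
     by (rule submod_add[OF Ms ghom_add[OF g v w]
      submod_diff[OF Ms neg_one_R submod_add[OF Ms h(2)[OF v] h(2)[OF w]] h(2)[OF vw]]])
    finally show "h a (v + w) - (h a v + h a w) \<in> ?M"
     by (rule reg[rotated]) (intro L_diff L_add Lh_L[OF h(1)] v w vw)
   next
    fix n a t v assume t: "t \<in> H n" and v: "v \<in> Lh a"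
    let ?D = "\<lambda>a v. g a v - r *s v - \<theta> j *s h a v"
    have tv: "t *s v \<in> Lh (n + a)" by (rule Lh_scale[OF t v])
    have tR: "t \<in> R" using H_R[OF t] .
    have "\<theta> j *s (h (n + a) (t *s v) - t *s h a v) =
     (g (n + a) (t *s v) - t *s g a v) + (t *s ?D a v - ?D (n + a) (t *s v))"
     by (simp add: scale_right_diff_distrib mult.commute)
    also have "... \<in> ?M"
     by (rule submod_add[OF Ms ghom_scale[OF g t v]
      submod_diff[OF Ms neg_one_R submod_scale[OF Ms tR h(2)[OF v]] h(2)[OF tv]]])
    finally show "h (n + a) (t *s v) - t *s h a v \<in> ?M"
     by (rule reg[rotated]) (intro L_diff L_scale tR Lh_L[OF h(1)] v tv)
   next
    fix a v assume v: "v \<in> Lh a" "v \<in> K"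
    have "\<theta> j *s h a v = g a v - r *s v - (g a v - r *s v - \<theta> j *s h a v)" by simp
    also have "... \<in> ?M"
     by (rule submod_diff[OF Ms neg_one_R submod_diff[OF Ms neg_one_R ghom_K[OF g v]
      submod_scale[OF Ms H_R[OF r(1)] Nth_superset[OF v(2)]]] h(2)[OF v(1)]])
    finally show "h a v \<in> ?M" by (rule reg[OF Lh_L[OF h(1)[OF v(1)]]])
   qed
   moreover have "nat (\<epsilon> - e j - \<epsilon>0) < nat (\<epsilon> - \<epsilon>0) \<or> \<epsilon> - e j < \<epsilon>0" using e_pos[OF j(1)] False by linarith
   ultimately have "\<exists>r'\<in>H (\<epsilon> - e j). \<forall>a. \<forall>v\<in>Lh a. h a v - r' *s v \<in> ?M"
   proof (elim disjE)
    assume "ghom ?M (\<epsilon> - e j) h" "nat (\<epsilon> - e j - \<epsilon>0) < nat (\<epsilon> - \<epsilon>0)"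
    then show ?thesis using less.hyps by blast
   next
    assume "ghom ?M (\<epsilon> - e j) h" "\<epsilon> - e j < \<epsilon>0"
    then show ?thesis using \<epsilon>0 Ms by (intro bexI[of _ 0]) auto
   qed
   then obtain r' where r': "r' \<in> H (\<epsilon> - e j)" "!!a v. v \<in> Lh a ==> h a v - r' *s v \<in> ?M" by blast
   have "r + \<theta> j * r' \<in> H \<epsilon>"
    using H_add[OF r(1)] H_mult[OF theta_H[OF j(1)] r'(1)] by simp
   moreover have "g a v - (r + \<theta> j * r') *s v \<in> ?M" if v: "v \<in> Lh a" for a v
   proof -
    have "g a v - (r + \<theta> j * r') *s v = (g a v - r *s v - \<theta> j *s h a v) + \<theta> j *s (h a v - r' *s v)"
     by (simp add: scale_left_distrib scale_right_diff_distrib)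
    also have "... \<in> ?M"
     by (rule submod_add[OF Ms h(2)[OF v] submod_scale[OF Ms theta_R[OF j(1)] r'(2)[OF v]]])
    finally show ?thesis .
   qed
   ultimately show ?thesis by blast
  qed
 qed
qed

section \<open>The component of lowest degree\<close>

lemma H_above_top: "s \<in> H n ==> n > top ==> v \<in> L ==> s *s v \<in> N"
 using above_top[of n] I_scale_N[of s v] by (auto simp: I_def)

lemma Lh_low:
 assumes "a < \<sigma> - top"
 shows "Lh a \<subseteq> K"
proof (rule degree_induct_below[OF grsub_zero[OF K] _ assms])
 fix a assume a: "a < \<sigma> - top" and IH: "!!a'. a' < a ==> Lh a' \<subseteq> K"
 show "Lh a \<subseteq> K"
 proof
  fix v assume v: "v \<in> Lh a"
  have "v \<in> N"
  proof (rule ccontr)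
   assume "v \<notin> N"
   from pairing[OF v this] obtain s where s: "s \<in> H (\<sigma> - a)" "cg (s *s v) u" by blast
   have "s *s v \<in> N" by (rule H_above_top[OF s(1) _ Lh_L[OF v]]) (use a in simp)
   then show False using cg_in[OF cg_sym[OF s(2)]] u_N by blast
  qed
  from Nth_hom[OF K theta_H v this[unfolded N_def]] obtain w where
   w: "\<forall>i<d. w i \<in> Lh (a - e i)" "v - (\<Sum>i<d. \<theta> i *s w i) \<in> K" by blast
  have "(\<Sum>i<d. \<theta> i *s w i) \<in> K"
  proof (rule grsub_sum[OF K], rule grsub_scale[OF K])
   fix i assume i: "i \<in> {..<d}"
   show "\<theta> i \<in> R" using theta_R i by simp
   show "w i \<in> K" using w(1) i IH[of "a - e i"] e_pos[of i] by auto
  qed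
  from grsub_add[OF K w(2) this] show "v \<in> K" by simp
 qed
qed

text \<open>
 The pairing puts the components of \<open>L/N\<close> in degrees \<open>\<sigma> - n\<close> in duality with those of \<open>R/\<theta>R\<close> in
 degrees \<open>n\<close>, and the last one of the latter is a line.
\<close>

lemma lowest_component:
 "\<exists>v0\<in>Lh (\<sigma> - top). v0 \<notin> N \<and> (\<forall>v\<in>Lh (\<sigma> - top). \<exists>a. v - emb a *s v0 \<in> K)"
proof -
 obtain \<rho> where \<rho>: "\<rho> \<in> H top" "\<rho> \<notin> I" "\<forall>r\<in>H top. \<exists>a. r - emb a * \<rho> \<in> I" using top_one unfolding I_def by blast
 have "\<exists>a. \<exists>w\<in>Lh a. \<rho> *s w \<notin> N"
 proof (rule ccontr)
  assume neg: "\<not> ?thesis"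
  let ?M = "{v. \<rho> *s v \<in> N}"
  have "submod R ?M"
  proof (rule submodI)
   show "0 \<in> ?M" using submod_zero[OF Ns] by simp
   show "v + w \<in> ?M" if "v \<in> ?M" "w \<in> ?M" for v w
    using that submod_add[OF Ns, of "\<rho> *s v" "\<rho> *s w"] by (simp add: scale_right_distrib)
   show "r *s v \<in> ?M" if "r \<in> R" "v \<in> ?M" for r v
    using submod_scale[OF Ns that(1), of "\<rho> *s v"] that(2) by (simp add: mult.commute)
  qed
  then have "v \<in> ?M" if "v \<in> L" for v using hom_induct[of ?M v] neg that by blast
  then show False using annihilator[OF H_R[OF \<rho>(1)]] \<rho>(2) by blast
 qed
 then obtain a v0 where v0: "v0 \<in> Lh a" "\<rho> *s v0 \<notin> N" by blast
 have \<rho>v: "\<rho> *s v0 \<in> Lh (top + a)" by (rule Lh_scale[OF \<rho>(1) v0(1)])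
 obtain s where s: "s \<in> H (\<sigma> - (top + a))" "cg (s *s \<rho> *s v0) u" using pairing[OF \<rho>v v0(2)] by blast
 have sN: "(s * \<rho>) *s v0 \<notin> N" using cg_in[OF cg_sym[OF s(2)]] u_N by auto
 have "\<sigma> - (top + a) = 0"
 proof (rule ccontr)
  assume "\<not> ?thesis"
  then consider "\<sigma> - (top + a) < 0" | "\<sigma> - (top + a) > 0" by linarith
  then show False
  proof cases
   case 1
   then show ?thesis using H_neg[OF s(1)] sN submod_zero[OF Ns] by simp
  next
   case 2
   then show ?thesis using H_above_top[OF H_mult[OF s(1) \<rho>(1)] _ Lh_L[OF v0(1)]] sN by simp
  qed
 qed
 then have a: "a = \<sigma> - top" by simp
 have v0N: "v0 \<notin> N" using v0(2) submod_scale[OF Ns H_R[OF \<rho>(1)]] by blast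
 have \<rho>L: "\<rho> *s v \<in> Lh \<sigma>" if "v \<in> Lh (\<sigma> - top)" for v by (rule Lh_scale'[OF \<rho>(1) that]) simp
 have l0: "lam (\<rho> *s v0) ~= 0" using lam_0[OF \<rho>L] v0 a by simp
 have "\<exists>q. v - emb q *s v0 \<in> K" if v: "v \<in> Lh (\<sigma> - top)" for v
 proof -
  define q where "q = lam (\<rho> *s v) / lam (\<rho> *s v0)"
  define w where "w = v - emb q *s v0"
  have w: "w \<in> Lh (\<sigma> - top)" unfolding w_def using v v0(1) a by (intro Lh_diff Lh_emb) auto
  have qv: "emb q *s v0 \<in> Lh (\<sigma> - top)" using v0(1) a by (intro Lh_emb) auto
  have "lam (\<rho> *s v) = lam (\<rho> *s w) + lam (\<rho> *s emb q *s v0)"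
   using lam_add[OF \<rho>L[OF w] \<rho>L[OF qv]] by (simp add: w_def scale_right_diff_distrib)
  also have "\<rho> *s emb q *s v0 = emb q *s \<rho> *s v0" by (simp add: mult.commute)
  also have "lam (emb q *s \<rho> *s v0) = q * lam (\<rho> *s v0)" using v0(1) a by (intro lam_scale \<rho>L) simp
  finally have "lam (\<rho> *s w) = 0" using l0 by (simp add: q_def)
  then have \<rho>w: "\<rho> *s w \<in> N" using lam_0[OF \<rho>L[OF w]] by simp
  have "w \<in> N"
  proof (rule ccontr)
   assume "w \<notin> N"
   from pairing[OF w this] obtain t where t: "t \<in> H top" "cg (t *s w) u" by auto
   obtain q' where q': "t - emb q' * \<rho> \<in> I" using \<rho>(3) t(1) by blast
   have "(t - emb q' * \<rho>) *s w \<in> N" by (rule I_scale_N[OF q' Lh_L[OF w]])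
   moreover have "emb q' *s \<rho> *s w \<in> N" by (rule submod_scale[OF Ns emb_R \<rho>w])
   ultimately have "(t - emb q' * \<rho>) *s w + emb q' *s \<rho> *s w \<in> N" by (rule submod_add[OF Ns])
   then have "t *s w \<in> N" by (simp add: scale_left_diff_distrib)
   then show False using cg_in[OF cg_sym[OF t(2)]] u_N by blast
  qed
  from Nth_hom[OF K theta_H w this[unfolded N_def]] obtain z where
   z: "\<forall>i<d. z i \<in> Lh (\<sigma> - top - e i)" "w - (\<Sum>i<d. \<theta> i *s z i) \<in> K" by blast
  have "(\<Sum>i<d. \<theta> i *s z i) \<in> K"
  proof (rule grsub_sum[OF K], rule grsub_scale[OF K])
   fix i assume i: "i \<in> {..<d}"
   show "\<theta> i \<in> R" using theta_R i by simp
   show "z i \<in> K" using z(1) i Lh_low[of "\<sigma> - top - e i"] e_pos[of i] by auto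
  qed
  from grsub_add[OF K z(2) this] have "w \<in> K" by simp
  then show ?thesis unfolding w_def by blast
 qed
 then show ?thesis using v0(1) v0N unfolding a by blast
qed

end

section \<open>The Hilbert series modulo a regular sequence\<close>

context graded_domain
begin

text \<open>\<open>C\<close> is a basis of a complement of \<open>I \<inter> R\<^sub>n\<close> in \<open>R\<^sub>n\<close>.\<close>

definition compl_basis :: "'r set => int => 'r set => bool" where
 "compl_basis I n C \<longleftrightarrow> finite C \<and> C \<subseteq> H n \<and>
   (\<forall>f. (\<Sum>x\<in>C. emb (f x) * x) \<in> I --> (\<forall>x\<in>C. f x = 0)) \<and>
   (\<forall>r\<in>H n. \<exists>f. r - (\<Sum>x\<in>C. emb (f x) * x) \<in> I)"

lemma compl_basisI:
 assumes "finite C" "C \<subseteq> H n" "!!f x. (\<Sum>x\<in>C. emb (f x) * x) \<in> I ==> x \<in> C ==> f x = 0"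
  "!!r. r \<in> H n ==> \<exists>f. r - (\<Sum>x\<in>C. emb (f x) * x) \<in> I"
 shows "compl_basis I n C"
 unfolding compl_basis_def by (intro conjI allI impI ballI assms)

lemma compl_basisD:
 assumes "compl_basis I n C"
 shows "finite C" "C \<subseteq> H n" "!!f x. (\<Sum>x\<in>C. emb (f x) * x) \<in> I ==> x \<in> C ==> f x = 0"
  "!!r. r \<in> H n ==> \<exists>f. r - (\<Sum>x\<in>C. emb (f x) * x) \<in> I"
 using assms unfolding compl_basis_def by (simp_all only: simp_thms)

definition hilb :: "'r set => int => int" where
 "hilb I n = int (kR.dim (H n)) - int (kR.dim (H n \<inter> I))"

lemma subspace_H: "kR.subspace (H n)"
 by (rule kR.subspaceI) (auto intro: H_add H_emb_mult)

lemma subspace_I: "RR.submod R I ==> kR.subspace I"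
 by (rule kR.subspaceI) (auto intro: RR.submod_zero RR.submod_add RR.submod_scale)

lemma finite_independent_H:
 assumes "kR.independent B" "B \<subseteq> H n"
 shows "finite B"
proof -
 obtain F where "finite F" "H n \<subseteq> kR.span F" using H_finite_span by blast
 then show ?thesis using kR.independent_span_bound[OF _ assms(1)] assms(2) by blast
qed

lemma compl_basis_exists:
 assumes I: "RR.submod R I"
 shows "\<exists>C. compl_basis I n C"
proof -
 let ?U = "H n \<inter> I"
 have U_sub: "kR.subspace ?U" by (rule kR.subspace_inter[OF subspace_H subspace_I[OF I]])
 obtain B where B: "B \<subseteq> ?U" "kR.independent B" "?U \<subseteq> kR.span B" using kR.maximal_independent_subset by blast
 obtain G where G: "B \<subseteq> G" "G \<subseteq> H n" "kR.independent G" "H n \<subseteq> kR.span G"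
  using kR.maximal_independent_subset_extend[of B "H n"] B by blast
 have fG: "finite G" by (rule finite_independent_H[OF G(3,2)])
 have fB: "finite B" using finite_subset[OF G(1) fG] .
 let ?C = "G - B"
 have 1: "f x = 0" if f: "(\<Sum>x\<in>?C. emb (f x) * x) \<in> I" and x: "x \<in> ?C" for f x
 proof -
  have "(\<Sum>x\<in>?C. emb (f x) * x) \<in> H n" using G(2) by (intro H_sum H_emb_mult) auto
  then have "(\<Sum>x\<in>?C. emb (f x) * x) \<in> kR.span B" using f B(3) by blast
  then obtain g where g: "(\<Sum>x\<in>?C. emb (f x) * x) = (\<Sum>x\<in>B. emb (g x) * x)"
   unfolding kR.span_finite[OF fB] by blast
  let ?h = "\<lambda>x. if x \<in> B then - g x else f x"
  have "(\<Sum>x\<in>G. emb (?h x) * x) = (\<Sum>x\<in>?C. emb (?h x) * x) + (\<Sum>x\<in>B. emb (?h x) * x)"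
   by (rule sum.subset_diff[OF G(1) fG])
  also have "(\<Sum>x\<in>?C. emb (?h x) * x) = (\<Sum>x\<in>?C. emb (f x) * x)" by (rule sum.cong) auto
  also have "(\<Sum>x\<in>B. emb (?h x) * x) = - (\<Sum>x\<in>B. emb (g x) * x)"
   by (simp add: emb_minus sum_negf)
  finally have "(\<Sum>x\<in>G. emb (?h x) * x) = 0" using g by simp
  then have "?h x = 0" using kR.independentD[OF G(3) fG subset_refl, of ?h x] x by blast
  then show ?thesis using x by simp
 qed
 have 2: "\<exists>f. r - (\<Sum>x\<in>?C. emb (f x) * x) \<in> I" if r: "r \<in> H n" for r
 proof -
  obtain f where f: "r = (\<Sum>x\<in>G. emb (f x) * x)" using r G(4) unfolding kR.span_finite[OF fG] by blast
  have "r = (\<Sum>x\<in>?C. emb (f x) * x) + (\<Sum>x\<in>B. emb (f x) * x)"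
   unfolding f by (rule sum.subset_diff[OF G(1) fG])
  moreover have "(\<Sum>x\<in>B. emb (f x) * x) \<in> I"
   using B(1) by (intro RR.submod_sum[OF I] RR.submod_scale[OF I]) auto
  ultimately have "r - (\<Sum>x\<in>?C. emb (f x) * x) \<in> I" by simp
  then show ?thesis by blast
 qed
 have "compl_basis I n ?C"
 proof (rule compl_basisI)
  show "finite ?C" "?C \<subseteq> H n" using fG G(2) by auto
  show "f x = 0" if "(\<Sum>x\<in>?C. emb (f x) * x) \<in> I" "x \<in> ?C" for f x by (rule 1[OF that])
  show "\<exists>f. r - (\<Sum>x\<in>?C. emb (f x) * x) \<in> I" if "r \<in> H n" for r by (rule 2[OF that])
 qed
 then show ?thesis by (rule exI)
qed

lemma compl_basis_card:
 assumes I: "RR.submod R I" and C: "compl_basis I n C"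
 shows "int (card C) = hilb I n"
proof -
 let ?U = "H n \<inter> I"
 obtain B where B: "B \<subseteq> ?U" "kR.independent B" "?U \<subseteq> kR.span B" using kR.maximal_independent_subset by blast
 have fB: "finite B" using finite_independent_H[OF B(2)] B(1) by blast
 have fC: "finite C" and CH: "C \<subseteq> H n"
  and ind: "!!f x. (\<Sum>x\<in>C. emb (f x) * x) \<in> I ==> x \<in> C ==> f x = 0"
  and sp: "!!r. r \<in> H n ==> \<exists>f. r - (\<Sum>x\<in>C. emb (f x) * x) \<in> I"
  by (rule compl_basisD[OF C]; assumption)+
 have BI: "(\<Sum>x\<in>B. emb (f x) * x) \<in> I" for f
  using B(1) by (intro RR.submod_sum[OF I] RR.submod_scale[OF I]) auto
 have disj: "B \<inter> C = {}"
 proof (rule ccontr)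
  assume "B \<inter> C ~= {}"
  then obtain x where x: "x \<in> B" "x \<in> C" by blast
  have "(\<Sum>y\<in>C. emb (if y = x then 1 else 0) * y) = (\<Sum>y\<in>C. if y = x then x else 0)"
   by (rule sum.cong) auto
  then have "(\<Sum>y\<in>C. emb (if y = x then 1 else 0) * y) \<in> I" using x fC B(1) by auto
  from ind[OF this x(2)] show False by simp
 qed
 have "kR.independent (B \<union> C)"
 proof (rule kR.independent_if_scalars_zero)
  show "finite (B \<union> C)" using fB fC by simp
  fix f x assume 0: "(\<Sum>x\<in>B \<union> C. emb (f x) * x) = 0" and x: "x \<in> B \<union> C"
  have sum: "(\<Sum>x\<in>B. emb (f x) * x) + (\<Sum>x\<in>C. emb (f x) * x) = 0"
   using 0 sum.union_disjoint[OF fB fC disj, of "\<lambda>x. emb (f x) * x"] by simp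
  then have "(\<Sum>x\<in>C. emb (f x) * x) = - 1 * (\<Sum>x\<in>B. emb (f x) * x)" by (simp add: eq_neg_iff_add_eq_0 add.commute)
  then have "(\<Sum>x\<in>C. emb (f x) * x) \<in> I" using RR.submod_scale[OF I neg_one_R BI[of f]] by simp
  then have fC0: "!!x. x \<in> C ==> f x = 0" using ind by blast
  then have "(\<Sum>x\<in>B. emb (f x) * x) = 0" using sum by simp
  then have "!!x. x \<in> B ==> f x = 0" using kR.independentD[OF B(2) fB subset_refl, of f] by blast
  then show "f x = 0" using fC0 x by blast
 qed
 moreover have "H n \<subseteq> kR.span (B \<union> C)"
 proof
  fix r assume r: "r \<in> H n"
  obtain f where f: "r - (\<Sum>x\<in>C. emb (f x) * x) \<in> I" using sp[OF r] by blast
  have "(\<Sum>x\<in>C. emb (f x) * x) \<in> H n" using CH by (intro H_sum H_emb_mult) auto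
  then have "r - (\<Sum>x\<in>C. emb (f x) * x) \<in> kR.span B" using f B(3) H_diff[OF r] by blast
  then have 1: "r - (\<Sum>x\<in>C. emb (f x) * x) \<in> kR.span (B \<union> C)" using kR.span_mono[of B "B \<union> C"] by blast
  have 2: "(\<Sum>x\<in>C. emb (f x) * x) \<in> kR.span (B \<union> C)"
   by (intro kR.span_sum kR.span_scale kR.span_base) simp
  show "r \<in> kR.span (B \<union> C)" using kR.span_add[OF 1 2] by simp
 qed
 moreover have "B \<union> C \<subseteq> H n" using B(1) CH by blast
 ultimately have "card (B \<union> C) = kR.dim (H n)" by (intro kR.basis_card_eq_dim)
 moreover have "card B = kR.dim ?U" by (rule kR.basis_card_eq_dim[OF B(1,3,2)])
 moreover have "card (B \<union> C) = card B + card C" by (rule card_Un_disjoint[OF fB fC disj])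
 ultimately show ?thesis by (simp add: hilb_def)
qed

lemma hilb_addmul:
 fixes n a :: int
 assumes I: "RR.submod R I" "I \<subseteq> R" "!!a v. v \<in> I ==> cmp a v \<in> I" and t: "t \<in> H a"
  and reg: "!!v. v \<in> R ==> t * v \<in> I ==> v \<in> I"
  and J: "J = {i + t * v | i v. i \<in> I \<and> v \<in> R}"
 shows "hilb J n = hilb I n - hilb I (n - a)"
proof -
 interpret S: graded_module emb R cmp X "(*)" R cmp "{1}" by (rule graded_module_self)
 have gI: "S.grsub I" using I by (simp add: S.grsub_def)
 have J': "J = S.addmul I t" unfolding J S.addmul_def ..
 have Js: "RR.submod R J" unfolding J' by (rule S.submod_addmul[OF I(1) H_R[OF t]])
 obtain C where C: "compl_basis J n C" using compl_basis_exists[OF Js] by blast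
 obtain D where D: "compl_basis I (n - a) D" using compl_basis_exists[OF I(1)] by blast
 have fC: "finite C" and CH: "C \<subseteq> H n"
  and C_ind: "!!f x. (\<Sum>x\<in>C. emb (f x) * x) \<in> J ==> x \<in> C ==> f x = 0"
  and C_sp: "!!r. r \<in> H n ==> \<exists>f. r - (\<Sum>x\<in>C. emb (f x) * x) \<in> J"
  by (rule compl_basisD[OF C]; assumption)+
 have fD: "finite D" and DH: "D \<subseteq> H (n - a)"
  and D_ind: "!!f x. (\<Sum>x\<in>D. emb (f x) * x) \<in> I ==> x \<in> D ==> f x = 0"
  and D_sp: "!!r. r \<in> H (n - a) ==> \<exists>f. r - (\<Sum>x\<in>D. emb (f x) * x) \<in> I"
  by (rule compl_basisD[OF D]; assumption)+
 have tD: "t * x \<in> J" if "x \<in> D" for x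
  unfolding J' using DH that H_R by (intro S.addmul_mult[OF I(1)]) blast
 have inj: "inj_on ((*) t) D"
 proof (cases "t = 0")
  case True
  have "x \<in> I" if "x \<in> D" for x
   using reg[of x] DH that H_R True RR.submod_zero[OF I(1)] by auto
  then have "(\<Sum>x\<in>D. emb 1 * x) \<in> I" by (intro RR.submod_sum[OF I(1)]) simp
  then have "D = {}" using D_ind[of "\<lambda>_. 1"] by auto
  then show ?thesis by simp
 qed (auto simp: inj_on_def)
 have disj: "C \<inter> (*) t ` D = {}"
 proof (rule ccontr)
  assume "\<not> ?thesis"
  then obtain x where x: "x \<in> C" "x \<in> J" using tD by blast
  have "(\<Sum>y\<in>C. emb (if y = x then 1 else 0) * y) = (\<Sum>y\<in>C. if y = x then x else 0)"
   by (rule sum.cong) auto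
  then have "(\<Sum>y\<in>C. emb (if y = x then 1 else 0) * y) \<in> J" using x fC by simp
  from C_ind[OF this x(1)] show False by simp
 qed
 have split: "(\<Sum>x\<in>C \<union> (*) t ` D. emb (f x) * x) =
  (\<Sum>x\<in>C. emb (f x) * x) + t * (\<Sum>x\<in>D. emb (f (t * x)) * x)" for f
 proof -
  have 1: "(\<Sum>x\<in>(*) t ` D. emb (f x) * x) = (\<Sum>x\<in>D. emb (f (t * x)) * (t * x))"
   by (simp only: sum.reindex[OF inj] o_def)
  have 2: "(\<Sum>x\<in>D. emb (f (t * x)) * (t * x)) = t * (\<Sum>x\<in>D. emb (f (t * x)) * x)"
   unfolding sum_distrib_left by (intro sum.cong refl) (rule mult.left_commute)
  show ?thesis unfolding sum.union_disjoint[OF fC finite_imageI[OF fD] disj] 1 2 ..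
 qed
 have DR: "(\<Sum>x\<in>D. emb (g x) * x) \<in> R" for g using DH by (intro R_sum R_mult emb_R) (auto intro: H_R)
 have "compl_basis I n (C \<union> (*) t ` D)"
 proof (rule compl_basisI)
  show "finite (C \<union> (*) t ` D)" using fC fD by simp
  show "C \<union> (*) t ` D \<subseteq> H n" using CH DH H_mult[OF t] by fastforce
 next
  fix f x assume f: "(\<Sum>x\<in>C \<union> (*) t ` D. emb (f x) * x) \<in> I" and x: "x \<in> C \<union> (*) t ` D"
  let ?c = "\<Sum>x\<in>C. emb (f x) * x" and ?d = "\<Sum>x\<in>D. emb (f (t * x)) * x"
  have f': "?c + t * ?d \<in> I" using f unfolding split .
  have "(?c + t * ?d) - t * ?d \<in> J"
   using S.addmul_superset[OF f', of t] S.addmul_mult[OF I(1) DR, of t] unfolding J'[symmetric]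
   by (rule RR.submod_diff[OF Js neg_one_R])
  then have "?c \<in> J" by simp
  then have c0: "!!x. x \<in> C ==> f x = 0" using C_ind by blast
  then have "?c = 0" by simp
  then have "?d \<in> I" using f' reg[OF DR] by simp
  then have "!!x. x \<in> D ==> f (t * x) = 0" using D_ind[of "\<lambda>x. f (t * x)"] by blast
  then show "f x = 0" using c0 x by blast
 next
  fix r assume r: "r \<in> H n"
  obtain f where f: "r - (\<Sum>x\<in>C. emb (f x) * x) \<in> J" using C_sp[OF r] by blast
  let ?c = "\<Sum>x\<in>C. emb (f x) * x"
  have "?c \<in> H n" using CH by (intro H_sum H_emb_mult) auto
  then have h: "r - ?c \<in> S.Lh n" using H_diff[OF r] by (simp add: S.Lh_def H_def)
  obtain w where w: "w \<in> H (n - a)" "r - ?c - t * w \<in> I"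
   using S.addmul_hom[OF gI t h] f unfolding J' S.Lh_def H_def by blast
  obtain g where g: "w - (\<Sum>x\<in>D. emb (g x) * x) \<in> I" using D_sp[OF w(1)] by blast
  let ?d = "\<Sum>x\<in>D. emb (g x) * x"
  define h where "h x = (if x \<in> C then f x else g (the_inv_into D ((*) t) x))" for x
  have hC: "(\<Sum>x\<in>C. emb (h x) * x) = ?c" by (rule sum.cong) (auto simp: h_def)
  have "h (t * x) = g x" if "x \<in> D" for x
   using disj that the_inv_into_f_f[OF inj that] by (auto simp: h_def)
  then have hD: "(\<Sum>x\<in>D. emb (h (t * x)) * x) = ?d" by (intro sum.cong) auto
  have "(r - ?c - t * w) + t * (w - ?d) \<in> I"
   by (rule RR.submod_add[OF I(1) w(2) RR.submod_scale[OF I(1) H_R[OF t] g]])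
  also have "(r - ?c - t * w) + t * (w - ?d) = r - (?c + t * ?d)" by (simp add: right_diff_distrib)
  also have "?c + t * ?d = (\<Sum>x\<in>C \<union> (*) t ` D. emb (h x) * x)" unfolding split hC hD ..
  finally show "\<exists>f. r - (\<Sum>x\<in>C \<union> (*) t ` D. emb (f x) * x) \<in> I" by blast
 qed
 from compl_basis_card[OF I(1) this] have "hilb I n = int (card C + card ((*) t ` D))"
  using card_Un_disjoint[OF fC finite_imageI[OF fD] disj] by simp
 also have "card ((*) t ` D) = card D" by (rule card_image[OF inj])
 finally show ?thesis using compl_basis_card[OF Js C] compl_basis_card[OF I(1) D] by simp
qed

lemma hilb_nonneg: "RR.submod R I ==> hilb I n \<ge> 0"
 using compl_basis_exists[of I n] compl_basis_card[of I n] by fastforce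

lemma hilb_zero:
 assumes "RR.submod R I" "hilb I n = 0"
 shows "H n \<subseteq> I"
proof -
 obtain C where C: "compl_basis I n C" using compl_basis_exists[OF assms(1)] by blast
 then have "C = {}" using compl_basis_card[OF assms(1) C] assms(2) by (simp add: compl_basis_def)
 then show ?thesis using C by (auto simp: compl_basis_def)
qed

lemma hilb_one:
 assumes "RR.submod R I" "hilb I n = 1"
 shows "\<exists>\<rho>\<in>H n. \<rho> \<notin> I \<and> (\<forall>r\<in>H n. \<exists>a. r - emb a * \<rho> \<in> I)"
proof -
 obtain C where C: "compl_basis I n C" using compl_basis_exists[OF assms(1)] by blast
 then have "card C = 1" using compl_basis_card[OF assms(1) C] assms(2) by simp
 then obtain \<rho> where \<rho>: "C = {\<rho>}" by (rule card_1_singletonE)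
 have *: "\<rho> \<in> H n" "!!f. emb (f \<rho>) * \<rho> \<in> I ==> f \<rho> = (0::'k)" "!!r. r \<in> H n ==> \<exists>f. r - emb (f \<rho>) * \<rho> \<in> I"
  using C unfolding compl_basis_def \<rho> by simp_all
 have "\<rho> \<notin> I" using *(2)[of "\<lambda>_. 1"] by auto
 then show ?thesis using *(1,3) by blast
qed

lemma hilb_zero_ideal: "hilb {0} n = int (kR.dim (H n))"
proof -
 have "H n \<inter> {0} = kR.span {}" using H_zero by auto
 then show ?thesis using kR.dim_span[of "{}"] kR.dim_eq_card_independent[OF kR.independent_empty] by (simp add: hilb_def)
qed

text \<open>
 If \<open>H(t) (1 - t)\<^sup>d\<close> is a polynomial of degree \<open>s\<close> with leading coefficient \<open>h s\<close>, then
 \<open>H(t) \<Prod> (1 - t\<^bsup>e i\<^esup>)\<close> is one with the same leading coefficient.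
\<close>

lemma fps_top_mult:
 fixes F :: "int fps"
 assumes "!!n. n > m ==> fps_nth F n = 0" "k \<ge> 1"
 shows "(\<forall>n>m + k - 1. fps_nth (F * (\<Sum>i<k. fps_X ^ i)) n = 0) \<and>
  fps_nth (F * (\<Sum>i<k. fps_X ^ i)) (m + k - 1) = fps_nth F m"
proof -
 have coeff: "fps_nth (F * (\<Sum>i<k. fps_X ^ i)) n = (\<Sum>i<k. if n < i then 0 else fps_nth F (n - i))" for n
  by (simp add: sum_distrib_left fps_sum_nth fps_X_power_mult_right_nth)
 have "fps_nth (F * (\<Sum>i<k. fps_X ^ i)) n = 0" if "n > m + k - 1" for n
  unfolding coeff using that assms by (intro sum.neutral) auto
 moreover have "(\<Sum>i<k. if m + k - 1 < i then 0 else fps_nth F (m + k - 1 - i)) =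
  (\<Sum>i<k. if i = k - 1 then fps_nth F m else 0)"
  using assms by (intro sum.cong) auto
 then have "fps_nth (F * (\<Sum>i<k. fps_X ^ i)) (m + k - 1) = fps_nth F m"
  unfolding coeff using assms(2) by simp
 ultimately show ?thesis by blast
qed

text \<open>
 Dividing by \<open>\<theta>\<^sub>i\<close> multiplies the Hilbert series by \<open>1 - t\<^sup>e\<close> with \<open>e = deg \<theta>\<^sub>i\<close>, and
 \<open>(1 - t\<^sup>e)/(1 - t)\<close> is a polynomial with leading coefficient 1.
\<close>

lemma hilb_series:
 assumes t: "!!i. i < d ==> \<theta> i \<in> H (e i)" "!!i. i < d ==> e i > 0"
  and reg: "!!i. i < d ==> graded_module.regular (*) R (graded_module.Nth (*) R {0} \<theta> i) (\<theta> i)"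
  and h: "Abs_fps (\<lambda>i. int (kR.dim (H (int i)))) * (1 - fps_X) ^ d = (\<Sum>i\<le>s. fps_const (h i) * fps_X ^ i)"
 shows "\<exists>m. (\<forall>n>m. H n \<subseteq> graded_module.Nth (*) R {0} \<theta> d) \<and>
  hilb (graded_module.Nth (*) R {0} \<theta> d) m = h s"
proof -
 interpret S: graded_module emb R cmp X "(*)" R cmp "{1}" by (rule graded_module_self)
 let ?I = "\<lambda>j. S.Nth {0} \<theta> j"
 have g0: "S.grsub {0}" by (auto simp: S.grsub_def RR.submod_def)
 have gr: "S.grsub (?I j)" if "j \<le> d" for j by (rule S.grsub_Nth[OF g0, of j \<theta> e]) (use t(1) that in auto)
 define Q where "Q j = Abs_fps (\<lambda>n. hilb (?I j) (int n))" for j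
 have hneg: "hilb (?I j) n = 0" if "n < 0" for j n
 proof -
  have "H n = {0}" using H_neg that by (auto simp: H_def)
  then have "H n \<inter> ?I j = H n \<or> H n \<inter> ?I j = {}" by auto
  moreover have "kR.dim {0} = 0" "kR.dim {} = 0"
   using kR.dim_span[of "{}"] kR.dim_eq_card_independent[OF kR.independent_empty] by simp_all
  ultimately show ?thesis using \<open>H n = {0}\<close> by (auto simp: hilb_def)
 qed
 have Q_Suc: "Q (Suc j) = Q j * (1 - fps_X ^ nat (e j))" if j: "j < d" for j
 proof (rule fps_ext)
  fix n
  have ej: "int (nat (e j)) = e j" using t(2)[OF j] by simp
  have gj: "RR.submod R (?I j)" "?I j \<subseteq> R" "!!a v. v \<in> ?I j ==> cmp a v \<in> ?I j"
   using gr[of j] j by (auto simp: S.grsub_def)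
  have "hilb (?I (Suc j)) (int n) = hilb (?I j) (int n) - hilb (?I j) (int n - e j)"
   by (rule hilb_addmul[OF gj t(1)[OF j]]) (use reg[OF j] in \<open>auto simp: S.regular_def S.addmul_def\<close>)
  moreover have "fps_nth (Q j * (1 - fps_X ^ nat (e j))) n =
    hilb (?I j) (int n) - (if n < nat (e j) then 0 else hilb (?I j) (int (n - nat (e j))))"
   by (simp add: Q_def right_diff_distrib fps_X_power_mult_right_nth)
  moreover have "(if n < nat (e j) then 0 else hilb (?I j) (int (n - nat (e j)))) = hilb (?I j) (int n - e j)"
  proof (cases "n < nat (e j)")
   case True
   then show ?thesis using hneg[of "int n - e j"] ej by simp
  next
   case False
   then show ?thesis using ej by (simp add: of_nat_diff)
  qed
  ultimately show "fps_nth (Q (Suc j)) n = fps_nth (Q j * (1 - fps_X ^ nat (e j))) n" by (simp add: Q_def)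
 qed
 define P :: "int fps" where "P = (\<Sum>i\<le>s. fps_const (h i) * fps_X ^ i)"
 have P_nth: "fps_nth P n = (if n \<le> s then h n else 0)" for n
 proof -
  have "fps_nth P n = (\<Sum>i\<le>s. if i = n then h n else 0)"
   unfolding P_def by (simp add: fps_sum_nth fps_X_power_nth if_distrib[of "\<lambda>z. _ * z"] cong: if_cong)
  then show ?thesis by simp
 qed
 have Q_eq: "Q j * (1 - fps_X) ^ (d - j) = P * (\<Prod>i<j. \<Sum>l<nat (e i). fps_X ^ l)" if "j \<le> d" for j
  using that
 proof (induction j)
  case 0
  have "Q 0 = Abs_fps (\<lambda>i. int (kR.dim (H (int i))))" by (simp add: Q_def hilb_zero_ideal)
  then show ?case using h by (simp add: P_def)
 next
  case (Suc j)
  then have j: "j < d" by simp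
  have "(1 - fps_X ^ nat (e j) :: int fps) = (1 - fps_X) * (\<Sum>l<nat (e j). fps_X ^ l)"
   by (rule one_diff_power_eq)
  then have "Q (Suc j) * (1 - fps_X) ^ (d - Suc j) =
   (Q j * ((1 - fps_X) * (1 - fps_X) ^ (d - Suc j))) * (\<Sum>l<nat (e j). fps_X ^ l)"
   using Q_Suc[OF j] by (simp only: mult_ac)
  also have "(1 - fps_X) * (1 - fps_X :: int fps) ^ (d - Suc j) = (1 - fps_X) ^ (d - j)"
   using j by (simp flip: power_Suc add: Suc_diff_Suc)
  also have "Q j * (1 - fps_X) ^ (d - j) = P * (\<Prod>i<j. \<Sum>l<nat (e i). fps_X ^ l)" using Suc by simp
  finally show ?case by (simp add: mult.assoc)
 qed
 have "j \<le> d ==> \<exists>m. (\<forall>n>m. fps_nth (P * (\<Prod>i<j. \<Sum>l<nat (e i). fps_X ^ l)) n = 0) \<and>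
  fps_nth (P * (\<Prod>i<j. \<Sum>l<nat (e i). fps_X ^ l)) m = h s" for j
 proof (induction j)
  case 0
  then show ?case by (intro exI[of _ s]) (simp add: P_nth)
 next
  case (Suc j)
  then obtain m where m: "\<forall>n>m. fps_nth (P * (\<Prod>i<j. \<Sum>l<nat (e i). fps_X ^ l)) n = 0"
   "fps_nth (P * (\<Prod>i<j. \<Sum>l<nat (e i). fps_X ^ l)) m = h s" by auto
  have "nat (e j) \<ge> 1" using t(2)[of j] Suc.prems by simp
  from fps_top_mult[OF m(1)[rule_format] this] m(2) show ?case
   by (intro exI[of _ "m + nat (e j) - 1"]) (simp add: mult.assoc)
 qed
 from this[of d] obtain m where m: "\<forall>n>m. fps_nth (Q d) n = 0" "fps_nth (Q d) m = h s"
  using Q_eq[of d] by auto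
 have "H n \<subseteq> ?I d" if n: "n > int m" for n
 proof (rule hilb_zero[OF S.grsub_submod[OF gr[OF order_refl]]])
  have "fps_nth (Q d) (nat n) = 0" using m(1) n by simp
  then show "hilb (?I d) n = 0" using n by (simp add: Q_def)
 qed
 moreover have "hilb (?I d) (int m) = h s" using m(2) by (simp add: Q_def)
 ultimately show ?thesis by blast
qed

end

section \<open>The trace of the canonical module\<close>

context canonical_candidate
begin

text \<open>Homogeneous homomorphisms \<open>L/K \<rightarrow> R\<close> of degree \<open>\<epsilon>\<close>; \<open>\<psi> a\<close> is the component in degree \<open>a\<close>.\<close>

definition rhom :: "int => (int => 'v => 'r) => bool" where
 "rhom \<epsilon> \<psi> \<longleftrightarrow> (\<forall>a. \<forall>v\<in>Lh a. \<psi> a v \<in> H (a + \<epsilon>)) \<and>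
   (\<forall>a. \<forall>v\<in>Lh a. \<forall>w\<in>Lh a. \<psi> a (v + w) = \<psi> a v + \<psi> a w) \<and>
   (\<forall>n a. \<forall>r\<in>H n. \<forall>v\<in>Lh a. \<psi> (n + a) (r *s v) = r * \<psi> a v) \<and>
   (\<forall>a. \<forall>v\<in>Lh a. v \<in> K --> \<psi> a v = 0)"

end

context dualizing_socle
begin

lemma rhom_H: "rhom \<epsilon> \<psi> ==> v \<in> Lh a ==> \<psi> a v \<in> H (a + \<epsilon>)"
 and rhom_add: "rhom \<epsilon> \<psi> ==> v \<in> Lh a ==> w \<in> Lh a ==> \<psi> a (v + w) = \<psi> a v + \<psi> a w"
 and rhom_scale: "rhom \<epsilon> \<psi> ==> r \<in> H n ==> v \<in> Lh a ==> \<psi> (n + a) (r *s v) = r * \<psi> a v"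
 and rhom_K: "rhom \<epsilon> \<psi> ==> v \<in> Lh a ==> v \<in> K ==> \<psi> a v = 0"
 unfolding rhom_def by blast+

lemma rhom_cong:
 assumes "rhom \<epsilon> \<psi>" "v \<in> Lh a" "w \<in> Lh a" "v - w \<in> K"
 shows "\<psi> a v = \<psi> a w"
 using rhom_add[OF assms(1,3) Lh_diff[OF assms(2,3)]] rhom_K[OF assms(1) Lh_diff[OF assms(2,3)] assms(4)]
 by simp

lemma rhom_emb: "rhom \<epsilon> \<psi> ==> v \<in> Lh a ==> \<psi> a (emb q *s v) = emb q * \<psi> a v"
 using rhom_scale[OF _ H_emb, of \<epsilon> \<psi> v a q] by simp

lemma rhom_combination:
 assumes "!!i. i \<in> A ==> rhom \<epsilon> (\<psi> i)"
 shows "rhom \<epsilon> (\<lambda>a v. \<Sum>i\<in>A. emb (q i) * \<psi> i a v)"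
 unfolding rhom_def
proof (intro conjI allI ballI impI)
 show "(\<Sum>i\<in>A. emb (q i) * \<psi> i a v) \<in> H (a + \<epsilon>)" if "v \<in> Lh a" for a v
  by (intro H_sum H_emb_mult rhom_H[OF assms] that)
next
 fix a v w assume "v \<in> Lh a" "w \<in> Lh a"
 then show "(\<Sum>i\<in>A. emb (q i) * \<psi> i a (v + w)) = (\<Sum>i\<in>A. emb (q i) * \<psi> i a v) + (\<Sum>i\<in>A. emb (q i) * \<psi> i a w)"
  unfolding sum.distrib[symmetric] distrib_left[symmetric]
  by (intro sum.cong refl) (simp only: rhom_add[OF assms])
next
 fix n a r v assume "r \<in> H n" "v \<in> Lh a"
 then show "(\<Sum>i\<in>A. emb (q i) * \<psi> i (n + a) (r *s v)) = r * (\<Sum>i\<in>A. emb (q i) * \<psi> i a v)"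
  unfolding sum_distrib_left
  by (intro sum.cong refl) (simp only: rhom_scale[OF assms] mult.left_commute)
next
 fix a v assume "v \<in> Lh a" "v \<in> K"
 then show "(\<Sum>i\<in>A. emb (q i) * \<psi> i a v) = 0"
  by (intro sum.neutral ballI) (simp add: rhom_K[OF assms])
qed

text \<open>
 The endomorphism \<open>w \<mapsto> \<psi>(w) v\<close> is the multiplication by some \<open>r\<close>; applying \<open>\<psi>\<close> shows that \<open>r = \<psi>(v)\<close>.
\<close>

lemma rhom_commute:
 assumes \<psi>: "rhom \<epsilon> \<psi>" and v: "v \<in> Lh n" and w: "w \<in> Lh a"
 shows "\<psi> a w *s v - \<psi> n v *s w \<in> K"
proof (cases "\<exists>a. \<exists>w\<in>Lh a. \<psi> a w ~= 0")
 case False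
 then have "\<psi> a w = 0" "\<psi> n v = 0" using v w by blast+
 then show ?thesis using grsub_zero[OF K] by simp
next
 case True
 then obtain a0 w0 where w0: "w0 \<in> Lh a0" "\<psi> a0 w0 ~= 0" by blast
 have "ghom (Nth K \<theta> 0) (\<epsilon> + n) (\<lambda>a w. \<psi> a w *s v)" unfolding ghom_def Nth.simps
 proof (intro conjI allI ballI impI)
  show "\<psi> a w *s v \<in> Lh (a + (\<epsilon> + n))" if "w \<in> Lh a" for a w
   by (rule Lh_scale'[OF rhom_H[OF \<psi> that] v]) simp
  show "\<psi> a (w + w') *s v - (\<psi> a w *s v + \<psi> a w' *s v) \<in> K" if "w \<in> Lh a" "w' \<in> Lh a" for a w w'
   using grsub_zero[OF K] by (simp add: rhom_add[OF \<psi> that] scale_left_distrib)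
  show "\<psi> (m + a) (r *s w) *s v - r *s \<psi> a w *s v \<in> K" if "r \<in> H m" "w \<in> Lh a" for m a r w
   using grsub_zero[OF K] by (simp add: rhom_scale[OF \<psi> that])
  show "\<psi> a w *s v \<in> K" if "w \<in> Lh a" "w \<in> K" for a w
   using grsub_zero[OF K] by (simp add: rhom_K[OF \<psi> that])
 qed
 from scalar[OF le0 this] obtain r where r: "r \<in> H (\<epsilon> + n)" "!!a w. w \<in> Lh a ==> \<psi> a w *s v - r *s w \<in> K"
  by auto
 let ?p = "\<psi> a0 w0"
 have pv: "?p *s v \<in> Lh (a0 + \<epsilon> + n)" by (rule Lh_scale'[OF rhom_H[OF \<psi> w0(1)] v]) simp
 have rw: "r *s w0 \<in> Lh (a0 + \<epsilon> + n)" by (rule Lh_scale'[OF r(1) w0(1)]) simp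
 have "\<psi> (a0 + \<epsilon> + n) (?p *s v) = \<psi> (a0 + \<epsilon> + n) (r *s w0)"
  by (rule rhom_cong[OF \<psi> pv rw r(2)[OF w0(1)]])
 also have "\<psi> (a0 + \<epsilon> + n) (?p *s v) = ?p * \<psi> n v" by (rule rhom_scale[OF \<psi> rhom_H[OF \<psi> w0(1)] v])
 also have "\<psi> (a0 + \<epsilon> + n) (r *s w0) = r * ?p"
  using rhom_scale[OF \<psi> r(1) w0(1)] by (simp add: algebra_simps)
 finally have "?p * \<psi> n v = ?p * r" by (simp only: mult.commute)
 then have "r = \<psi> n v" using w0(2) by simp
 then show ?thesis using r(2)[OF w] by simp
qed

lemma prj_scale_hom:
 assumes "r \<in> R" "v \<in> Lh a"
 shows "prj (a + n) (r *s v) = cmp n r *s v"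
proof -
 have "prj (a + n) (r *s v) = (\<Sum>m | cmp m r ~= 0. cmp m r *s prj (a + n - m) v)"
  by (rule prj_scale[OF assms(1) Lh_L[OF assms(2)]])
 also have "... = (\<Sum>m | cmp m r ~= 0. if m = n then cmp n r *s v else 0)"
  by (rule sum.cong) (auto simp: prj_Lh[OF assms(2)] prj_Lh_other[OF assms(2)])
 also have "... = cmp n r *s v" using finite_cmp[OF assms(1)] by simp
 finally show ?thesis .
qed

lemma mm_scale_in_K: "(!!x. x \<in> X ==> x *s v \<in> K) ==> v \<in> L ==> r \<in> mm ==> r *s v \<in> K"
 using mm_scale_in[OF grsub_submod[OF K], of v r] K by (auto simp: grsub_def)

lemma cyclic_of_no_generators:
 assumes "H 1 = {0}"
 shows "\<exists>v0\<in>L. (\<forall>w\<in>L. \<exists>r\<in>R. w - r *s v0 \<in> K) \<and> (\<forall>r\<in>R. r *s v0 \<in> K --> r = 0)"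
proof -
 have mm0: "r = 0" if "r \<in> mm" for r
 proof -
  obtain s where "r = (\<Sum>x\<in>X. x * s x)" using mm_gen[OF \<open>r \<in> mm\<close>] by blast
  also have "... = 0" using X_H assms by (intro sum.neutral) auto
  finally show ?thesis .
 qed
 have d0: "d = 0"
 proof (rule ccontr)
  assume "d ~= 0"
  then have "S.regular {0} (\<theta> 0)" "\<theta> 0 = 0" using theta_regular_R[of 0] mm0[OF theta_mm[of 0]] by simp_all
  then have "\<forall>v\<in>R. v = 0" by (simp add: S.regular_def)
  from bspec[OF this R_one] show False by simp
 qed
 have NK: "N = K" unfolding N_def using d0 by simp
 have *: "\<exists>a. cg w (emb a *s u)" if "w \<in> L" for w
  by (rule simple_socle[OF that]) (use mm0 submod_zero[OF Ns] in force)
 have "w - emb a *s u \<in> K" if "cg w (emb a *s u)" for w a using that by (simp add: cg_def NK)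
 then have "\<exists>r\<in>R. w - r *s u \<in> K" if "w \<in> L" for w using *[OF that] emb_R by blast
 moreover have "r = 0" if r: "r \<in> R" "r *s u \<in> K" for r
 proof -
  obtain a where "r - emb a \<in> mm" using R_decomp[OF r(1)] by blast
  then have "r = emb a" using mm0 by fastforce
  then show ?thesis using emb_u_N[of a] r(2) by (simp add: NK)
 qed
 ultimately show ?thesis using u_L by blast
qed

text \<open>
 The trace argument. Any \<open>v0\<close> that spans the lowest component generates \<open>L/K\<close> freely: the trace
 contains all forms \<open>r\<close> of degree 1, so, unless some \<open>\<psi>(v0)\<close> is a unit, \<open>r = \<psi>(v0)\<close> for degree
 reasons, and then \<open>r w = \<psi>(w) v0\<close> lies in \<open>R v0\<close> for all \<open>w\<close>.
\<close>

lemma cyclic: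
 assumes trace: "!!r. r \<in> H 1 ==> \<exists>(n::nat) \<psi> a w. r = (\<Sum>i<n. \<psi> i (a i) (w i)) \<and>
   (\<forall>i<n. rhom (1 - a i) (\<psi> i) \<and> w i \<in> Lh (a i))"
  and H1: "H 1 ~= {0}" and d: "d \<ge> 1"
  and dim2: "d \<ge> 2 \<or> (\<exists>x\<in>H 1. \<forall>r\<in>H 1. \<exists>a. r = emb a * x)"
 shows "\<exists>v0\<in>L. (\<forall>w\<in>L. \<exists>r\<in>R. w - r *s v0 \<in> K) \<and> (\<forall>r\<in>R. r *s v0 \<in> K --> r = 0)"
proof -
 define \<tau> where "\<tau> = \<sigma> - top"
 obtain v0 where v0: "v0 \<in> Lh \<tau>" "v0 \<notin> N" "!!v. v \<in> Lh \<tau> ==> \<exists>a. v - emb a *s v0 \<in> K"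
  using lowest_component unfolding \<tau>_def by blast
 have v0K: "v0 \<notin> K" using v0(2) Nth_superset unfolding N_def by blast
 have v0L: "v0 \<in> L" by (rule Lh_L[OF v0(1)])
 have low: "Lh a \<subseteq> K" if "a < \<tau>" for a using Lh_low that unfolding \<tau>_def by blast
 have reg0: "w \<in> K" if "w \<in> L" "\<theta> 0 *s w \<in> K" for w
  using theta_regular[of 0] d that by (simp add: regular_def)
 have nonzero: "\<psi> \<tau> v0 ~= 0" if \<psi>: "rhom \<epsilon> \<psi>" and w: "w \<in> Lh a" "\<psi> a w ~= 0" for \<epsilon> \<psi> a w
 proof
  assume 0: "\<psi> \<tau> v0 = 0"
  have "\<psi> a w *s v0 - \<psi> \<tau> v0 *s w \<in> K" by (rule rhom_commute[OF \<psi> v0(1) w(1)])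
  then have pK: "\<psi> a w *s v0 \<in> K" using 0 by simp
  have pL: "\<psi> a w *s v0 \<in> Lh (a + \<epsilon> + \<tau>)" by (rule Lh_scale[OF rhom_H[OF \<psi> w(1)] v0(1)])
  have vanish: "\<psi>' \<tau> v0 = 0" if \<psi>': "rhom \<epsilon>' \<psi>'" for \<epsilon>' \<psi>'
  proof -
   have "\<psi>' (a + \<epsilon> + \<tau>) (\<psi> a w *s v0) = \<psi> a w * \<psi>' \<tau> v0"
    by (rule rhom_scale[OF \<psi>' rhom_H[OF \<psi> w(1)] v0(1)])
   then show ?thesis using rhom_K[OF \<psi>' pL pK] w(2) by simp
  qed
  have xv: "x *s v0 \<in> K" if x: "x \<in> X" for x
  proof -
   obtain n :: nat and \<psi>' a' w' where t: "x = (\<Sum>i<n. \<psi>' i (a' i) (w' i))"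
    "\<forall>i<n. rhom (1 - a' i) (\<psi>' i) \<and> w' i \<in> Lh (a' i)" using trace[OF X_H[OF x]] by blast
   have "\<psi>' i (a' i) (w' i) *s v0 \<in> K" if i: "i < n" for i
   proof -
    have h: "rhom (1 - a' i) (\<psi>' i)" "w' i \<in> Lh (a' i)" using t(2) i by blast+
    show ?thesis using rhom_commute[OF h(1) v0(1) h(2)] vanish[OF h(1)] by simp
   qed
   then show ?thesis unfolding t(1) scale_sum_left by (intro grsub_sum[OF K]) simp
  qed
  have "\<theta> 0 \<in> mm" using theta_mm[of 0] d by simp
  from mm_scale_in_K[OF xv v0L this] have "\<theta> 0 *s v0 \<in> K" by simp
  then show False using reg0[OF v0L] v0K by blast
 qed
 have ex_nonzero: "\<exists>\<epsilon> \<psi>. rhom \<epsilon> \<psi> \<and> \<psi> \<tau> v0 ~= 0"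
 proof -
  obtain r where r: "r \<in> H 1" "r ~= 0" using H1 H_zero by blast
  obtain n :: nat and \<psi> a w where t: "r = (\<Sum>i<n. \<psi> i (a i) (w i))"
   "\<forall>i<n. rhom (1 - a i) (\<psi> i) \<and> w i \<in> Lh (a i)" using trace[OF r(1)] by blast
  have "\<exists>i<n. \<psi> i (a i) (w i) ~= 0"
  proof (rule ccontr)
   assume "\<not> ?thesis"
   then have "r = 0" unfolding t(1) by (intro sum.neutral) simp
   then show False using r(2) by simp
  qed
  then obtain i where i: "i < n" "\<psi> i (a i) (w i) ~= 0" by blast
  then have "rhom (1 - a i) (\<psi> i)" "w i \<in> Lh (a i)" using t(2) by blast+
  then show ?thesis using nonzero i(2) by blast
 qed
 have ann: "r = 0" if r: "r \<in> R" "r *s v0 \<in> K" for r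
 proof -
  obtain \<epsilon> \<psi> where \<psi>: "rhom \<epsilon> \<psi>" "\<psi> \<tau> v0 ~= 0" using ex_nonzero by blast
  have "cmp n r = 0" for n
  proof -
   have K': "cmp n r *s v0 \<in> K"
    using grsub_prj[OF K r(2), of "\<tau> + n"] prj_scale_hom[OF r(1) v0(1), of n] by simp
   have "cmp n r * \<psi> \<tau> v0 = \<psi> (n + \<tau>) (cmp n r *s v0)" by (rule rhom_scale[OF \<psi>(1) H_cmp[OF r(1)] v0(1), symmetric])
   also have "... = 0" by (rule rhom_K[OF \<psi>(1) Lh_scale[OF H_cmp[OF r(1)] v0(1)] K'])
   finally show ?thesis using \<psi>(2) by simp
  qed
  then show ?thesis using sum_cmp[OF r(1)] by simp
 qed
 define M where "M = {v \<in> L. \<exists>r\<in>R. v - r *s v0 \<in> K}"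
 have M_sub: "submod R M"
 proof (rule submodI)
  show "0 \<in> M" unfolding M_def using grsub_zero[OF K] by (auto intro!: bexI[of _ 0])
 next
  fix v w assume "v \<in> M" "w \<in> M"
  then obtain r s where *: "v \<in> L" "w \<in> L" "r \<in> R" "s \<in> R" "v - r *s v0 \<in> K" "w - s *s v0 \<in> K"
   unfolding M_def by blast
  have "(v + w) - (r + s) *s v0 = (v - r *s v0) + (w - s *s v0)" by (simp add: scale_left_distrib)
  then have "(v + w) - (r + s) *s v0 \<in> K" using grsub_add[OF K *(5,6)] by (simp only:)
  then show "v + w \<in> M" unfolding M_def using L_add[OF *(1,2)] R_add[OF *(3,4)] by blast
 next
  fix t v assume t: "t \<in> R" and "v \<in> M"
  then obtain r where *: "v \<in> L" "r \<in> R" "v - r *s v0 \<in> K" unfolding M_def by blast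
  have "t *s v - (t * r) *s v0 = t *s (v - r *s v0)" by (simp add: scale_right_diff_distrib)
  then have "t *s v - (t * r) *s v0 \<in> K" using grsub_scale[OF K t *(3)] by (simp only:)
  then show "t *s v \<in> M" unfolding M_def using L_scale[OF t *(1)] R_mult[OF t *(2)] by blast
 qed
 have M_sub_L: "M \<subseteq> L" by (auto simp: M_def)
 have KM: "v \<in> M" if "v \<in> K" for v
  using that K unfolding M_def by (auto simp: grsub_def intro!: bexI[of _ 0])
 have "w \<in> M" if w: "w \<in> Lh a" for w a
 proof (cases "\<exists>\<epsilon> \<psi>. rhom \<epsilon> \<psi> \<and> \<psi> \<tau> v0 ~= 0 \<and> \<epsilon> + \<tau> = 0")
  case True
  then obtain \<epsilon> \<psi> where \<psi>: "rhom \<epsilon> \<psi>" "\<psi> \<tau> v0 ~= 0" "\<tau> + \<epsilon> = 0" by (auto simp: add.commute)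
  obtain q where q: "\<psi> \<tau> v0 = emb q" using H_zero_emb[of "\<psi> \<tau> v0"] rhom_H[OF \<psi>(1) v0(1)] \<psi>(3) by auto
  have q0: "q ~= 0" using q \<psi>(2) by auto
  have "emb (- inverse q) *s (\<psi> a w *s v0 - emb q *s w) \<in> K"
   using rhom_commute[OF \<psi>(1) v0(1) w] unfolding q by (intro grsub_scale[OF K emb_R])
  also have "emb (- inverse q) *s (\<psi> a w *s v0 - emb q *s w) = w - (emb (inverse q) * \<psi> a w) *s v0"
   using emb_inverse[OF q0] by (simp add: emb_minus scale_right_diff_distrib)
  finally have "w - (emb (inverse q) * \<psi> a w) *s v0 \<in> K" .
  then show ?thesis unfolding M_def
   using Lh_L[OF w] R_mult[OF emb_R H_R[OF rhom_H[OF \<psi>(1) w]]] by blast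
 next
  case False
  have lift: "\<exists>\<psi>. rhom (1 - \<tau>) \<psi> \<and> \<psi> \<tau> v0 = r" if r: "r \<in> H 1" for r
  proof -
   obtain n :: nat and \<psi> a w where t: "r = (\<Sum>i<n. \<psi> i (a i) (w i))"
    "\<forall>i<n. rhom (1 - a i) (\<psi> i) \<and> w i \<in> Lh (a i)" using trace[OF r] by blast
   have "\<exists>\<psi>'. rhom (1 - \<tau>) \<psi>' \<and> \<psi>' \<tau> v0 = \<psi> i (a i) (w i)" if i: "i < n" for i
   proof (cases "\<psi> i (a i) (w i) = 0")
    case True
    then show ?thesis by (intro exI[of _ "\<lambda>_ _. 0"]) (simp add: rhom_def)
   next
    case nz: False
    have h: "rhom (1 - a i) (\<psi> i)" "w i \<in> Lh (a i)" using t(2) i by blast+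
    have nz': "\<psi> i \<tau> v0 ~= 0" by (rule nonzero[OF h nz])
    have "\<not> \<tau> + (1 - a i) < 0" using H_neg[OF rhom_H[OF h(1) v0(1)]] nz' by blast
    moreover have "(1 - a i) + \<tau> ~= 0" using False h(1) nz' by blast
    moreover have "\<not> a i < \<tau>" using low[of "a i"] rhom_K[OF h] h(2) nz by blast
    ultimately have ai: "a i = \<tau>" by linarith
    obtain q where q: "w i - emb q *s v0 \<in> K" using v0(3) h(2) ai by blast
    have "\<psi> i \<tau> (w i) = \<psi> i \<tau> (emb q *s v0)"
     by (rule rhom_cong[OF h(1) _ Lh_emb[OF v0(1)] q]) (use h(2) ai in simp)
    also have "... = emb q * \<psi> i \<tau> v0" by (rule rhom_emb[OF h(1) v0(1)])
    finally have "emb q * \<psi> i \<tau> v0 = \<psi> i (a i) (w i)" using ai by simp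
    moreover have "rhom (1 - \<tau>) (\<lambda>b v. \<Sum>j\<in>{i}. emb q * \<psi> j b v)"
     by (rule rhom_combination) (use h(1) ai in simp)
    ultimately show ?thesis by (intro exI[of _ "\<lambda>b v. emb q * \<psi> i b v"]) simp
   qed
   then have "\<forall>i. \<exists>\<psi>'. i < n --> rhom (1 - \<tau>) \<psi>' \<and> \<psi>' \<tau> v0 = \<psi> i (a i) (w i)" by blast
   from choice[OF this] obtain \<phi> where \<phi>: "!!i. i < n ==> rhom (1 - \<tau>) (\<phi> i) \<and> \<phi> i \<tau> v0 = \<psi> i (a i) (w i)"
    by blast
   have "rhom (1 - \<tau>) (\<lambda>b v. \<Sum>i\<in>{..<n}. emb 1 * \<phi> i b v)"
    by (rule rhom_combination) (use \<phi> in auto)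
   moreover have "(\<Sum>i\<in>{..<n}. emb 1 * \<phi> i \<tau> v0) = r" unfolding t(1) using \<phi> by (intro sum.cong) auto
   ultimately show ?thesis by blast
  qed
  have step: "\<exists>p\<in>H (a + (1 - \<tau>)). r *s w - p *s v0 \<in> K" if r: "r \<in> H 1" for r
  proof -
   obtain \<psi> where \<psi>: "rhom (1 - \<tau>) \<psi>" "\<psi> \<tau> v0 = r" using lift[OF r] by blast
   have "emb (- 1) *s (\<psi> a w *s v0 - r *s w) \<in> K"
    using rhom_commute[OF \<psi>(1) v0(1) w] unfolding \<psi>(2) by (intro grsub_scale[OF K emb_R])
   then have "r *s w - \<psi> a w *s v0 \<in> K" by (simp add: emb_minus)
   then show ?thesis using rhom_H[OF \<psi>(1) w] by blast
  qed
  have wL: "w \<in> L" by (rule Lh_L[OF w])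
  have xM: "x *s w \<in> M" if "x \<in> X" for x
   using step[OF X_H[OF that]] H_R L_scale[OF X_R[OF that] wL] unfolding M_def by blast
  have mM: "r *s w \<in> M" if "r \<in> mm" for r
   by (rule mm_scale_in[OF M_sub wL M_sub_L xM that])
  show ?thesis
  proof (cases "d \<ge> 2")
   case True
   then have d2: "0 < d" "1 < d" by simp_all
   obtain p where p: "p \<in> R" "\<theta> 0 *s w - p *s v0 \<in> K" using mM[OF theta_mm[OF d2(1)]] unfolding M_def by blast
   obtain q where q: "q \<in> R" "\<theta> 1 *s w - q *s v0 \<in> K" using mM[OF theta_mm[OF d2(2)]] unfolding M_def by blast
   have "\<theta> 0 *s (\<theta> 1 *s w - q *s v0) - \<theta> 1 *s (\<theta> 0 *s w - p *s v0) \<in> K"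
    by (rule grsub_diff[OF K grsub_scale[OF K theta_R[OF d2(1)] q(2)] grsub_scale[OF K theta_R[OF d2(2)] p(2)]])
   also have "\<theta> 0 *s (\<theta> 1 *s w - q *s v0) - \<theta> 1 *s (\<theta> 0 *s w - p *s v0) = (\<theta> 1 * p - \<theta> 0 * q) *s v0"
    by (simp add: scale_right_diff_distrib scale_left_diff_distrib mult.commute)
   finally have "\<theta> 1 * p - \<theta> 0 * q = 0"
    by (intro ann R_diff R_mult theta_R d2 p(1) q(1))
   then have "\<theta> 1 * p \<in> S.Nth {0} \<theta> 1" using q(1) by (auto simp: S.addmul_iff intro!: bexI[of _ q])
   then have "p \<in> S.Nth {0} \<theta> 1" using theta_regular_R[OF d2(2)] p(1) unfolding S.regular_def by blast
   then obtain t where t: "t \<in> R" "p = \<theta> 0 * t" by (auto simp: S.addmul_iff)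
   have "\<theta> 0 *s (w - t *s v0) \<in> K" using p(2) by (simp add: t(2) scale_right_diff_distrib)
   then have "w - t *s v0 \<in> K" using reg0 L_diff[OF wL L_scale[OF t(1) v0L]] by blast
   then show ?thesis unfolding M_def using wL t(1) by blast
  next
   case False
   then obtain x where x: "x \<in> H 1" "\<forall>r\<in>H 1. \<exists>a. r = emb a * x" using dim2 by blast
   have xR: "x \<in> R" by (rule H_R[OF x(1)])
   have mm_x: "\<exists>s\<in>R. r = x * s" if r: "r \<in> mm" for r
   proof -
    obtain s where s: "\<forall>y\<in>X. s y \<in> R" "r = (\<Sum>y\<in>X. y * s y)" using mm_gen[OF r] by blast
    have "\<forall>y. \<exists>a. y \<in> X --> y = emb a * x" using x(2) X_H by blast
    from choice[OF this] obtain A where A: "!!y. y \<in> X ==> y = emb (A y) * x" by blast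
    have "r = (\<Sum>y\<in>X. x * (emb (A y) * s y))"
     unfolding s(2)
    proof (rule sum.cong[OF refl])
     fix y assume y: "y \<in> X"
     have "y * s y = (emb (A y) * x) * s y" by (rule arg_cong[OF A[OF y]])
     also have "... = x * (emb (A y) * s y)" by (simp only: mult_ac)
     finally show "y * s y = x * (emb (A y) * s y)" .
    qed
    then have "r = x * (\<Sum>y\<in>X. emb (A y) * s y)" by (simp add: sum_distrib_left)
    moreover have "(\<Sum>y\<in>X. emb (A y) * s y) \<in> R" using s(1) by (intro R_sum R_mult) auto
    ultimately show ?thesis by blast
   qed
   have regx: "v \<in> K" if v: "v \<in> L" "x *s v \<in> K" for v
   proof -
    have "\<theta> 0 \<in> mm" using theta_mm d by simp
    from mm_x[OF this] obtain s where s: "s \<in> R" "\<theta> 0 = x * s" by blast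
    have "\<theta> 0 *s v = s *s x *s v" by (simp add: s(2) mult.commute)
    then have "\<theta> 0 *s v \<in> K" using grsub_scale[OF K s(1) v(2)] by simp
    then show ?thesis using reg0 v(1) by blast
   qed
   show ?thesis
   proof (cases "a < \<tau>")
    case True
    then show ?thesis using low[OF True] w KM by blast
   next
    case False
    obtain p where p: "p \<in> H (a + (1 - \<tau>))" "x *s w - p *s v0 \<in> K" using step[OF x(1)] by blast
    have "p \<in> mm" using H_mm[OF p(1)] False by simp
    from mm_x[OF this] obtain t where t: "t \<in> R" "p = x * t" by blast
    have "x *s (w - t *s v0) \<in> K" using p(2) by (simp add: t(2) scale_right_diff_distrib)
    then have "w - t *s v0 \<in> K" using regx L_diff[OF wL L_scale[OF t(1) v0L]] by blast
    then show ?thesis unfolding M_def using wL t(1) by blast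
   qed
  qed
 qed
 then have "w \<in> M" if "w \<in> L" for w using hom_induct[OF M_sub _ that] by blast
 then show ?thesis using ann v0L unfolding M_def by blast
qed

end

section \<open>The algebraic core\<close>

lemma (in graded_domain) span_indexed:
 assumes "r \<in> kR.span U"
 shows "\<exists>(n::nat) f a. (\<forall>i<n. f i \<in> U) \<and> r = (\<Sum>i<n. emb (a i) * f i)"
proof -
 obtain t a where t: "finite t" "t \<subseteq> U" "r = (\<Sum>x\<in>t. emb (a x) * x)"
  using assms unfolding kR.span_explicit by blast
 obtain f where f: "bij_betw f {..<card t} t"
  using ex_bij_betw_nat_finite[OF t(1)] by (auto simp: atLeast0LessThan)
 have "r = (\<Sum>i<card t. emb (a (f i)) * f i)"
  unfolding t(3) by (rule sum.reindex_bij_betw[OF f, symmetric])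
 moreover have "\<forall>i<card t. f i \<in> U" using f t(2) by (auto dest!: bij_betwE)
 ultimately show ?thesis by (intro exI[of _ "card t"] exI[of _ f] exI[of _ "\<lambda>i. a (f i)"]) blast
qed

text \<open>Otherwise the Hilbert function is eventually constant.\<close>

lemma (in graded_domain) dimension_of_growth:
 assumes h: "Abs_fps (\<lambda>i. int (kR.dim (H (int i)))) * (1 - fps_X) ^ d = (\<Sum>i\<le>s. fps_const (h i) * fps_X ^ i)"
  and growth: "!!n. n + 1 \<le> kR.dim (H (int n))"
 shows "d \<ge> 2"
proof (rule ccontr)
 assume "\<not> ?thesis"
 then consider "d = 0" | "d = 1" by linarith
 then show False
 proof cases
  case 1
  then have "fps_nth (Abs_fps (\<lambda>i. int (kR.dim (H (int i))))) (Suc s) =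
   fps_nth (\<Sum>i\<le>s. fps_const (h i) * fps_X ^ i) (Suc s)" using h by simp
  also have "... = 0" by (simp add: fps_sum_nth fps_X_power_nth)
  finally show False using growth[of "Suc s"] by simp
 next
  case 2
  define q where "q n = int (kR.dim (H (int n)))" for n
  have "q (Suc n) - q n = fps_nth (\<Sum>i\<le>s. fps_const (h i) * fps_X ^ i) (Suc n)" for n
   using arg_cong[OF h, of "\<lambda>F. fps_nth F (Suc n)"] 2 by (simp add: q_def right_diff_distrib)
  moreover have "fps_nth (\<Sum>i\<le>s. fps_const (h i) * fps_X ^ i) (Suc n) = 0" if "n \<ge> s" for n
   unfolding fps_sum_nth using that by (intro sum.neutral) (auto simp: fps_X_power_nth)
  ultimately have step: "q (Suc n) = q n" if "n \<ge> s" for n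
   using that by (metis eq_iff_diff_eq_0)
  have "q (s + m) = q s" for m by (induction m) (simp_all add: step)
  moreover have "q n \<ge> int n + 1" for n using growth[of n] unfolding q_def by linarith
  ultimately have "q s \<ge> int (s + nat (q s)) + 1" by metis
  then show False by linarith
 qed
qed

context canonical_candidate
begin

text \<open>
 Here \<open>d\<close> is the dimension of \<open>R\<close>: the module \<open>L/K\<close> has the cohomology of a canonical module, and that
 of \<open>R\<close> vanishes below \<open>d\<close>. If the last entry of the \<open>h\<close>-vector is at most 1 and the trace of \<open>L/K\<close>
 contains the maximal ideal, then \<open>L/K\<close> is free of rank 1.
\<close>

theorem free_of_rank_one:
 assumes depth: "!!i. i < d ==> S.coh_le {0} i 0"
  and h: "Abs_fps (\<lambda>i. int (kR.dim (H (int i)))) * (1 - fps_X) ^ d = (\<Sum>i\<le>s. fps_const (h i) * fps_X ^ i)"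
  and hs: "h s ~= 0" "h s < 2"
  and trace: "H 1 \<subseteq> kR.span {\<psi> a w | \<psi> a w. rhom (1 - a) \<psi> \<and> w \<in> Lh a}"
  and growth: "H 1 = {0} \<or> (\<exists>x\<in>H 1. x ~= 0 \<and> (\<forall>r\<in>H 1. \<exists>a. r = emb a * x)) \<or> (\<forall>n. n + 1 \<le> kR.dim (H (int n)))"
 shows "\<exists>v0\<in>L. (\<forall>w\<in>L. \<exists>r\<in>R. w - r *s v0 \<in> K) \<and> (\<forall>r\<in>R. r *s v0 \<in> K --> r = 0)"
proof -
 obtain \<theta> e where t: "\<forall>i<d. \<theta> i \<in> H (e i) \<and> e i > 0 \<and> regular (Nth K \<theta> i) (\<theta> i) \<and>
  S.regular (S.Nth {0} \<theta> i) (\<theta> i)" using common_regular_sequence[OF depth] by blast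
 have t': "!!i. i < d ==> \<theta> i \<in> H (e i)" "!!i. i < d ==> e i > 0" "!!i. i < d ==> regular (Nth K \<theta> i) (\<theta> i)"
  "!!i. i < d ==> S.regular (S.Nth {0} \<theta> i) (\<theta> i)" using t by blast+
 obtain m where m: "\<forall>n>m. H n \<subseteq> S.Nth {0} \<theta> d" "hilb (S.Nth {0} \<theta> d) m = h s"
  using hilb_series[OF t'(1,2,4) h] by blast
 have Is: "RR.submod R (S.Nth {0} \<theta> d)" by (rule S.grsub_submod[OF S.grsub_Nth[OF S_grsub_0 t'(1)]])
 have "h s \<ge> 0" using hilb_nonneg[OF Is, of m] m(2) by simp
 then have "hilb (S.Nth {0} \<theta> d) m = 1" using m(2) hs by simp
 from hilb_one[OF Is this] interpret dualizing emb R cmp X scale L prj E b D c K d \<theta> e m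
  using t' m(1) by unfold_locales blast+
 obtain \<sigma> u where u: "u \<in> Lh \<sigma>" "u \<notin> N" "\<forall>r\<in>mm. r *s u \<in> N" using socle_exists by blast
 interpret dualizing_socle emb R cmp X scale L prj E b D c K d \<theta> e m u \<sigma>
  using u by unfold_locales blast+
 show ?thesis
 proof (cases "H 1 = {0}")
  case True
  then show ?thesis by (rule cyclic_of_no_generators)
 next
  case False
  have dim: "d \<ge> 2 \<or> (\<exists>x\<in>H 1. \<forall>r\<in>H 1. \<exists>a. r = emb a * x)"
   using growth False dimension_of_growth[OF h] by blast
  obtain x where x: "x \<in> H 1" "x ~= 0" using False H_zero by blast
  have "d ~= 0"
  proof
   assume d0: "d = 0"
   define n where "n = nat m + 1"
   have "x ^ n \<in> H (int n)" using H_power[OF x(1), of n] by simp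
   moreover have "int n > m" by (simp add: n_def)
   ultimately have "x ^ n \<in> S.Nth {0} \<theta> d" using m(1) by blast
   then have "x ^ n = 0" using d0 by simp
   then show False using x(2) by simp
  qed
  then have d1: "d \<ge> 1" by simp
  show ?thesis
  proof (rule cyclic[OF _ False d1 dim])
   fix r assume "r \<in> H 1"
   then have "r \<in> kR.span {\<psi> a w | \<psi> a w. rhom (1 - a) \<psi> \<and> w \<in> Lh a}" using trace by blast
   from span_indexed[OF this] obtain n :: nat and f q where
    f: "\<forall>i<n. f i \<in> {\<psi> a w | \<psi> a w. rhom (1 - a) \<psi> \<and> w \<in> Lh a}" "r = (\<Sum>i<n. emb (q i) * f i)" by blast
   have "\<forall>i. \<exists>p. i < n --> f i = fst p (fst (snd p)) (snd (snd p)) \<and> rhom (1 - fst (snd p)) (fst p) \<and>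
    snd (snd p) \<in> Lh (fst (snd p))"
   proof
    fix i
    show "\<exists>p. i < n --> f i = fst p (fst (snd p)) (snd (snd p)) \<and> rhom (1 - fst (snd p)) (fst p) \<and>
     snd (snd p) \<in> Lh (fst (snd p))"
    proof (cases "i < n")
     case True
     then obtain \<psi> a w where "f i = \<psi> a w" "rhom (1 - a) \<psi>" "w \<in> Lh a" using f(1) by blast
     then show ?thesis by (intro exI[of _ "(\<psi>, a, w)"]) simp
    qed blast
   qed
   from choice[OF this] obtain p where p: "!!i. i < n ==> f i = fst (p i) (fst (snd (p i))) (snd (snd (p i))) \<and>
    rhom (1 - fst (snd (p i))) (fst (p i)) \<and> snd (snd (p i)) \<in> Lh (fst (snd (p i)))" by blast
   define \<psi> where "\<psi> i = (\<lambda>b v. \<Sum>j\<in>{i}. emb (q i) * fst (p j) b v)" for i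
   have "r = (\<Sum>i<n. \<psi> i (fst (snd (p i))) (snd (snd (p i))))"
    unfolding f(2) \<psi>_def using p by (intro sum.cong) auto
   moreover have "\<forall>i<n. rhom (1 - fst (snd (p i))) (\<psi> i) \<and> snd (snd (p i)) \<in> Lh (fst (snd (p i)))"
    unfolding \<psi>_def using p by (auto intro!: rhom_combination[where A = "{_}", simplified])
   ultimately show "\<exists>(n::nat) \<psi> a w. r = (\<Sum>i<n. \<psi> i (a i) (w i)) \<and>
    (\<forall>i<n. rhom (1 - a i) (\<psi> i) \<and> w i \<in> Lh (a i))"
    by (intro exI[of _ n] exI[of _ \<psi>] exI[of _ "\<lambda>i. fst (snd (p i))"] exI[of _ "\<lambda>i. snd (snd (p i))"]) blast
  qed
 qed
qed

end

section \<open>Homogeneous affine semigroup rings\<close>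

locale graded_semigroup =
 fixes S :: "(nat \<Rightarrow>\<^sub>0 nat) set" and \<delta> :: "(nat \<Rightarrow>\<^sub>0 nat) => int"
 assumes S_zero: "0 \<in> S"
  and S_add: "a \<in> S ==> b \<in> S ==> a + b \<in> S"
  and finite_generators: "finite (minimal_generators S)"
  and S_gen: "a \<in> S ==> \<exists>A. set_mset A \<subseteq> minimal_generators S \<and> a = sum_mset A"
  and \<delta>_add: "a \<in> S ==> b \<in> S ==> \<delta> (a + b) = \<delta> a + \<delta> b"
  and \<delta>_gen: "g \<in> minimal_generators S ==> \<delta> g = 1"

text \<open>
 Divided by its value on the minimal generators, the linear form counts the generators in any
 decomposition of an element of \<open>S\<close>.
\<close>

lemma homogeneous_affine_semigroup_graded:
 assumes "affine_semigroup n S" "homogeneous_semigroup n S"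
 shows "\<exists>\<delta>. graded_semigroup S \<delta>"
proof -
 obtain G where G: "finite G" "!!a. a \<in> G ==> Poly_Mapping.keys a \<subseteq> {..<n}" "S = semigroup_generated G"
  using assms(1) unfolding affine_semigroup_def by blast
 obtain u :: "nat => real" and c where c: "c ~= 0"
  "!!a. a \<in> minimal_generators S ==> (\<Sum>j<n. u j * real (Poly_Mapping.lookup a j)) = c"
  using assms(2) unfolding homogeneous_semigroup_def by blast
 have zero: "0 \<in> S" unfolding G(3) semigroup_generated_def by (intro CollectI exI[of _ "{#}"]) simp
 have add: "a + b \<in> S" if a: "a \<in> S" and b: "b \<in> S" for a b
 proof -
  obtain A B where "a = sum_mset A" "b = sum_mset B" "set_mset A \<subseteq> G" "set_mset B \<subseteq> G"
   using a b unfolding G(3) semigroup_generated_def by blast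
  then show ?thesis unfolding G(3) semigroup_generated_def
   by (intro CollectI exI[of _ "A + B"]) simp
 qed
 have GS: "g \<in> S" if "g \<in> G" for g
  unfolding G(3) semigroup_generated_def using that by (intro CollectI exI[of _ "{#g#}"]) simp
 have sumS: "set_mset A \<subseteq> S ==> sum_mset A \<in> S" for A
  by (induction A) (auto intro: zero add)
 have keysS: "Poly_Mapping.keys a \<subseteq> {..<n}" if "a \<in> S" for a
 proof -
  have "set_mset A \<subseteq> G ==> Poly_Mapping.keys (sum_mset A) \<subseteq> {..<n}" for A
  proof (induction A)
   case (add g A)
   then show ?case using Poly_Mapping.keys_add[of g "sum_mset A"] G(2)[of g] by auto
  qed simp
  then show ?thesis using that unfolding G(3) semigroup_generated_def by blast
 qed
 have min_G: "a \<in> set_mset A" if "set_mset A \<subseteq> G" "a = sum_mset A" "a \<in> minimal_generators S" for a A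
  using that
 proof (induction A)
  case empty
  then show ?case by (simp add: minimal_generators_def)
 next
  case (add g A)
  have gA: "g \<in> S" "sum_mset A \<in> S" using add.prems(1) GS by (auto intro!: sumS)
  have "g = 0 \<or> sum_mset A = 0"
   using add.prems(2,3) gA unfolding minimal_generators_def by auto
  then show ?case
  proof
   assume "g = 0"
   then show ?thesis using add by simp
  next
   assume "sum_mset A = 0"
   then show ?thesis using add.prems(2) by simp
  qed
 qed
 have "minimal_generators S \<subseteq> G"
 proof
  fix a assume a: "a \<in> minimal_generators S"
  then obtain A where A: "set_mset A \<subseteq> G" "a = sum_mset A"
   unfolding minimal_generators_def G(3) semigroup_generated_def by blast
  from min_G[OF A a] show "a \<in> G" using A(1) by blast
 qed
 then have fin: "finite (minimal_generators S)" using finite_subset G(1) by blast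
 define \<mu> where "\<mu> a = (\<Sum>j<n. Poly_Mapping.lookup a j)" for a :: "nat \<Rightarrow>\<^sub>0 nat"
 have \<mu>_add: "\<mu> (a + b) = \<mu> a + \<mu> b" for a b by (simp add: \<mu>_def lookup_add sum.distrib)
 have \<mu>_pos: "\<mu> a > 0" if a: "a \<in> S" "a ~= 0" for a
 proof -
  have "Poly_Mapping.keys a ~= {}" using a(2) by simp
  then obtain j where j: "j \<in> Poly_Mapping.keys a" by blast
  have "j < n" using j keysS[OF a(1)] by auto
  moreover have "Poly_Mapping.lookup a j > 0" using j by (simp add: in_keys_iff)
  ultimately show ?thesis unfolding \<mu>_def by (intro sum_pos2[of _ j]) auto
 qed
 have gen: "a \<in> S ==> \<exists>A. set_mset A \<subseteq> minimal_generators S \<and> a = sum_mset A" for a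
 proof (induction "\<mu> a" arbitrary: a rule: less_induct)
  case less
  show ?case
  proof (cases "a = 0 \<or> a \<in> minimal_generators S")
   case True
   then show ?thesis
   proof
    assume "a = 0"
    then show ?thesis by (intro exI[of _ "{#}"]) simp
   next
    assume "a \<in> minimal_generators S"
    then show ?thesis by (intro exI[of _ "{#a#}"]) simp
   qed
  next
   case False
   then obtain b b' where b: "b \<in> S" "b ~= 0" "b' \<in> S" "b' ~= 0" "a = b + b'"
    using less.prems unfolding minimal_generators_def by blast
   have "\<mu> b < \<mu> a" "\<mu> b' < \<mu> a" using \<mu>_pos[OF b(1,2)] \<mu>_pos[OF b(3,4)] \<mu>_add b(5) by simp_all
   then obtain A A' where "set_mset A \<subseteq> minimal_generators S" "b = sum_mset A"
    "set_mset A' \<subseteq> minimal_generators S" "b' = sum_mset A'" using less.hyps b(1,3) by metis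
   then show ?thesis using b(5) by (intro exI[of _ "A + A'"]) simp
  qed
 qed
 define \<rho> where "\<rho> a = (\<Sum>j<n. u j * real (Poly_Mapping.lookup a j)) / c" for a
 have \<rho>_add: "\<rho> (a + b) = \<rho> a + \<rho> b" for a b
  by (simp add: \<rho>_def lookup_add distrib_left sum.distrib add_divide_distrib)
 have \<rho>_gen: "\<rho> g = 1" if "g \<in> minimal_generators S" for g
  using c(1) c(2)[OF that] by (simp add: \<rho>_def)
 have \<rho>_int: "\<rho> a \<in> \<int>" if "a \<in> S" for a
 proof -
  have "set_mset A \<subseteq> minimal_generators S ==> \<rho> (sum_mset A) \<in> \<int>" for A
  proof (induction A)
   case empty
   then show ?case by (simp add: \<rho>_def)
  next
   case (add g A)
   then show ?case by (simp add: \<rho>_add \<rho>_gen)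
  qed
  then show ?thesis using gen[OF that] by blast
 qed
 have "graded_semigroup S (\<lambda>a. \<lfloor>\<rho> a\<rfloor>)"
 proof
  show "\<lfloor>\<rho> (a + b)\<rfloor> = \<lfloor>\<rho> a\<rfloor> + \<lfloor>\<rho> b\<rfloor>" if ab: "a \<in> S" "b \<in> S" for a b
   using \<rho>_int[OF ab(1)] by (auto simp: \<rho>_add elim!: Ints_cases)
 qed (use zero add fin gen \<rho>_gen in auto)
 then show ?thesis by blast
qed

definition deg_component :: "('a => int) => int => ('a \<Rightarrow>\<^sub>0 'k) => ('a \<Rightarrow>\<^sub>0 'k::comm_monoid_add)" where
 "deg_component \<delta> n p = (\<Sum>a\<in>Poly_Mapping.keys p. Poly_Mapping.single a (if \<delta> a = n then Poly_Mapping.lookup p a else 0))"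

lemma lookup_deg_component:
 "Poly_Mapping.lookup (deg_component \<delta> n p) b = (if \<delta> b = n then Poly_Mapping.lookup p b else 0)"
proof -
 have "Poly_Mapping.lookup (deg_component \<delta> n p) b =
  (\<Sum>a\<in>Poly_Mapping.keys p. if a = b then (if \<delta> b = n then Poly_Mapping.lookup p b else 0) else 0)"
  unfolding deg_component_def lookup_sum by (intro sum.cong) (auto simp: lookup_single when_def)
 then show ?thesis by (simp add: in_keys_iff)
qed

lemma keys_deg_component: "Poly_Mapping.keys (deg_component \<delta> n p) = {a \<in> Poly_Mapping.keys p. \<delta> a = n}"
 by (auto simp: in_keys_iff lookup_deg_component split: if_splits)

lemma sum_single_keys: "(\<Sum>a\<in>Poly_Mapping.keys p. Poly_Mapping.single a (Poly_Mapping.lookup p a)) = p"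
proof (rule poly_mapping_eqI)
 fix b
 have "Poly_Mapping.lookup (\<Sum>a\<in>Poly_Mapping.keys p. Poly_Mapping.single a (Poly_Mapping.lookup p a)) b =
  (\<Sum>a\<in>Poly_Mapping.keys p. if a = b then Poly_Mapping.lookup p b else 0)"
  unfolding lookup_sum by (intro sum.cong) (auto simp: lookup_single when_def)
 then show "Poly_Mapping.lookup (\<Sum>a\<in>Poly_Mapping.keys p. Poly_Mapping.single a (Poly_Mapping.lookup p a)) b = Poly_Mapping.lookup p b"
  by (simp add: in_keys_iff)
qed

lemma deg_component_id: "deg_component \<delta> n p = p \<longleftrightarrow> (\<forall>a\<in>Poly_Mapping.keys p. \<delta> a = n)"
proof
 assume "deg_component \<delta> n p = p"
 then show "\<forall>a\<in>Poly_Mapping.keys p. \<delta> a = n" using keys_deg_component[of \<delta> n p] by auto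
next
 assume *: "\<forall>a\<in>Poly_Mapping.keys p. \<delta> a = n"
 show "deg_component \<delta> n p = p"
  by (rule poly_mapping_eqI) (use * in \<open>auto simp: lookup_deg_component in_keys_iff\<close>)
qed

context graded_semigroup
begin

lemma generator_in: "g \<in> minimal_generators S ==> g \<in> S"
 by (simp add: minimal_generators_def)

lemma sum_mset_in: "set_mset A \<subseteq> minimal_generators S ==> sum_mset A \<in> S"
 by (induction A) (auto intro: S_zero S_add generator_in)

lemma \<delta>_zero: "\<delta> 0 = 0" using \<delta>_add[OF S_zero S_zero] by simp

lemma \<delta>_sum_mset: "set_mset A \<subseteq> minimal_generators S ==> \<delta> (sum_mset A) = int (size A)"
proof (induction A)
 case (add g A)
 then show ?case using \<delta>_add[of g "sum_mset A"] by (simp add: generator_in sum_mset_in \<delta>_gen)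
qed (simp add: \<delta>_zero)

lemma \<delta>_nonneg: "a \<in> S ==> \<delta> a \<ge> 0"
 using S_gen \<delta>_sum_mset by fastforce

lemma \<delta>_eq_0: "a \<in> S ==> \<delta> a = 0 ==> a = 0"
 using S_gen \<delta>_sum_mset by fastforce

lemma S_split:
 assumes "a \<in> S" "\<delta> a = n + 1" "n \<ge> 0"
 shows "\<exists>g\<in>minimal_generators S. \<exists>a'\<in>S. a = g + a' \<and> \<delta> a' = n"
proof -
 obtain A where A: "set_mset A \<subseteq> minimal_generators S" "a = sum_mset A" using S_gen[OF assms(1)] by blast
 have "A ~= {#}" using A assms(2,3) \<delta>_zero by auto
 then obtain g A' where gA: "A = add_mset g A'" using multiset_cases by blast
 have "g \<in> minimal_generators S" "sum_mset A' \<in> S" "a = g + sum_mset A'"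
  using A gA sum_mset_in by auto
 moreover have "\<delta> (sum_mset A') = n" using A gA \<delta>_sum_mset[of A] \<delta>_sum_mset[of A'] assms(2) by simp
 ultimately show ?thesis by blast
qed

lemma component_eq:
 "semigroup_ring_component S i = {p. Poly_Mapping.keys p \<subseteq> {a \<in> S. \<delta> a = int i}}"
proof -
 have "{sum_mset A | A. set_mset A \<subseteq> minimal_generators S \<and> size A = i} = {a \<in> S. \<delta> a = int i}" (is "?l = ?r")
 proof
  show "?l \<subseteq> ?r" using sum_mset_in \<delta>_sum_mset by auto
  show "?r \<subseteq> ?l"
  proof
   fix a assume a: "a \<in> ?r"
   then obtain A where A: "set_mset A \<subseteq> minimal_generators S" "a = sum_mset A" using S_gen by blast
   then have "size A = i" using a \<delta>_sum_mset[OF A(1)] by simp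
   then show "a \<in> ?l" using A by blast
  qed
 qed
 then show ?thesis unfolding semigroup_ring_component_def by simp
qed

lemma graded_domain_semigroup_ring:
 "graded_domain (Poly_Mapping.single 0 :: 'k::field => (nat \<Rightarrow>\<^sub>0 nat) \<Rightarrow>\<^sub>0 'k) {p. Poly_Mapping.keys p \<subseteq> S}
  (deg_component \<delta>) ((\<lambda>g. Poly_Mapping.single g 1) ` minimal_generators S)"
proof
 let ?R = "{p :: (nat \<Rightarrow>\<^sub>0 nat) \<Rightarrow>\<^sub>0 'k. Poly_Mapping.keys p \<subseteq> S}"
 fix r s :: "(nat \<Rightarrow>\<^sub>0 nat) \<Rightarrow>\<^sub>0 'k" and m n :: int and a b :: 'k
 show "Poly_Mapping.single 0 (a + b) = Poly_Mapping.single 0 a + (Poly_Mapping.single 0 b :: (nat \<Rightarrow>\<^sub>0 nat) \<Rightarrow>\<^sub>0 'k)"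
  by (rule single_add)
 show "Poly_Mapping.single 0 (a * b) = Poly_Mapping.single 0 a * (Poly_Mapping.single 0 b :: (nat \<Rightarrow>\<^sub>0 nat) \<Rightarrow>\<^sub>0 'k)"
  by (simp add: mult_single)
 show "Poly_Mapping.single 0 1 = (1 :: (nat \<Rightarrow>\<^sub>0 nat) \<Rightarrow>\<^sub>0 'k)" by simp
 show "Poly_Mapping.single 0 a \<in> ?R" using S_zero by auto
 show "finite ((\<lambda>g. Poly_Mapping.single g (1::'k)) ` minimal_generators S)" using finite_generators by simp
 show "deg_component \<delta> 0 (Poly_Mapping.single 0 a) = (Poly_Mapping.single 0 a :: (nat \<Rightarrow>\<^sub>0 nat) \<Rightarrow>\<^sub>0 'k)"
  unfolding deg_component_id by (simp add: \<delta>_zero)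
 show "deg_component \<delta> n (r + s) = deg_component \<delta> n r + deg_component \<delta> n s"
  by (rule poly_mapping_eqI) (simp add: lookup_deg_component lookup_add)
 show "deg_component \<delta> m (deg_component \<delta> n r) = (if m = n then deg_component \<delta> n r else 0)"
  by (rule poly_mapping_eqI) (auto simp: lookup_deg_component)
 show "finite {n. deg_component \<delta> n r ~= 0}"
 proof (rule finite_subset)
  show "{n. deg_component \<delta> n r ~= 0} \<subseteq> \<delta> ` Poly_Mapping.keys r"
  proof
   fix n assume "n \<in> {n. deg_component \<delta> n r ~= 0}"
   then have "Poly_Mapping.keys (deg_component \<delta> n r) ~= {}" by simp
   then show "n \<in> \<delta> ` Poly_Mapping.keys r" unfolding keys_deg_component by blast
  qed
 qed simp
 then show "(\<Sum>n | deg_component \<delta> n r ~= 0. deg_component \<delta> n r) = r"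
 proof (intro poly_mapping_eqI)
  fix b assume fin: "finite {n. deg_component \<delta> n r ~= 0}"
  have "Poly_Mapping.lookup (\<Sum>n | deg_component \<delta> n r ~= 0. deg_component \<delta> n r) b =
   (\<Sum>n | deg_component \<delta> n r ~= 0. if n = \<delta> b then Poly_Mapping.lookup r b else 0)"
   unfolding lookup_sum by (intro sum.cong) (auto simp: lookup_deg_component)
  also have "... = (if deg_component \<delta> (\<delta> b) r ~= 0 then Poly_Mapping.lookup r b else 0)"
   using fin by simp
  also have "... = Poly_Mapping.lookup r b"
   using lookup_deg_component[of \<delta> "\<delta> b" r b] by auto
  finally show "Poly_Mapping.lookup (\<Sum>n | deg_component \<delta> n r ~= 0. deg_component \<delta> n r) b = Poly_Mapping.lookup r b" .
 qed
 {
  assume r: "r \<in> ?R"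
  show "deg_component \<delta> n r \<in> ?R" using r by (auto simp: keys_deg_component)
  show "deg_component \<delta> n r = 0" if "n < 0"
   using r that \<delta>_nonneg keys_deg_component[of \<delta> n r] by (fastforce simp flip: keys_eq_empty)
  have "deg_component \<delta> 0 r = Poly_Mapping.single 0 (Poly_Mapping.lookup r 0)"
  proof (rule poly_mapping_eqI)
   fix b
   show "Poly_Mapping.lookup (deg_component \<delta> 0 r) b = Poly_Mapping.lookup (Poly_Mapping.single 0 (Poly_Mapping.lookup r 0)) b"
   proof (cases "b \<in> Poly_Mapping.keys r")
    case True
    then show ?thesis using r \<delta>_eq_0[of b] by (auto simp: lookup_deg_component \<delta>_zero lookup_single when_def)
   next
    case False
    then have "Poly_Mapping.lookup r b = 0" by (simp add: in_keys_iff)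
    then show ?thesis by (auto simp: lookup_deg_component lookup_single when_def)
   qed
  qed
  then show "\<exists>a. deg_component \<delta> 0 r = Poly_Mapping.single 0 a" by blast
  show "\<exists>q. (\<forall>x\<in>(\<lambda>g. Poly_Mapping.single g (1::'k)) ` minimal_generators S. q x \<in> ?R \<and> deg_component \<delta> n (q x) = q x) \<and>
   r = (\<Sum>x\<in>(\<lambda>g. Poly_Mapping.single g (1::'k)) ` minimal_generators S. x * q x)"
   if n: "n \<ge> 0" and rn: "deg_component \<delta> (n + 1) r = r"
  proof -
   let ?K = "Poly_Mapping.keys r" and ?X = "(\<lambda>g. Poly_Mapping.single g (1::'k)) ` minimal_generators S"
   have "\<forall>a. \<exists>p. a \<in> ?K --> fst p \<in> minimal_generators S \<and> snd p \<in> S \<and> a = fst p + snd p \<and> \<delta> (snd p) = n"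
    using S_split[OF _ _ n] r rn unfolding deg_component_id by fastforce
   from choice[OF this] obtain p where p: "!!a. a \<in> ?K ==> fst (p a) \<in> minimal_generators S \<and>
    snd (p a) \<in> S \<and> a = fst (p a) + snd (p a) \<and> \<delta> (snd (p a)) = n" by blast
   define q where "q x = (\<Sum>a | a \<in> ?K \<and> Poly_Mapping.single (fst (p a)) (1::'k) = x.
    Poly_Mapping.single (snd (p a)) (Poly_Mapping.lookup r a))" for x
   have qk: "Poly_Mapping.keys (q x) \<subseteq> {a \<in> S. \<delta> a = n}" for x
   proof -
    have "Poly_Mapping.keys (q x) \<subseteq> (\<Union>a\<in>{a. a \<in> ?K \<and> Poly_Mapping.single (fst (p a)) (1::'k) = x}.
     Poly_Mapping.keys (Poly_Mapping.single (snd (p a)) (Poly_Mapping.lookup r a)))"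
     unfolding q_def by (rule keys_sum)
    also have "... \<subseteq> {a \<in> S. \<delta> a = n}" using p by (auto split: if_splits)
    finally show ?thesis .
   qed
   have mult: "x * q x = (\<Sum>a | a \<in> ?K \<and> Poly_Mapping.single (fst (p a)) (1::'k) = x. Poly_Mapping.single a (Poly_Mapping.lookup r a))" for x
    unfolding q_def sum_distrib_left
   proof (intro sum.cong refl)
    fix a assume a: "a \<in> {a. a \<in> ?K \<and> Poly_Mapping.single (fst (p a)) (1::'k) = x}"
    then have "x * Poly_Mapping.single (snd (p a)) (Poly_Mapping.lookup r a) =
     Poly_Mapping.single (fst (p a) + snd (p a)) (1 * Poly_Mapping.lookup r a)"
     by (auto simp only: mult_single[symmetric])
    also have "fst (p a) + snd (p a) = a" using p[of a] a by simp
    finally show "x * Poly_Mapping.single (snd (p a)) (Poly_Mapping.lookup r a) = Poly_Mapping.single a (Poly_Mapping.lookup r a)"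
     by simp
   qed
   have "(\<Sum>x\<in>?X. x * q x) = (\<Sum>a\<in>?K. Poly_Mapping.single a (Poly_Mapping.lookup r a))"
    unfolding mult by (rule sum.group) (use p finite_generators in auto)
   then have "r = (\<Sum>x\<in>?X. x * q x)" by (simp only: sum_single_keys)
   moreover have "\<forall>x\<in>?X. q x \<in> ?R \<and> deg_component \<delta> n (q x) = q x"
    using qk unfolding deg_component_id by blast
   ultimately show ?thesis by blast
  qed
  assume s: "s \<in> ?R"
  show "r + s \<in> ?R" using Poly_Mapping.keys_add[of r s] r s by auto
  have keys_rs: "Poly_Mapping.keys (r * s) \<subseteq> {a + b | a b. a \<in> Poly_Mapping.keys r \<and> b \<in> Poly_Mapping.keys s}"
   by (rule keys_mult)
  then show "r * s \<in> ?R" using r s S_add by fastforce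
  show "deg_component \<delta> (m + n) (r * s) = r * s" if rs: "deg_component \<delta> m r = r" "deg_component \<delta> n s = s"
   unfolding deg_component_id
  proof
   fix x assume "x \<in> Poly_Mapping.keys (r * s)"
   then obtain a b where ab: "x = a + b" "a \<in> Poly_Mapping.keys r" "b \<in> Poly_Mapping.keys s" using keys_rs by blast
   have "\<delta> a = m" "\<delta> b = n" using rs ab(2,3) unfolding deg_component_id by blast+
   then show "\<delta> x = m + n" using \<delta>_add[of a b] ab r s by auto
  qed
 }
 show "x \<in> ?R" if "x \<in> (\<lambda>g. Poly_Mapping.single g (1::'k)) ` minimal_generators S" for x
  using that generator_in by auto
 show "deg_component \<delta> 1 x = x" if "x \<in> (\<lambda>g. Poly_Mapping.single g (1::'k)) ` minimal_generators S" for x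
  using that \<delta>_gen unfolding deg_component_id by auto
qed

end

locale graded_semigroup_field = graded_semigroup S \<delta>
 for S :: "(nat \<Rightarrow>\<^sub>0 nat) set" and \<delta> +
 fixes F :: "'k::field itself"
begin

abbreviation emb :: "'k => (nat \<Rightarrow>\<^sub>0 nat) \<Rightarrow>\<^sub>0 'k" where "emb \<equiv> Poly_Mapping.single 0"

definition RS :: "((nat \<Rightarrow>\<^sub>0 nat) \<Rightarrow>\<^sub>0 'k) set" where "RS = {p. Poly_Mapping.keys p \<subseteq> S}"

definition XS :: "((nat \<Rightarrow>\<^sub>0 nat) \<Rightarrow>\<^sub>0 'k) set" where "XS = (\<lambda>g. Poly_Mapping.single g 1) ` minimal_generators S"

definition cS :: "int => ((nat \<Rightarrow>\<^sub>0 nat) \<Rightarrow>\<^sub>0 'k) => (nat \<Rightarrow>\<^sub>0 nat) \<Rightarrow>\<^sub>0 'k" where "cS = deg_component \<delta>"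

sublocale graded_domain emb RS cS XS
 unfolding RS_def XS_def cS_def by (rule graded_domain_semigroup_ring)

lemma H_eq: "H n = {p. Poly_Mapping.keys p \<subseteq> {a \<in> S. \<delta> a = n}}"
 unfolding H_def unfolding RS_def cS_def deg_component_id by auto

lemma component_H: "semigroup_ring_component S i = H (int i)"
 unfolding H_eq component_eq ..

lemma mm_eq: "mm = graded_maximal_ideal S"
proof -
 have "deg_component \<delta> 0 p = 0 \<longleftrightarrow> 0 \<notin> Poly_Mapping.keys p" if p: "Poly_Mapping.keys p \<subseteq> S" for p :: "(nat \<Rightarrow>\<^sub>0 nat) \<Rightarrow>\<^sub>0 'k"
 proof -
  have "deg_component \<delta> 0 p = 0 \<longleftrightarrow> {a \<in> Poly_Mapping.keys p. \<delta> a = 0} = {}"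
   unfolding keys_deg_component[symmetric] keys_eq_empty ..
  also have "... \<longleftrightarrow> 0 \<notin> Poly_Mapping.keys p"
   using p \<delta>_eq_0 \<delta>_zero by blast
  finally show ?thesis .
 qed
 then show ?thesis unfolding mm_def unfolding RS_def cS_def graded_maximal_ideal_def by auto
qed

lemma dim_eq: "kR.dim (H (int i)) = poly_mapping.dim (semigroup_ring_component S i :: ((nat \<Rightarrow>\<^sub>0 nat) \<Rightarrow>\<^sub>0 'k) set)"
proof -
 have "(\<lambda>c r. emb c * r) = poly_scale" by (simp add: fun_eq_iff poly_scale_def)
 then show ?thesis by (simp add: component_H)
qed

lemma single_H: "a \<in> S ==> Poly_Mapping.single a (1::'k) \<in> H (\<delta> a)"
 unfolding H_eq by simp

text \<open>Two different minimal generators \<open>g\<close> and \<open>g'\<close> give the \<open>n + 1\<close> elements \<open>i g + (n - i) g'\<close>.\<close>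

lemma growth:
 "H 1 = {0} \<or> (\<exists>x\<in>H 1. x ~= 0 \<and> (\<forall>r\<in>H 1. \<exists>a. r = emb a * x)) \<or> (\<forall>n. n + 1 \<le> kR.dim (H (int n)))"
proof -
 have S1: "{a \<in> S. \<delta> a = 1} = minimal_generators S"
 proof
  show "minimal_generators S \<subseteq> {a \<in> S. \<delta> a = 1}" using generator_in \<delta>_gen by blast
  show "{a \<in> S. \<delta> a = 1} \<subseteq> minimal_generators S"
  proof
   fix a assume "a \<in> {a \<in> S. \<delta> a = 1}"
   then obtain g a' where "g \<in> minimal_generators S" "a' \<in> S" "a = g + a'" "\<delta> a' = 0" using S_split[of a 0] by auto
   then show "a \<in> minimal_generators S" using \<delta>_eq_0[of a'] by simp
  qed
 qed
 consider "minimal_generators S = {}" | g where "minimal_generators S = {g}"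
  | g g' where "g \<in> minimal_generators S" "g' \<in> minimal_generators S" "g ~= g'"
  by blast
 then show ?thesis
 proof cases
  case 1
  then have "H 1 = {0}" unfolding H_eq S1 by auto
  then show ?thesis by blast
 next
  case (2 g)
  let ?x = "Poly_Mapping.single g (1::'k)"
  have "?x \<in> H 1" unfolding H_eq S1 2 by simp
  moreover have "?x ~= 0" by (metis lookup_single_eq lookup_zero zero_neq_one)
  moreover have "\<exists>a. r = emb a * ?x" if "r \<in> H 1" for r
  proof -
   have k: "Poly_Mapping.keys r \<subseteq> {g}" using that unfolding H_eq S1 2 by simp
   have "r = Poly_Mapping.single g (Poly_Mapping.lookup r g)"
    by (rule poly_mapping_eqI) (use k in \<open>auto simp: lookup_single when_def in_keys_iff\<close>)
   then have "r = emb (Poly_Mapping.lookup r g) * ?x" by (simp add: mult_single)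
   then show ?thesis by blast
  qed
  ultimately show ?thesis by blast
 next
  case (3 g g')
  have "n + 1 \<le> kR.dim (H (int n))" for n
  proof -
   define p where "p i = sum_mset (replicate_mset i g + replicate_mset (n - i) g')" for i
   have lp: "Poly_Mapping.lookup (p i) j = i * Poly_Mapping.lookup g j + (n - i) * Poly_Mapping.lookup g' j" for i j
   proof -
    have "Poly_Mapping.lookup (sum_mset (replicate_mset m h)) j = m * Poly_Mapping.lookup h j" for m and h :: "nat \<Rightarrow>\<^sub>0 nat"
    proof (induction m)
     case (Suc m)
     then show ?case unfolding replicate_mset_Suc sum_mset.add_mset lookup_add by simp
    qed simp
    then show ?thesis unfolding p_def sum_mset.union lookup_add by simp
   qed
   have pS: "p i \<in> S" "\<delta> (p i) = int n" if "i \<le> n" for i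
   proof -
    have A: "set_mset (replicate_mset i g + replicate_mset (n - i) g') \<subseteq> minimal_generators S"
     using 3(1,2) by (auto split: if_splits)
    show "p i \<in> S" unfolding p_def by (rule sum_mset_in[OF A])
    show "\<delta> (p i) = int n" unfolding p_def \<delta>_sum_mset[OF A] using that by simp
   qed
   have "\<exists>j. Poly_Mapping.lookup g j ~= Poly_Mapping.lookup g' j"
   proof (rule ccontr)
    assume "\<not> ?thesis"
    then have "g = g'" by (intro poly_mapping_eqI) simp
    then show False using 3(3) by simp
   qed
   then obtain j where j: "Poly_Mapping.lookup g j ~= Poly_Mapping.lookup g' j" by (rule exE)
   have inj: "inj_on p {..n}"
   proof (rule inj_onI)
    fix i i' assume i: "i \<in> {..n}" "i' \<in> {..n}" "p i = p i'"
    have "int i * int (Poly_Mapping.lookup g j) + (int n - int i) * int (Poly_Mapping.lookup g' j) =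
     int i' * int (Poly_Mapping.lookup g j) + (int n - int i') * int (Poly_Mapping.lookup g' j)"
     using arg_cong[OF i(3), of "\<lambda>a. int (Poly_Mapping.lookup a j)"] i(1,2) unfolding lp by (simp add: of_nat_diff)
    then have "(int i - int i') * (int (Poly_Mapping.lookup g j) - int (Poly_Mapping.lookup g' j)) = 0"
     by (simp add: algebra_simps)
    then show "i = i'" using j by simp
   qed
   let ?B = "(\<lambda>a. Poly_Mapping.single a (1::'k)) ` p ` {..n}"
   have inj1: "inj_on (\<lambda>a. Poly_Mapping.single a (1::'k)) A" for A
    by (rule inj_onI) (metis lookup_single_eq lookup_single_not_eq zero_neq_one)
   have BH: "?B \<subseteq> H (int n)" using single_H pS by fastforce
   have ind: "kR.independent ?B"
   proof (rule kR.independent_if_scalars_zero)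
    fix f x assume 0: "(\<Sum>x\<in>?B. emb (f x) * x) = 0" and x: "x \<in> ?B"
    then obtain a where a: "x = Poly_Mapping.single a 1" "a \<in> p ` {..n}" by blast
    have "0 = Poly_Mapping.lookup (\<Sum>x\<in>?B. emb (f x) * x) a" using 0 by simp
    also have "(\<Sum>x\<in>?B. emb (f x) * x) = (\<Sum>y\<in>p ` {..n}. emb (f (Poly_Mapping.single y 1)) * Poly_Mapping.single y 1)"
     by (simp only: sum.reindex[OF inj1] o_def)
    also have "Poly_Mapping.lookup ... a = (\<Sum>y\<in>p ` {..n}. if y = a then f (Poly_Mapping.single a 1) else 0)"
     unfolding lookup_sum by (intro sum.cong) (auto simp: mult_single lookup_single when_def)
    also have "... = f x" using a by simp
    finally show "f x = 0" by simp
   qed simp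
   obtain G where G: "?B \<subseteq> G" "G \<subseteq> H (int n)" "kR.independent G" "H (int n) \<subseteq> kR.span G"
    using kR.maximal_independent_subset_extend[OF BH ind] by blast
   have "card ?B \<le> card G" by (rule card_mono[OF finite_independent_H[OF G(3,2)] G(1)])
   also have "card G = kR.dim (H (int n))" by (rule kR.basis_card_eq_dim[OF G(2,4,3)])
   finally show ?thesis using card_image[OF inj1, of "p ` {..n}"] card_image[OF inj] by simp
  qed
  then show ?thesis by blast
 qed
qed

end

section \<open>Existence of a resolution\<close>

context graded_module
begin

lemma gen_finite_sum:
 assumes "finite W" "v \<in> gen R W"
 shows "\<exists>r. (\<forall>w\<in>W. r w \<in> R) \<and> v = (\<Sum>w\<in>W. r w *s w)"
proof -
 let ?A = "{v. \<exists>r. (\<forall>w\<in>W. r w \<in> R) \<and> v = (\<Sum>w\<in>W. r w *s w)}"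
 have A: "(\<Sum>w\<in>W. r w *s w) \<in> ?A" if "!!w. w \<in> W ==> r w \<in> R" for r using that by blast
 have "submod R ?A"
 proof (rule submodI)
  show "0 \<in> ?A" using A[of "\<lambda>_. 0"] by simp
 next
  fix v w assume "v \<in> ?A" "w \<in> ?A"
  then obtain r s where "\<forall>w\<in>W. r w \<in> R" "v = (\<Sum>w\<in>W. r w *s w)" "\<forall>w\<in>W. s w \<in> R" "w = (\<Sum>w\<in>W. s w *s w)" by blast
  then show "v + w \<in> ?A" using A[of "\<lambda>w. r w + s w"] R_add by (simp add: scale_left_distrib sum.distrib)
 next
  fix t v assume t: "t \<in> R" and "v \<in> ?A"
  then obtain r where "\<forall>w\<in>W. r w \<in> R" "v = (\<Sum>w\<in>W. r w *s w)" by blast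
  then show "t *s v \<in> ?A" using A[of "\<lambda>w. t * r w"] R_mult[OF t] by (simp add: scale_sum_right)
 qed
 moreover have "W \<subseteq> ?A"
 proof
  fix w assume w: "w \<in> W"
  have "(\<Sum>x\<in>W. (if x = w then 1 else 0) *s x) = (\<Sum>x\<in>W. if x = w then w else 0)"
   by (rule sum.cong) auto
  then show "w \<in> ?A" using A[of "\<lambda>x. if x = w then 1 else 0"] w assms(1) by simp
 qed
 ultimately have "gen R W \<subseteq> ?A" by (rule gen_minimal)
 then show ?thesis using assms(2) by blast
qed

lemma finite_generators_of_submod:
 assumes "submod R N" "N \<subseteq> L"
 shows "\<exists>(n::nat) M. (\<forall>k<n. M k \<in> N) \<and> (\<forall>v\<in>N. \<exists>y. (\<forall>k<n. y k \<in> R) \<and> v = (\<Sum>k<n. y k *s M k))"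
proof -
 obtain W where W: "finite W" "W \<subseteq> N" "N \<subseteq> gen R W"
  using noetherian_L assms unfolding noetherian_def by meson
 obtain f where f: "bij_betw f {..<card W} W"
  using ex_bij_betw_nat_finite[OF W(1)] by (auto simp: atLeast0LessThan)
 have fW: "f k \<in> W" if "k < card W" for k using bij_betwE[OF f] that by simp
 have "\<exists>y. (\<forall>k<card W. y k \<in> R) \<and> v = (\<Sum>k<card W. y k *s f k)" if v: "v \<in> N" for v
 proof -
  obtain r where r: "\<forall>w\<in>W. r w \<in> R" "v = (\<Sum>w\<in>W. r w *s w)" using gen_finite_sum[OF W(1)] W(3) v by blast
  have "v = (\<Sum>k<card W. r (f k) *s f k)"
   unfolding r(2) by (rule sum.reindex_bij_betw[OF f, symmetric])
  then show ?thesis using r(1) fW by (intro exI[of _ "\<lambda>k. r (f k)"]) simp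
 qed
 then show ?thesis using fW W(2) by (intro exI[of _ "card W"] exI[of _ f]) blast
qed

end

context graded_domain
begin

definition fscale :: "'r => (nat => 'r) => nat => 'r" where "fscale r f = (\<lambda>i. r * f i)"

text \<open>
 Vectors vanish beyond \<open>m\<close>, so that they are closed under the operations of the function type. This
 differs from the extensional vectors of \<open>free_module\<close>, which do not form a group under pointwise addition.
\<close>

definition Rpow :: "nat => (nat => 'r) set" where
 "Rpow m = {f. (\<forall>i<m. f i \<in> R) \<and> (\<forall>i\<ge>m. f i = 0)}"

definition unit_vec :: "nat => nat => 'r" where "unit_vec i = (\<lambda>j. if j = i then 1 else 0)"

sublocale FM: scalar_module fscale
proof (rule scalar_module.intro, rule module.intro)
 fix a b :: 'r and x y :: "nat => 'r"
 show "fscale a (x + y) = fscale a x + fscale a y"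
  by (rule ext) (simp only: fscale_def plus_fun_apply distrib_left)
 show "fscale (a + b) x = fscale a x + fscale b x"
  by (rule ext) (simp only: fscale_def plus_fun_apply distrib_right)
 show "fscale a (fscale b x) = fscale (a * b) x"
  by (rule ext) (simp only: fscale_def mult.assoc)
 show "fscale 1 x = x"
  by (rule ext) (simp only: fscale_def mult_1_left)
qed

lemma sum_fscale_eval: "(\<Sum>k\<in>A. fscale (y k) (M k)) j = (\<Sum>k\<in>A. y k * M k j)"
 by (simp add: sum_fun_eval fscale_def)

lemma Rpow_expand:
 assumes "f \<in> Rpow m"
 shows "f = (\<Sum>i<m. fscale (f i) (unit_vec i))"
proof
 fix j
 have "(\<Sum>i<m. fscale (f i) (unit_vec i)) j = (\<Sum>i<m. if i = j then f j else 0)"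
  unfolding sum_fscale_eval by (rule sum.cong) (auto simp: unit_vec_def)
 also have "... = f j" using assms by (simp add: Rpow_def)
 finally show "f j = (\<Sum>i<m. fscale (f i) (unit_vec i)) j" ..
qed

lemma submod_Rpow: "FM.submod R (Rpow m)"
 by (rule FM.submodI) (auto simp: Rpow_def fscale_def R_add R_mult)

lemma unit_vec_Rpow: "i < m ==> unit_vec i \<in> Rpow m"
 by (auto simp: Rpow_def unit_vec_def)

text \<open>The free module of rank \<open>m\<close> with basis elements of degrees \<open>\<epsilon> i\<close>.\<close>

lemma graded_module_Rpow:
 "graded_module emb R cmp X fscale (Rpow m) (\<lambda>a f i. cmp (a - \<epsilon> i) (f i)) (unit_vec ` {..<m})"
proof
 fix f g :: "nat => 'r" and a b n :: int and r :: 'r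
 show "FM.submod R (Rpow m)" by (rule submod_Rpow)
 show "finite (unit_vec ` {..<m})" by simp
 show "e \<in> unit_vec ` {..<m} ==> e \<in> Rpow m" for e using unit_vec_Rpow by auto
 show "\<exists>a. (\<lambda>i. cmp (a - \<epsilon> i) (e i)) = e" if "e \<in> unit_vec ` {..<m}" for e
 proof -
  obtain i where i: "e = unit_vec i" using \<open>e \<in> unit_vec ` {..<m}\<close> by blast
  have "(\<lambda>j. cmp (\<epsilon> i - \<epsilon> j) (e j)) = e" by (auto simp: i unit_vec_def fun_eq_iff cmp_H[OF H_one])
  then show ?thesis by blast
 qed
 show "Rpow m \<subseteq> FM.gen R (unit_vec ` {..<m})"
 proof
  fix f assume f: "f \<in> Rpow m"
  have "(\<Sum>i<m. fscale (f i) (unit_vec i)) \<in> FM.gen R (unit_vec ` {..<m})"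
  proof (rule FM.submod_sum[OF FM.submod_gen], rule FM.submod_scale[OF FM.submod_gen])
   fix i assume "i \<in> {..<m}"
   then show "f i \<in> R" "unit_vec i \<in> FM.gen R (unit_vec ` {..<m})"
    using f FM.gen_superset[of "unit_vec ` {..<m}" R] by (auto simp: Rpow_def)
  qed
  then show "f \<in> FM.gen R (unit_vec ` {..<m})" by (simp only: Rpow_expand[OF f, symmetric])
 qed
 assume f: "f \<in> Rpow m"
 then have fR: "!!i. f i \<in> R" unfolding Rpow_def using R_zero by (metis (mono_tags, lifting) linorder_not_le mem_Collect_eq)
 show "(\<lambda>i. cmp (a - \<epsilon> i) (f i)) \<in> Rpow m" using f by (auto simp: Rpow_def cmp_R)
 show "(\<lambda>i. cmp (a - \<epsilon> i) (cmp (b - \<epsilon> i) (f i))) = (if a = b then \<lambda>i. cmp (b - \<epsilon> i) (f i) else 0)"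
  using fR by (auto simp: fun_eq_iff cmp_cmp)
 show fin: "finite {a. (\<lambda>i. cmp (a - \<epsilon> i) (f i)) ~= 0}"
 proof (rule finite_subset)
  show "{a. (\<lambda>i. cmp (a - \<epsilon> i) (f i)) ~= 0} \<subseteq> (\<Union>i<m. (\<lambda>n. n + \<epsilon> i) ` {n. cmp n (f i) ~= 0})"
  proof
   fix a assume "a \<in> {a. (\<lambda>i. cmp (a - \<epsilon> i) (f i)) ~= 0}"
   then obtain i where i: "cmp (a - \<epsilon> i) (f i) ~= 0" by (auto simp: fun_eq_iff)
   then have "i < m" using f by (auto simp: Rpow_def intro: ccontr)
   moreover have "a \<in> (\<lambda>n. n + \<epsilon> i) ` {n. cmp n (f i) ~= 0}" using i by (intro image_eqI[of _ _ "a - \<epsilon> i"]) auto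
   ultimately show "a \<in> (\<Union>i<m. (\<lambda>n. n + \<epsilon> i) ` {n. cmp n (f i) ~= 0})" by blast
  qed
 qed (use fR finite_cmp in auto)
 show "(\<Sum>a | (\<lambda>i. cmp (a - \<epsilon> i) (f i)) ~= 0. (\<lambda>i. cmp (a - \<epsilon> i) (f i))) = f"
 proof
  fix i
  let ?A = "{a. (\<lambda>i. cmp (a - \<epsilon> i) (f i)) ~= 0}" and ?B = "(\<lambda>n. n + \<epsilon> i) ` {n. cmp n (f i) ~= 0}"
  have "(\<Sum>a\<in>?A. (\<lambda>i. cmp (a - \<epsilon> i) (f i))) i = (\<Sum>a\<in>?A. cmp (a - \<epsilon> i) (f i))" by (rule sum_fun_eval)
  also have "... = (\<Sum>a\<in>?B. cmp (a - \<epsilon> i) (f i))"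
  proof (rule sum.mono_neutral_right[OF fin])
   show "?B \<subseteq> ?A" by (auto simp: fun_eq_iff intro!: exI[of _ i])
   show "\<forall>a\<in>?A - ?B. cmp (a - \<epsilon> i) (f i) = 0"
   proof
    fix a assume a: "a \<in> ?A - ?B"
    show "cmp (a - \<epsilon> i) (f i) = 0"
    proof (rule ccontr)
     assume "cmp (a - \<epsilon> i) (f i) ~= 0"
     then have "a \<in> ?B" by (intro image_eqI[of _ _ "a - \<epsilon> i"]) auto
     then show False using a by simp
    qed
   qed
  qed
  also have "... = (\<Sum>n | cmp n (f i) ~= 0. cmp n (f i))"
   by (subst sum.reindex) (auto simp: inj_on_def)
  also have "... = f i" by (rule sum_cmp[OF fR])
  finally show "(\<Sum>a\<in>?A. (\<lambda>i. cmp (a - \<epsilon> i) (f i))) i = f i" .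
 qed
 show "(\<lambda>i. cmp (a - \<epsilon> i) (fscale r f i)) = fscale r (\<lambda>i. cmp (a - n - \<epsilon> i) (f i))" if r: "r \<in> H n"
 proof
  fix i
  interpret S: graded_module emb R cmp X "(*)" R cmp "{1}" by (rule graded_module_self)
  show "cmp (a - \<epsilon> i) (fscale r f i) = fscale r (\<lambda>i. cmp (a - n - \<epsilon> i) (f i)) i"
   using S.prj_scale_H[OF r fR, of "a - \<epsilon> i" i] by (simp add: fscale_def algebra_simps)
 qed
 assume g: "g \<in> Rpow m"
 then have gR: "!!i. g i \<in> R" unfolding Rpow_def using R_zero by (metis (mono_tags, lifting) linorder_not_le mem_Collect_eq)
 show "(\<lambda>i. cmp (a - \<epsilon> i) ((f + g) i)) = (\<lambda>i. cmp (a - \<epsilon> i) (f i)) + (\<lambda>i. cmp (a - \<epsilon> i) (g i))"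
  using fR gR by (auto simp: fun_eq_iff cmp_add)
qed

definition ker_rows :: "nat => nat => (nat => nat => 'r) => (nat => 'r) set" where
 "ker_rows m n M = {a \<in> Rpow n. \<forall>j<m. (\<Sum>k<n. a k * M k j) = 0}"

lemma submod_ker_rows: "FM.submod R (ker_rows m n M)"
proof (rule FM.submodI)
 show "0 \<in> ker_rows m n M" using FM.submod_zero[OF submod_Rpow] by (simp add: ker_rows_def)
 show "a + a' \<in> ker_rows m n M" if a: "a \<in> ker_rows m n M" and a': "a' \<in> ker_rows m n M" for a a'
 proof -
  have "(\<Sum>k<n. (a + a') k * M k j) = (\<Sum>k<n. a k * M k j) + (\<Sum>k<n. a' k * M k j)" for j
   by (simp only: plus_fun_apply distrib_right sum.distrib)
  moreover have "a + a' \<in> Rpow n" using a a' unfolding ker_rows_def by (intro FM.submod_add[OF submod_Rpow]) simp_all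
  ultimately show ?thesis using a a' unfolding ker_rows_def by simp
 qed
 show "fscale r a \<in> ker_rows m n M" if r: "r \<in> R" and a: "a \<in> ker_rows m n M" for r a
 proof -
  have "(\<Sum>k<n. fscale r a k * M k j) = r * (\<Sum>k<n. a k * M k j)" for j
   by (simp only: fscale_def mult.assoc sum_distrib_left)
  moreover have "fscale r a \<in> Rpow n" using r a unfolding ker_rows_def by (intro FM.submod_scale[OF submod_Rpow]) simp_all
  ultimately show ?thesis using a unfolding ker_rows_def by simp
 qed
qed

definition gen_rows :: "(nat => 'r) set => nat => (nat => nat => 'r) => bool" where
 "gen_rows N n M \<longleftrightarrow> (\<forall>k<n. M k \<in> N) \<and> (\<forall>v\<in>N. \<exists>y. (\<forall>k<n. y k \<in> R) \<and> v = (\<Sum>k<n. fscale (y k) (M k)))"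

lemma gen_rows_exists:
 assumes "FM.submod R N" "N \<subseteq> Rpow m"
 shows "\<exists>n M. gen_rows N n M"
 unfolding gen_rows_def
 by (rule graded_module.finite_generators_of_submod[OF graded_module_Rpow[where \<epsilon> = "\<lambda>_. 0"] assms])

text \<open>
 The rows of each matrix generate the kernel of the preceding one, which is finitely generated
 because a free module of finite rank is Noetherian.
\<close>

lemma residue_resolution_exists:
 "\<exists>b D c. residue_resolution emb R cmp X b D c \<and> b 0 = 1 \<and> c 0 = 1"
proof -
 define A0 where "A0 = {f \<in> Rpow 1. f 0 \<in> mm}"
 have "FM.submod R A0"
 proof (rule FM.submodI)
  show "0 \<in> A0" unfolding A0_def using FM.submod_zero[OF submod_Rpow] RR.submod_zero[OF submod_mm] by simp
  show "f + g \<in> A0" if "f \<in> A0" "g \<in> A0" for f g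
   using that FM.submod_add[OF submod_Rpow, of f 1 g] RR.submod_add[OF submod_mm, of "f 0" "g 0"]
   unfolding A0_def by simp
  show "fscale r f \<in> A0" if "r \<in> R" "f \<in> A0" for r f
   using that FM.submod_scale[OF submod_Rpow, of r f 1] RR.submod_scale[OF submod_mm, of r "f 0"]
   unfolding A0_def fscale_def by simp
 qed
 moreover have "A0 \<subseteq> Rpow 1" by (auto simp: A0_def)
 ultimately obtain n1 M0 where M0: "gen_rows A0 n1 M0" using gen_rows_exists by blast
 define P where "P i st \<longleftrightarrow> (\<forall>k<fst (snd st). snd (snd st) k \<in> Rpow (fst st)) \<and>
  (i = 0 --> fst st = 1 \<and> gen_rows A0 (fst (snd st)) (snd (snd st)))"
  for i :: nat and st :: "nat \<times> nat \<times> (nat => nat => 'r)"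
 define Q where "Q st st' \<longleftrightarrow> fst st' = fst (snd st) \<and>
  gen_rows (ker_rows (fst st) (fst (snd st)) (snd (snd st))) (fst (snd st')) (snd (snd st'))"
  for st st' :: "nat \<times> nat \<times> (nat => nat => 'r)"
 have "\<exists>f. \<forall>n. P n (f n) \<and> Q (f n) (f (Suc n))"
 proof (rule dependent_nat_choice)
  show "\<exists>st. P 0 st" using M0 by (intro exI[of _ "(1, n1, M0)"]) (auto simp: P_def gen_rows_def A0_def)
  fix st i assume "P i st"
  let ?N = "ker_rows (fst st) (fst (snd st)) (snd (snd st))"
  have NR: "?N \<subseteq> Rpow (fst (snd st))" by (auto simp: ker_rows_def)
  from gen_rows_exists[OF submod_ker_rows NR] obtain n M where M: "gen_rows ?N n M" by blast
  then have "\<forall>k<n. M k \<in> Rpow (fst (snd st))" using NR unfolding gen_rows_def by blast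
  then show "\<exists>st'. P (Suc i) st' \<and> Q st st'"
   using M by (intro exI[of _ "(fst (snd st), n, M)"]) (simp add: P_def Q_def)
 qed
 then obtain f where f: "!!n. P n (f n)" "!!n. Q (f n) (f (Suc n))" by blast
 define b where "b i = fst (f i)" for i
 define D where "D i = snd (snd (f i))" for i
 have b_Suc: "fst (snd (f i)) = b (Suc i)" for i using f(2)[of i] by (simp add: Q_def b_def)
 have D_Rpow: "D i k \<in> Rpow (b i)" if "k < b (Suc i)" for i k
  using f(1)[of i] that unfolding P_def b_Suc D_def b_def by blast
 have b0: "b 0 = 1" using f(1)[of 0] by (simp add: P_def b_def)
 have gen0: "gen_rows A0 (b 1) (D 0)" using f(1)[of 0] unfolding P_def D_def b_Suc by simp
 have gen: "gen_rows (ker_rows (b i) (b (Suc i)) (D i)) (b (Suc (Suc i))) (D (Suc i))" for i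
  using f(2)[of i] unfolding Q_def D_def b_Suc b_def[symmetric] by blast
 have "residue_resolution emb R cmp X b D (\<lambda>_. 1)"
 proof
  show "D i k j \<in> R" if "k < b (Suc i)" "j < b i" for i k j
   using D_Rpow[OF that(1)] that(2) by (simp add: Rpow_def)
  show "(\<Sum>j<b 0. D 0 k j * emb 1) \<in> mm" if "k < b 1" for k
   using gen0 that by (simp add: b0 gen_rows_def A0_def)
  show "\<exists>j<b 0. (1::'k) ~= 0" using b0 by auto
  show "\<exists>y. (\<forall>k<b 1. y k \<in> R) \<and> (\<forall>j<b 0. a j = (\<Sum>k<b 1. y k * D 0 k j))"
   if a: "!!j. j < b 0 ==> a j \<in> R" "(\<Sum>j<b 0. a j * emb 1) \<in> mm" for a
  proof -
   let ?a = "\<lambda>j. if j < b 0 then a j else 0"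
   have "?a \<in> A0" using a by (auto simp: A0_def Rpow_def b0)
   then obtain y where y: "\<forall>k<b 1. y k \<in> R" "?a = (\<Sum>k<b 1. fscale (y k) (D 0 k))"
    using gen0 unfolding gen_rows_def by blast
   have "a j = (\<Sum>k<b 1. y k * D 0 k j)" if "j < b 0" for j
    using fun_cong[OF y(2), of j] that unfolding sum_fscale_eval by simp
   then show ?thesis using y(1) by blast
  qed
  show "(\<Sum>k<b (Suc i). D (Suc i) l k * D i k j) = 0" if "l < b (Suc (Suc i))" "j < b i" for i l j
   using gen[of i] that by (auto simp: gen_rows_def ker_rows_def)
  show "\<exists>y. (\<forall>l<b (Suc (Suc i)). y l \<in> R) \<and> (\<forall>k<b (Suc i). a k = (\<Sum>l<b (Suc (Suc i)). y l * D (Suc i) l k))"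
   if a: "!!k. k < b (Suc i) ==> a k \<in> R" "!!j. j < b i ==> (\<Sum>k<b (Suc i). a k * D i k j) = 0" for i a
  proof -
   let ?a = "\<lambda>j. if j < b (Suc i) then a j else 0"
   have "?a \<in> ker_rows (b i) (b (Suc i)) (D i)" using a by (auto simp: ker_rows_def Rpow_def)
   then obtain y where y: "\<forall>l<b (Suc (Suc i)). y l \<in> R" "?a = (\<Sum>l<b (Suc (Suc i)). fscale (y l) (D (Suc i) l))"
    using gen[of i] unfolding gen_rows_def by blast
   have "a k = (\<Sum>l<b (Suc (Suc i)). y l * D (Suc i) l k)" if "k < b (Suc i)" for k
    using fun_cong[OF y(2), of k] that unfolding sum_fscale_eval by simp
   then show ?thesis using y(1) by blast
  qed
 qed
 then show ?thesis using b0 by blast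
qed

end

context graded_module_resolution
begin

lemma Nth_shift: "Nth N x (Suc j) = Nth (addmul N (x 0)) (\<lambda>i. x (Suc i)) j"
 by (induction j) simp_all

text \<open>A regular sequence of length \<open>n\<close>, homogeneous or not, makes the cohomology vanish below \<open>n\<close>.\<close>

lemma coh_zero_of_regular_sequence:
 assumes "submod R N" "N \<subseteq> L" "!!j. j < n ==> x j \<in> mm" "!!j. j < n ==> regular (Nth N x j) (x j)" "i < n"
 shows "coh_le N i 0"
 using assms
proof (induction n arbitrary: N x i)
 case (Suc n)
 have x0: "x 0 \<in> mm" "regular N (x 0)" using Suc.prems(3)[of 0] Suc.prems(4)[of 0] by simp_all
 show ?case
 proof (cases i)
  case 0
  then show ?thesis using coh_zero_of_regular[OF Suc.prems(1) x0] by simp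
 next
  case (Suc i')
  have "coh_le (addmul N (x 0)) i' 0"
  proof (rule Suc.IH[where x = "\<lambda>i. x (Suc i)"])
   show "submod R (addmul N (x 0))" by (rule submod_addmul[OF Suc.prems(1) mm_R[OF x0(1)]])
   show "addmul N (x 0) \<subseteq> L" by (rule addmul_subset_L[OF Suc.prems(2) mm_R[OF x0(1)]])
   show "x (Suc j) \<in> mm" if "j < n" for j using Suc.prems(3)[of "Suc j"] that by simp
   show "regular (Nth (addmul N (x 0)) (\<lambda>i. x (Suc i)) j) (x (Suc j))" if "j < n" for j
    using Suc.prems(4)[of "Suc j"] that unfolding Nth_shift by simp
   show "i' < n" using Suc.prems(5) \<open>i = Suc i'\<close> by simp
  qed
  then show ?thesis using coh_zero_Suc[OF Suc.prems(1,2) x0] \<open>i = Suc i'\<close> by simp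
 qed
qed simp

end

section \<open>The ring and its residue field as records\<close>

context graded_domain
begin

definition Rrec :: "'r ring" where
 "Rrec = \<lparr>carrier = R, monoid.mult = (*), one = 1, zero = 0, add = (+)\<rparr>"

lemma Rrec_simps [simp]:
 "carrier Rrec = R" "r \<otimes>\<^bsub>Rrec\<^esub> s = r * s" "\<one>\<^bsub>Rrec\<^esub> = 1" "\<zero>\<^bsub>Rrec\<^esub> = 0" "r \<oplus>\<^bsub>Rrec\<^esub> s = r + s"
 by (simp_all add: Rrec_def)

lemma ring_module_simps [simp]:
 "carrier (ring_module Rrec) = R" "r \<odot>\<^bsub>ring_module Rrec\<^esub> s = r * s" "\<zero>\<^bsub>ring_module Rrec\<^esub> = 0"
 "r \<oplus>\<^bsub>ring_module Rrec\<^esub> s = r + s"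
 by (simp_all add: ring_module_def)

lemma cring_Rrec: "cring Rrec"
proof (rule cringI)
 show "abelian_group Rrec"
 proof (rule abelian_groupI, unfold Rrec_simps)
  show "\<exists>y\<in>R. y + x = 0" if "x \<in> R" for x
   by (rule bexI[of _ "- x"]) (rule left_minus, rule R_minus[OF that])
 qed (rule R_add R_zero add.assoc add.commute add_0; assumption)+
 show "comm_monoid Rrec"
  by (rule comm_monoidI, unfold Rrec_simps) (rule R_mult R_one mult.assoc mult.commute mult_1_left; assumption)+
qed (unfold Rrec_simps, rule distrib_right)

lemma module_Rrec: "Module.module Rrec (ring_module Rrec)"
proof (rule moduleI[OF cring_Rrec])
 show "abelian_group (ring_module Rrec)"
 proof (rule abelian_groupI, unfold ring_module_simps)
  show "\<exists>y\<in>R. y + x = 0" if "x \<in> R" for x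
   by (rule bexI[of _ "- x"]) (rule left_minus, rule R_minus[OF that])
 qed (rule R_add R_zero add.assoc add.commute add_0; assumption)+
qed (unfold ring_module_simps Rrec_simps, (rule R_mult distrib_left distrib_right mult.assoc mult_1_left; assumption)+)

lemma subgroup_add:
 fixes N :: "'x::ab_group_add set" and M :: "('x, 'z) ring_scheme"
 assumes "N \<subseteq> carrier M" "!!x y. x \<oplus>\<^bsub>M\<^esub> y = x + y" "\<zero>\<^bsub>M\<^esub> = 0" "abelian_group M"
  and "0 \<in> N" "!!x y. x \<in> N ==> y \<in> N ==> x + y \<in> N" "!!x. x \<in> N ==> - x \<in> N"
 shows "subgroup N (add_monoid M)"
proof -
 interpret M: abelian_group M by (rule assms(4))
 show ?thesis
 proof (rule group.subgroupI[OF M.a_group])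
  show "inv\<^bsub>add_monoid M\<^esub> x \<in> N" if x: "x \<in> N" for x
  proof -
   have "- x \<oplus>\<^bsub>M\<^esub> x = \<zero>\<^bsub>M\<^esub>" by (simp add: assms(2,3))
   then have "\<ominus>\<^bsub>M\<^esub> x = - x" using x assms(1,7) by (intro M.minus_equality) auto
   then show ?thesis using assms(7)[OF x] by (simp add: a_inv_def)
  qed
 qed (use assms in auto)
qed

lemma ideal_Rrec:
 assumes "RR.submod R I" "I \<subseteq> R"
 shows "ideal I Rrec"
proof (rule idealI)
 show "ring Rrec" using cring_Rrec by (rule cring.axioms)
 show "subgroup I (add_monoid Rrec)"
 proof (rule subgroup_add)
  show "abelian_group Rrec" using \<open>ring Rrec\<close> by (rule ring.axioms)
  show "- x \<in> I" if "x \<in> I" for x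
   using RR.submod_scale[OF assms(1) R_minus[OF R_one] that] by simp
 qed (use assms(2) RR.submod_zero[OF assms(1)] RR.submod_add[OF assms(1)] in simp_all)
 show "x \<otimes>\<^bsub>Rrec\<^esub> a \<in> I" "a \<otimes>\<^bsub>Rrec\<^esub> x \<in> I" if "a \<in> I" "x \<in> carrier Rrec" for a x
  using RR.submod_scale[OF assms(1) _ that(1), of x] that(2) by (simp_all add: mult.commute)
qed

lemma submod_ideal:
 assumes "ideal I Rrec"
 shows "RR.submod R I"
proof -
 interpret I: ideal I Rrec by (rule assms)
 show ?thesis
 proof (rule RR.submodI)
  show "0 \<in> I" using additive_subgroup.zero_closed[OF I.is_additive_subgroup] unfolding Rrec_simps .
  show "v + w \<in> I" if "v \<in> I" "w \<in> I" for v w using additive_subgroup.a_closed[OF I.is_additive_subgroup that] unfolding Rrec_simps .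
  show "r * v \<in> I" if "r \<in> R" "v \<in> I" for r v using I.I_l_closed[OF that(2), of r] that(1) by simp
 qed
qed

lemma Idl_subset: "RR.submod R I ==> I \<subseteq> R ==> W \<subseteq> I ==> Idl\<^bsub>Rrec\<^esub> W \<subseteq> I"
 unfolding genideal_def using ideal_Rrec by blast

lemma Idl_Rrec:
 assumes "RR.submod R I" "I \<subseteq> R" "W \<subseteq> I" "!!N. RR.submod R N ==> W \<subseteq> N ==> I \<subseteq> N"
 shows "Idl\<^bsub>Rrec\<^esub> W = I"
proof (rule subset_antisym)
 show "Idl\<^bsub>Rrec\<^esub> W \<subseteq> I" by (rule Idl_subset[OF assms(1-3)])
 show "I \<subseteq> Idl\<^bsub>Rrec\<^esub> W" unfolding genideal_def using assms(4)[OF submod_ideal] by blast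
qed

definition coset :: "'r => 'r set" where "coset r = (\<lambda>m. m + r) ` mm"

abbreviation residue_field :: "('r, 'r set) module" where
 "residue_field \<equiv> quotient_module (ring_module Rrec) mm"

lemma coset_eq_iff: "coset r = coset s \<longleftrightarrow> r - s \<in> mm"
proof
 assume "coset r = coset s"
 moreover have "0 + r \<in> coset r" unfolding coset_def by (rule imageI) (rule RR.submod_zero[OF submod_mm])
 ultimately show "r - s \<in> mm" by (auto simp: coset_def)
next
 have sub: "coset r \<subseteq> coset s" if "r - s \<in> mm" for r s
 proof
  fix x assume "x \<in> coset r"
  then obtain m where m: "m \<in> mm" "x = m + r" by (auto simp: coset_def)
  have "x = (m + (r - s)) + s" by (simp add: m(2))
  then show "x \<in> coset s" unfolding coset_def using RR.submod_add[OF submod_mm m(1) that] by blast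
 qed
 assume rs: "r - s \<in> mm"
 then have "s - r \<in> mm" using RR.submod_scale[OF submod_mm R_minus[OF R_one] rs] by simp
 then show "coset r = coset s" using sub[OF rs] sub[of s r] by blast
qed

lemma coset_rcos: "mm +>\<^bsub>ring_module Rrec\<^esub> r = coset r"
 by (auto simp: a_r_coset_def' coset_def)

lemma residue_carrier: "carrier residue_field = coset ` R"
 by (auto simp: quotient_module_def A_RCOSETS_def' coset_rcos)

lemma residue_zero: "\<zero>\<^bsub>residue_field\<^esub> = coset 0"
 by (simp add: quotient_module_def coset_def)

lemma residue_add: "coset r \<oplus>\<^bsub>residue_field\<^esub> coset s = coset (r + s)"
proof -
 have "(\<Union>h\<in>coset r. \<Union>k\<in>coset s. {h + k}) = coset (r + s)"
 proof (rule subset_antisym; rule subsetI)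
  fix x assume "x \<in> (\<Union>h\<in>coset r. \<Union>k\<in>coset s. {h + k})"
  then obtain m n where m: "m \<in> mm" "n \<in> mm" "x = (m + r) + (n + s)" by (auto simp: coset_def)
  then have "x = (m + n) + (r + s)" by (simp add: ac_simps)
  then show "x \<in> coset (r + s)" unfolding coset_def using RR.submod_add[OF submod_mm m(1,2)] by blast
 next
  fix x assume "x \<in> coset (r + s)"
  then obtain m where m: "m \<in> mm" "x = (m + r) + (0 + s)" by (auto simp: coset_def ac_simps)
  then show "x \<in> (\<Union>h\<in>coset r. \<Union>k\<in>coset s. {h + k})"
   unfolding coset_def using RR.submod_zero[OF submod_mm] by blast
 qed
 then show ?thesis by (simp add: quotient_module_def set_add_def')
qed

lemma residue_smult:
 assumes "s \<in> R"
 shows "s \<odot>\<^bsub>residue_field\<^esub> coset r = coset (s * r)"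
proof -
 have "coset (s * x) = coset (s * r)" if x: "x \<in> coset r" for x
 proof -
  obtain m where m: "m \<in> mm" "x = m + r" using x by (auto simp: coset_def)
  have "s * x - s * r = s * m" by (simp add: m(2) distrib_left)
  then show ?thesis using RR.submod_scale[OF submod_mm assms m(1)] by (simp add: coset_eq_iff)
 qed
 moreover have "coset r ~= {}" using RR.submod_zero[OF submod_mm] by (auto simp: coset_def)
 ultimately have "(\<Union>x\<in>coset r. coset (s * x)) = coset (s * r)" by simp
 then show ?thesis by (simp add: quotient_module_def coset_rcos)
qed

lemma coset_emb: "r \<in> R ==> \<exists>a. coset r = coset (emb a)"
 using R_decomp by (simp add: coset_eq_iff)

lemma one_notin_mm: "1 \<notin> mm"
 using cmp_emb[of 1] by (simp add: mm_def)

end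

context canonical_candidate
begin

lemma Idl_take:
 assumes "set xs \<subseteq> R" "i \<le> length xs"
 shows "Idl\<^bsub>Rrec\<^esub> (set (take i xs)) = S.Nth {0} (\<lambda>j. xs ! j) i"
proof -
 have "RR.submod R (S.Nth {0} (\<lambda>j. xs ! j) i) \<and> S.Nth {0} (\<lambda>j. xs ! j) i \<subseteq> R \<and>
   set (take i xs) \<subseteq> S.Nth {0} (\<lambda>j. xs ! j) i \<and>
   (\<forall>N. RR.submod R N --> set (take i xs) \<subseteq> N --> S.Nth {0} (\<lambda>j. xs ! j) i \<subseteq> N)"
  using assms(2)
 proof (induction i)
  case 0
  have "RR.submod R {0}" by (rule RR.submodI) simp_all
  then show ?case using RR.submod_zero by auto
 next
  case (Suc i)
  let ?N = "S.Nth {0} (\<lambda>j. xs ! j) i" and ?x = "xs ! i"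
  have x: "?x \<in> R" using Suc.prems assms(1) by auto
  have IH: "RR.submod R ?N" "?N \<subseteq> R" "set (take i xs) \<subseteq> ?N"
   "!!N. RR.submod R N ==> set (take i xs) \<subseteq> N ==> ?N \<subseteq> N" using Suc by simp_all
  have t: "set (take (Suc i) xs) = insert ?x (set (take i xs))"
   using Suc.prems by (simp add: take_Suc_conv_app_nth)
  have A: "S.addmul ?N ?x = {n + ?x * v | n v. n \<in> ?N \<and> v \<in> R}" by (rule S.addmul_def)
  have "set (take i xs) \<subseteq> S.addmul ?N ?x"
  proof
   fix y assume "y \<in> set (take i xs)"
   then have "y = y + ?x * 0" "y \<in> ?N" using IH(3) by auto
   then show "y \<in> S.addmul ?N ?x" unfolding A using R_zero by blast
  qed
  moreover have "?x \<in> S.addmul ?N ?x"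
  proof -
   have "?x = 0 + ?x * 1" by simp
   then show ?thesis unfolding A using RR.submod_zero[OF IH(1)] R_one by blast
  qed
  moreover have "S.addmul ?N ?x \<subseteq> N" if N: "RR.submod R N" "set (take (Suc i) xs) \<subseteq> N" for N
  proof
   fix y assume "y \<in> S.addmul ?N ?x"
   then obtain n v where y: "y = n + v * ?x" "n \<in> ?N" "v \<in> R" unfolding A by (auto simp: mult.commute)
   have "n \<in> N" using IH(4)[OF N(1)] N(2) y(2) unfolding t by blast
   moreover have "v * ?x \<in> N" using RR.submod_scale[OF N(1) y(3)] N(2) unfolding t by blast
   ultimately show "y \<in> N" unfolding y(1) by (rule RR.submod_add[OF N(1)])
  qed
  ultimately show ?case
   using S.submod_addmul[OF IH(1) x] S.addmul_subset_L[OF IH(2) x] unfolding t S.Nth.simps by blast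
 qed
 then show ?thesis by (intro Idl_Rrec) blast+
qed

text \<open>The depth is a supremum of natural numbers, so some regular sequence is longer than any \<open>i < d\<close>.\<close>

lemma depth_vanishing:
 assumes "cohen_macaulay Rrec mm" "krull_dim Rrec = enat d" "i < d"
 shows "S.coh_le {0} i 0"
proof -
 have "enat i < depth Rrec mm" using assms by (simp add: cohen_macaulay_def)
 then obtain xs where xs: "i < length xs" "regular_sequence Rrec xs" "set xs \<subseteq> mm"
  unfolding depth_def less_Sup_iff by auto
 have R: "set xs \<subseteq> R" using xs(3) mm_R by blast
 show ?thesis
 proof (rule S.coh_zero_of_regular_sequence[where x = "\<lambda>j. xs ! j" and n = "length xs"])
  show "RR.submod R {0}" by (rule RR.submodI) simp_all
  show "S.regular (S.Nth {0} (\<lambda>j. xs ! j) j) (xs ! j)" if j: "j < length xs" for j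
  proof -
   have "\<forall>a\<in>R. xs ! j * a \<in> Idl\<^bsub>Rrec\<^esub> (set (take j xs)) --> a \<in> Idl\<^bsub>Rrec\<^esub> (set (take j xs))"
    using xs(2) j unfolding regular_sequence_def Rrec_simps by blast
   then show ?thesis unfolding S.regular_def Idl_take[OF R less_imp_le[OF j]] .
  qed
 qed (use xs in auto)
qed

end

section \<open>Free resolutions of the residue field\<close>

context graded_domain
begin

abbreviation free :: "nat => ('r, nat => 'r) module" where "free m \<equiv> free_module Rrec m"

lemma free_simps [simp]:
 "carrier (free m) = {..<m} \<rightarrow>\<^sub>E R" "\<zero>\<^bsub>free m\<^esub> = (\<lambda>j\<in>{..<m}. 0)"
 "x \<oplus>\<^bsub>free m\<^esub> y = (\<lambda>j\<in>{..<m}. x j + y j)" "r \<odot>\<^bsub>free m\<^esub> x = (\<lambda>j\<in>{..<m}. r * x j)"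
 by (simp_all add: free_module_def)

definition basis :: "nat => nat => nat => 'r" where
 "basis m k = (\<lambda>j\<in>{..<m}. if j = k then 1 else 0)"

lemma basis_carrier: "basis m k \<in> {..<m} \<rightarrow>\<^sub>E R"
 by (auto simp: basis_def)

lemma sum_basis: "k < m ==> (\<Sum>j<m. basis m k j * y j) = y k"
proof -
 assume k: "k < m"
 have "(\<Sum>j<m. basis m k j * y j) = (\<Sum>j<m. if j = k then y j else 0)"
  by (rule sum.cong) (auto simp: basis_def)
 then show ?thesis using k by simp
qed

lemma free_nth: "x \<in> {..<m} \<rightarrow>\<^sub>E R ==> j < m ==> x j \<in> R"
 by (auto dest: PiE_mem)

lemma free_ext:
 assumes "x \<in> {..<m} \<rightarrow>\<^sub>E A" "y \<in> {..<m} \<rightarrow>\<^sub>E B" "!!j. j < m ==> x j = y j"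
 shows "x = y"
 using assms by (intro extensionalityI[of x "{..<m}" y]) (auto simp: PiE_def)

lemma mod_homI:
 assumes "f \<in> extensional (carrier M)" "!!x. x \<in> carrier M ==> f x \<in> carrier N"
  and "!!x y. x \<in> carrier M ==> y \<in> carrier M ==> f (x \<oplus>\<^bsub>M\<^esub> y) = f x \<oplus>\<^bsub>N\<^esub> f y"
  and "!!r x. r \<in> carrier A ==> x \<in> carrier M ==> f (r \<odot>\<^bsub>M\<^esub> x) = r \<odot>\<^bsub>N\<^esub> f x"
 shows "f \<in> mod_hom A M N"
 using assms unfolding mod_hom_def by (auto simp: PiE_def)

lemma mod_homD:
 assumes "f \<in> mod_hom A M N"
 shows "f \<in> extensional (carrier M)" "!!x. x \<in> carrier M ==> f x \<in> carrier N"
  "!!x y. x \<in> carrier M ==> y \<in> carrier M ==> f (x \<oplus>\<^bsub>M\<^esub> y) = f x \<oplus>\<^bsub>N\<^esub> f y"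
  "!!r x. r \<in> carrier A ==> x \<in> carrier M ==> f (r \<odot>\<^bsub>M\<^esub> x) = r \<odot>\<^bsub>N\<^esub> f x"
 using assms unfolding mod_hom_def by (auto simp: PiE_def Pi_def)

text \<open>By induction on the number of leading coordinates that may be nonzero.\<close>

lemma free_hom_eqI:
 assumes null: "!!c. c \<in> carrier C ==> 0 \<odot>\<^bsub>C\<^esub> c = \<zero>\<^bsub>C\<^esub>"
  and f: "f \<in> mod_hom Rrec (free m) C" and g: "g \<in> mod_hom Rrec (free m) C"
  and eq: "!!k. k < m ==> f (basis m k) = g (basis m k)"
 shows "f = g"
proof -
 have val: "f x = g x" if "x \<in> {..<m} \<rightarrow>\<^sub>E R" "\<forall>j<m. k \<le> j --> x j = 0" for x k
  using that
 proof (induction k arbitrary: x)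
  case 0
  have x0: "0 \<odot>\<^bsub>free m\<^esub> x = x"
   by (rule free_ext[of _ m R _ R]) (use 0 in auto)
  have x: "x \<in> carrier (free m)" using 0(1) by simp
  have "f x = \<zero>\<^bsub>C\<^esub>" using mod_homD(4)[OF f _ x, of 0] null[OF mod_homD(2)[OF f x]] unfolding x0 by simp
  moreover have "g x = \<zero>\<^bsub>C\<^esub>" using mod_homD(4)[OF g _ x, of 0] null[OF mod_homD(2)[OF g x]] unfolding x0 by simp
  ultimately show ?case by simp
 next
  case (Suc k)
  show ?case
  proof (cases "k < m")
   case False
   then show ?thesis using Suc by auto
  next
   case True
   define x' where "x' = (\<lambda>j\<in>{..<m}. if j = k then 0 else x j)"
   have x': "x' \<in> carrier (free m)" using free_nth[OF Suc.prems(1)] by (auto simp: x'_def)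
   have xk: "x k \<in> R" by (rule free_nth[OF Suc.prems(1) True])
   have b: "basis m k \<in> carrier (free m)" using basis_carrier by simp
   have xb: "x k \<odot>\<^bsub>free m\<^esub> basis m k \<in> carrier (free m)"
    using xk by (auto simp: basis_def)
   have x: "x = x' \<oplus>\<^bsub>free m\<^esub> (x k \<odot>\<^bsub>free m\<^esub> basis m k)"
    by (rule free_ext[OF Suc.prems(1), where B = R])
     (use x' xb free_nth[OF Suc.prems(1)] in \<open>auto simp: x'_def basis_def\<close>)
   have IH: "f x' = g x'"
    by (rule Suc.IH) (use x' Suc.prems in \<open>auto simp: x'_def\<close>)
   have "f x = f x' \<oplus>\<^bsub>C\<^esub> (x k \<odot>\<^bsub>C\<^esub> f (basis m k))"
    by (subst x) (use mod_homD(3)[OF f x' xb] mod_homD(4)[OF f _ b, of "x k"] xk in simp)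
   moreover have "g x = g x' \<oplus>\<^bsub>C\<^esub> (x k \<odot>\<^bsub>C\<^esub> g (basis m k))"
    by (subst x) (use mod_homD(3)[OF g x' xb] mod_homD(4)[OF g _ b, of "x k"] xk in simp)
   ultimately show ?thesis by (simp add: IH eq[OF True])
  qed
 qed
 show "f = g"
 proof (rule extensionalityI[OF mod_homD(1)[OF f] mod_homD(1)[OF g]])
  fix x assume "x \<in> carrier (free m)"
  then show "f x = g x" using val[of x m] by simp
 qed
qed

definition matrix_map :: "nat => nat => (nat => nat => 'r) => (nat => 'r) => nat => 'r" where
 "matrix_map m n M = (\<lambda>x\<in>{..<m} \<rightarrow>\<^sub>E R. \<lambda>j\<in>{..<n}. \<Sum>k<m. x k * M k j)"

definition residue_map :: "nat => (nat => 'k) => (nat => 'r) => 'r set" where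
 "residue_map m c = (\<lambda>x\<in>{..<m} \<rightarrow>\<^sub>E R. coset (\<Sum>k<m. x k * emb (c k)))"

lemma matrix_map_nth: "y \<in> {..<m} \<rightarrow>\<^sub>E R ==> j < n ==> matrix_map m n M y j = (\<Sum>k<m. y k * M k j)"
 by (simp add: matrix_map_def)

lemma free_add_in: "x \<in> {..<m} \<rightarrow>\<^sub>E R ==> y \<in> {..<m} \<rightarrow>\<^sub>E R ==> (\<lambda>j\<in>{..<m}. x j + y j) \<in> {..<m} \<rightarrow>\<^sub>E R"
 by (rule restrict_PiE_iff[THEN iffD2]) (blast intro: R_add dest: free_nth)

lemma free_smult_in: "r \<in> R ==> y \<in> {..<m} \<rightarrow>\<^sub>E R ==> (\<lambda>j\<in>{..<m}. r * y j) \<in> {..<m} \<rightarrow>\<^sub>E R"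
 by (rule restrict_PiE_iff[THEN iffD2]) (blast intro: R_mult dest: free_nth)

lemma sum_free_add: "(\<Sum>k<m. (\<lambda>j\<in>{..<m}. x j + y j) k * (a k :: 'r)) = (\<Sum>k<m. x k * a k) + (\<Sum>k<m. y k * a k)"
proof -
 have "(\<Sum>k<m. (\<lambda>j\<in>{..<m}. x j + y j) k * a k) = (\<Sum>k<m. x k * a k + y k * a k)"
  by (rule sum.cong) (simp_all add: distrib_right)
 then show ?thesis by (simp only: sum.distrib)
qed

lemma sum_free_smult: "(\<Sum>k<m. (\<lambda>j\<in>{..<m}. r * x j) k * (a k :: 'r)) = r * (\<Sum>k<m. x k * a k)"
proof -
 have "(\<Sum>k<m. (\<lambda>j\<in>{..<m}. r * x j) k * a k) = (\<Sum>k<m. r * (x k * a k))"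
  by (rule sum.cong) simp_all
 then show ?thesis by (simp only: sum_distrib_left)
qed

lemma matrix_map_hom:
 assumes M: "!!k j. k < m ==> j < n ==> M k j \<in> R"
 shows "matrix_map m n M \<in> mod_hom Rrec (free m) (free n)"
proof (rule mod_homI; (unfold free_simps Rrec_simps)?)
 show "matrix_map m n M \<in> extensional ({..<m} \<rightarrow>\<^sub>E R)" unfolding matrix_map_def by (rule restrict_extensional)
 fix x assume x: "x \<in> {..<m} \<rightarrow>\<^sub>E R"
 show "matrix_map m n M x \<in> {..<n} \<rightarrow>\<^sub>E R"
  unfolding matrix_map_def restrict_apply'[OF x] restrict_PiE_iff
  by (intro ballI R_sum R_mult free_nth[OF x] M) simp_all
 show "matrix_map m n M (\<lambda>j\<in>{..<m}. x j + y j) = (\<lambda>j\<in>{..<n}. matrix_map m n M x j + matrix_map m n M y j)"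
  if y: "y \<in> {..<m} \<rightarrow>\<^sub>E R" for y
  unfolding matrix_map_def restrict_apply'[OF x] restrict_apply'[OF y] restrict_apply'[OF free_add_in[OF x y]] sum_free_add
  by (rule restrict_ext) simp
 show "matrix_map m n M (\<lambda>j\<in>{..<m}. r * x j) = (\<lambda>j\<in>{..<n}. r * matrix_map m n M x j)" if r: "r \<in> R" for r
  unfolding matrix_map_def restrict_apply'[OF x] restrict_apply'[OF free_smult_in[OF r x]] sum_free_smult
  by (rule restrict_ext) simp
qed

lemma residue_map_hom: "residue_map m c \<in> mod_hom Rrec (free m) residue_field"
proof (rule mod_homI; (unfold free_simps Rrec_simps residue_carrier)?)
 show "residue_map m c \<in> extensional ({..<m} \<rightarrow>\<^sub>E R)" unfolding residue_map_def by (rule restrict_extensional)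
 fix x assume x: "x \<in> {..<m} \<rightarrow>\<^sub>E R"
 show "residue_map m c x \<in> coset ` R"
  unfolding residue_map_def restrict_apply'[OF x] by (intro imageI R_sum R_mult free_nth[OF x] emb_R) simp_all
 show "residue_map m c (\<lambda>j\<in>{..<m}. x j + y j) = residue_map m c x \<oplus>\<^bsub>residue_field\<^esub> residue_map m c y"
  if y: "y \<in> {..<m} \<rightarrow>\<^sub>E R" for y
  unfolding residue_map_def restrict_apply'[OF x] restrict_apply'[OF y] restrict_apply'[OF free_add_in[OF x y]]
   sum_free_add residue_add ..
 show "residue_map m c (\<lambda>j\<in>{..<m}. r * x j) = r \<odot>\<^bsub>residue_field\<^esub> residue_map m c x" if r: "r \<in> R" for r
  unfolding residue_map_def restrict_apply'[OF x] restrict_apply'[OF free_smult_in[OF r x]]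
   sum_free_smult residue_smult[OF r] ..
qed

lemma free_hom_matrix:
 assumes f: "f \<in> mod_hom Rrec (free m) (free n)"
 shows "f = matrix_map m n (\<lambda>k. f (basis m k))"
proof (rule free_hom_eqI[OF _ f matrix_map_hom])
 have b: "f (basis m k) \<in> {..<n} \<rightarrow>\<^sub>E R" for k
  using mod_homD(2)[OF f, of "basis m k"] basis_carrier by simp
 show "f (basis m k) j \<in> R" if "k < m" "j < n" for k j by (rule free_nth[OF b that(2)])
 show "0 \<odot>\<^bsub>free n\<^esub> c = \<zero>\<^bsub>free n\<^esub>" for c by simp
 show "f (basis m k) = matrix_map m n (\<lambda>k. f (basis m k)) (basis m k)" if k: "k < m" for k
 proof (rule free_ext[OF b, where B = UNIV])
  show "f (basis m k) j = matrix_map m n (\<lambda>k. f (basis m k)) (basis m k) j" if "j < n" for j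
   unfolding matrix_map_nth[OF basis_carrier that] sum_basis[OF k] ..
  show "matrix_map m n (\<lambda>k. f (basis m k)) (basis m k) \<in> {..<n} \<rightarrow>\<^sub>E UNIV"
   unfolding matrix_map_def restrict_apply'[OF basis_carrier] by simp
 qed
qed

lemma residue_smult_zero: "c \<in> carrier residue_field ==> 0 \<odot>\<^bsub>residue_field\<^esub> c = \<zero>\<^bsub>residue_field\<^esub>"
 unfolding residue_carrier residue_zero using residue_smult[OF R_zero] by auto

lemma free_hom_residue:
 assumes f: "f \<in> mod_hom Rrec (free m) residue_field"
 shows "\<exists>c. f = residue_map m c"
proof -
 have "\<exists>a. f (basis m k) = coset (emb a)" for k
  using mod_homD(2)[OF f, of "basis m k"] basis_carrier coset_emb unfolding residue_carrier by auto
 then have "\<forall>k. \<exists>a. f (basis m k) = coset (emb a)" by blast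
 from choice[OF this] obtain c where c: "\<forall>k. f (basis m k) = coset (emb (c k))" ..
 have "f = residue_map m c"
 proof (rule free_hom_eqI[OF residue_smult_zero f residue_map_hom])
  show "f (basis m k) = residue_map m c (basis m k)" if "k < m" for k
   unfolding residue_map_def restrict_apply'[OF basis_carrier] sum_basis[OF that] using c by blast
 qed
 then show ?thesis by (rule exI[of _ c])
qed

lemma free_resolution_iff:
 "free_resolution Rrec residue_field b d e \<longleftrightarrow>
  e \<in> mod_hom Rrec (free (b 0)) residue_field \<and> (\<forall>i. d i \<in> mod_hom Rrec (free (b (Suc i))) (free (b i))) \<and>
  e ` ({..<b 0} \<rightarrow>\<^sub>E R) = coset ` R \<and>
  d 0 ` ({..<b 1} \<rightarrow>\<^sub>E R) = {x \<in> {..<b 0} \<rightarrow>\<^sub>E R. e x = coset 0} \<and>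
  (\<forall>i. d (Suc i) ` ({..<b (Suc (Suc i))} \<rightarrow>\<^sub>E R) =
   {x \<in> {..<b (Suc i)} \<rightarrow>\<^sub>E R. d i x = (\<lambda>j\<in>{..<b i}. 0)})"
 unfolding free_resolution_def Let_def free_simps residue_carrier residue_zero ..

lemma matrix_map_zero_iff:
 assumes "x \<in> {..<m} \<rightarrow>\<^sub>E R"
 shows "matrix_map m n M x = (\<lambda>j\<in>{..<n}. 0) \<longleftrightarrow> (\<forall>j<n. (\<Sum>k<m. x k * M k j) = 0)"
 unfolding matrix_map_def restrict_apply'[OF assms]
 by (auto simp: fun_eq_iff restrict_def)

lemma residue_map_zero_iff:
 assumes "x \<in> {..<m} \<rightarrow>\<^sub>E R"
 shows "residue_map m c x = coset 0 \<longleftrightarrow> (\<Sum>k<m. x k * emb (c k)) \<in> mm"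
 unfolding residue_map_def restrict_apply'[OF assms] coset_eq_iff diff_zero ..

lemma matrix_map_eqI:
 assumes "y \<in> {..<m} \<rightarrow>\<^sub>E R" "x \<in> {..<n} \<rightarrow>\<^sub>E R" "!!j. j < n ==> x j = (\<Sum>k<m. y k * M k j)"
 shows "x = matrix_map m n M y"
 by (rule free_ext[OF assms(2), where B = UNIV])
  (simp_all add: matrix_map_def assms)

lemma restrict_free: "(\<forall>j<m. a j \<in> R) ==> restrict a {..<m} \<in> {..<m} \<rightarrow>\<^sub>E R"
 unfolding restrict_PiE_iff by simp

lemma sum_restrict: "(\<Sum>k<m. restrict a {..<m} k * (y k :: 'r)) = (\<Sum>k<m. a k * y k)"
 by (rule sum.cong) simp_all

lemma free_resolution_exists: "\<exists>b d e. free_resolution Rrec residue_field b d e"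
proof -
 obtain b D c where "residue_resolution emb R cmp X b D c" and b0: "b 0 = 1" and c0: "c 0 = 1"
  using residue_resolution_exists by blast
 then interpret rr: residue_resolution emb R cmp X b D c by blast
 let ?d = "\<lambda>i. matrix_map (b (Suc i)) (b i) (D i)" and ?e = "residue_map (b 0) c"
 have dhom: "?d i \<in> mod_hom Rrec (free (b (Suc i))) (free (b i))" for i
  by (rule matrix_map_hom) (rule rr.D_R)
 have dcar: "?d i y \<in> {..<b i} \<rightarrow>\<^sub>E R" if "y \<in> {..<b (Suc i)} \<rightarrow>\<^sub>E R" for i y
  using mod_homD(2)[OF dhom, of y i] that by simp
 have swap: "(\<Sum>k<n. (\<Sum>l<m. y l * M l k) * t k) = (\<Sum>l<m. y l * (\<Sum>k<n. M l k * t k))"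
  for n m and y :: "nat => 'r" and M and t :: "nat => 'r"
 proof -
  have "(\<Sum>k<n. (\<Sum>l<m. y l * M l k) * t k) = (\<Sum>k<n. \<Sum>l<m. y l * (M l k * t k))"
   by (simp only: sum_distrib_right mult.assoc)
  also have "... = (\<Sum>l<m. \<Sum>k<n. y l * (M l k * t k))" by (rule sum.swap)
  finally show ?thesis by (simp only: sum_distrib_left)
 qed
 have "free_resolution Rrec residue_field b ?d ?e"
  unfolding free_resolution_iff
 proof (intro conjI allI)
  show "?e \<in> mod_hom Rrec (free (b 0)) residue_field" by (rule residue_map_hom)
  show "?d i \<in> mod_hom Rrec (free (b (Suc i))) (free (b i))" for i by (rule dhom)
  show "?e ` ({..<b 0} \<rightarrow>\<^sub>E R) = coset ` R"
  proof (rule subset_antisym; rule subsetI)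
   fix X assume "X \<in> ?e ` ({..<b 0} \<rightarrow>\<^sub>E R)"
   then show "X \<in> coset ` R" using mod_homD(2)[OF residue_map_hom] unfolding free_simps residue_carrier by blast
  next
   fix X assume "X \<in> coset ` R"
   then obtain r where r: "r \<in> R" "X = coset r" by blast
   have m: "(\<lambda>j\<in>{..<b 0}. r) \<in> {..<b 0} \<rightarrow>\<^sub>E R" using r(1) by (intro restrict_free) simp
   have "?e (\<lambda>j\<in>{..<b 0}. r) = X" unfolding residue_map_def restrict_apply'[OF m] by (simp add: b0 c0 r(2))
   then show "X \<in> ?e ` ({..<b 0} \<rightarrow>\<^sub>E R)" using m by blast
  qed
  show "?d 0 ` ({..<b 1} \<rightarrow>\<^sub>E R) = {x \<in> {..<b 0} \<rightarrow>\<^sub>E R. ?e x = coset 0}"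
  proof (rule subset_antisym; rule subsetI)
   fix x assume "x \<in> ?d 0 ` ({..<b 1} \<rightarrow>\<^sub>E R)"
   then obtain y where y: "y \<in> {..<b (Suc 0)} \<rightarrow>\<^sub>E R" "x = ?d 0 y" by auto
   have "(\<Sum>k<b 0. x k * emb (c k)) = (\<Sum>k<b 0. (\<Sum>l<b (Suc 0). y l * D 0 l k) * emb (c k))"
    unfolding y(2) by (rule sum.cong) (simp_all add: matrix_map_nth[OF y(1)])
   also have "... \<in> mm"
    unfolding swap
    by (intro RR.submod_sum[OF submod_mm] RR.submod_scale[OF submod_mm] free_nth[OF y(1)] rr.aug) simp_all
   finally show "x \<in> {x \<in> {..<b 0} \<rightarrow>\<^sub>E R. ?e x = coset 0}"
    using residue_map_zero_iff dcar[OF y(1)] unfolding y(2) by blast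
  next
   fix x assume "x \<in> {x \<in> {..<b 0} \<rightarrow>\<^sub>E R. ?e x = coset 0}"
   then have x: "x \<in> {..<b 0} \<rightarrow>\<^sub>E R" "(\<Sum>k<b 0. x k * emb (c k)) \<in> mm" using residue_map_zero_iff by blast+
   obtain y where y: "\<forall>k<b 1. y k \<in> R" "\<forall>j<b 0. x j = (\<Sum>k<b 1. y k * D 0 k j)"
    using rr.aug_exact[OF free_nth[OF x(1)] x(2)] by blast
   have "x = ?d 0 (restrict y {..<b 1})"
    using y(2) by (intro matrix_map_eqI x(1)) (simp_all only: One_nat_def[symmetric] restrict_free[OF y(1)] sum_restrict)
   then show "x \<in> ?d 0 ` ({..<b 1} \<rightarrow>\<^sub>E R)" using restrict_free[OF y(1)] by blast
  qed
  fix i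
  show "?d (Suc i) ` ({..<b (Suc (Suc i))} \<rightarrow>\<^sub>E R) = {x \<in> {..<b (Suc i)} \<rightarrow>\<^sub>E R. ?d i x = (\<lambda>j\<in>{..<b i}. 0)}"
  proof (rule subset_antisym; rule subsetI)
   fix x assume "x \<in> ?d (Suc i) ` ({..<b (Suc (Suc i))} \<rightarrow>\<^sub>E R)"
   then obtain y where y: "y \<in> {..<b (Suc (Suc i))} \<rightarrow>\<^sub>E R" "x = ?d (Suc i) y" by auto
   have "(\<Sum>k<b (Suc i). x k * D i k j) = 0" if j: "j < b i" for j
   proof -
    have "(\<Sum>k<b (Suc i). x k * D i k j) = (\<Sum>k<b (Suc i). (\<Sum>l<b (Suc (Suc i)). y l * D (Suc i) l k) * D i k j)"
     unfolding y(2) by (rule sum.cong) (simp_all add: matrix_map_nth[OF y(1)])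
    also have "... = (\<Sum>l<b (Suc (Suc i)). y l * 0)"
     unfolding swap by (rule sum.cong) (simp_all add: rr.complex[OF _ j])
    finally show ?thesis by simp
   qed
   then show "x \<in> {x \<in> {..<b (Suc i)} \<rightarrow>\<^sub>E R. ?d i x = (\<lambda>j\<in>{..<b i}. 0)}"
    using matrix_map_zero_iff dcar[OF y(1)] unfolding y(2) by blast
  next
   fix x assume "x \<in> {x \<in> {..<b (Suc i)} \<rightarrow>\<^sub>E R. ?d i x = (\<lambda>j\<in>{..<b i}. 0)}"
   then have x: "x \<in> {..<b (Suc i)} \<rightarrow>\<^sub>E R" "\<forall>j<b i. (\<Sum>k<b (Suc i). x k * D i k j) = 0"
    using matrix_map_zero_iff by blast+
   obtain y where y: "\<forall>k<b (Suc (Suc i)). y k \<in> R"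
    "\<forall>j<b (Suc i). x j = (\<Sum>k<b (Suc (Suc i)). y k * D (Suc i) k j)"
    using rr.exact[of i x, OF free_nth[OF x(1)]] x(2) by blast
   have "x = ?d (Suc i) (restrict y {..<b (Suc (Suc i))})"
    using y(2) by (intro matrix_map_eqI x(1)) (simp_all only: restrict_free[OF y(1)] sum_restrict)
   then show "x \<in> ?d (Suc i) ` ({..<b (Suc (Suc i))} \<rightarrow>\<^sub>E R)" using restrict_free[OF y(1)] by blast
  qed
 qed
 then show ?thesis by blast
qed

text \<open>
 The matrices consist of the images of the basis vectors; every class in the residue field contains
 a constant \<open>emb a\<close>, which gives the scalars \<open>c\<close> of the augmentation.
\<close>

lemma residue_resolution_of_free_resolution:
 assumes "free_resolution Rrec residue_field b d e"
 shows "\<exists>D c. residue_resolution emb R cmp X b D c \<and> (\<forall>i. d i = matrix_map (b (Suc i)) (b i) (D i))"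
proof -
 note res = assms[unfolded free_resolution_iff]
 have e: "e \<in> mod_hom Rrec (free (b 0)) residue_field" by (rule conjunct1[OF res])
 note res = conjunct2[OF res]
 have d: "d i \<in> mod_hom Rrec (free (b (Suc i))) (free (b i))" for i by (rule spec[OF conjunct1[OF res]])
 note res = conjunct2[OF res]
 have surj: "e ` ({..<b 0} \<rightarrow>\<^sub>E R) = coset ` R" by (rule conjunct1[OF res])
 note res = conjunct2[OF res]
 have ex0: "d 0 ` ({..<b 1} \<rightarrow>\<^sub>E R) = {x \<in> {..<b 0} \<rightarrow>\<^sub>E R. e x = coset 0}" by (rule conjunct1[OF res])
 have ex: "d (Suc i) ` ({..<b (Suc (Suc i))} \<rightarrow>\<^sub>E R) = {x \<in> {..<b (Suc i)} \<rightarrow>\<^sub>E R. d i x = (\<lambda>j\<in>{..<b i}. 0)}"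
  for i by (rule spec[OF conjunct2[OF res]])
 obtain c where c: "e = residue_map (b 0) c" using free_hom_residue[OF e] by blast
 define D where "D i k = d i (basis (b (Suc i)) k)" for i k
 have dD: "d i = matrix_map (b (Suc i)) (b i) (D i)" for i
  unfolding D_def by (rule free_hom_matrix[OF d])
 have DR: "D i k \<in> {..<b i} \<rightarrow>\<^sub>E R" for i k
  using mod_homD(2)[OF d, of "basis (b (Suc i)) k" i] basis_carrier unfolding D_def by simp
 have "residue_resolution emb R cmp X b D c"
 proof
  show "D i k j \<in> R" if "k < b (Suc i)" "j < b i" for i k j by (rule free_nth[OF DR that(2)])
  show "(\<Sum>j<b 0. D 0 k j * emb (c j)) \<in> mm" if "k < b 1" for k
  proof -
   have "D 0 k \<in> d 0 ` ({..<b 1} \<rightarrow>\<^sub>E R)" unfolding D_def One_nat_def by (rule imageI) (rule basis_carrier)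
   then have "e (D 0 k) = coset 0" unfolding ex0 by blast
   then show ?thesis unfolding c residue_map_zero_iff[OF DR] .
  qed
  show "\<exists>j<b 0. c j ~= 0"
  proof (rule ccontr)
   assume "\<not> (\<exists>j<b 0. c j ~= 0)"
   then have c0: "c j = 0" if "j < b 0" for j using that by blast
   have "coset 1 \<in> e ` ({..<b 0} \<rightarrow>\<^sub>E R)" unfolding surj by (rule imageI) (rule R_one)
   then obtain x where x: "x \<in> {..<b 0} \<rightarrow>\<^sub>E R" "coset 1 = e x" by blast
   have "emb 0 = 0" using emb_add[of 0 0] by simp
   then have "(\<Sum>k<b 0. x k * emb (c k)) = 0" by (intro sum.neutral) (simp add: c0)
   then have "coset 1 = coset 0" using x unfolding c residue_map_def by simp
   then show False using one_notin_mm by (simp add: coset_eq_iff)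
  qed
  show "\<exists>y. (\<forall>k<b 1. y k \<in> R) \<and> (\<forall>j<b 0. a j = (\<Sum>k<b 1. y k * D 0 k j))"
   if a: "!!j. j < b 0 ==> a j \<in> R" "(\<Sum>j<b 0. a j * emb (c j)) \<in> mm" for a
  proof -
   have x: "restrict a {..<b 0} \<in> {..<b 0} \<rightarrow>\<^sub>E R" using a(1) by (intro restrict_free) blast
   have "e (restrict a {..<b 0}) = coset 0"
    unfolding c residue_map_zero_iff[OF x] sum_restrict by (rule a(2))
   then have "restrict a {..<b 0} \<in> d 0 ` ({..<b 1} \<rightarrow>\<^sub>E R)" unfolding ex0 using x by blast
   then obtain y where y: "y \<in> {..<b (Suc 0)} \<rightarrow>\<^sub>E R" "restrict a {..<b 0} = d 0 y" by auto
   have "a j = (\<Sum>k<b 1. y k * D 0 k j)" if "j < b 0" for j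
    using fun_cong[OF y(2), of j] that unfolding dD matrix_map_nth[OF y(1) that] by simp
   then show ?thesis using free_nth[OF y(1)] by (intro exI[of _ y]) simp
  qed
  show "(\<Sum>k<b (Suc i). D (Suc i) l k * D i k j) = 0" if "l < b (Suc (Suc i))" "j < b i" for i l j
  proof -
   have "D (Suc i) l \<in> d (Suc i) ` ({..<b (Suc (Suc i))} \<rightarrow>\<^sub>E R)" unfolding D_def by (rule imageI) (rule basis_carrier)
   then have "d i (D (Suc i) l) = (\<lambda>j\<in>{..<b i}. 0)" unfolding ex by blast
   then show ?thesis unfolding dD[of i] matrix_map_zero_iff[OF DR] using that(2) by blast
  qed
  show "\<exists>y. (\<forall>l<b (Suc (Suc i)). y l \<in> R) \<and> (\<forall>k<b (Suc i). a k = (\<Sum>l<b (Suc (Suc i)). y l * D (Suc i) l k))"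
   if a: "!!k. k < b (Suc i) ==> a k \<in> R" "!!j. j < b i ==> (\<Sum>k<b (Suc i). a k * D i k j) = 0" for i a
  proof -
   have x: "restrict a {..<b (Suc i)} \<in> {..<b (Suc i)} \<rightarrow>\<^sub>E R" using a(1) by (intro restrict_free) blast
   have "d i (restrict a {..<b (Suc i)}) = (\<lambda>j\<in>{..<b i}. 0)"
    unfolding dD[of i] matrix_map_zero_iff[OF x] sum_restrict using a(2) by blast
   then have "restrict a {..<b (Suc i)} \<in> d (Suc i) ` ({..<b (Suc (Suc i))} \<rightarrow>\<^sub>E R)" unfolding ex using x by blast
   then obtain y where y: "y \<in> {..<b (Suc (Suc i))} \<rightarrow>\<^sub>E R" "restrict a {..<b (Suc i)} = d (Suc i) y" by auto
   have "a k = (\<Sum>l<b (Suc (Suc i)). y l * D (Suc i) l k)" if "k < b (Suc i)" for k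
    using fun_cong[OF y(2), of k] that unfolding dD matrix_map_nth[OF y(1) that] by simp
   then show ?thesis using free_nth[OF y(1)] by (intro exI[of _ y]) simp
  qed
 qed
 then show ?thesis using dD by blast
qed

lemma chosen_resolution:
 "\<exists>b D c. residue_resolution emb R cmp X b D c \<and>
   (SOME (b, d). \<exists>e. free_resolution Rrec residue_field b d e) = (b, \<lambda>i. matrix_map (b (Suc i)) (b i) (D i))"
proof -
 obtain b d where bd: "(SOME (b, d). \<exists>e. free_resolution Rrec residue_field b d e) = (b, d)"
  by (cases "SOME (b, d). \<exists>e. free_resolution Rrec residue_field b d e")
 have "case (SOME (b, d). \<exists>e. free_resolution Rrec residue_field b d e) of (b, d) => \<exists>e. free_resolution Rrec residue_field b d e"
  by (rule someI_ex) (use free_resolution_exists in auto)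
 then obtain e where "free_resolution Rrec residue_field b d e" unfolding bd by auto
 then obtain D c where D: "residue_resolution emb R cmp X b D c" "\<forall>i. d i = matrix_map (b (Suc i)) (b i) (D i)"
  using residue_resolution_of_free_resolution by blast
 have "d = (\<lambda>i. matrix_map (b (Suc i)) (b i) (D i))" using D(2) by auto
 then show ?thesis using D(1) bd by auto
qed

end

section \<open>Ext modules in terms of cochains of representatives\<close>

text \<open>
 A module \<open>C\<close> presented as the image of \<open>L\<close> under \<open>\<tau>\<close>. Homomorphisms from free modules to \<open>C\<close>
 are then given by tuples of elements of \<open>L\<close>, and this identifies \<open>Ext(k, C)\<close> with the cohomology
 with values in \<open>L\<close> modulo the kernel of \<open>\<tau>\<close>.
\<close>

locale presented_module = graded_module_resolution emb R cmp X scale L prj E b D c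
 for emb :: "'k::field => 'r::idom" and R cmp X
  and scale :: "'r => 'v::ab_group_add => 'v" (infixr "*s" 75)
  and L prj E b D c +
 fixes C :: "('r, 'm) module" and \<tau> :: "'v => 'm"
 assumes C: "Module.module Rrec C"
  and \<tau>_add: "v \<in> L ==> w \<in> L ==> \<tau> (v + w) = \<tau> v \<oplus>\<^bsub>C\<^esub> \<tau> w"
  and \<tau>_scale: "r \<in> R ==> v \<in> L ==> \<tau> (r *s v) = r \<odot>\<^bsub>C\<^esub> \<tau> v"
  and \<tau>_surj: "\<tau> ` L = carrier C"
begin

interpretation C: Module.module Rrec C by (rule C)

definition ker :: "'v set" where "ker = {v \<in> L. \<tau> v = \<zero>\<^bsub>C\<^esub>}"

lemma \<tau>_carrier: "v \<in> L ==> \<tau> v \<in> carrier C"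
 using \<tau>_surj by blast

lemma C_null: "x \<in> carrier C ==> 0 \<odot>\<^bsub>C\<^esub> x = \<zero>\<^bsub>C\<^esub>"
 using C.smult_l_null[of x] by simp

lemma \<tau>_zero: "\<tau> 0 = \<zero>\<^bsub>C\<^esub>"
 using \<tau>_scale[OF R_zero L_zero] C_null[OF \<tau>_carrier[OF L_zero]] by simp

lemma ker_L: "v \<in> ker ==> v \<in> L"
 by (simp add: ker_def)

lemma submod_ker: "submod R ker"
proof (rule submodI)
 show "0 \<in> ker" by (simp add: ker_def \<tau>_zero)
 show "v + w \<in> ker" if "v \<in> ker" "w \<in> ker" for v w
  using that \<tau>_add[of v w] L_add[of v w] by (simp add: ker_def)
 show "r *s v \<in> ker" if r: "r \<in> R" and v: "v \<in> ker" for r v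
  using v \<tau>_scale[OF r ker_L[OF v]] L_scale[OF r ker_L[OF v]] C.smult_r_null[of r] r by (simp add: ker_def)
qed

lemma \<tau>_eq_iff:
 assumes v: "v \<in> L" and w: "w \<in> L"
 shows "\<tau> v = \<tau> w \<longleftrightarrow> v - w \<in> ker"
proof
 assume eq: "\<tau> v = \<tau> w"
 have mw: "(- 1) *s w \<in> L" by (rule L_scale[OF R_minus[OF R_one] w])
 have "\<tau> (v - w) = \<tau> v \<oplus>\<^bsub>C\<^esub> \<tau> ((- 1) *s w)" using \<tau>_add[OF v mw] by simp
 also have "... = \<tau> w \<oplus>\<^bsub>C\<^esub> \<tau> ((- 1) *s w)" unfolding eq ..
 also have "... = \<tau> 0" using \<tau>_add[OF w mw] by simp
 finally show "v - w \<in> ker" using L_diff[OF v w] by (simp add: ker_def \<tau>_zero)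
next
 assume k: "v - w \<in> ker"
 have "\<tau> ((v - w) + w) = \<zero>\<^bsub>C\<^esub> \<oplus>\<^bsub>C\<^esub> \<tau> w" using \<tau>_add[OF ker_L[OF k] w] k by (simp add: ker_def)
 then show "\<tau> v = \<tau> w" using \<tau>_carrier[OF w] by simp
qed

definition comb :: "nat => (nat => 'v) => (nat => 'r) => 'v" where
 "comb i z x = (\<Sum>j<b i. x j *s z j)"

text \<open>The homomorphism from the free module that maps the \<open>j\<close>-th basis vector to \<open>\<tau> (z j)\<close>.\<close>

definition hz :: "nat => (nat => 'v) => (nat => 'r) => 'm" where
 "hz i z = (\<lambda>x\<in>{..<b i} \<rightarrow>\<^sub>E R. \<tau> (comb i z x))"

lemma comb_L: "coch i z ==> x \<in> {..<b i} \<rightarrow>\<^sub>E R ==> comb i z x \<in> L"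
 unfolding comb_def coch_def by (intro submod_sum[OF L_sub] submod_scale[OF L_sub] free_nth) auto

lemma comb_basis: "k < b i ==> comb i z (basis (b i) k) = z k"
proof -
 assume k: "k < b i"
 have "comb i z (basis (b i) k) = (\<Sum>j<b i. if j = k then z j else 0)"
  unfolding comb_def by (rule sum.cong) (auto simp: basis_def)
 then show ?thesis using k by simp
qed

lemma comb_add: "comb i z (\<lambda>j\<in>{..<b i}. x j + y j) = comb i z x + comb i z y"
proof -
 have "comb i z (\<lambda>j\<in>{..<b i}. x j + y j) = (\<Sum>j<b i. x j *s z j + y j *s z j)"
  unfolding comb_def by (rule sum.cong) (simp_all add: scale_left_distrib)
 then show ?thesis unfolding comb_def by (simp only: sum.distrib)
qed

lemma comb_scale: "comb i z (\<lambda>j\<in>{..<b i}. r * x j) = r *s comb i z x"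
proof -
 have "comb i z (\<lambda>j\<in>{..<b i}. r * x j) = (\<Sum>j<b i. r *s (x j *s z j))"
  unfolding comb_def by (rule sum.cong) simp_all
 then show ?thesis unfolding comb_def by (simp only: scale_sum_right)
qed

lemma comb_add_left: "comb i (\<lambda>j. z j + w j) x = comb i z x + comb i w x"
 unfolding comb_def by (simp only: scale_right_distrib sum.distrib)

lemma comb_scale_left: "comb i (\<lambda>j. r *s z j) x = r *s comb i z x"
 unfolding comb_def scale_sum_right scale_scale by (simp only: mult.commute)

abbreviation dm :: "nat => (nat => 'r) => nat => 'r" where
 "dm i \<equiv> matrix_map (b (Suc i)) (b i) (D i)"

lemma dm_carrier: "x \<in> {..<b (Suc i)} \<rightarrow>\<^sub>E R ==> dm i x \<in> {..<b i} \<rightarrow>\<^sub>E R"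
 using mod_homD(2)[OF matrix_map_hom[of "b (Suc i)" "b i" "D i", OF D_R], of x] by simp

lemma comb_dm:
 assumes x: "x \<in> {..<b (Suc i)} \<rightarrow>\<^sub>E R"
 shows "comb i z (dm i x) = comb (Suc i) (delta i z) x"
proof -
 have "comb i z (dm i x) = (\<Sum>j<b i. (\<Sum>k<b (Suc i). x k * D i k j) *s z j)"
  unfolding comb_def by (rule sum.cong) (simp_all add: matrix_map_nth[OF x])
 also have "... = (\<Sum>j<b i. \<Sum>k<b (Suc i). x k *s (D i k j *s z j))"
  by (simp only: scale_sum_left scale_scale)
 also have "... = (\<Sum>k<b (Suc i). \<Sum>j<b i. x k *s (D i k j *s z j))" by (rule sum.swap)
 also have "... = comb (Suc i) (delta i z) x" unfolding comb_def delta_def by (simp only: scale_sum_right)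
 finally show ?thesis .
qed

lemma hz_apply: "x \<in> {..<b i} \<rightarrow>\<^sub>E R ==> hz i z x = \<tau> (comb i z x)"
 by (simp add: hz_def)

lemma hz_hom:
 assumes z: "coch i z"
 shows "hz i z \<in> mod_hom Rrec (free (b i)) C"
proof (rule mod_homI; (unfold free_simps Rrec_simps)?)
 show "hz i z \<in> extensional ({..<b i} \<rightarrow>\<^sub>E R)" unfolding hz_def by (rule restrict_extensional)
 fix x assume x: "x \<in> {..<b i} \<rightarrow>\<^sub>E R"
 show "hz i z x \<in> carrier C" unfolding hz_apply[OF x] by (rule \<tau>_carrier[OF comb_L[OF z x]])
 show "hz i z (\<lambda>j\<in>{..<b i}. x j + y j) = hz i z x \<oplus>\<^bsub>C\<^esub> hz i z y" if y: "y \<in> {..<b i} \<rightarrow>\<^sub>E R" for y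
  unfolding hz_apply[OF x] hz_apply[OF y] hz_apply[OF free_add_in[OF x y]] comb_add
  by (rule \<tau>_add[OF comb_L[OF z x] comb_L[OF z y]])
 show "hz i z (\<lambda>j\<in>{..<b i}. r * x j) = r \<odot>\<^bsub>C\<^esub> hz i z x" if r: "r \<in> R" for r
  unfolding hz_apply[OF x] hz_apply[OF free_smult_in[OF r x]] comb_scale
  by (rule \<tau>_scale[OF r comb_L[OF z x]])
qed

lemma hz_basis: "k < b i ==> hz i z (basis (b i) k) = \<tau> (z k)"
 by (simp add: hz_apply[OF basis_carrier] comb_basis)

lemma hz_eq_iff:
 assumes z: "coch i z" and w: "coch i w"
 shows "hz i z = hz i w \<longleftrightarrow> (\<forall>j<b i. z j - w j \<in> ker)"
proof
 assume eq: "hz i z = hz i w"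
 show "\<forall>j<b i. z j - w j \<in> ker"
 proof (intro allI impI)
  fix j assume j: "j < b i"
  have "\<tau> (z j) = \<tau> (w j)" using fun_cong[OF eq, of "basis (b i) j"] unfolding hz_basis[OF j] .
  then show "z j - w j \<in> ker" using \<tau>_eq_iff[of "z j" "w j"] z w j by (simp add: coch_def)
 qed
next
 assume k: "\<forall>j<b i. z j - w j \<in> ker"
 show "hz i z = hz i w"
 proof (rule free_hom_eqI[OF C_null hz_hom[OF z] hz_hom[OF w]])
  show "hz i z (basis (b i) j) = hz i w (basis (b i) j)" if j: "j < b i" for j
   unfolding hz_basis[OF j] using \<tau>_eq_iff[of "z j" "w j"] z w j k by (simp add: coch_def)
 qed
qed

lemma hom_hz:
 assumes f: "f \<in> mod_hom Rrec (free (b i)) C"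
 shows "\<exists>z. coch i z \<and> f = hz i z"
proof -
 have "\<exists>v\<in>L. f (basis (b i) j) = \<tau> v" for j
  using mod_homD(2)[OF f, of "basis (b i) j"] basis_carrier unfolding \<tau>_surj[symmetric] by auto
 then have "\<forall>j. \<exists>v. v \<in> L \<and> f (basis (b i) j) = \<tau> v" by blast
 from choice[OF this] obtain z where z: "\<forall>j. z j \<in> L \<and> f (basis (b i) j) = \<tau> (z j)" by blast
 then have zc: "coch i z" by (simp add: coch_def)
 have "f = hz i z"
 proof (rule free_hom_eqI[OF C_null f hz_hom[OF zc]])
  show "f (basis (b i) j) = hz i z (basis (b i) j)" if j: "j < b i" for j
   unfolding hz_basis[OF j] using z by blast
 qed
 then show ?thesis using zc by blast
qed

lemma coch_zero: "coch i (\<lambda>_. 0)"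
 by (simp add: coch_def)

lemma hz_zero: "hz i (\<lambda>_. 0) = (\<lambda>x\<in>{..<b i} \<rightarrow>\<^sub>E R. \<zero>\<^bsub>C\<^esub>)"
 unfolding hz_def comb_def by (rule restrict_ext) (simp add: \<tau>_zero)

lemma hz_dm: "x \<in> {..<b (Suc i)} \<rightarrow>\<^sub>E R ==> hz i z (dm i x) = hz (Suc i) (delta i z) x"
 by (simp only: hz_apply dm_carrier comb_dm)

lemma hz_cocycle_iff:
 assumes z: "coch i z"
 shows "hz i z \<in> ext_cocycles Rrec b dm C i \<longleftrightarrow> z \<in> cocyc ker i"
proof -
 have "hz i z \<in> ext_cocycles Rrec b dm C i \<longleftrightarrow>
   (\<forall>x\<in>{..<b (Suc i)} \<rightarrow>\<^sub>E R. hz (Suc i) (delta i z) x = \<zero>\<^bsub>C\<^esub>)"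
  unfolding ext_cocycles_def free_simps using hz_hom[OF z] hz_dm[of _ i z] by auto
 also have "... \<longleftrightarrow> hz (Suc i) (delta i z) = hz (Suc i) (\<lambda>_. 0)"
  unfolding hz_zero by (auto simp: hz_def fun_eq_iff restrict_def)
 also have "... \<longleftrightarrow> z \<in> cocyc ker i"
  unfolding hz_eq_iff[OF coch_delta[OF z] coch_zero] cocyc_def using z by simp
 finally show ?thesis .
qed

lemma cocycles_eq: "ext_cocycles Rrec b dm C i = hz i ` cocyc ker i"
proof (rule subset_antisym; rule subsetI)
 fix f assume f: "f \<in> ext_cocycles Rrec b dm C i"
 then have "f \<in> mod_hom Rrec (free (b i)) C" unfolding ext_cocycles_def by blast
 then obtain z where z: "coch i z" "f = hz i z" using hom_hz by blast
 then show "f \<in> hz i ` cocyc ker i" using f hz_cocycle_iff[OF z(1)] by blast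
next
 fix f assume "f \<in> hz i ` cocyc ker i"
 then obtain z where z: "z \<in> cocyc ker i" "f = hz i z" by blast
 then have "coch i z" unfolding cocyc_def by blast
 then show "f \<in> ext_cocycles Rrec b dm C i" using hz_cocycle_iff z by blast
qed

lemma cobd_coch:
 assumes "z \<in> cobd ker i"
 shows "coch i z"
proof (cases i)
 case 0
 then show ?thesis using assms ker_L by (simp add: coch_def)
next
 case (Suc n)
 then obtain w where w: "coch n w" "\<forall>j<b i. z j - delta n w j \<in> ker" using assms by auto
 have "z j \<in> L" if j: "j < b i" for j
 proof -
  have "delta n w j \<in> L" using coch_delta[OF w(1)] j Suc by (simp add: coch_def)
  then show ?thesis using L_add[OF ker_L[of "z j - delta n w j"], of "delta n w j"] w(2) j by simp
 qed
 then show ?thesis by (simp add: coch_def)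
qed

lemma cobd_add:
 assumes "z \<in> cobd ker i" "w \<in> cobd ker i"
 shows "(\<lambda>j. z j + w j) \<in> cobd ker i"
 using kc.subspace_add[OF subspace_cobd[OF submod_ker] assms] by (simp add: plus_fun_def)

lemma cobd_scale:
 assumes "z \<in> cobd ker i" and r: "r \<in> R"
 shows "(\<lambda>j. r *s z j) \<in> cobd ker i"
proof (cases i)
 case 0
 then show ?thesis using assms submod_scale[OF submod_ker r] by simp
next
 case (Suc n)
 then obtain w where w: "coch n w" "\<forall>j<b i. z j - delta n w j \<in> ker" using assms(1) by auto
 have "r *s z j - delta n (\<lambda>j. r *s w j) j \<in> ker" if j: "j < b i" for j
  using submod_scale[OF submod_ker r, of "z j - delta n w j"] w(2) j
  unfolding delta_scale scale_right_diff_distrib by blast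
 then show ?thesis using coch_scale[OF r w(1)] unfolding Suc by auto
qed

lemma cobd_zero: "(\<lambda>_. 0) \<in> cobd ker i"
 using kc.subspace_0[OF subspace_cobd[OF submod_ker, of i]] by (simp add: zero_fun_def)

lemma cobd_diff:
 assumes "z \<in> cobd ker i" "w \<in> cobd ker i"
 shows "(\<lambda>j. z j - w j) \<in> cobd ker i"
 using cobd_add[OF assms(1) cobd_scale[OF assms(2) R_minus[OF R_one]]] by simp

lemma cobd_ker:
 assumes "z \<in> cobd ker i" "\<forall>j<b i. w j - z j \<in> ker"
 shows "w \<in> cobd ker i"
proof (cases i)
 case 0
 have "(w j - z j) + z j \<in> ker" if "j < b 0" for j
  using assms that unfolding 0 by (intro submod_add[OF submod_ker]) simp_all
 then show ?thesis unfolding 0 by simp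
next
 case (Suc n)
 then obtain u where u: "coch n u" "\<forall>j<b i. z j - delta n u j \<in> ker" using assms(1) by auto
 have "(w j - z j) + (z j - delta n u j) \<in> ker" if "j < b i" for j
  using assms(2) u(2) that by (intro submod_add[OF submod_ker]) blast+
 then have "\<forall>j<b (Suc n). w j - delta n u j \<in> ker" unfolding Suc by simp
 then show ?thesis using u(1) unfolding Suc cobd.simps by blast
qed

lemma coboundaries_eq: "ext_coboundaries Rrec b dm C i = hz i ` cobd ker i"
proof (cases i)
 case 0
 have "hz 0 z = hz 0 (\<lambda>_. 0)" if "z \<in> cobd ker 0" for z
  using that hz_eq_iff[OF cobd_coch[OF that] coch_zero] by simp
 then have "hz 0 ` cobd ker 0 = {hz 0 (\<lambda>_. 0)}" using cobd_zero[of 0] by blast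
 then show ?thesis by (simp add: 0 hz_zero hom_module_def)
next
 case (Suc n)
 have comp: "compose ({..<b (Suc n)} \<rightarrow>\<^sub>E R) (hz n w) (dm n) = hz (Suc n) (delta n w)" for w
 proof (rule extensionalityI)
  show "compose ({..<b (Suc n)} \<rightarrow>\<^sub>E R) (hz n w) (dm n) \<in> extensional ({..<b (Suc n)} \<rightarrow>\<^sub>E R)" by (rule compose_extensional)
  show "hz (Suc n) (delta n w) \<in> extensional ({..<b (Suc n)} \<rightarrow>\<^sub>E R)" unfolding hz_def by (rule restrict_extensional)
  show "compose ({..<b (Suc n)} \<rightarrow>\<^sub>E R) (hz n w) (dm n) x = hz (Suc n) (delta n w) x"
   if "x \<in> {..<b (Suc n)} \<rightarrow>\<^sub>E R" for x
   unfolding compose_eq[OF that] by (rule hz_dm[OF that])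
 qed
 have "mod_hom Rrec (free (b n)) C = hz n ` {w. coch n w}"
  using hom_hz hz_hom by blast
 then have "ext_coboundaries Rrec b dm C i = (\<lambda>w. hz (Suc n) (delta n w)) ` {w. coch n w}"
  by (simp only: Suc ext_coboundaries.simps free_simps image_image comp)
 also have "... = hz (Suc n) ` cobd ker (Suc n)"
 proof (rule subset_antisym; rule subsetI)
  fix f assume "f \<in> (\<lambda>w. hz (Suc n) (delta n w)) ` {w. coch n w}"
  then obtain w where w: "coch n w" "f = hz (Suc n) (delta n w)" by blast
  have "delta n w \<in> cobd ker (Suc n)" using w(1) submod_zero[OF submod_ker] by (auto intro!: exI[of _ w])
  then show "f \<in> hz (Suc n) ` cobd ker (Suc n)" unfolding w(2) by (rule imageI)
 next
  fix f assume "f \<in> hz (Suc n) ` cobd ker (Suc n)"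
  then obtain z where z: "z \<in> cobd ker (Suc n)" "f = hz (Suc n) z" by blast
  then obtain w where w: "coch n w" "\<forall>j<b (Suc n). z j - delta n w j \<in> ker" by auto
  have "f = hz (Suc n) (delta n w)"
   unfolding z(2) hz_eq_iff[OF cobd_coch[OF z(1)] coch_delta[OF w(1)]] by (rule w(2))
  then show "f \<in> (\<lambda>w. hz (Suc n) (delta n w)) ` {w. coch n w}" using w(1) by blast
 qed
 finally show ?thesis unfolding Suc .
qed

abbreviation ext :: "nat => ('r, ((nat => 'r) => 'm) set) module" where
 "ext i \<equiv> ext_of_resolution Rrec b dm C i"

text \<open>The coset of \<open>hz i z\<close> modulo coboundaries, as an element of the Ext module.\<close>

definition cls :: "nat => (nat => 'v) => ((nat => 'r) => 'm) set" where
 "cls i z = (\<lambda>u. hz i (\<lambda>j. u j + z j)) ` cobd ker i"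

lemma hz_add:
 assumes z: "coch i z" and w: "coch i w"
 shows "(\<lambda>x\<in>{..<b i} \<rightarrow>\<^sub>E R. hz i z x \<oplus>\<^bsub>C\<^esub> hz i w x) = hz i (\<lambda>j. z j + w j)"
 unfolding hz_def[of i "\<lambda>j. z j + w j"]
proof (rule restrict_ext)
 fix x assume x: "x \<in> {..<b i} \<rightarrow>\<^sub>E R"
 show "hz i z x \<oplus>\<^bsub>C\<^esub> hz i w x = \<tau> (comb i (\<lambda>j. z j + w j) x)"
  unfolding hz_apply[OF x] comb_add_left by (rule \<tau>_add[OF comb_L[OF z x] comb_L[OF w x], symmetric])
qed

lemma hz_scale:
 assumes z: "coch i z" and r: "r \<in> R"
 shows "(\<lambda>x\<in>{..<b i} \<rightarrow>\<^sub>E R. r \<odot>\<^bsub>C\<^esub> hz i z x) = hz i (\<lambda>j. r *s z j)"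
 unfolding hz_def[of i "\<lambda>j. r *s z j"]
proof (rule restrict_ext)
 fix x assume x: "x \<in> {..<b i} \<rightarrow>\<^sub>E R"
 show "r \<odot>\<^bsub>C\<^esub> hz i z x = \<tau> (comb i (\<lambda>j. r *s z j) x)"
  unfolding hz_apply[OF x] comb_scale_left by (rule \<tau>_scale[OF r comb_L[OF z x], symmetric])
qed

lemma cocyc_coch: "z \<in> cocyc N i ==> coch i z"
 by (simp add: cocyc_def)

lemma cls_rcos:
 assumes z: "coch i z"
 shows "ext_coboundaries Rrec b dm C i +>\<^bsub>hom_module Rrec (free (b i)) C \<lparr>carrier := Z\<rparr>\<^esub> hz i z = cls i z"
proof -
 have "(\<Union>h\<in>hz i ` cobd ker i. {\<lambda>x\<in>{..<b i} \<rightarrow>\<^sub>E R. h x \<oplus>\<^bsub>C\<^esub> hz i z x}) = cls i z"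
  unfolding cls_def using hz_add[OF cobd_coch z] by auto
 then show ?thesis by (simp add: a_r_coset_def' hom_module_def coboundaries_eq)
qed

lemma ext_carrier: "carrier (ext i) = cls i ` cocyc ker i"
proof -
 have "carrier (ext i) = (\<Union>a\<in>hz i ` cocyc ker i. {ext_coboundaries Rrec b dm C i
   +>\<^bsub>hom_module Rrec (free (b i)) C \<lparr>carrier := ext_cocycles Rrec b dm C i\<rparr>\<^esub> a})"
  by (simp add: ext_of_resolution_def quotient_module_def A_RCOSETS_def' cocycles_eq)
 also have "... = (\<Union>z\<in>cocyc ker i. {cls i z})" using cls_rcos[OF cocyc_coch] by simp
 finally show ?thesis by auto
qed

lemma cls_zero: "\<zero>\<^bsub>ext i\<^esub> = cls i (\<lambda>_. 0)"
 by (simp add: ext_of_resolution_def quotient_module_def cls_def coboundaries_eq)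

lemma cls_subset:
 assumes z: "coch i z" and w: "coch i w" and zw: "(\<lambda>j. z j - w j) \<in> cobd ker i"
 shows "cls i z \<subseteq> cls i w"
proof
 fix f assume "f \<in> cls i z"
 then obtain u where u: "u \<in> cobd ker i" "f = hz i (\<lambda>j. u j + z j)" unfolding cls_def by blast
 have "(\<lambda>j. u j + z j) = (\<lambda>j. (u j + (z j - w j)) + w j)" by (simp add: fun_eq_iff)
 then have "f = hz i (\<lambda>j. (u j + (z j - w j)) + w j)" unfolding u(2) by (rule arg_cong)
 then show "f \<in> cls i w" unfolding cls_def 
  by (rule image_eqI[where x = "\<lambda>j. u j + (z j - w j)"]) (rule cobd_add[OF u(1) zw])
qed

lemma cls_eq_iff:
 assumes z: "coch i z" and w: "coch i w"
 shows "cls i z = cls i w \<longleftrightarrow> (\<lambda>j. z j - w j) \<in> cobd ker i"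
proof
 assume eq: "cls i z = cls i w"
 have "hz i (\<lambda>j. 0 + z j) \<in> cls i z" unfolding cls_def using cobd_zero by (rule image_eqI[rotated]) simp
 then have "hz i z \<in> cls i w" unfolding eq by simp
 then obtain u where u: "u \<in> cobd ker i" "hz i z = hz i (\<lambda>j. u j + w j)" unfolding cls_def by blast
 have "\<forall>j<b i. z j - (u j + w j) \<in> ker"
  using u(2) unfolding hz_eq_iff[OF z coch_add[OF cobd_coch[OF u(1)] w]] .
 then have "\<forall>j<b i. (z j - w j) - u j \<in> ker" by (simp add: diff_diff_eq add.commute)
 then show "(\<lambda>j. z j - w j) \<in> cobd ker i" by (rule cobd_ker[OF u(1)])
next
 assume zw: "(\<lambda>j. z j - w j) \<in> cobd ker i"
 then have "(\<lambda>j. w j - z j) \<in> cobd ker i" using cobd_diff[OF cobd_zero zw] by simp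
 then show "cls i z = cls i w" using cls_subset z w zw by blast
qed

lemma cls_add:
 assumes z: "coch i z" and w: "coch i w"
 shows "cls i z \<oplus>\<^bsub>ext i\<^esub> cls i w = cls i (\<lambda>j. z j + w j)"
proof -
 have "(\<Union>h\<in>cls i z. \<Union>k\<in>cls i w. {\<lambda>x\<in>{..<b i} \<rightarrow>\<^sub>E R. h x \<oplus>\<^bsub>C\<^esub> k x}) =
   (\<Union>u\<in>cobd ker i. \<Union>v\<in>cobd ker i. {hz i (\<lambda>j. (u j + v j) + (z j + w j))})"
 proof -
  have "(\<lambda>x\<in>{..<b i} \<rightarrow>\<^sub>E R. hz i (\<lambda>j. u j + z j) x \<oplus>\<^bsub>C\<^esub> hz i (\<lambda>j. v j + w j) x) =
    hz i (\<lambda>j. (u j + v j) + (z j + w j))" if "u \<in> cobd ker i" "v \<in> cobd ker i" for u v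
   unfolding hz_add[OF coch_add[OF cobd_coch[OF that(1)] z] coch_add[OF cobd_coch[OF that(2)] w]]
   by (rule arg_cong[of _ _ "hz i"]) (simp add: fun_eq_iff)
  then show ?thesis unfolding cls_def by simp
 qed
 also have "... = cls i (\<lambda>j. z j + w j)"
 proof (rule subset_antisym; rule subsetI)
  fix f assume "f \<in> (\<Union>u\<in>cobd ker i. \<Union>v\<in>cobd ker i. {hz i (\<lambda>j. (u j + v j) + (z j + w j))})"
  then obtain u v where uv: "u \<in> cobd ker i" "v \<in> cobd ker i" "f = hz i (\<lambda>j. (u j + v j) + (z j + w j))" by blast
  show "f \<in> cls i (\<lambda>j. z j + w j)" unfolding cls_def 
   by (rule image_eqI[where x = "\<lambda>j. u j + v j"]) (rule uv(3), rule cobd_add[OF uv(1,2)])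
 next
  fix f assume "f \<in> cls i (\<lambda>j. z j + w j)"
  then obtain u where u: "u \<in> cobd ker i" "f = hz i (\<lambda>j. (u j + 0) + (z j + w j))" unfolding cls_def by auto
  show "f \<in> (\<Union>u\<in>cobd ker i. \<Union>v\<in>cobd ker i. {hz i (\<lambda>j. (u j + v j) + (z j + w j))})"
   by (rule UN_I[OF u(1)], rule UN_I[OF cobd_zero]) (simp add: u(2))
 qed
 finally show ?thesis
  by (simp add: ext_of_resolution_def quotient_module_def set_add_def' hom_module_def)
qed

lemma cls_smult:
 assumes z: "coch i z" and r: "r \<in> R"
 shows "r \<odot>\<^bsub>ext i\<^esub> cls i z = cls i (\<lambda>j. r *s z j)"
proof -
 let ?M = "hom_module Rrec (free (b i)) C \<lparr>carrier := ext_cocycles Rrec b dm C i\<rparr>"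
 have "ext_coboundaries Rrec b dm C i +>\<^bsub>?M\<^esub> (r \<odot>\<^bsub>?M\<^esub> f) = cls i (\<lambda>j. r *s z j)" if f: "f \<in> cls i z" for f
 proof -
  obtain u where u: "u \<in> cobd ker i" "f = hz i (\<lambda>j. u j + z j)" using f unfolding cls_def by blast
  have uz: "coch i (\<lambda>j. u j + z j)" by (rule coch_add[OF cobd_coch[OF u(1)] z])
  have "r \<odot>\<^bsub>?M\<^esub> f = hz i (\<lambda>j. r *s (u j + z j))"
   unfolding u(2) hz_scale[OF uz r, symmetric] by (simp add: hom_module_def)
  then have "ext_coboundaries Rrec b dm C i +>\<^bsub>?M\<^esub> (r \<odot>\<^bsub>?M\<^esub> f) = cls i (\<lambda>j. r *s (u j + z j))"
   using cls_rcos[OF coch_scale[OF r uz]] by simp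
  also have "... = cls i (\<lambda>j. r *s z j)"
   unfolding cls_eq_iff[OF coch_scale[OF r uz] coch_scale[OF r z]]
   using cobd_scale[OF u(1) r] by (simp add: scale_right_distrib)
  finally show ?thesis .
 qed
 moreover have "cls i z ~= {}" using cobd_zero unfolding cls_def by blast
 ultimately have "(\<Union>f\<in>cls i z. ext_coboundaries Rrec b dm C i +>\<^bsub>?M\<^esub> (r \<odot>\<^bsub>?M\<^esub> f)) = cls i (\<lambda>j. r *s z j)"
  by simp
 then show ?thesis by (simp add: ext_of_resolution_def quotient_module_def)
qed

lemma zero_cocyc: "(\<lambda>_. 0) \<in> cocyc ker i"
 using kc.subspace_0[OF subspace_cocyc[OF submod_ker, of i]] by (simp add: zero_fun_def)

lemma cocyc_add: "z \<in> cocyc ker i ==> w \<in> cocyc ker i ==> (\<lambda>j. z j + w j) \<in> cocyc ker i"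
 using kc.subspace_add[OF subspace_cocyc[OF submod_ker], of z i w] by (simp add: plus_fun_def)

lemma cocyc_scale: "z \<in> cocyc ker i ==> r \<in> R ==> (\<lambda>j. r *s z j) \<in> cocyc ker i"
 unfolding cocyc_def using coch_scale[of r i z] submod_scale[OF submod_ker] by (simp add: delta_scale)

lemma ext_trivial_iff: "carrier (ext i) = {\<zero>\<^bsub>ext i\<^esub>} \<longleftrightarrow> coh_le ker i 0"
proof -
 have "carrier (ext i) = {\<zero>\<^bsub>ext i\<^esub>} \<longleftrightarrow> (\<forall>z\<in>cocyc ker i. cls i z = cls i (\<lambda>_. 0))"
  unfolding ext_carrier cls_zero using zero_cocyc by blast
 also have "... \<longleftrightarrow> cocyc ker i \<subseteq> cobd ker i"
  using cls_eq_iff[OF cocyc_coch coch_zero] by (auto simp: subset_iff)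
 finally show ?thesis unfolding coh_le_0[OF submod_ker] .
qed

text \<open>
 A cocycle \<open>z1\<close> over \<open>1\<close> spans the cohomology, since its multiples by constants represent all classes
 of the residue field.
\<close>

lemma ext_residue_field:
 assumes "mod_iso Rrec (ext i) residue_field"
 shows "coh_le ker i 1" "\<not> coh_le ker i 0"
proof -
 obtain F where F: "F \<in> mod_hom Rrec (ext i) residue_field" "bij_betw F (carrier (ext i)) (carrier residue_field)"
  using assms unfolding mod_iso_def by blast
 have inj: "inj_on F (carrier (ext i))" and surj: "F ` carrier (ext i) = coset ` R"
  using F(2) unfolding bij_betw_def residue_carrier by blast+
 have "coset 1 \<in> F ` carrier (ext i)" unfolding surj by (rule imageI) (rule R_one)
 then obtain z1 where z1: "z1 \<in> cocyc ker i" "F (cls i z1) = coset 1" unfolding ext_carrier by auto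
 have rep: "\<exists>a. (\<lambda>j. z j - emb a *s z1 j) \<in> cobd ker i" if z: "z \<in> cocyc ker i" for z
 proof -
  have zc: "cls i z \<in> carrier (ext i)" and z1c: "cls i z1 \<in> carrier (ext i)"
   unfolding ext_carrier using z z1(1) by blast+
  have "F (cls i z) \<in> coset ` R" using zc unfolding surj[symmetric] by (rule imageI)
  then obtain a where a: "F (cls i z) = coset (emb a)" using coset_emb by blast
  have z2: "(\<lambda>j. emb a *s z1 j) \<in> cocyc ker i" by (rule cocyc_scale[OF z1(1) emb_R])
  have "F (cls i (\<lambda>j. emb a *s z1 j)) = emb a \<odot>\<^bsub>residue_field\<^esub> F (cls i z1)"
   using mod_homD(4)[OF F(1) _ z1c, of "emb a"] unfolding cls_smult[OF cocyc_coch[OF z1(1)] emb_R] by simp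
  also have "... = F (cls i z)" unfolding z1(2) residue_smult[OF emb_R] a by simp
  finally have "cls i z = cls i (\<lambda>j. emb a *s z1 j)"
   using inj_onD[OF inj _ zc, of "cls i (\<lambda>j. emb a *s z1 j)"] z2 unfolding ext_carrier by auto
  then have "(\<lambda>j. z j - emb a *s z1 j) \<in> cobd ker i"
   unfolding cls_eq_iff[OF cocyc_coch[OF z] cocyc_coch[OF z2]] .
  then show ?thesis by (rule exI[of _ a])
 qed
 show "coh_le ker i 1"
  unfolding coh_le_def kc.codim_le_def
 proof (intro exI[of _ "{z1}"] conjI subsetI)
  fix z assume "z \<in> cocyc ker i"
  then obtain a where a: "(\<lambda>j. z j - emb a *s z1 j) \<in> cobd ker i" using rep by blast
  have "(\<lambda>j. z j - emb a *s z1 j) + (\<lambda>j. emb a *s z1 j) \<in> kc.span (cobd ker i \<union> {z1})"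
   by (intro kc.span_add kc.span_scale kc.span_base) (use a in simp_all)
  then show "z \<in> kc.span (cobd ker i \<union> {z1})" by (simp add: plus_fun_def)
 qed simp_all
 show "\<not> coh_le ker i 0"
 proof
  assume "coh_le ker i 0"
  then have "carrier (ext i) = {\<zero>\<^bsub>ext i\<^esub>}" by (simp only: ext_trivial_iff)
  then have "coset ` R = {F \<zero>\<^bsub>ext i\<^esub>}" unfolding surj[symmetric] by simp
  then have "coset 1 = coset 0" using imageI[OF R_one, of coset] imageI[OF R_zero, of coset] by simp
  then show False using one_notin_mm by (simp add: coset_eq_iff)
 qed
qed

text \<open>Modules with presentations having the same kernel have isomorphic Ext modules.\<close>

lemma ext_transfer:
 assumes "presented_module emb R cmp X scale L prj E b D c C' \<tau>'" and ker': "{v \<in> L. \<tau>' v = \<zero>\<^bsub>C'\<^esub>} = ker"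
  and iso: "mod_iso Rrec (ext i) residue_field"
 shows "mod_iso Rrec (ext_of_resolution Rrec b dm C' i) residue_field"
proof -
 interpret P: presented_module emb R cmp X scale L prj E b D c C' \<tau>' by (rule assms(1))
 have k: "P.ker = ker" unfolding P.ker_def by (rule ker')
 obtain F where F: "F \<in> mod_hom Rrec (ext i) residue_field" "bij_betw F (carrier (ext i)) (carrier residue_field)"
  using iso unfolding mod_iso_def by blast
 define G where "G = (\<lambda>Y\<in>carrier (P.ext i). F (cls i (SOME z. z \<in> cocyc ker i \<and> P.cls i z = Y)))"
 have eqv: "P.cls i z = P.cls i w \<longleftrightarrow> cls i z = cls i w" if "coch i z" "coch i w" for z w
  unfolding cls_eq_iff[OF that] P.cls_eq_iff[OF that] k ..
 have Gc: "G (P.cls i z) = F (cls i z)" if z: "z \<in> cocyc ker i" for z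
 proof -
  let ?w = "SOME w. w \<in> cocyc ker i \<and> P.cls i w = P.cls i z"
  have w: "?w \<in> cocyc ker i \<and> P.cls i ?w = P.cls i z" by (rule someI[of _ z]) (simp add: z)
  then have "cls i ?w = cls i z" using eqv[OF cocyc_coch cocyc_coch[OF z]] by blast
  moreover have "P.cls i z \<in> carrier (P.ext i)" unfolding P.ext_carrier k using z by (rule imageI)
  ultimately show ?thesis unfolding G_def by simp
 qed
 have carr: "cls i z \<in> carrier (ext i)" if "z \<in> cocyc ker i" for z
  unfolding ext_carrier using that by (rule imageI)
 have hom: "G \<in> mod_hom Rrec (P.ext i) residue_field"
 proof (rule mod_homI)
  show "G \<in> extensional (carrier (P.ext i))" unfolding G_def by (rule restrict_extensional)
  fix Y assume "Y \<in> carrier (P.ext i)"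
  then obtain z where z: "z \<in> cocyc ker i" "Y = P.cls i z" unfolding P.ext_carrier k by blast
  show "G Y \<in> carrier residue_field" unfolding z(2) Gc[OF z(1)] by (rule mod_homD(2)[OF F(1) carr[OF z(1)]])
  show "G (Y \<oplus>\<^bsub>P.ext i\<^esub> Y') = G Y \<oplus>\<^bsub>residue_field\<^esub> G Y'" if Y': "Y' \<in> carrier (P.ext i)" for Y'
  proof -
   obtain w where w: "w \<in> cocyc ker i" "Y' = P.cls i w" using Y' unfolding P.ext_carrier k by blast
   show ?thesis
    unfolding z(2) w(2) P.cls_add[OF cocyc_coch[OF z(1)] cocyc_coch[OF w(1)]] Gc[OF cocyc_add[OF z(1) w(1)]]
     Gc[OF z(1)] Gc[OF w(1)] cls_add[OF cocyc_coch[OF z(1)] cocyc_coch[OF w(1)], symmetric]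
    by (rule mod_homD(3)[OF F(1) carr[OF z(1)] carr[OF w(1)]])
  qed
  show "G (r \<odot>\<^bsub>P.ext i\<^esub> Y) = r \<odot>\<^bsub>residue_field\<^esub> G Y" if "r \<in> carrier Rrec" for r
  proof -
   have r: "r \<in> R" using that by simp
   show ?thesis
    unfolding z(2) P.cls_smult[OF cocyc_coch[OF z(1)] r] Gc[OF cocyc_scale[OF z(1) r]] Gc[OF z(1)]
     cls_smult[OF cocyc_coch[OF z(1)] r, symmetric]
    by (rule mod_homD(4)[OF F(1) that carr[OF z(1)]])
  qed
 qed
 have "bij_betw G (carrier (P.ext i)) (carrier residue_field)"
  unfolding bij_betw_def
 proof
  show "inj_on G (carrier (P.ext i))"
  proof (rule inj_onI)
   fix Y Y' assume Y: "Y \<in> carrier (P.ext i)" "Y' \<in> carrier (P.ext i)" and eq: "G Y = G Y'"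
   obtain z where z: "z \<in> cocyc ker i" "Y = P.cls i z" using Y(1) unfolding P.ext_carrier k by blast
   obtain w where w: "w \<in> cocyc ker i" "Y' = P.cls i w" using Y(2) unfolding P.ext_carrier k by blast
   have "F (cls i z) = F (cls i w)" using eq unfolding z(2) w(2) Gc[OF z(1)] Gc[OF w(1)] .
   then have "cls i z = cls i w"
    using F(2) carr[OF z(1)] carr[OF w(1)] unfolding bij_betw_def by (auto dest: inj_onD)
   then show "Y = Y'" unfolding z(2) w(2) eqv[OF cocyc_coch[OF z(1)] cocyc_coch[OF w(1)]] .
  qed
  have "G ` carrier (P.ext i) = F ` carrier (ext i)"
   unfolding P.ext_carrier ext_carrier k image_image using Gc by (rule image_cong[OF refl])
  then show "G ` carrier (P.ext i) = carrier residue_field" using F(2) unfolding bij_betw_def by simp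
 qed
 then show ?thesis using hom unfolding mod_iso_def by blast
qed

end

section \<open>Presentations of graded modules\<close>

lemma subgroup_finsum:
 assumes "abelian_group M" and N: "subgroup N (add_monoid M)" and "finite A" and "!!a. a \<in> A ==> f a \<in> N"
 shows "finsum M f A \<in> N"
proof -
 interpret M: abelian_group M by (rule assms(1))
 have sub: "N \<subseteq> carrier M" using subgroup.subset[OF N] by simp
 show ?thesis
  using assms(3,4)
 proof (induction A rule: finite_induct)
  case empty
  show ?case using subgroup.one_closed[OF N] by simp
 next
  case (insert a A)
  have "f a \<in> carrier M" "f \<in> A \<rightarrow> carrier M" using insert.prems sub by auto
  then have "finsum M f (insert a A) = f a \<oplus>\<^bsub>M\<^esub> finsum M f A" using insert.hyps by (simp add: M.finsum_insert)
  also have "... \<in> N" using subgroup.m_closed[OF N, of "f a" "finsum M f A"] insert by simp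
  finally show ?case .
 qed
qed

locale homogeneous_tuple = graded_domain emb R cmp X
 for emb :: "'k::field => 'r::idom" and R cmp X +
 fixes C :: "('r, 'm) module" and Cg :: "int => 'm set" and g :: nat and w :: "nat => 'm" and \<epsilon> :: "nat => int"
 assumes C: "Module.module Rrec C"
  and grading: "module_grading Rrec (\<lambda>i. H (int i)) C Cg"
  and w_Cg: "i < g ==> w i \<in> Cg (\<epsilon> i)"
begin

interpretation C: Module.module Rrec C by (rule C)

interpretation F: graded_module emb R cmp X fscale "Rpow g" "\<lambda>a f i. cmp (a - \<epsilon> i) (f i)" "unit_vec ` {..<g}"
 by (rule graded_module_Rpow)

definition \<tau> :: "(nat => 'r) => 'm" where "\<tau> v = finsum C (\<lambda>i. v i \<odot>\<^bsub>C\<^esub> w i) {..<g}"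

lemma Cg_subgroup: "subgroup (Cg a) (add_monoid C)"
 using grading unfolding module_grading_def by blast

lemma w_carrier: "i < g ==> w i \<in> carrier C"
 using w_Cg subgroup.subset[OF Cg_subgroup] by auto

lemma vw_carrier: "v \<in> Rpow g ==> i < g ==> v i \<odot>\<^bsub>C\<^esub> w i \<in> carrier C"
 using C.smult_closed[of "v i" "w i"] w_carrier by (simp add: Rpow_def)

lemma vw_Pi: "v \<in> Rpow g ==> (\<lambda>i. v i \<odot>\<^bsub>C\<^esub> w i) \<in> {..<g} \<rightarrow> carrier C"
 using vw_carrier by auto

lemma \<tau>_carrier: "v \<in> Rpow g ==> \<tau> v \<in> carrier C"
 unfolding \<tau>_def by (rule C.finsum_closed[OF vw_Pi])

lemma \<tau>_add:
 assumes v: "v \<in> Rpow g" and u: "u \<in> Rpow g"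
 shows "\<tau> (v + u) = \<tau> v \<oplus>\<^bsub>C\<^esub> \<tau> u"
proof -
 have "\<tau> (v + u) = finsum C (\<lambda>i. v i \<odot>\<^bsub>C\<^esub> w i \<oplus>\<^bsub>C\<^esub> u i \<odot>\<^bsub>C\<^esub> w i) {..<g}"
  unfolding \<tau>_def
 proof (rule C.finsum_cong'[OF refl])
  show "(\<lambda>i. v i \<odot>\<^bsub>C\<^esub> w i \<oplus>\<^bsub>C\<^esub> u i \<odot>\<^bsub>C\<^esub> w i) \<in> {..<g} \<rightarrow> carrier C"
   using vw_carrier[OF v] vw_carrier[OF u] by auto
  show "(v + u) i \<odot>\<^bsub>C\<^esub> w i = v i \<odot>\<^bsub>C\<^esub> w i \<oplus>\<^bsub>C\<^esub> u i \<odot>\<^bsub>C\<^esub> w i" if "i \<in> {..<g}" for i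
   using C.smult_l_distr[of "v i" "u i" "w i"] v u w_carrier that by (simp add: Rpow_def)
 qed
 also have "... = \<tau> v \<oplus>\<^bsub>C\<^esub> \<tau> u" unfolding \<tau>_def by (rule C.finsum_addf[OF vw_Pi[OF v] vw_Pi[OF u]])
 finally show ?thesis .
qed

lemma \<tau>_scale:
 assumes r: "r \<in> R" and v: "v \<in> Rpow g"
 shows "\<tau> (fscale r v) = r \<odot>\<^bsub>C\<^esub> \<tau> v"
proof -
 have "\<tau> (fscale r v) = finsum C (\<lambda>i. r \<odot>\<^bsub>C\<^esub> (v i \<odot>\<^bsub>C\<^esub> w i)) {..<g}"
  unfolding \<tau>_def
 proof (rule C.finsum_cong'[OF refl])
  show "(\<lambda>i. r \<odot>\<^bsub>C\<^esub> (v i \<odot>\<^bsub>C\<^esub> w i)) \<in> {..<g} \<rightarrow> carrier C"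
   using vw_carrier[OF v] r by auto
  show "fscale r v i \<odot>\<^bsub>C\<^esub> w i = r \<odot>\<^bsub>C\<^esub> (v i \<odot>\<^bsub>C\<^esub> w i)" if "i \<in> {..<g}" for i
   using C.smult_assoc1[of r "v i" "w i"] v r w_carrier that by (simp add: Rpow_def fscale_def)
 qed
 also have "... = r \<odot>\<^bsub>C\<^esub> \<tau> v"
  unfolding \<tau>_def by (rule C.finsum_smult_ldistr[symmetric]) (use r vw_Pi[OF v] in simp_all)
 finally show ?thesis .
qed

lemma presented:
 assumes "residue_resolution emb R cmp X b D c" and \<tau>_surj: "\<tau> ` Rpow g = carrier C"
 shows "presented_module emb R cmp X fscale (Rpow g) (\<lambda>a f i. cmp (a - \<epsilon> i) (f i)) (unit_vec ` {..<g}) b D c C \<tau>"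
proof -
 interpret rr: residue_resolution emb R cmp X b D c by (rule assms(1))
 show ?thesis
  by unfold_locales (rule C \<tau>_add \<tau>_scale \<tau>_surj; assumption)+
qed

lemma \<tau>_zero: "\<tau> 0 = \<zero>\<^bsub>C\<^esub>"
proof -
 have "\<tau> 0 = \<tau> (fscale 0 0)" by (simp only: FM.scale_zero_right)
 also have "... = 0 \<odot>\<^bsub>C\<^esub> \<tau> 0" by (rule \<tau>_scale[OF R_zero F.L_zero])
 also have "... = \<zero>\<^bsub>C\<^esub>" using C.smult_l_null[OF \<tau>_carrier[OF F.L_zero]] unfolding Rrec_simps .
 finally show ?thesis .
qed

lemma \<tau>_sum: "finite A ==> (!!a. a \<in> A ==> f a \<in> Rpow g) ==> \<tau> (sum f A) = finsum C (\<lambda>a. \<tau> (f a)) A"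
proof (induction A rule: finite_induct)
 case empty
 show ?case unfolding sum.empty C.finsum_empty by (rule \<tau>_zero)
next
 case (insert a A)
 have "(\<lambda>a. \<tau> (f a)) \<in> A \<rightarrow> carrier C" "\<tau> (f a) \<in> carrier C" using insert.prems \<tau>_carrier by auto
 then have "finsum C (\<lambda>a. \<tau> (f a)) (insert a A) = \<tau> (f a) \<oplus>\<^bsub>C\<^esub> finsum C (\<lambda>a. \<tau> (f a)) A"
  using insert.hyps by (simp add: C.finsum_insert)
 also have "... = \<tau> (f a) \<oplus>\<^bsub>C\<^esub> \<tau> (sum f A)" using insert.IH insert.prems by simp
 also have "... = \<tau> (f a + sum f A)"
  by (rule \<tau>_add[symmetric]) (use insert.prems FM.submod_sum[OF submod_Rpow, of A f] in auto)
 finally show ?case unfolding sum.insert[OF insert.hyps] by (rule sym)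
qed

lemma \<tau>_prj:
 assumes v: "v \<in> Rpow g"
 shows "\<tau> (\<lambda>i. cmp (a - \<epsilon> i) (v i)) \<in> Cg a"
 unfolding \<tau>_def
proof (rule subgroup_finsum[OF C.abelian_group_axioms Cg_subgroup])
 fix i assume "i \<in> {..<g}"
 then have i: "i < g" "v i \<in> R" using v by (simp_all add: Rpow_def)
 show "cmp (a - \<epsilon> i) (v i) \<odot>\<^bsub>C\<^esub> w i \<in> Cg a"
 proof (cases "a - \<epsilon> i < 0")
  case True
  then have "cmp (a - \<epsilon> i) (v i) \<odot>\<^bsub>C\<^esub> w i = \<zero>\<^bsub>C\<^esub>"
   using C.smult_l_null[OF w_carrier[OF i(1)]] by (simp add: cmp_neg[OF i(2)])
  then show ?thesis using subgroup.one_closed[OF Cg_subgroup[of a]] by simp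
 next
  case False
  define n where "n = nat (a - \<epsilon> i)"
  have n: "int n = a - \<epsilon> i" using False by (simp add: n_def)
  have "cmp (int n) (v i) \<in> H (int n)" by (rule H_cmp[OF i(2)])
  then have "cmp (int n) (v i) \<odot>\<^bsub>C\<^esub> w i \<in> Cg (int n + \<epsilon> i)"
   using grading w_Cg[OF i(1)] unfolding module_grading_def by blast
  then show ?thesis by (simp add: n)
 qed
qed simp

text \<open>Uniqueness of the decomposition of \<open>0\<close> makes the relations homogeneous.\<close>

lemma \<tau>_prj_zero:
 assumes v: "v \<in> Rpow g" and z: "\<tau> v = \<zero>\<^bsub>C\<^esub>"
 shows "\<tau> (\<lambda>i. cmp (a - \<epsilon> i) (v i)) = \<zero>\<^bsub>C\<^esub>"
proof -
 define p where "p a = (\<lambda>i. cmp (a - \<epsilon> i) (v i))" for a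
 define T where "T a = \<tau> (p a)" for a
 let ?A = "{a. p a ~= 0}"
 have fin: "finite ?A" unfolding p_def by (rule F.finite_prj[OF v])
 have pR: "p a \<in> Rpow g" for a unfolding p_def by (rule F.prj_L[OF v])
 have Tc: "T a \<in> carrier C" for a unfolding T_def by (rule \<tau>_carrier[OF pR])
 have sub: "{a. T a ~= \<zero>\<^bsub>C\<^esub>} \<subseteq> ?A" using \<tau>_zero by (auto simp: T_def)
 have "(\<Sum>a\<in>?A. p a) = v" using F.sum_prj[OF v] unfolding p_def .
 then have "finsum C T ?A = \<zero>\<^bsub>C\<^esub>" using \<tau>_sum[of ?A p, OF fin pR] z unfolding T_def by simp
 moreover have "finsum C T {a. T a ~= \<zero>\<^bsub>C\<^esub>} = finsum C T ?A"
  by (rule C.add.finprod_mono_neutral_cong_left[OF fin sub]) (use Tc in auto)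
 ultimately have sum0: "\<zero>\<^bsub>C\<^esub> = finsum C T {a. T a ~= \<zero>\<^bsub>C\<^esub>}" by simp
 have "\<exists>!c. (\<forall>j. c j \<in> Cg j) \<and> finite {j. c j ~= \<zero>\<^bsub>C\<^esub>} \<and> \<zero>\<^bsub>C\<^esub> = finsum C c {j. c j ~= \<zero>\<^bsub>C\<^esub>}"
  using grading C.zero_closed unfolding module_grading_def by blast
 then obtain c0 where c0: "!!c. (\<forall>j. c j \<in> Cg j) \<and> finite {j. c j ~= \<zero>\<^bsub>C\<^esub>} \<and> \<zero>\<^bsub>C\<^esub> = finsum C c {j. c j ~= \<zero>\<^bsub>C\<^esub>} ==> c = c0"
  by (elim ex1E) blast
 have "T = c0"
  by (rule c0) (use \<tau>_prj[OF v] finite_subset[OF sub fin] sum0 in \<open>unfold T_def p_def, blast\<close>)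
 moreover have "(\<lambda>_. \<zero>\<^bsub>C\<^esub>) = c0"
  by (rule c0) (use subgroup.one_closed[OF Cg_subgroup] in simp)
 ultimately have "T = (\<lambda>_. \<zero>\<^bsub>C\<^esub>)" by simp
 then have "T a = \<zero>\<^bsub>C\<^esub>" by (rule fun_cong)
 then show ?thesis unfolding T_def p_def .
qed

lemma ker_graded:
 assumes "\<tau> ` Rpow g = carrier C"
 shows "F.grsub {v \<in> Rpow g. \<tau> v = \<zero>\<^bsub>C\<^esub>}"
 unfolding F.grsub_def
proof (intro conjI allI ballI)
 obtain b D c where "residue_resolution emb R cmp X b D c" using residue_resolution_exists by blast
 from presented[OF this assms] interpret P: presented_module emb R cmp X fscale "Rpow g" "\<lambda>a f i. cmp (a - \<epsilon> i) (f i)"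
  "unit_vec ` {..<g}" b D c C \<tau> .
 show "FM.submod R {v \<in> Rpow g. \<tau> v = \<zero>\<^bsub>C\<^esub>}" using P.submod_ker unfolding P.ker_def .
 show "(\<lambda>i. cmp (a - \<epsilon> i) (v i)) \<in> {v \<in> Rpow g. \<tau> v = \<zero>\<^bsub>C\<^esub>}" if "v \<in> {v \<in> Rpow g. \<tau> v = \<zero>\<^bsub>C\<^esub>}" for a v
  using that F.prj_L[of v a] \<tau>_prj_zero[of v a] by simp
qed auto

end

context graded_domain
begin

text \<open>The homogeneous components of finitely many generators.\<close>

lemma homogeneous_generators_exist:
 assumes C: "Module.module Rrec C" and fg: "finitely_generated_module Rrec C"
  and gr: "module_grading Rrec (\<lambda>i. H (int i)) C Cg"
 shows "\<exists>g w \<epsilon>. homogeneous_tuple emb R cmp X C Cg g w \<epsilon> \<and> homogeneous_tuple.\<tau> C g w ` Rpow g = carrier C"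
proof -
 interpret C: Module.module Rrec C by (rule C)
 obtain G where G: "finite G" "G \<subseteq> carrier C" "!!N. submodule N Rrec C ==> G \<subseteq> N ==> N = carrier C"
  using fg unfolding finitely_generated_module_def by blast
 have Cg_sub: "subgroup (Cg a) (add_monoid C)" for a using gr unfolding module_grading_def by blast
 have "\<forall>x. \<exists>c. x \<in> G --> (\<forall>j. c j \<in> Cg j) \<and> finite {j. c j ~= \<zero>\<^bsub>C\<^esub>} \<and> x = finsum C c {j. c j ~= \<zero>\<^bsub>C\<^esub>}"
 proof
  fix x
  show "\<exists>c. x \<in> G --> (\<forall>j. c j \<in> Cg j) \<and> finite {j. c j ~= \<zero>\<^bsub>C\<^esub>} \<and> x = finsum C c {j. c j ~= \<zero>\<^bsub>C\<^esub>}"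
  proof (cases "x \<in> G")
   case True
   then have "\<exists>!c. (\<forall>j. c j \<in> Cg j) \<and> finite {j. c j ~= \<zero>\<^bsub>C\<^esub>} \<and> x = finsum C c {j. c j ~= \<zero>\<^bsub>C\<^esub>}"
    using gr G(2) unfolding module_grading_def by blast
   then show ?thesis by (elim ex1E) blast
  qed simp
 qed
 from choice[OF this] obtain dec where dec: "!!x. x \<in> G ==> \<forall>j. dec x j \<in> Cg j"
  "!!x. x \<in> G ==> finite {j. dec x j ~= \<zero>\<^bsub>C\<^esub>}"
  "!!x. x \<in> G ==> x = finsum C (dec x) {j. dec x j ~= \<zero>\<^bsub>C\<^esub>}" by blast
 define W where "W = (\<Union>x\<in>G. dec x ` {j. dec x j ~= \<zero>\<^bsub>C\<^esub>})"
 have "finite W" unfolding W_def using G(1) dec(2) by blast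
 then obtain w g where w: "W = w ` {i::nat. i < g}" using finite_imp_nat_seg_image_inj_on by blast
 have "\<forall>i. \<exists>a. i < g --> w i \<in> Cg a"
 proof
  fix i
  show "\<exists>a. i < g --> w i \<in> Cg a"
  proof (cases "i < g")
   case True
   then have "w i \<in> W" unfolding w by blast
   then obtain x j where "x \<in> G" "w i = dec x j" unfolding W_def by blast
   then have "w i \<in> Cg j" using dec(1) by simp
   then show ?thesis by blast
  qed simp
 qed
 from choice[OF this] obtain \<epsilon> where \<epsilon>: "!!i. i < g ==> w i \<in> Cg (\<epsilon> i)" by blast
 interpret T: homogeneous_tuple emb R cmp X C Cg g w \<epsilon>
  by unfold_locales (rule C gr \<epsilon>; assumption)+
 let ?N = "T.\<tau> ` Rpow g"
 have Nc: "?N \<subseteq> carrier C" using T.\<tau>_carrier by blast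
 have sm: "submodule ?N Rrec C"
 proof (rule C.submoduleI[OF Nc])
  show "\<zero>\<^bsub>C\<^esub> \<in> ?N"
   using imageI[OF FM.submod_zero[OF submod_Rpow], of T.\<tau>] unfolding T.\<tau>_zero .
  show sc: "a \<odot>\<^bsub>C\<^esub> x \<in> ?N" if aR: "a \<in> carrier Rrec" and x: "x \<in> ?N" for a x
  proof -
   obtain v where v: "v \<in> Rpow g" "x = T.\<tau> v" using x by blast
   have a: "a \<in> R" using aR by simp
   show ?thesis unfolding v(2) T.\<tau>_scale[OF a v(1), symmetric] by (rule imageI[OF FM.submod_scale[OF submod_Rpow a v(1)]])
  qed
  show "\<ominus>\<^bsub>C\<^esub> x \<in> ?N" if x: "x \<in> ?N" for x
  proof -
   have "\<ominus>\<^bsub>C\<^esub> x = (\<ominus>\<^bsub>Rrec\<^esub> 1) \<odot>\<^bsub>C\<^esub> x"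
    using C.smult_l_minus[of 1 x] C.smult_one[of x] x Nc by auto
   moreover have "\<ominus>\<^bsub>Rrec\<^esub> 1 \<in> carrier Rrec" by (rule C.R.a_inv_closed) simp
   ultimately show ?thesis using sc x by simp
  qed
  show "x \<oplus>\<^bsub>C\<^esub> y \<in> ?N" if x: "x \<in> ?N" and y: "y \<in> ?N" for x y
  proof -
   obtain v u where v: "v \<in> Rpow g" "x = T.\<tau> v" "u \<in> Rpow g" "y = T.\<tau> u" using x y by blast
   show ?thesis unfolding v(2,4) T.\<tau>_add[OF v(1,3), symmetric] by (rule imageI[OF FM.submod_add[OF submod_Rpow v(1,3)]])
  qed
 qed
 have wN: "w i \<in> ?N" if i: "i < g" for i
 proof -
  have "T.\<tau> (unit_vec i) = finsum C (\<lambda>j. if i = j then w j else \<zero>\<^bsub>C\<^esub>) {..<g}"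
   unfolding T.\<tau>_def
  proof (rule C.finsum_cong'[OF refl])
   show "(\<lambda>j. if i = j then w j else \<zero>\<^bsub>C\<^esub>) \<in> {..<g} \<rightarrow> carrier C" using T.w_carrier by auto
   show "unit_vec i j \<odot>\<^bsub>C\<^esub> w j = (if i = j then w j else \<zero>\<^bsub>C\<^esub>)" if "j \<in> {..<g}" for j
    using C.smult_one[OF T.w_carrier[of j]] C.smult_l_null[OF T.w_carrier[of j]] that by (auto simp: unit_vec_def)
  qed
  also have "... = w i" by (rule C.finsum_singleton) (use i T.w_carrier in auto)
  finally show ?thesis using unit_vec_Rpow[OF i] by (metis imageI)
 qed
 have "G \<subseteq> ?N"
 proof
  fix x assume x: "x \<in> G"
  have "finsum C (dec x) {j. dec x j ~= \<zero>\<^bsub>C\<^esub>} \<in> ?N"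
  proof (rule subgroup_finsum[OF C.abelian_group_axioms submodule.axioms(1)[OF sm] dec(2)[OF x]])
   fix j assume "j \<in> {j. dec x j ~= \<zero>\<^bsub>C\<^esub>}"
   then have "dec x j \<in> W" unfolding W_def using x by blast
   then obtain i where "i < g" "dec x j = w i" unfolding w by blast
   then show "dec x j \<in> ?N" using wN by simp
  qed
  then show "x \<in> ?N" using dec(3)[OF x] by simp
 qed
 then have "?N = carrier C" by (rule G(3)[OF sm])
 then show ?thesis using T.homogeneous_tuple_axioms by blast
qed

end

context canonical_candidate
begin

text \<open>
 Homomorphisms \<open>\<chi>\<close> to \<open>R\<close> are not homogeneous in general. But the component of degree 1 of \<open>\<chi>(v)\<close> is the sum
 of those of \<open>\<chi>(v\<^sub>a)\<close>, with \<open>v\<^sub>a\<close> the component of \<open>v\<close> of degree \<open>a\<close>, and these are values of the part of \<open>\<chi>\<close>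
 of degree \<open>1 - a\<close>.
\<close>

lemma trace_degree_one:
 assumes mm: "mm \<subseteq> Idl\<^bsub>Rrec\<^esub> W"
  and W: "!!r. r \<in> W ==> \<exists>\<chi> v. v \<in> L \<and> r = \<chi> v \<and> (\<forall>v\<in>L. \<chi> v \<in> R) \<and> (\<forall>v\<in>L. \<forall>w\<in>L. \<chi> (v + w) = \<chi> v + \<chi> w) \<and>
   (\<forall>r\<in>R. \<forall>v\<in>L. \<chi> (r *s v) = r * \<chi> v) \<and> (\<forall>v\<in>K. \<chi> v = 0)"
 shows "H 1 \<subseteq> kR.span {\<psi> a w | \<psi> a w. rhom (1 - a) \<psi> \<and> w \<in> Lh a}"
proof -
 define lin where "lin \<chi> \<longleftrightarrow> (\<forall>v\<in>L. \<chi> v \<in> R) \<and> (\<forall>v\<in>L. \<forall>w\<in>L. \<chi> (v + w) = \<chi> v + \<chi> w) \<and>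
   (\<forall>r\<in>R. \<forall>v\<in>L. \<chi> (r *s v) = r * \<chi> v) \<and> (\<forall>v\<in>K. \<chi> v = 0)" for \<chi> :: "'v => 'r"
 define U where "U = {\<chi> v | \<chi> v. lin \<chi> \<and> v \<in> L}"
 let ?P = "{\<psi> a w | \<psi> a w. rhom (1 - a) \<psi> \<and> w \<in> Lh a}"
 have linR: "\<chi> v \<in> R" if "lin \<chi>" "v \<in> L" for \<chi> v using that unfolding lin_def by blast
 have lin_scale: "\<chi> (r *s v) = r * \<chi> v" if "lin \<chi>" "r \<in> R" "v \<in> L" for \<chi> r v using that unfolding lin_def by blast
 have lin_add: "\<chi> (v + w) = \<chi> v + \<chi> w" if "lin \<chi>" "v \<in> L" "w \<in> L" for \<chi> v w using that unfolding lin_def by blast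
 have lin_zero: "\<chi> 0 = 0" if "lin \<chi>" for \<chi> using lin_scale[OF that R_zero L_zero] by simp
 have lin_sum: "\<chi> (sum f A) = (\<Sum>a\<in>A. \<chi> (f a))" if "lin \<chi>" "finite A" "!!a. a \<in> A ==> f a \<in> L" for \<chi> f and A :: "int set"
  using that(2,3)
 proof (induction A rule: finite_induct)
  case empty
  show ?case using lin_zero[OF that(1)] by simp
 next
  case (insert a A)
  have "\<chi> (f a + sum f A) = \<chi> (f a) + \<chi> (sum f A)"
   by (rule lin_add[OF that(1)]) (use insert.prems submod_sum[OF L_sub, of A f] in auto)
  then show ?case using insert by simp
 qed
 have subR: "kR.subspace R" by (rule kR.subspaceI) (auto intro: R_add R_mult)
 have UR: "U \<subseteq> R" unfolding U_def using linR by blast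
 have JR: "kR.span U \<subseteq> R" by (rule kR.span_minimal[OF UR subR])
 have J: "RR.submod R (kR.span U)"
 proof (rule RR.submodI[OF kR.span_zero kR.span_add])
  fix r v assume r: "r \<in> R" and v: "v \<in> kR.span U"
  have "kR.span U \<subseteq> {v. r * v \<in> kR.span U}"
  proof (rule kR.span_minimal)
   show "U \<subseteq> {v. r * v \<in> kR.span U}"
   proof
    fix u assume "u \<in> U"
    then obtain \<chi> x where u: "lin \<chi>" "x \<in> L" "u = \<chi> x" unfolding U_def by blast
    have "r * u \<in> U" unfolding U_def u(3) lin_scale[OF u(1) r u(2), symmetric] using u(1) L_scale[OF r u(2)] by blast
    then show "u \<in> {v. r * v \<in> kR.span U}" using kR.span_base by blast
   qed
   show "kR.subspace {v. r * v \<in> kR.span U}"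
   proof (rule kR.subspaceI)
    show "0 \<in> {v. r * v \<in> kR.span U}" using kR.span_zero by simp
    show "x + y \<in> {v. r * v \<in> kR.span U}" if "x \<in> {v. r * v \<in> kR.span U}" "y \<in> {v. r * v \<in> kR.span U}" for x y
     using that kR.span_add by (simp add: distrib_left)
    show "emb c * x \<in> {v. r * v \<in> kR.span U}" if "x \<in> {v. r * v \<in> kR.span U}" for c x
    proof -
     have "emb c * (r * x) \<in> kR.span U" using that by (intro kR.span_scale) blast
     moreover have "r * (emb c * x) = emb c * (r * x)" by (rule mult.left_commute)
     ultimately show ?thesis by (simp only: mem_Collect_eq)
    qed
   qed
  qed
  then show "r * v \<in> kR.span U" using v by blast
 qed
 have "W \<subseteq> U"
 proof
  fix r assume "r \<in> W"
  from W[OF this] show "r \<in> U" unfolding U_def lin_def by blast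
 qed
 then have "mm \<subseteq> kR.span U"
  using mm Idl_subset[OF J JR, of W] kR.span_superset[of U] by blast
 moreover have "kR.span U \<subseteq> {r \<in> R. cmp 1 r \<in> kR.span ?P}"
 proof (rule kR.span_minimal)
  show "kR.subspace {r \<in> R. cmp 1 r \<in> kR.span ?P}"
  proof (rule kR.subspaceI)
   show "0 \<in> {r \<in> R. cmp 1 r \<in> kR.span ?P}" using kR.span_zero[of ?P] by simp
   show "x + y \<in> {r \<in> R. cmp 1 r \<in> kR.span ?P}"
    if "x \<in> {r \<in> R. cmp 1 r \<in> kR.span ?P}" "y \<in> {r \<in> R. cmp 1 r \<in> kR.span ?P}" for x y
    using that kR.span_add[of "cmp 1 x" ?P "cmp 1 y"] R_add cmp_add by simp
   show "emb c * x \<in> {r \<in> R. cmp 1 r \<in> kR.span ?P}" if x: "x \<in> {r \<in> R. cmp 1 r \<in> kR.span ?P}" for c x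
   proof -
    have "cmp 1 (emb c * x) = emb c * cmp 1 x" using S.prj_scale_H[OF H_emb, of x 1 c] x by simp
    then show ?thesis using x kR.span_scale[of "cmp 1 x" ?P c] R_mult[OF emb_R, of x c] by simp
   qed
  qed
  show "U \<subseteq> {r \<in> R. cmp 1 r \<in> kR.span ?P}"
  proof
   fix u assume "u \<in> U"
   then obtain \<chi> v where u: "lin \<chi>" "v \<in> L" "u = \<chi> v" unfolding U_def by blast
   let ?A = "{a. prj a v ~= 0}"
   have "u = \<chi> (\<Sum>a\<in>?A. prj a v)" unfolding u(3) sum_prj[OF u(2)] ..
   also have "... = (\<Sum>a\<in>?A. \<chi> (prj a v))" by (rule lin_sum[OF u(1) finite_prj[OF u(2)] prj_L[OF u(2)]])
   finally have "cmp 1 u = (\<Sum>a\<in>?A. cmp 1 (\<chi> (prj a v)))"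
    using cmp_sum[of ?A "\<lambda>a. \<chi> (prj a v)" 1] linR[OF u(1) prj_L[OF u(2)]] by simp
   moreover have "cmp 1 (\<chi> (prj a v)) \<in> ?P" for a
   proof -
    define \<psi> where "\<psi> e x = cmp (e + (1 - a)) (\<chi> x)" for e x
    have "rhom (1 - a) \<psi>"
     unfolding rhom_def \<psi>_def
    proof (intro conjI allI ballI impI)
     show "cmp (e + (1 - a)) (\<chi> x) \<in> H (e + (1 - a))" if "x \<in> Lh e" for e x
      by (rule H_cmp[OF linR[OF u(1) Lh_L[OF that]]])
     show "cmp (e + (1 - a)) (\<chi> (x + y)) = cmp (e + (1 - a)) (\<chi> x) + cmp (e + (1 - a)) (\<chi> y)"
      if "x \<in> Lh e" "y \<in> Lh e" for e x y
      unfolding lin_add[OF u(1) Lh_L[OF that(1)] Lh_L[OF that(2)]]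
      by (rule cmp_add[OF linR[OF u(1) Lh_L[OF that(1)]] linR[OF u(1) Lh_L[OF that(2)]]])
     show "cmp (n + e + (1 - a)) (\<chi> (r *s x)) = r * cmp (e + (1 - a)) (\<chi> x)" if "r \<in> H n" "x \<in> Lh e" for n e r x
     proof -
      have "n + e + (1 - a) - n = e + (1 - a)" by simp
      then show ?thesis
       unfolding lin_scale[OF u(1) H_R[OF that(1)] Lh_L[OF that(2)]]
       using S.prj_scale_H[OF that(1) linR[OF u(1) Lh_L[OF that(2)]], of "n + e + (1 - a)"] by simp
     qed
     show "cmp (e + (1 - a)) (\<chi> x) = 0" if "x \<in> K" for e x
      using u(1) that unfolding lin_def by simp
    qed
    moreover have "cmp 1 (\<chi> (prj a v)) = \<psi> a (prj a v)" by (simp add: \<psi>_def)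
    ultimately show ?thesis using Lh_prj[OF u(2)] by blast
   qed
   ultimately have "cmp 1 u \<in> kR.span ?P" using kR.span_sum[of ?A "\<lambda>a. cmp 1 (\<chi> (prj a v))" ?P] kR.span_base by simp
   then show "u \<in> {r \<in> R. cmp 1 r \<in> kR.span ?P}" using UR \<open>u \<in> U\<close> by blast
  qed
 qed
 ultimately show ?thesis
 proof -
  assume s: "mm \<subseteq> kR.span U" "kR.span U \<subseteq> {r \<in> R. cmp 1 r \<in> kR.span ?P}"
  show ?thesis
  proof
   fix r assume r: "r \<in> H 1"
   have "r \<in> mm" by (rule H_mm[OF r]) simp
   then have "cmp 1 r \<in> kR.span ?P" using s by blast
   then show "r \<in> kR.span ?P" using r by (simp add: H_def)
  qed
 qed
qed

end

section \<open>The Gorenstein criterion\<close>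

context graded_domain
begin

lemma finsum_ring_module:
 assumes "finite A" "!!a. a \<in> A ==> f a \<in> R"
 shows "finsum (ring_module Rrec) f A = sum f A"
proof -
 interpret M: Module.module Rrec "ring_module Rrec" by (rule module_Rrec)
 show ?thesis
  using assms
 proof (induction A rule: finite_induct)
  case empty
  show ?case unfolding sum.empty M.finsum_empty by simp
 next
  case (insert a A)
  have "f a \<in> carrier (ring_module Rrec)" "f \<in> A \<rightarrow> carrier (ring_module Rrec)" using insert.prems by auto
  then have "finsum (ring_module Rrec) f (insert a A) = f a \<oplus>\<^bsub>ring_module Rrec\<^esub> finsum (ring_module Rrec) f A"
   using insert.hyps by (simp add: M.finsum_insert)
  also have "... = f a + sum f A" using insert by simp
  finally show ?case unfolding sum.insert[OF insert.hyps] .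
 qed
qed

lemma module_grading_self: "module_grading Rrec (\<lambda>i. H (int i)) (ring_module Rrec) H"
 unfolding module_grading_def
proof (intro conjI allI ballI)
 have ab: "abelian_group (ring_module Rrec)" using module_Rrec by (rule module.axioms)
 fix j
 show "subgroup (H j) (add_monoid (ring_module Rrec))"
 proof (rule subgroup_add[OF _ _ _ ab])
  show "- x \<in> H j" if "x \<in> H j" for x using H_diff[OF _ that, of 0] by (simp add: H_def)
  show "0 \<in> H j" by (simp add: H_def)
  show "x + y \<in> H j" if "x \<in> H j" "y \<in> H j" for x y by (rule H_add[OF that])
 qed (auto dest: H_R)
next
 fix i j r x assume "r \<in> H (int i)" "x \<in> H j"
 then show "r \<odot>\<^bsub>ring_module Rrec\<^esub> x \<in> H (int i + j)" unfolding ring_module_simps by (rule H_mult)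
next
 fix x assume "x \<in> carrier (ring_module Rrec)"
 then have x: "x \<in> R" by simp
 show "\<exists>!c. (\<forall>j. c j \<in> H j) \<and> finite {j. c j ~= \<zero>\<^bsub>ring_module Rrec\<^esub>} \<and>
  x = finsum (ring_module Rrec) c {j. c j ~= \<zero>\<^bsub>ring_module Rrec\<^esub>}"
  unfolding ring_module_simps
 proof (rule ex1I[of _ "\<lambda>j. cmp j x"])
  show "(\<forall>j. cmp j x \<in> H j) \<and> finite {j. cmp j x ~= 0} \<and> x = finsum (ring_module Rrec) (\<lambda>j. cmp j x) {j. cmp j x ~= 0}"
   using H_cmp[OF x] finite_cmp[OF x] sum_cmp[OF x]
    finsum_ring_module[OF finite_cmp[OF x], of "\<lambda>j. cmp j x"] cmp_R[OF x] by simp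
 next
  fix c assume c: "(\<forall>j. c j \<in> H j) \<and> finite {j. c j ~= 0} \<and> x = finsum (ring_module Rrec) c {j. c j ~= 0}"
  then have cH: "!!j. c j \<in> H j" and fin: "finite {j. c j ~= 0}" by blast+
  have xs: "x = (\<Sum>j | c j ~= 0. c j)" using c finsum_ring_module[OF fin, of c] H_R[OF cH] by simp
  show "c = (\<lambda>j. cmp j x)"
  proof
   fix n
   have "cmp n x = (\<Sum>j | c j ~= 0. cmp n (c j))" unfolding xs by (rule cmp_sum) (rule H_R[OF cH])
   also have "... = (\<Sum>j | c j ~= 0. if j = n then c j else 0)"
    by (rule sum.cong[OF refl]) (use cmp_H[OF cH] cmp_H_other[OF cH] in auto)
   also have "... = c n" using fin by simp
   finally show "c n = cmp n x" ..
  qed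
 qed
qed

lemma finitely_generated_self: "finitely_generated_module Rrec (ring_module Rrec)"
 unfolding finitely_generated_module_def
proof (intro exI[of _ "{1}"] conjI allI impI)
 fix N assume N: "submodule N Rrec (ring_module Rrec) \<and> {1} \<subseteq> N"
 interpret N: submodule N Rrec "ring_module Rrec" using N by blast
 show "N = carrier (ring_module Rrec)"
 proof (rule subset_antisym)
  show "N \<subseteq> carrier (ring_module Rrec)" using N.subset by simp
  show "carrier (ring_module Rrec) \<subseteq> N"
  proof
   fix r assume "r \<in> carrier (ring_module Rrec)"
   then show "r \<in> N" using N.smult_closed[of r 1] N by simp
  qed
 qed
qed simp_all

text \<open>
 The free generator \<open>v0\<close> gives a map \<open>\<rho>\<close> from \<open>L\<close> onto \<open>R\<close> with the same kernel as the presentation of \<open>\<omega>\<close>: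
 it sends \<open>v\<close> to the coefficient \<open>r\<close> with \<open>v \<equiv> r v0\<close>.
\<close>

theorem gorenstein_of_trace:
 fixes \<omega> :: "('r, 'm) module"
 assumes CM: "cohen_macaulay Rrec mm" and dim: "krull_dim Rrec = enat d"
  and h: "Abs_fps (\<lambda>i. int (kR.dim (H (int i)))) * (1 - fps_X) ^ d = (\<Sum>i\<le>s. fps_const (h i) * fps_X ^ i)"
  and hs: "h s ~= 0" "h s < 2"
  and canon: "canonical_module Rrec (\<lambda>i. H (int i)) mm \<omega>"
  and ng: "mm \<subseteq> trace_ideal Rrec \<omega>"
  and growth: "H 1 = {0} \<or> (\<exists>x\<in>H 1. x ~= 0 \<and> (\<forall>r\<in>H 1. \<exists>a. r = emb a * x)) \<or> (\<forall>n. n + 1 \<le> kR.dim (H (int n)))"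
 shows "gorenstein Rrec (\<lambda>i. H (int i)) mm"
proof -
 obtain b D c where rr: "residue_resolution emb R cmp X b D c"
  and chosen: "(SOME (b, d). \<exists>e. free_resolution Rrec residue_field b d e) = (b, \<lambda>i. matrix_map (b (Suc i)) (b i) (D i))"
  using chosen_resolution by blast
 let ?dm = "\<lambda>i. matrix_map (b (Suc i)) (b i) (D i)"
 have \<omega>: "Module.module Rrec \<omega>" "finitely_generated_module Rrec \<omega>" "\<exists>Cg. module_grading Rrec (\<lambda>i. H (int i)) \<omega> Cg"
  using canon unfolding canonical_module_def by blast+
 have E\<omega>: "Ext Rrec residue_field \<omega> i = ext_of_resolution Rrec b ?dm \<omega> i" for i
  unfolding Ext_def chosen by simp
 have ext: "if enat i = krull_dim Rrec then mod_iso Rrec (ext_of_resolution Rrec b ?dm \<omega> i) residue_field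
   else carrier (ext_of_resolution Rrec b ?dm \<omega> i) = {\<zero>\<^bsub>ext_of_resolution Rrec b ?dm \<omega> i\<^esub>}" for i
  using canon unfolding canonical_module_def E\<omega> by blast
 have ext_d: "mod_iso Rrec (ext_of_resolution Rrec b ?dm \<omega> d) residue_field"
  using ext[of d] unfolding dim by simp
 have ext_other: "carrier (ext_of_resolution Rrec b ?dm \<omega> i) = {\<zero>\<^bsub>ext_of_resolution Rrec b ?dm \<omega> i\<^esub>}"
  if "i ~= d" for i
  using ext[of i] that unfolding dim by simp
 obtain Cg where Cg: "module_grading Rrec (\<lambda>i. H (int i)) \<omega> Cg" using \<omega>(3) by blast
 obtain g w \<epsilon> where tuple: "homogeneous_tuple emb R cmp X \<omega> Cg g w \<epsilon>"
  and surj: "homogeneous_tuple.\<tau> \<omega> g w ` Rpow g = carrier \<omega>"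
  using homogeneous_generators_exist[OF \<omega>(1,2) Cg] by blast
 interpret T: homogeneous_tuple emb R cmp X \<omega> Cg g w \<epsilon> by (rule tuple)
 let ?prj = "\<lambda>a f i. cmp (a - \<epsilon> i) (f i)" and ?E = "unit_vec ` {..<g}"
 interpret P: presented_module emb R cmp X fscale "Rpow g" ?prj ?E b D c \<omega> T.\<tau>
  by (rule T.presented[OF rr surj])
 interpret Q: canonical_candidate emb R cmp X fscale "Rpow g" ?prj ?E b D c P.ker d
 proof (rule canonical_candidate.intro[OF P.graded_module_resolution_axioms], rule canonical_candidate_axioms.intro)
  show "P.grsub P.ker" unfolding P.ker_def by (rule T.ker_graded[OF surj])
  show "P.coh_le P.ker i 0" if "i ~= d" for i
   using ext_other[OF that] by (simp only: P.ext_trivial_iff)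
  show "P.coh_le P.ker d 1" "\<not> P.coh_le P.ker d 0" by (rule P.ext_residue_field[OF ext_d])+
 qed
 have trace: "H 1 \<subseteq> kR.span {\<psi> a w | \<psi> a w. Q.rhom (1 - a) \<psi> \<and> w \<in> P.Lh a}"
 proof (rule Q.trace_degree_one)
  show "mm \<subseteq> Idl\<^bsub>Rrec\<^esub> (\<Union>\<phi>\<in>mod_hom Rrec \<omega> (ring_module Rrec). \<phi> ` carrier \<omega>)"
   using ng unfolding trace_ideal_def .
  fix r assume "r \<in> (\<Union>\<phi>\<in>mod_hom Rrec \<omega> (ring_module Rrec). \<phi> ` carrier \<omega>)"
  then obtain \<phi> x where \<phi>: "\<phi> \<in> mod_hom Rrec \<omega> (ring_module Rrec)" "x \<in> carrier \<omega>" "r = \<phi> x" by blast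
  obtain v where v: "v \<in> Rpow g" "x = T.\<tau> v" using \<phi>(2) unfolding surj[symmetric] by blast
  note hom = mod_homD[OF \<phi>(1), unfolded ring_module_simps Rrec_simps]
  have \<phi>0: "\<phi> \<zero>\<^bsub>\<omega>\<^esub> = 0"
   using hom(4)[OF R_zero T.\<tau>_carrier[OF P.L_zero]] T.\<tau>_scale[OF R_zero P.L_zero]
   unfolding FM.scale_zero_left T.\<tau>_zero by simp
  show "\<exists>\<chi> v. v \<in> Rpow g \<and> r = \<chi> v \<and> (\<forall>v\<in>Rpow g. \<chi> v \<in> R) \<and>
    (\<forall>v\<in>Rpow g. \<forall>w\<in>Rpow g. \<chi> (v + w) = \<chi> v + \<chi> w) \<and>
    (\<forall>r\<in>R. \<forall>v\<in>Rpow g. \<chi> (fscale r v) = r * \<chi> v) \<and> (\<forall>v\<in>P.ker. \<chi> v = 0)"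
  proof (intro exI[of _ "\<lambda>v. \<phi> (T.\<tau> v)"] exI[of _ v] conjI ballI)
   show "v \<in> Rpow g" by (rule v(1))
   show "r = \<phi> (T.\<tau> v)" unfolding \<phi>(3) v(2) ..
   show "\<phi> (T.\<tau> u) \<in> R" if "u \<in> Rpow g" for u by (rule hom(2)[OF T.\<tau>_carrier[OF that]])
   show "\<phi> (T.\<tau> (u + u')) = \<phi> (T.\<tau> u) + \<phi> (T.\<tau> u')" if "u \<in> Rpow g" "u' \<in> Rpow g" for u u'
    unfolding T.\<tau>_add[OF that] by (rule hom(3)[OF T.\<tau>_carrier[OF that(1)] T.\<tau>_carrier[OF that(2)]])
   show "\<phi> (T.\<tau> (fscale q u)) = q * \<phi> (T.\<tau> u)" if "q \<in> R" "u \<in> Rpow g" for q u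
    unfolding T.\<tau>_scale[OF that] by (rule hom(4)[OF that(1) T.\<tau>_carrier[OF that(2)]])
   show "\<phi> (T.\<tau> u) = 0" if "u \<in> P.ker" for u using that \<phi>0 unfolding P.ker_def by simp
  qed
 qed
 obtain v0 where v0: "v0 \<in> Rpow g" "\<forall>w\<in>Rpow g. \<exists>r\<in>R. w - fscale r v0 \<in> P.ker"
  "\<forall>r\<in>R. fscale r v0 \<in> P.ker --> r = 0"
  using Q.free_of_rank_one[OF Q.depth_vanishing[OF CM dim] h hs trace growth] by blast
 define \<rho> where "\<rho> v = (THE r. r \<in> R \<and> v - fscale r v0 \<in> P.ker)" for v
 have uniq: "r = r'" if "r \<in> R" "r' \<in> R" "v - fscale r v0 \<in> P.ker" "v - fscale r' v0 \<in> P.ker" for r r' v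
 proof -
  have "fscale (r' - r) v0 = (v - fscale r v0) - (v - fscale r' v0)" by (simp only: FM.scale_left_diff_distrib) simp
  also have "... \<in> P.ker" by (rule FM.submod_diff[OF P.submod_ker R_minus[OF R_one] that(3,4)])
  finally have "r' - r = 0" using v0(3) R_diff[OF that(2,1)] by blast
  then show ?thesis by simp
 qed
 have \<rho>: "\<rho> v \<in> R \<and> v - fscale (\<rho> v) v0 \<in> P.ker" if v: "v \<in> Rpow g" for v
 proof -
  obtain r where r: "r \<in> R" "v - fscale r v0 \<in> P.ker" using bspec[OF v0(2) v] by (elim bexE)
  show ?thesis unfolding \<rho>_def
  proof (rule theI)
   show "r \<in> R \<and> v - fscale r v0 \<in> P.ker" using r by (rule conjI)
   show "r' = r" if "r' \<in> R \<and> v - fscale r' v0 \<in> P.ker" for r'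
    by (rule uniq[OF conjunct1[OF that] r(1) conjunct2[OF that] r(2)])
  qed
 qed
 have \<rho>I: "\<rho> v = r" if "v \<in> Rpow g" "r \<in> R" "v - fscale r v0 \<in> P.ker" for v r
  by (rule uniq[OF conjunct1[OF \<rho>[OF that(1)]] that(2) conjunct2[OF \<rho>[OF that(1)]] that(3)])
 have pres: "presented_module emb R cmp X fscale (Rpow g) ?prj ?E b D c (ring_module Rrec) \<rho>"
 proof (rule presented_module.intro[OF P.graded_module_resolution_axioms], rule presented_module_axioms.intro;
   (unfold ring_module_simps)?)
  show "Module.module Rrec (ring_module Rrec)" by (rule module_Rrec)
  show "\<rho> (v + u) = \<rho> v + \<rho> u" if v: "v \<in> Rpow g" and u: "u \<in> Rpow g" for v u
  proof (rule \<rho>I[OF P.L_add[OF v u]])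
   have "(v + u) - fscale (\<rho> v + \<rho> u) v0 = (v - fscale (\<rho> v) v0) + (u - fscale (\<rho> u) v0)"
    by (simp only: FM.scale_left_distrib add_diff_add)
   also have "... \<in> P.ker" by (rule FM.submod_add[OF P.submod_ker conjunct2[OF \<rho>[OF v]] conjunct2[OF \<rho>[OF u]]])
   finally show "(v + u) - fscale (\<rho> v + \<rho> u) v0 \<in> P.ker" .
  qed (rule R_add[OF conjunct1[OF \<rho>[OF v]] conjunct1[OF \<rho>[OF u]]])
  show "\<rho> (fscale r v) = r * \<rho> v" if r: "r \<in> R" and v: "v \<in> Rpow g" for r v
  proof (rule \<rho>I[OF P.L_scale[OF r v]])
   have "fscale r v - fscale (r * \<rho> v) v0 = fscale r (v - fscale (\<rho> v) v0)"
    by (simp only: FM.scale_right_diff_distrib FM.scale_scale)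
   also have "... \<in> P.ker" by (rule FM.submod_scale[OF P.submod_ker r conjunct2[OF \<rho>[OF v]]])
   finally show "fscale r v - fscale (r * \<rho> v) v0 \<in> P.ker" .
  qed (rule R_mult[OF r conjunct1[OF \<rho>[OF v]]])
  show "\<rho> ` Rpow g = R"
  proof (rule subset_antisym; rule subsetI)
   fix r assume "r \<in> \<rho> ` Rpow g"
   then show "r \<in> R" using \<rho> by blast
  next
   fix r assume r: "r \<in> R"
   have "\<rho> (fscale r v0) = r"
    by (rule \<rho>I[OF P.L_scale[OF r v0(1)] r]) (simp only: diff_self FM.submod_zero[OF P.submod_ker])
   then show "r \<in> \<rho> ` Rpow g" using P.L_scale[OF r v0(1)] by (metis imageI)
  qed
 qed
 have ker\<rho>: "{v \<in> Rpow g. \<rho> v = \<zero>\<^bsub>ring_module Rrec\<^esub>} = P.ker"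
  unfolding ring_module_simps
 proof (rule subset_antisym; rule subsetI)
  fix v assume "v \<in> {v \<in> Rpow g. \<rho> v = 0}"
  then have "v - fscale 0 v0 \<in> P.ker" using \<rho>[of v] by simp
  then show "v \<in> P.ker" unfolding FM.scale_zero_left diff_zero .
 next
  fix v assume v: "v \<in> P.ker"
  have "\<rho> v = 0" by (rule \<rho>I[OF P.ker_L[OF v] R_zero]) (unfold FM.scale_zero_left diff_zero, rule v)
  then show "v \<in> {v \<in> Rpow g. \<rho> v = 0}" using P.ker_L[OF v] by blast
 qed
 interpret P': presented_module emb R cmp X fscale "Rpow g" ?prj ?E b D c "ring_module Rrec" \<rho> by (rule pres)
 have k: "P'.ker = P.ker" unfolding P'.ker_def by (rule ker\<rho>)
 have "canonical_module Rrec (\<lambda>i. H (int i)) mm (ring_module Rrec)"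
  unfolding canonical_module_def
 proof (intro conjI allI)
  show "Module.module Rrec (ring_module Rrec)" by (rule module_Rrec)
  show "finitely_generated_module Rrec (ring_module Rrec)" by (rule finitely_generated_self)
  show "\<exists>Cg. module_grading Rrec (\<lambda>i. H (int i)) (ring_module Rrec) Cg" using module_grading_self by (rule exI[of _ H])
  fix i
  have E: "Ext Rrec residue_field (ring_module Rrec) i = ext_of_resolution Rrec b ?dm (ring_module Rrec) i"
   unfolding Ext_def chosen by simp
  show "if enat i = krull_dim Rrec then mod_iso Rrec (Ext Rrec residue_field (ring_module Rrec) i) residue_field
   else carrier (Ext Rrec residue_field (ring_module Rrec) i) = {\<zero>\<^bsub>Ext Rrec residue_field (ring_module Rrec) i\<^esub>}"
  proof (cases "i = d")
   case True
   then show ?thesis using P.ext_transfer[OF pres ker\<rho> ext_d] unfolding E dim by simp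
  next
   case False
   have "P.coh_le P'.ker i 0" unfolding k by (rule Q.coh_other[OF False])
   then show ?thesis using False P'.ext_trivial_iff[of i] unfolding E dim by simp
  qed
 qed
 then show ?thesis using CM unfolding gorenstein_def by blast
qed

end

section \<open>Nearly Gorenstein homogeneous affine semigroup rings\<close>

lemma (in graded_semigroup_field) semigroup_ring_Rrec: "semigroup_ring S = Rrec"
 unfolding semigroup_ring_def unfolding Rrec_def unfolding RS_def ..

theorem theorem4p4:
  fixes n :: nat
    and S :: "(nat \<Rightarrow>\<^sub>0 nat) set"
    and R :: "((nat \<Rightarrow>\<^sub>0 nat) \<Rightarrow>\<^sub>0 'k::field) ring"
    and Rg :: "nat \<Rightarrow> ((nat \<Rightarrow>\<^sub>0 nat) \<Rightarrow>\<^sub>0 'k) set"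
    and \<mm> :: "((nat \<Rightarrow>\<^sub>0 nat) \<Rightarrow>\<^sub>0 'k) set"
    and \<omega> :: "((nat \<Rightarrow>\<^sub>0 nat) \<Rightarrow>\<^sub>0 'k, 'm) module"
    and s :: nat
    and h :: "nat \<Rightarrow> int"
  assumes "affine_semigroup n S"
    and "homogeneous_semigroup n S"
    and "R = semigroup_ring S"
    and "Rg = semigroup_ring_component S"
    and "\<mm> = graded_maximal_ideal S"
    and "cohen_macaulay R \<mm>"
    and "is_h_vector R Rg s h"
    and "canonical_module R Rg \<mm> \<omega>"
    and "nearly_gorenstein R \<mm> \<omega>"
    and "\<not> gorenstein R Rg \<mm>"
  shows "h s \<ge> 2"
proof (rule ccontr)
  assume "\<not> h s \<ge> 2"
  then have hs: "h s < 2" by simp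
  obtain \<delta> where "graded_semigroup S \<delta>" using homogeneous_affine_semigroup_graded[OF assms(1,2)] by blast
  then interpret G: graded_semigroup_field S \<delta> "TYPE('k)" by (rule graded_semigroup_field.intro)
  have R: "R = G.Rrec" unfolding assms(3) by (rule G.semigroup_ring_Rrec)
  have Rg: "Rg = (\<lambda>i. G.H (int i))" unfolding assms(4) by (rule ext) (rule G.component_H)
  have mm: "\<mm> = G.mm" unfolding assms(5) by (rule G.mm_eq[symmetric])
  obtain d where d: "krull_dim R = enat d" "h s \<noteq> 0"
    "Abs_fps (\<lambda>i. int (poly_mapping.dim (Rg i))) * (1 - fps_X) ^ d = (\<Sum>i\<le>s. fps_const (h i) * fps_X ^ i)"
    using assms(7) unfolding is_h_vector_def by blast
  have dim: "poly_mapping.dim (Rg i) = G.kR.dim (G.H (int i))" for i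
    unfolding G.dim_eq assms(4) ..
  have "gorenstein G.Rrec (\<lambda>i. G.H (int i)) G.mm"
  proof (rule G.gorenstein_of_trace[where h = h and s = s and \<omega> = \<omega> and d = d])
    show "h s \<noteq> 0" by (rule d(2))
    show "h s < 2" by (rule hs)
    show "cohen_macaulay G.Rrec G.mm" using assms(6) unfolding R mm .
    show "krull_dim G.Rrec = enat d" using d(1) unfolding R .
    show "Abs_fps (\<lambda>i. int (G.kR.dim (G.H (int i)))) * (1 - fps_X) ^ d = (\<Sum>i\<le>s. fps_const (h i) * fps_X ^ i)"
      using d(3) unfolding dim .
    show "canonical_module G.Rrec (\<lambda>i. G.H (int i)) G.mm \<omega>" using assms(8) unfolding R Rg mm .
    show "G.mm \<subseteq> trace_ideal G.Rrec \<omega>" using assms(9) unfolding nearly_gorenstein_def R mm by blast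
  next
    show "G.H 1 = {0} \<or> (\<exists>x\<in>G.H 1. x \<noteq> 0 \<and> (\<forall>r\<in>G.H 1. \<exists>a. r = G.emb a * x)) \<or> (\<forall>n. n + 1 \<le> G.kR.dim (G.H (int n)))"
      by (rule G.growth)
  qed
  then show False using assms(10) unfolding R Rg mm by blast
qed

end
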